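(* Let $S=\mathbb{K}[x_1,\dots,x_n]$ and let $I\subseteq S$ be a square-free monomial ideal which contains no variable. Assume that for some integer $s\geq 1$ the ideal $I^s$ has linear quotients with respect to (the restriction to $G(I^s)$ of) a monomial order. Then $S/I$ is a Golod ring.
   Context: $G(J)$ denotes the set of minimal monomial generators of a monomial ideal $J$. A monomial order is a multiplicative total order on monomials with $1$ least. If $u_1\prec\dots\prec u_t$ is a linear order on $G(J)$, $J$ has linear quotients with respect to it if for every $2\leq i\leq t$ the ideal $(u_1,\dots,u_{i-1}):u_i$ is generated by a subset of the variables. $S/I$ is Golod if all Massey operations on the Koszul complex of $S/I$ with respect to $x_1,\dots,x_n$ vanish; equivalently, equality holds in the coefficientwise inequality $\sum_{i\ge0}\dim_{\mathbb{K}}\operatorname{Tor}_i^{S/I}(\mathbb{K},\mathbb{K})t^i\le \frac{(1+t)^n}{1-t\sum_{i\ge1}\dim_{\mathbb{K}}\operatorname{Tor}_i^S(S/I,\mathbb{K})t^i}$. *)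

theory Defs
  imports Main "HOL-Library.Function_Algebras" "HOL-Computational_Algebra.Formal_Power_Series"
begin

definition mons :: "nat \<Rightarrow> (nat \<Rightarrow> nat) set" where
  "mons n = {m. \<forall>i. n \<le> i \<longrightarrow> m i = 0}"

definition var :: "nat \<Rightarrow> nat \<Rightarrow> nat" where
  "var j = (\<lambda>k. if k = j then 1 else 0)"

text \<open>A monomial ideal is represented by the set of monomials it contains
  (it is their K-span); divisibility is the pointwise order.\<close>
definition is_monomial_ideal :: "nat \<Rightarrow> (nat \<Rightarrow> nat) set \<Rightarrow> bool" where
  "is_monomial_ideal n I \<longleftrightarrow> I \<subseteq> mons n \<and> (\<forall>u\<in>I. \<forall>m\<in>mons n. u \<le> m \<longrightarrow> m \<in> I)"

definition mingens :: "(nat \<Rightarrow> nat) set \<Rightarrow> (nat \<Rightarrow> nat) set" where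
  "mingens J = {u \<in> J. \<forall>v\<in>J. v \<le> u \<longrightarrow> v = u}"

definition gen_ideal :: "nat \<Rightarrow> (nat \<Rightarrow> nat) set \<Rightarrow> (nat \<Rightarrow> nat) set" where
  "gen_ideal n A = {m \<in> mons n. \<exists>a\<in>A. a \<le> m}"

definition squarefree_mon :: "(nat \<Rightarrow> nat) \<Rightarrow> bool" where
  "squarefree_mon u \<longleftrightarrow> (\<forall>i. u i \<le> 1)"

definition mon_ideal_power :: "nat \<Rightarrow> (nat \<Rightarrow> nat) set \<Rightarrow> nat \<Rightarrow> (nat \<Rightarrow> nat) set" where
  "mon_ideal_power n I s = gen_ideal n {sum_list gs | gs. length gs = s \<and> set gs \<subseteq> I}"

definition monomial_order :: "nat \<Rightarrow> ((nat \<Rightarrow> nat) \<Rightarrow> (nat \<Rightarrow> nat) \<Rightarrow> bool) \<Rightarrow> bool" where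
  "monomial_order n lt \<longleftrightarrow>
     (\<forall>a\<in>mons n. \<not> lt a a) \<and>
     (\<forall>a\<in>mons n. \<forall>b\<in>mons n. \<forall>c\<in>mons n. lt a b \<longrightarrow> lt b c \<longrightarrow> lt a c) \<and>
     (\<forall>a\<in>mons n. \<forall>b\<in>mons n. a \<noteq> b \<longrightarrow> lt a b \<or> lt b a) \<and>
     (\<forall>a\<in>mons n. \<forall>b\<in>mons n. \<forall>c\<in>mons n. lt a b \<longrightarrow> lt (a + c) (b + c)) \<and>
     (\<forall>a\<in>mons n. a \<noteq> 0 \<longrightarrow> lt 0 a)"

definition colon :: "nat \<Rightarrow> (nat \<Rightarrow> nat) set \<Rightarrow> (nat \<Rightarrow> nat) \<Rightarrow> (nat \<Rightarrow> nat) set" where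
  "colon n J u = {m \<in> mons n. m + u \<in> J}"

definition linear_quotients ::
  "nat \<Rightarrow> (nat \<Rightarrow> nat) set \<Rightarrow> ((nat \<Rightarrow> nat) \<Rightarrow> (nat \<Rightarrow> nat) \<Rightarrow> bool) \<Rightarrow> bool" where
  "linear_quotients n J lt \<longleftrightarrow>
     (\<forall>u\<in>mingens J. \<exists>V \<subseteq> {..<n}.
        colon n (gen_ideal n {v \<in> mingens J. lt v u}) u = gen_ideal n (var ` V))"

definition lin_indep_rows :: "'r set \<Rightarrow> 'c set \<Rightarrow> ('r \<Rightarrow> 'c \<Rightarrow> 'k::field) \<Rightarrow> bool" where
  "lin_indep_rows R C M \<longleftrightarrow>
     (\<forall>c. (\<forall>y\<in>C. (\<Sum>r\<in>R. c r * M r y) = 0) \<longrightarrow> (\<forall>r\<in>R. c r = 0))"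

definition mat_rank :: "'r set \<Rightarrow> 'c set \<Rightarrow> ('r \<Rightarrow> 'c \<Rightarrow> 'k::field) \<Rightarrow> nat" where
  "mat_rank R C M = Max {card R' | R'. R' \<subseteq> R \<and> lin_indep_rows R' C M}"

text \<open>Dimension of the i-th homology of a finite chain complex with bases B j and
  differential B j \<rightarrow> B (j-1) given by the coefficient function d.\<close>
definition hom_dim :: "(nat \<Rightarrow> 'a set) \<Rightarrow> ('a \<Rightarrow> 'a \<Rightarrow> 'k::field) \<Rightarrow> nat \<Rightarrow> nat" where
  "hom_dim B d i = card (B i) - (if i = 0 then 0 else mat_rank (B i) (B (i - 1)) d)
                     - mat_rank (B (Suc i)) (B i) d"

definition bar_basis :: "nat \<Rightarrow> (nat \<Rightarrow> nat) set \<Rightarrow> nat \<Rightarrow> (nat \<Rightarrow> nat) \<Rightarrow> (nat \<Rightarrow> nat) list set" where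
  "bar_basis n I i a = {ms. length ms = i \<and> (\<forall>m\<in>set ms. m \<in> mons n \<and> m \<notin> I \<and> m \<noteq> 0)
                            \<and> sum_list ms = a}"

definition bar_merge :: "nat \<Rightarrow> (nat \<Rightarrow> nat) list \<Rightarrow> (nat \<Rightarrow> nat) list" where
  "bar_merge j ms = take j ms @ [ms ! j + ms ! Suc j] @ drop (Suc (Suc j)) ms"

definition bar_coef :: "(nat \<Rightarrow> nat) list \<Rightarrow> (nat \<Rightarrow> nat) list \<Rightarrow> 'k::field" where
  "bar_coef s t = (\<Sum>j < length s - 1. if bar_merge j s = t then (-1) ^ Suc j else 0)"

definition tor_R_KK :: "'k::field itself \<Rightarrow> nat \<Rightarrow> (nat \<Rightarrow> nat) set \<Rightarrow> nat \<Rightarrow> (nat \<Rightarrow> nat) \<Rightarrow> nat" where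
  "tor_R_KK K n I i a = hom_dim (\<lambda>j. bar_basis n I j a) (bar_coef :: _ \<Rightarrow> _ \<Rightarrow> 'k) i"

definition indic :: "nat set \<Rightarrow> nat \<Rightarrow> nat" where
  "indic F = (\<lambda>k. if k \<in> F then 1 else 0)"

definition kos_basis :: "nat \<Rightarrow> (nat \<Rightarrow> nat) set \<Rightarrow> nat \<Rightarrow> (nat \<Rightarrow> nat) \<Rightarrow> (nat set \<times> (nat \<Rightarrow> nat)) set" where
  "kos_basis n I i a = {(F, m). F \<subseteq> {..<n} \<and> card F = i \<and> m \<in> mons n \<and> m \<notin> I \<and> m + indic F = a}"

definition kos_coef :: "nat set \<times> (nat \<Rightarrow> nat) \<Rightarrow> nat set \<times> (nat \<Rightarrow> nat) \<Rightarrow> 'k::field" where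
  "kos_coef x y = (\<Sum>j\<in>fst x. if fst y = fst x - {j} \<and> snd y = snd x + var j
                              then (-1) ^ card {k \<in> fst x. k < j} else 0)"

definition tor_S_RK :: "'k::field itself \<Rightarrow> nat \<Rightarrow> (nat \<Rightarrow> nat) set \<Rightarrow> nat \<Rightarrow> (nat \<Rightarrow> nat) \<Rightarrow> nat" where
  "tor_S_RK K n I i a = hom_dim (\<lambda>j. kos_basis n I j a) (kos_coef :: _ \<Rightarrow> _ \<Rightarrow> 'k) i"

text \<open>Total dimension: sum over all multidegrees (only finitely many are nonzero).\<close>
definition tot_dim :: "nat \<Rightarrow> ((nat \<Rightarrow> nat) \<Rightarrow> nat) \<Rightarrow> nat" where
  "tot_dim n f = (\<Sum>a\<in>{a \<in> mons n. f a \<noteq> 0}. f a)"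

definition golod :: "'k::field itself \<Rightarrow> nat \<Rightarrow> (nat \<Rightarrow> nat) set \<Rightarrow> bool" where
  "golod K n I \<longleftrightarrow>
     (Abs_fps (\<lambda>i. of_nat (tot_dim n (tor_R_KK K n I i))) :: rat fps)
       = (1 + fps_X) ^ n /
         (1 - fps_X * Abs_fps (\<lambda>i. if i = 0 then 0 else of_nat (tot_dim n (tor_S_RK K n I i))))"

end

theory Submission
  imports Defs "HOL-Library.Poly_Mapping"
begin

text \<open>
  Write \<open>R = S/I\<close>.  By square-freeness, linear quotients of \<open>I^s\<close> descend to \<open>I\<close>: if \<open>u \<prec> v\<close> are
  generators of \<open>I\<close>, there are a variable \<open>x_k\<close> and a generator \<open>w \<prec> v\<close> with \<open>w | v x_k\<close> and
  \<open>v_k < u_k\<close>; moreover \<open>deg w \<le> deg v\<close>, so the generators of degree at most \<open>D\<close> inherit the property.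

  The ring \<open>R\<close> is replaced by the dg algebra \<open>S \<ltimes> \<sigma>I\<close> with \<open>d(\<sigma> m) = m\<close>, all of whose constructions
  split by multidegree into finite complexes. Let \<open>L\<close> be its tensor product with the exterior
  algebra, with Koszul differential; its homology is \<open>Tor^S(R,K)\<close>. The bar complex with
  coefficients in \<open>L\<close> computes the exterior algebra. Call \<open>|c| - q\<close> the excess of a cycle of degree \<open>q\<close>
  and multidegree \<open>c\<close>. The augmentation ideal maps \<open>L\<close> in positive excess into the span \<open>Q\<close> of the
  basis elements other than \<open>\<sigma>u \<otimes> e_F\<close> with \<open>u\<close> a minimal generator, and linear quotients of
  the generators of bounded degree show that every cycle of \<open>Q\<close> is a boundary in \<open>L\<close>. One can therefore
  split off a quasi-isomorphic submodule \<open>P + H\<close> of the augmentation kernel of \<open>L\<close>, with \<open>P\<close> acyclic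
  and \<open>H\<close> a space of cycles representing the positive homology, such that the augmentation ideal maps \<open>P + H\<close> to \<open>P\<close>.
  Hence the action on homology is homotopically trivial, the bar complex with coefficients in
  \<open>P + H\<close> has homology \<open>Tor^R(K,K) \<otimes> H\<close>, and the long exact sequence of the augmentation of \<open>L\<close> becomes
  the recursion \<open>P(t) = (1 + t)^n + t b(t) P(t)\<close> for the Poincare series \<open>P\<close>, where \<open>b\<close> is the generating function
  of the positive Betti numbers of \<open>R\<close> over \<open>S\<close>.
\<close>

section \<open>Linear algebra on finitely supported functions\<close>

text \<open>Golodness asks for more than vanishing products in Koszul homology: the higher Massey
  operations must vanish too, so an argument on homology classes alone falls short. Therefore an
  acyclic submodule is built on the level of chains which absorbs the whole action, and dividing by
  it leaves zero differential and zero action at once. Degrees make this possible. In excess s a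
  basis element \<sigma>m times e_F has |m| = s + 1. If m is not a minimal generator, it is a
  multiple of a generator of degree at most s, so a cycle of \<open>Q\<close> lives over the ideal
  generated in degrees up to s. Linear quotients bound the regularity of that ideal by s, which is
  just enough to kill its homology in excess s. Hence the need for linear quotients of every
  truncation. The long exact sequence breaks into short pieces because the augmentation kernel maps
  to zero on bar homology: with coefficients in \<open>L\<close> this homology sits in excess zero,
  whereas words have excess at least zero and \<open>P + H\<close> has positive excess.\<close>

abbreviation keys :: "('x \<Rightarrow>\<^sub>0 'k::zero) \<Rightarrow> 'x set" where
  "keys \<equiv> Poly_Mapping.keys"

abbreviation lookup :: "('x \<Rightarrow>\<^sub>0 'k::zero) \<Rightarrow> 'x \<Rightarrow> 'k" where
  "lookup \<equiv> Poly_Mapping.lookup"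

definition scl :: "'k::field \<Rightarrow> ('x \<Rightarrow>\<^sub>0 'k) \<Rightarrow> ('x \<Rightarrow>\<^sub>0 'k)" where
  "scl c p = Poly_Mapping.map ((*) c) p"

lemma lookup_scl [simp]: "lookup (scl c p) x = c * lookup p x"
  by (simp add: scl_def Poly_Mapping.map.rep_eq when_def)

interpretation pm: vector_space "scl :: 'k::field \<Rightarrow> ('x \<Rightarrow>\<^sub>0 'k) \<Rightarrow> _"
  by unfold_locales (auto intro!: poly_mapping_eqI simp: lookup_add algebra_simps)

interpretation pp: vector_space_pair "scl :: 'k::field \<Rightarrow> ('x \<Rightarrow>\<^sub>0 'k) \<Rightarrow> _"
  "scl :: 'k::field \<Rightarrow> ('y \<Rightarrow>\<^sub>0 'k) \<Rightarrow> _"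
  by unfold_locales

abbreviation linear_pm :: "(('x \<Rightarrow>\<^sub>0 'k::field) \<Rightarrow> ('y \<Rightarrow>\<^sub>0 'k)) \<Rightarrow> bool" where
  "linear_pm \<equiv> Vector_Spaces.linear scl scl"

lemma linear_pmI:
  assumes "\<And>p q. f (p + q) = f p + f q" "\<And>c p. f (scl c p) = scl c (f p)"
  shows "linear_pm f"
  unfolding Vector_Spaces.linear_iff by (intro conjI allI assms pm.vector_space_axioms)

lemma linear_pm_compose: "linear_pm f \<Longrightarrow> linear_pm g \<Longrightarrow> linear_pm (\<lambda>x. g (f x))"
  by (intro linear_pmI) (simp_all add: pp.linear_add pp.linear_scale)

definition unitv :: "'x \<Rightarrow> ('x \<Rightarrow>\<^sub>0 'k::field)" where
  "unitv x = Poly_Mapping.single x 1"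

lemma lookup_unitv: "lookup (unitv x) y = (if x = y then 1 else 0)"
  by (simp add: unitv_def lookup_single when_def)

lemma keys_unitv [simp]: "keys (unitv x :: 'x \<Rightarrow>\<^sub>0 'k::field) = {x}"
  by (simp add: unitv_def)

definition lin :: "('x \<Rightarrow> ('y \<Rightarrow>\<^sub>0 'k::field)) \<Rightarrow> ('x \<Rightarrow>\<^sub>0 'k) \<Rightarrow> ('y \<Rightarrow>\<^sub>0 'k)" where
  "lin f p = (\<Sum>x\<in>keys p. scl (lookup p x) (f x))"

lemma lin_superset:
  assumes "finite A" "keys p \<subseteq> A"
  shows "lin f p = (\<Sum>x\<in>A. scl (lookup p x) (f x))"
  unfolding lin_def
  by (rule sum.mono_neutral_left) (use assms in \<open>auto simp: in_keys_iff\<close>)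

lemma linear_lin [simp, intro]:
  fixes f :: "'x \<Rightarrow> ('y \<Rightarrow>\<^sub>0 'k::field)"
  shows "linear_pm (lin f)"
proof (rule linear_pmI)
  fix p q :: "'x \<Rightarrow>\<^sub>0 'k"
  have "keys (p + q) \<subseteq> keys p \<union> keys q" by (rule keys_add)
  then show "lin f (p + q) = lin f p + lin f q"
    by (simp add: lin_superset[of "keys p \<union> keys q"] lookup_add pm.scale_left_distrib sum.distrib)
next
  fix c :: 'k and p :: "'x \<Rightarrow>\<^sub>0 'k"
  have "keys (scl c p) \<subseteq> keys p" by (auto simp: in_keys_iff)
  then show "lin f (scl c p) = scl c (lin f p)"
    by (simp add: lin_superset[of "keys p"] pm.scale_sum_right)
qed

lemmas lin_add [simp] = pp.linear_add[OF linear_lin]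
lemmas lin_scl [simp] = pp.linear_scale[OF linear_lin]
lemmas lin_0 [simp] = pp.linear_0[OF linear_lin]
lemmas lin_diff [simp] = pp.linear_diff[OF linear_lin]
lemmas lin_sum = pp.linear_sum[OF linear_lin]

lemma lin_unitv [simp]: "lin f (unitv x) = f x"
  by (simp add: lin_def unitv_def )

lemma lin_id: "lin unitv p = p"
  by (rule poly_mapping_eqI)
     (simp add: lin_def lookup_sum lookup_unitv in_keys_iff if_distrib cong: if_cong)

lemma pm_expand: "(\<Sum>x\<in>keys p. scl (lookup p x) (unitv x)) = p"
  using lin_id[of p] by (simp add: lin_def)

lemma linear_eq_lin:
  assumes "linear_pm f"
  shows "f p = lin (\<lambda>x. f (unitv x)) p"
proof -
  have "f p = f (\<Sum>x\<in>keys p. scl (lookup p x) (unitv x))" by (simp add: pm_expand)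
  also have "\<dots> = lin (\<lambda>x. f (unitv x)) p"
    using assms by (simp add: pp.linear_sum pp.linear_scale lin_def)
  finally show ?thesis .
qed

lemma lin_cong: "(\<And>x. x \<in> keys p \<Longrightarrow> f x = g x) \<Longrightarrow> lin f p = lin g p"
  by (simp add: lin_def)

lemma linear_eq_on_units:
  assumes "linear_pm f" "linear_pm g" "\<And>x. x \<in> keys p \<Longrightarrow> f (unitv x) = g (unitv x)"
  shows "f p = g p"
  by (rule trans[OF linear_eq_lin[OF assms(1)]], rule trans[OF _ linear_eq_lin[OF assms(2), symmetric]])
     (auto intro: lin_cong assms(3))

lemma lin_in_subspace:
  assumes "pm.subspace A" "\<And>x. x \<in> keys p \<Longrightarrow> f x \<in> A"
  shows "lin f p \<in> A"
  unfolding lin_def by (intro pm.subspace_sum assms pm.subspace_scale)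

section \<open>Coordinate subspaces, finite dimension and rank-nullity\<close>

definition SP :: "'x set \<Rightarrow> ('x \<Rightarrow>\<^sub>0 'k::field) set" where
  "SP A = {p. keys p \<subseteq> A}"

lemma subspace_SP [simp, intro]: "pm.subspace (SP A :: ('x \<Rightarrow>\<^sub>0 'k::field) set)"
proof (rule pm.subspaceI)
  show "0 \<in> (SP A :: ('x \<Rightarrow>\<^sub>0 'k) set)" by (simp add: SP_def)
  show "x + y \<in> SP A" if "x \<in> SP A" "y \<in> SP A" for x y :: "'x \<Rightarrow>\<^sub>0 'k"
    using that keys_add[of x y] by (auto simp: SP_def)
  show "scl c x \<in> SP A" if "x \<in> SP A" for c and x :: "'x \<Rightarrow>\<^sub>0 'k"
    using that by (auto simp: SP_def in_keys_iff)
qed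

lemma unitv_in_SP [simp]: "(unitv x :: 'x \<Rightarrow>\<^sub>0 'k::field) \<in> SP A \<longleftrightarrow> x \<in> A"
  by (simp add: SP_def)

lemma SP_mono: "A \<subseteq> B \<Longrightarrow> SP A \<subseteq> SP B"
  by (auto simp: SP_def)

lemma SP_eq_span: "SP A = pm.span (unitv ` A)"
proof
  show "SP A \<subseteq> pm.span (unitv ` A)"
  proof
    fix p assume "p \<in> SP A"
    then have "(\<Sum>x\<in>keys p. scl (lookup p x) (unitv x)) \<in> pm.span (unitv ` A)"
      by (intro pm.span_sum pm.span_scale pm.span_base) (auto simp: SP_def)
    then show "p \<in> pm.span (unitv ` A)" by (simp add: pm_expand)
  qed
  show "pm.span (unitv ` A) \<subseteq> SP A"
    by (rule pm.span_minimal) auto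
qed

text \<open>The ambient spaces are infinite-dimensional in general, and \<open>pm.dim\<close> is 0
  on subspaces without a finite basis. Dimension counts are meaningful only below a finite spanning
  set, and this predicate carries that information along.\<close>

definition fd :: "('x \<Rightarrow>\<^sub>0 'k::field) set \<Rightarrow> bool" where
  "fd A \<longleftrightarrow> pm.subspace A \<and> (\<exists>F. finite F \<and> A \<subseteq> pm.span F)"

lemma fd_SP: "finite A \<Longrightarrow> fd (SP A)"
  by (auto simp: fd_def SP_eq_span)

lemma fd_subspace: "fd A \<Longrightarrow> pm.subspace A"
  by (simp add: fd_def)

lemma fd_subset: "fd C \<Longrightarrow> pm.subspace A \<Longrightarrow> A \<subseteq> C \<Longrightarrow> fd A"
  unfolding fd_def by blast

lemma fd_independent_finite: "fd A \<Longrightarrow> B \<subseteq> A \<Longrightarrow> pm.independent B \<Longrightarrow> finite B"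
  unfolding fd_def using pm.independent_span_bound subset_trans by blast

lemma fd_basis:
  assumes "fd A"
  obtains B where "finite B" "B \<subseteq> A" "pm.independent B" "pm.span B = A" "card B = pm.dim A"
proof -
  obtain B where B: "B \<subseteq> A" "pm.independent B" "A \<subseteq> pm.span B" "card B = pm.dim A"
    using pm.basis_exists by blast
  have "pm.span B = A"
    using B assms by (simp add: fd_def pm.span_minimal subset_antisym)
  moreover have "finite B" by (rule fd_independent_finite[OF assms B(1,2)])
  ultimately show ?thesis using that[of B] B by simp
qed

lemma fd_image:
  assumes "linear_pm f" "fd A"
  shows "fd (f ` A)"
proof -
  obtain F where "finite F" "A \<subseteq> pm.span F" using assms by (auto simp: fd_def)
  then have "finite (f ` F)" "f ` A \<subseteq> pm.span (f ` F)"
    using assms by (auto simp: pp.linear_span_image)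
  moreover have "pm.subspace (f ` A)"
    using assms by (intro pp.linear_subspace_image) (auto simp: fd_def)
  ultimately show ?thesis unfolding fd_def by (intro conjI exI[of _ "f ` F"])
qed

lemma subspace_ker_on:
  "linear_pm f \<Longrightarrow> pm.subspace A \<Longrightarrow> pm.subspace {x \<in> A. f x = 0}"
  by (rule pm.subspaceI)
     (auto simp: pm.subspace_0 pm.subspace_add pm.subspace_scale pp.linear_0 pp.linear_add pp.linear_scale)

text \<open>Representations in an independent set are unique: the coordinates of x in B are
  supported on B0 by one assumption and off B0 by the other.\<close>

lemma span_Int_Diff:
  assumes "pm.independent B" "B0 \<subseteq> B" "x \<in> pm.span B0" "x \<in> pm.span (B - B0)"
  shows "x = 0"
proof -
  have xB: "x \<in> pm.span B" using assms pm.span_mono by blast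
  have "pm.representation B x = pm.representation B0 x"
    using assms by (intro pm.representation_extend) auto
  moreover have "pm.representation B x = pm.representation (B - B0) x"
    using assms by (intro pm.representation_extend) auto
  ultimately have "pm.representation B x b = 0" for b
    by (metis Diff_iff pm.representation_ne_zero)
  then show ?thesis
    using pm.sum_nonzero_representation_eq[OF assms(1) xB] by simp
qed

text \<open>A basis B0 of the kernel is extended to a basis B of A. On the span of the added vectors
  f is injective by \<open>span_Int_Diff\<close>, and their images already generate the image, so
  \<open>card (B - B0)\<close> is its dimension.\<close>

lemma rank_nullity:
  assumes f: "linear_pm f" and A: "fd A"
  shows "pm.dim A = pm.dim {x \<in> A. f x = 0} + pm.dim (f ` A)"
proof -
  let ?K = "{x \<in> A. f x = 0}"
  have "fd ?K"
    by (rule fd_subset[OF A]) (use f A in \<open>auto intro: subspace_ker_on fd_subspace\<close>)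
  then obtain B0 where B0: "finite B0" "B0 \<subseteq> ?K" "pm.independent B0" "pm.span B0 = ?K"
    "card B0 = pm.dim ?K" by (rule fd_basis)
  obtain B where B: "B0 \<subseteq> B" "B \<subseteq> A" "pm.independent B" "A \<subseteq> pm.span B"
    using pm.maximal_independent_subset_extend[of B0 A] B0 by blast
  have finB: "finite B" using A B fd_independent_finite by blast
  have spB: "pm.span B = A" using B A by (simp add: fd_def pm.span_minimal subset_antisym)
  have inj: "inj_on f (pm.span (B - B0))"
  proof -
    have "x = 0" if "x \<in> pm.span (B - B0)" "f x = 0" for x
    proof -
      have "x \<in> A" using that spB pm.span_mono[of "B - B0" B] by auto
      then have "x \<in> pm.span B0" using that B0 by simp
      then show ?thesis using span_Int_Diff B that by blast
    qed
    then show "inj_on f (pm.span (B - B0))"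
      using pp.linear_inj_on_iff_eq_0[OF f pm.subspace_span] by blast
  qed
  have ind: "pm.independent (f ` (B - B0))"
    using f inj pm.independent_mono[OF B(3) Diff_subset[of B B0]]
    by (intro pp.linear_independent_injective_image)
  have "f ` A = pm.span (f ` B)" using spB f by (simp add: pp.linear_span_image)
  also have "\<dots> = pm.span (f ` (B - B0))"
  proof (rule subset_antisym)
    show "pm.span (f ` B) \<subseteq> pm.span (f ` (B - B0))"
    proof (rule pm.span_minimal)
      show "f ` B \<subseteq> pm.span (f ` (B - B0))"
      proof
        fix y assume "y \<in> f ` B"
        then obtain b where b: "b \<in> B" "y = f b" by blast
        show "y \<in> pm.span (f ` (B - B0))"
        proof (cases "b \<in> B0")
          case True then show ?thesis using B0 b by (auto simp: pm.span_zero)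
        next
          case False then show ?thesis using b by (auto intro: pm.span_base)
        qed
      qed
    qed simp
  qed (intro pm.span_mono, auto)
  finally have "pm.dim (f ` A) = card (f ` (B - B0))"
    using pm.dim_eq_card_independent[OF ind] by simp
  also have "\<dots> = card (B - B0)"
    by (intro card_image inj_on_subset[OF inj] pm.span_superset)
  finally have "pm.dim (f ` A) = card (B - B0)" .
  moreover have "pm.dim A = card B"
    using pm.dim_span_eq_card_independent[OF B(3)] by (simp add: spB)
  moreover have "card B = card B0 + card (B - B0)"
    using B0 B finB card_Diff_subset[of B0 B] card_mono[of B B0] by simp
  ultimately show ?thesis using B0 by simp
qed

section \<open>Complexes and Betti numbers\<close>

lemma independent_unitv:
  fixes A :: "'x set"
  assumes "finite A"
  shows "pm.independent (unitv ` A :: ('x \<Rightarrow>\<^sub>0 'k::field) set)"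
proof (rule pm.independent_if_scalars_zero)
  fix f :: "('x \<Rightarrow>\<^sub>0 'k) \<Rightarrow> 'k" and x :: "'x \<Rightarrow>\<^sub>0 'k"
  assume f: "(\<Sum>x\<in>unitv ` A. scl (f x) x) = 0" and "x \<in> unitv ` A"
  then obtain a where a: "a \<in> A" "x = unitv a" by blast
  have inj: "inj_on (unitv :: 'x \<Rightarrow> 'x \<Rightarrow>\<^sub>0 'k) A"
  proof (rule inj_onI)
    fix u v :: 'x
    assume "(unitv u :: 'x \<Rightarrow>\<^sub>0 'k) = unitv v"
    then have "keys (unitv u :: 'x \<Rightarrow>\<^sub>0 'k) = keys (unitv v :: 'x \<Rightarrow>\<^sub>0 'k)" by (rule arg_cong)
    then show "u = v" by simp
  qed
  have "(\<Sum>b\<in>A. scl (f (unitv b)) (unitv b)) = 0"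
    using f by (simp add: sum.reindex[OF inj])
  then have "lookup (\<Sum>b\<in>A. scl (f (unitv b)) (unitv b)) a = 0"
    by simp
  moreover have "lookup (\<Sum>b\<in>A. scl (f (unitv b)) (unitv b)) a = f (unitv a)"
    using a assms by (simp add: lookup_sum lookup_unitv if_distrib cong: if_cong)
  ultimately show "f x = 0" using a by simp
qed (use assms in simp)

lemma dim_SP:
  assumes "finite A"
  shows "pm.dim (SP A :: ('x \<Rightarrow>\<^sub>0 'k::field) set) = card A"
proof -
  have "inj_on (unitv :: 'x \<Rightarrow> 'x \<Rightarrow>\<^sub>0 'k) A"
  proof (rule inj_onI)
    fix u v :: 'x
    assume "(unitv u :: 'x \<Rightarrow>\<^sub>0 'k) = unitv v"
    then have "keys (unitv u :: 'x \<Rightarrow>\<^sub>0 'k) = keys (unitv v :: 'x \<Rightarrow>\<^sub>0 'k)" by (rule arg_cong)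
    then show "u = v" by simp
  qed
  then show ?thesis
    unfolding SP_eq_span pm.dim_span_eq_card_independent[OF independent_unitv[OF assms]]
    by (rule card_image)
qed

lemma dim_mono_fd:
  assumes "fd C" "A \<subseteq> C"
  shows "pm.dim A \<le> pm.dim C"
proof -
  obtain B where "finite B" "pm.span B = C" "card B = pm.dim C"
    using fd_basis[OF assms(1)] by metis
  then show ?thesis using pm.dim_le_card[of A B] assms by simp
qed

text \<open>The projection along B onto a complement: zero on a basis of B, the identity on the
  vectors that extend it to a basis of the whole space. As the kernel of f is exactly B, f serves as
  a model of the quotient map by B, and quotient spaces need not be formed.\<close>

lemma linear_projection_exists:
  fixes B :: "('x \<Rightarrow>\<^sub>0 'k::field) set"
  assumes "pm.subspace B"
  obtains f where "linear_pm f" "\<And>x. x - f x \<in> B" "\<And>x. x \<in> B \<Longrightarrow> f x = 0"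
proof -
  obtain B0 where B0: "B0 \<subseteq> B" "pm.independent B0" "B \<subseteq> pm.span B0"
    using pm.maximal_independent_subset[of B] by blast
  obtain B1 where B1: "B0 \<subseteq> B1" "pm.independent B1" "UNIV \<subseteq> pm.span B1"
    using pm.maximal_independent_subset_extend[of B0 UNIV] B0 by auto
  obtain f where f: "linear_pm f" "\<forall>b\<in>B1. f b = (if b \<in> B0 then 0 else b)"
    using pp.linear_independent_extend[OF B1(2), of "\<lambda>b. if b \<in> B0 then 0 else b"] by blast
  have "x - f x \<in> B" for x
  proof -
    have "x \<in> pm.span B1" using B1 by auto
    then show ?thesis
    proof (induction rule: pm.span_induct_alt)
      case base
      then show ?case using assms f by (simp add: pp.linear_0 pm.subspace_0)
    next
      case (step c b y)
      have "b - f b \<in> B" using step f B0 assms by (auto simp: pm.subspace_0)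
      then have "scl c (b - f b) + (y - f y) \<in> B"
        using step assms by (intro pm.subspace_add pm.subspace_scale) auto
      then show ?case using f
        by (simp add: pp.linear_add pp.linear_scale pm.scale_right_diff_distrib algebra_simps)
    qed
  qed
  moreover have "f x = 0" if "x \<in> B" for x
  proof (rule pp.linear_eq_0_on_span[OF f(1)])
    show "f b = 0" if "b \<in> B0" for b using that f B1 by auto
    show "x \<in> pm.span B0" using that B0 by blast
  qed
  ultimately show ?thesis using that f by blast
qed

lemma complement_exists:
  assumes "pm.subspace A" "pm.subspace C" "A \<subseteq> C"
  obtains W where "pm.subspace W" "W \<subseteq> C" "A \<inter> W = {0}" "\<And>c. c \<in> C \<Longrightarrow> \<exists>a\<in>A. \<exists>w\<in>W. c = a + w"
proof -
  obtain f where f: "linear_pm f" "\<And>x. x - f x \<in> A" "\<And>x. x \<in> A \<Longrightarrow> f x = 0"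
    using linear_projection_exists[OF assms(1)] by blast
  have ff: "f (f x) = f x" for x
    using f(3)[OF f(2)[of x]] pp.linear_diff[OF f(1), of x "f x"] by simp
  show ?thesis
  proof (rule that)
    show "pm.subspace (f ` C)" using f assms by (intro pp.linear_subspace_image)
    show "f ` C \<subseteq> C"
    proof clarify
      fix x assume "x \<in> C"
      then have "x - (x - f x) \<in> C" by (rule pm.subspace_diff[OF assms(2)]) (use f(2) assms in auto)
      then show "f x \<in> C" by simp
    qed
    show "A \<inter> f ` C = {0}"
    proof
      show "A \<inter> f ` C \<subseteq> {0}" using ff f(3) by fastforce
      show "{0} \<subseteq> A \<inter> f ` C"
        using assms f(1) by (auto simp: pm.subspace_0 pp.linear_0 intro!: image_eqI[of _ _ 0])
    qed
    show "\<exists>a\<in>A. \<exists>w\<in>f ` C. c = a + w" if "c \<in> C" for c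
      using f(2)[of c] that by (intro bexI[of _ "c - f c"] bexI[of _ "f c"]) auto
  qed
qed

section \<open>Finite-dimensional complexes and the comparison of their homology\<close>

definition cpx :: "(('x \<Rightarrow>\<^sub>0 'k::field) \<Rightarrow> ('x \<Rightarrow>\<^sub>0 'k)) \<Rightarrow> (nat \<Rightarrow> ('x \<Rightarrow>\<^sub>0 'k) set) \<Rightarrow> bool" where
  "cpx d C \<longleftrightarrow> linear_pm d \<and> (\<forall>i. fd (C i)) \<and> (\<forall>i. \<forall>z\<in>C (Suc i). d z \<in> C i) \<and>
     (\<forall>z\<in>C 0. d z = 0) \<and> (\<forall>i. \<forall>z\<in>C i. d (d z) = 0)"

definition cycles :: "(('x \<Rightarrow>\<^sub>0 'k::field) \<Rightarrow> ('x \<Rightarrow>\<^sub>0 'k)) \<Rightarrow> (nat \<Rightarrow> ('x \<Rightarrow>\<^sub>0 'k) set) \<Rightarrow> nat \<Rightarrow> ('x \<Rightarrow>\<^sub>0 'k) set" where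
  "cycles d C i = {z \<in> C i. d z = 0}"

definition boundaries :: "(('x \<Rightarrow>\<^sub>0 'k::field) \<Rightarrow> ('x \<Rightarrow>\<^sub>0 'k)) \<Rightarrow> (nat \<Rightarrow> ('x \<Rightarrow>\<^sub>0 'k) set) \<Rightarrow> nat \<Rightarrow> ('x \<Rightarrow>\<^sub>0 'k) set" where
  "boundaries d C i = d ` C (Suc i)"

definition betti :: "(('x \<Rightarrow>\<^sub>0 'k::field) \<Rightarrow> ('x \<Rightarrow>\<^sub>0 'k)) \<Rightarrow> (nat \<Rightarrow> ('x \<Rightarrow>\<^sub>0 'k) set) \<Rightarrow> nat \<Rightarrow> nat" where
  "betti d C i = pm.dim (cycles d C i) - pm.dim (boundaries d C i)"

lemma cpxD:
  assumes "cpx d C"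
  shows "linear_pm d" "fd (C i)" "z \<in> C (Suc i) \<Longrightarrow> d z \<in> C i" "z \<in> C 0 \<Longrightarrow> d z = 0"
    "z \<in> C i \<Longrightarrow> d (d z) = 0" "pm.subspace (C i)"
  using assms by (auto simp: cpx_def fd_def)

lemma fd_cycles: "cpx d C \<Longrightarrow> fd (cycles d C i)"
  unfolding cycles_def
  by (rule fd_subset[of "C i"]) (auto intro: cpxD subspace_ker_on)

lemma fd_boundaries: "cpx d C \<Longrightarrow> fd (boundaries d C i)"
  unfolding boundaries_def by (intro fd_image cpxD)

lemma boundaries_subset_cycles: "cpx d C \<Longrightarrow> boundaries d C i \<subseteq> cycles d C i"
  by (auto simp: boundaries_def cycles_def dest: cpxD)

text \<open>\<open>betti\<close> subtracts natural numbers; nothing is lost because the boundaries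
  lie in the finite-dimensional space of cycles.\<close>

lemma dim_cycles: "cpx d C \<Longrightarrow> pm.dim (cycles d C i) = betti d C i + pm.dim (boundaries d C i)"
  unfolding betti_def
  using dim_mono_fd[OF fd_cycles boundaries_subset_cycles, of d C i] by simp

lemma dim_chains_Suc:
  "cpx d C \<Longrightarrow> pm.dim (C (Suc i)) = pm.dim (cycles d C (Suc i)) + pm.dim (boundaries d C i)"
  unfolding cycles_def boundaries_def by (rule rank_nullity) (auto dest: cpxD)

lemma cycles_0: "cpx d C \<Longrightarrow> cycles d C 0 = C 0"
  by (auto simp: cycles_def dest: cpxD)

lemma kernel_cpx:
  assumes "cpx d C" "cpx d' C'" "linear_pm f" "\<And>i z. z \<in> C i \<Longrightarrow> f (d z) = d' (f z)"
  shows "cpx d (\<lambda>i. {z \<in> C i. f z = 0})"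
proof -
  have "fd {z \<in> C i. f z = 0}" for i
    by (rule fd_subset[OF cpxD(2)[OF assms(1), of i]])
       (auto intro: subspace_ker_on assms cpxD(6)[OF assms(1)])
  moreover have "f (d z) = 0" if "z \<in> C i" "f z = 0" for z i
    using assms(4)[OF that(1)] that by (simp add: pp.linear_0[OF cpxD(1)[OF assms(2)]])
  ultimately show ?thesis
    using assms(1) unfolding cpx_def by blast
qed

text \<open>Assumption A says that the inclusion of the kernel complex is zero on homology.
  Restricted to the boundaries of C, f then has all cycles of the kernel complex as its kernel, and
  surjectivity makes the boundaries of C' its image. Both an acyclic kernel and the connecting maps
  lead to this situation.\<close>

lemma dim_boundaries_surj:
  assumes C: "cpx d C" and C': "cpx d' C'" and f: "linear_pm f"
    and surj: "\<And>i. f ` C i = C' i" and comm: "\<And>i z. z \<in> C i \<Longrightarrow> f (d z) = d' (f z)"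
    and A: "\<And>i. cycles d (\<lambda>i. {z \<in> C i. f z = 0}) i \<subseteq> boundaries d C i"
  shows "pm.dim (boundaries d C i) =
    pm.dim (boundaries d' C' i) + pm.dim (cycles d (\<lambda>i. {z \<in> C i. f z = 0}) i)"
proof -
  let ?A = "\<lambda>i. {z \<in> C i. f z = 0}"
  have "f ` boundaries d C i = boundaries d' C' i"
  proof -
    have "f ` boundaries d C i = (\<lambda>z. d' (f z)) ` C (Suc i)"
      unfolding boundaries_def image_image by (intro image_cong) (auto simp: comm)
    also have "\<dots> = boundaries d' C' i"
      unfolding boundaries_def surj[symmetric] image_image ..
    finally show ?thesis .
  qed
  moreover have "{z \<in> boundaries d C i. f z = 0} = cycles d ?A i"
    using A[of i] C by (auto simp: boundaries_def cycles_def dest: cpxD)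
  ultimately show ?thesis
    using rank_nullity[OF f fd_boundaries[OF C, of i]] by simp
qed

text \<open>Cycles of C' lift to cycles of C: the differential of an arbitrary preimage is a cycle
  of the kernel complex, hence the differential of some y there, and subtracting y corrects the
  preimage. Cycles and boundaries of C then exceed those of C' by the same amount, the cycles of the
  kernel.\<close>

lemma betti_surj_acyclic_kernel:
  assumes C: "cpx d C" and C': "cpx d' C'" and f: "linear_pm f"
    and surj: "\<And>i. f ` C i = C' i" and comm: "\<And>i z. z \<in> C i \<Longrightarrow> f (d z) = d' (f z)"
    and acyc: "\<And>i z. z \<in> C i \<Longrightarrow> f z = 0 \<Longrightarrow> d z = 0 \<Longrightarrow> \<exists>y\<in>C (Suc i). f y = 0 \<and> z = d y"
  shows "betti d C i = betti d' C' i"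
proof -
  let ?A = "\<lambda>i. {z \<in> C i. f z = 0}"
  have A: "cycles d ?A i \<subseteq> boundaries d C i" for i
    using acyc by (auto simp: cycles_def boundaries_def image_iff)
  have b: "pm.dim (boundaries d C i) = pm.dim (boundaries d' C' i) + pm.dim (cycles d ?A i)"
    by (rule dim_boundaries_surj[OF C C' f surj comm A])
  have "f ` cycles d C i = cycles d' C' i"
  proof (rule subset_antisym)
    show "f ` cycles d C i \<subseteq> cycles d' C' i"
    proof clarify
      fix z assume "z \<in> cycles d C i"
      then have "z \<in> C i" "d z = 0" by (auto simp: cycles_def)
      then show "f z \<in> cycles d' C' i"
        using comm[of z i] surj[of i] by (auto simp: cycles_def pp.linear_0[OF f])
    qed
    show "cycles d' C' i \<subseteq> f ` cycles d C i"
    proof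
      fix z' assume z': "z' \<in> cycles d' C' i"
      then obtain c where c: "c \<in> C i" "z' = f c"
        using surj[of i] by (auto simp: cycles_def)
      have fd0: "f (d c) = 0" using comm[OF c(1)] z' c by (auto simp: cycles_def)
      show "z' \<in> f ` cycles d C i"
      proof (cases i)
        case 0
        then show ?thesis using c cycles_0[OF C] by auto
      next
        case (Suc j)
        then have "d c \<in> C j" using c cpxD(3)[OF C] by auto
        then obtain y where y: "y \<in> C i" "f y = 0" "d c = d y"
          using acyc[of "d c" j] fd0 cpxD(5)[OF C c(1)] Suc by blast
        have "c - y \<in> cycles d C i"
          using c y pm.subspace_diff[OF cpxD(6)[OF C]] pp.linear_diff[OF cpxD(1)[OF C]]
          by (auto simp: cycles_def)
        moreover have "f (c - y) = z'" using c y by (simp add: pp.linear_diff[OF f])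
        ultimately show ?thesis by blast
      qed
    qed
  qed
  moreover have "{z \<in> cycles d C i. f z = 0} = cycles d ?A i"
    by (auto simp: cycles_def)
  ultimately have "pm.dim (cycles d C i) = pm.dim (cycles d' C' i) + pm.dim (cycles d ?A i)"
    using rank_nullity[OF f fd_cycles[OF C, of i]] by simp
  then show ?thesis using b by (simp add: betti_def)
qed

text \<open>The long exact sequence of the kernel complex, C and C' falls apart into short pieces,
  since A makes the map into the homology of C zero. Instead of a connecting homomorphism only
  dimensions are compared: the rank-nullity identities for chains, cycles and boundaries are linear
  and determine the Betti numbers.\<close>

lemma betti_connecting:
  assumes C: "cpx d C" and C': "cpx d' C'" and f: "linear_pm f"
    and surj: "\<And>i. f ` C i = C' i" and comm: "\<And>i z. z \<in> C i \<Longrightarrow> f (d z) = d' (f z)"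
    and A: "\<And>i. cycles d (\<lambda>i. {z \<in> C i. f z = 0}) i \<subseteq> boundaries d C i"
  shows "betti d' C' 0 = betti d C 0"
    and "betti d' C' (Suc i) = betti d C (Suc i) + betti d (\<lambda>i. {z \<in> C i. f z = 0}) i"
proof -
  let ?A = "\<lambda>i. {z \<in> C i. f z = 0}"
  have cA: "cpx d ?A" by (rule kernel_cpx[OF C C' f comm])
  have b: "pm.dim (boundaries d C i) = pm.dim (boundaries d' C' i) + pm.dim (cycles d ?A i)" for i
    by (rule dim_boundaries_surj[OF C C' f surj comm A])
  have c: "pm.dim (C i) = pm.dim (?A i) + pm.dim (C' i)" for i
    using rank_nullity[OF f cpxD(2)[OF C, of i]] surj[of i] by simp
  show "betti d' C' 0 = betti d C 0"
    using c[of 0] b[of 0] dim_cycles[OF C, of 0] dim_cycles[OF C', of 0]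
    by (simp add: cycles_0[OF C] cycles_0[OF C'] cycles_0[OF cA])
  show "betti d' C' (Suc i) = betti d C (Suc i) + betti d ?A i"
    using c[of "Suc i"] b[of "Suc i"] b[of i] dim_cycles[OF C, of "Suc i"] dim_cycles[OF C', of "Suc i"]
      dim_cycles[OF cA, of i] dim_chains_Suc[OF C, of i] dim_chains_Suc[OF C', of i]
      dim_chains_Suc[OF cA, of i]
    by simp
qed

text \<open>\<open>acyc\<close> states that C modulo A has no homology. The map f annihilates
  exactly the boundaries of C, so the image of the cycles is the homology of C. Cycles of A have the
  same image, since each cycle of C differs from one of A by a boundary, and a boundary of C lying
  in A is already a boundary of A.\<close>

lemma betti_sub_acyclic_quotient:
  assumes C: "cpx d C" and A: "cpx d A" and sub: "\<And>i. A i \<subseteq> C i"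
    and acyc: "\<And>i c. c \<in> C i \<Longrightarrow> d c \<in> A (i - 1) \<Longrightarrow> \<exists>a\<in>A i. \<exists>y\<in>C (Suc i). c = a + d y"
  shows "betti d A i = betti d C i"
proof -
  obtain f where f: "linear_pm f" "\<And>x. x - f x \<in> boundaries d C i" "\<And>x. x \<in> boundaries d C i \<Longrightarrow> f x = 0"
    using linear_projection_exists[OF fd_subspace[OF fd_boundaries[OF C, of i]]] by blast
  have f0: "f x = 0 \<longleftrightarrow> x \<in> boundaries d C i" for x
    using f(2)[of x] f(3)[of x] by auto
  have split: "\<exists>a\<in>cycles d A i. \<exists>y\<in>C (Suc i). c = a + d y" if c: "c \<in> cycles d C i" for c
  proof -
    have "d c \<in> A (i - 1)" using c pm.subspace_0[OF cpxD(6)[OF A]] by (simp add: cycles_def)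
    then obtain a y where ay: "a \<in> A i" "y \<in> C (Suc i)" "c = a + d y"
      using acyc[of c i] c by (auto simp: cycles_def)
    have "a = c - d y" using ay by simp
    then have "d a = 0"
      using c cpxD(5)[OF C ay(2)] by (simp add: cycles_def pp.linear_diff[OF cpxD(1)[OF C]])
    then show ?thesis using ay by (auto simp: cycles_def)
  qed
  have img: "f ` cycles d C i = f ` cycles d A i"
  proof (rule subset_antisym)
    show "f ` cycles d C i \<subseteq> f ` cycles d A i"
    proof clarify
      fix c assume "c \<in> cycles d C i"
      then obtain a y where ay: "a \<in> cycles d A i" "y \<in> C (Suc i)" "c = a + d y" using split by blast
      have "f (d y) = 0" using ay f0 by (auto simp: boundaries_def)
      then show "f c \<in> f ` cycles d A i" using ay by (simp add: pp.linear_add[OF f(1)])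
    qed
    show "f ` cycles d A i \<subseteq> f ` cycles d C i" using sub by (auto simp: cycles_def)
  qed
  have kC: "{z \<in> cycles d C i. f z = 0} = boundaries d C i"
    using boundaries_subset_cycles[OF C, of i] f0 by auto
  have kA: "{z \<in> cycles d A i. f z = 0} = boundaries d A i"
  proof (rule subset_antisym)
    show "boundaries d A i \<subseteq> {z \<in> cycles d A i. f z = 0}"
      using boundaries_subset_cycles[OF A, of i] sub f0 by (auto simp: boundaries_def)
    show "{z \<in> cycles d A i. f z = 0} \<subseteq> boundaries d A i"
    proof clarify
      fix z assume z: "z \<in> cycles d A i" "f z = 0"
      then obtain c where c: "c \<in> C (Suc i)" "z = d c" using f0 by (auto simp: boundaries_def)
      then obtain a y where ay: "a \<in> A (Suc i)" "y \<in> C (Suc (Suc i))" "c = a + d y"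
        using acyc[of c "Suc i"] z by (auto simp: cycles_def)
      have "z = d a"
        using c ay cpxD(5)[OF C ay(2)] by (simp add: pp.linear_add[OF cpxD(1)[OF C]])
      then show "z \<in> boundaries d A i" using ay by (auto simp: boundaries_def)
    qed
  qed
  show ?thesis
    using rank_nullity[OF f(1) fd_cycles[OF C, of i]] rank_nullity[OF f(1) fd_cycles[OF A, of i]]
      dim_cycles[OF C, of i] dim_cycles[OF A, of i]
    by (simp add: img kC kA)
qed

text \<open>The rows of M are the images of the basis vectors. A set R' of rows is independent iff d
  is injective on \<open>SP R'\<close>, which bounds its size by the dimension of the image; a
  maximal independent set among the images attains the bound.\<close>

lemma mat_rank_eq_dim:
  fixes M :: "'r \<Rightarrow> 'c \<Rightarrow> 'k::field"
  assumes R: "finite R" and C: "finite C" and d: "linear_pm d"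
    and row: "\<And>r. r \<in> R \<Longrightarrow> d (unitv r) = (\<Sum>y\<in>C. scl (M r y) (unitv y))"
  shows "mat_rank R C M = pm.dim (d ` SP R)"
proof -
  have look: "lookup (\<Sum>r\<in>R'. scl (c r) (d (unitv r))) y =
      (if y \<in> C then \<Sum>r\<in>R'. c r * M r y else 0)" if "R' \<subseteq> R" for c :: "'r \<Rightarrow> 'k" and R' y
  proof -
    have "lookup (d (unitv r)) y = (if y \<in> C then M r y else 0)" if "r \<in> R" for r
      using C by (simp add: row[OF that] lookup_sum lookup_unitv if_distrib cong: if_cong)
    then have "(\<Sum>r\<in>R'. c r * lookup (d (unitv r)) y) = (\<Sum>r\<in>R'. c r * (if y \<in> C then M r y else 0))"
      using that by (intro sum.cong) auto
    then show ?thesis by (simp add: lookup_sum)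
  qed
  have indep_iff: "lin_indep_rows R' C M \<longleftrightarrow>
      (\<forall>c. (\<Sum>r\<in>R'. scl (c r) (d (unitv r))) = 0 \<longrightarrow> (\<forall>r\<in>R'. c r = 0))" if "R' \<subseteq> R" for R'
  proof -
    have "(\<Sum>r\<in>R'. scl (c r) (d (unitv r))) = 0 \<longleftrightarrow> (\<forall>y\<in>C. (\<Sum>r\<in>R'. c r * M r y) = 0)" for c
      by (auto simp: poly_mapping_eq_iff fun_eq_iff look[OF that])
    then show ?thesis by (simp add: lin_indep_rows_def)
  qed
  let ?D = "pm.dim (d ` SP R)"
  have le: "card R' \<le> ?D" if "R' \<subseteq> R" "lin_indep_rows R' C M" for R'
  proof -
    have fR': "finite R'" using that R finite_subset by blast
    have "{x \<in> SP R'. d x = 0} = {0}"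
    proof -
      have "x = 0" if x: "x \<in> SP R'" "d x = 0" for x
      proof -
        have k: "keys x \<subseteq> R'" using x by (simp add: SP_def)
        have "(\<Sum>r\<in>R'. scl (lookup x r) (d (unitv r))) = d x"
          using linear_eq_lin[OF d, of x] lin_superset[OF fR' k, of "\<lambda>x. d (unitv x)"] by simp
        then have "\<forall>r\<in>R'. lookup x r = 0"
          using x \<open>lin_indep_rows R' C M\<close> indep_iff[OF \<open>R' \<subseteq> R\<close>] by simp
        then show "x = 0" using k by (intro poly_mapping_eqI) (auto simp: in_keys_iff)
      qed
      then show ?thesis using d by (auto simp: pp.linear_0 pm.subspace_0)
    qed
    then have "pm.dim (SP R' :: ('r \<Rightarrow>\<^sub>0 'k) set) = pm.dim {0 :: 'r \<Rightarrow>\<^sub>0 'k} + pm.dim (d ` SP R')"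
      using rank_nullity[OF d fd_SP[OF fR']] by simp
    moreover have "pm.dim {0 :: 'r \<Rightarrow>\<^sub>0 'k} = 0"
      using pm.dim_span_eq_card_independent[OF pm.independent_empty] by simp
    ultimately have "card R' = pm.dim (d ` SP R')" using dim_SP[OF fR', where 'k='k] by simp
    also have "\<dots> \<le> ?D"
      by (intro dim_mono_fd fd_image[OF d] fd_SP R image_mono SP_mono that)
    finally show ?thesis .
  qed
  have ex: "\<exists>R'\<subseteq>R. lin_indep_rows R' C M \<and> card R' = ?D"
  proof -
    let ?S = "(\<lambda>r. d (unitv r)) ` R"
    have sp: "d ` SP R = pm.span ?S"
      by (simp add: SP_eq_span pp.linear_span_image[OF d, symmetric] image_image)
    obtain B where B: "B \<subseteq> ?S" "pm.independent B" "?S \<subseteq> pm.span B"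
      using pm.maximal_independent_subset[of ?S] by blast
    have spB: "pm.span B = pm.span ?S"
      using B by (meson pm.span_eq pm.span_superset subset_trans)
    obtain R' where R': "R' \<subseteq> R" "inj_on (\<lambda>r. d (unitv r)) R'" "B = (\<lambda>r. d (unitv r)) ` R'"
      using B(1) by (auto simp: subset_image_inj)
    have fR': "finite R'" using R' R finite_subset by blast
    have "card R' = card B" using R' card_image by metis
    also have "\<dots> = ?D" using pm.dim_span_eq_card_independent[OF B(2)] by (simp add: sp spB)
    finally have card: "card R' = ?D" .
    have "\<forall>r\<in>R'. c r = 0" if c: "(\<Sum>r\<in>R'. scl (c r) (d (unitv r))) = 0" for c
    proof
      fix r assume r: "r \<in> R'"
      let ?u = "\<lambda>b. c (the_inv_into R' (\<lambda>r. d (unitv r)) b)"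
      have u: "?u (d (unitv r)) = c r" if "r \<in> R'" for r
        using the_inv_into_f_f[OF R'(2) that] by simp
      have "(\<Sum>b\<in>B. scl (?u b) b) = (\<Sum>r\<in>R'. scl (?u (d (unitv r))) (d (unitv r)))"
        unfolding R'(3) by (simp add: sum.reindex[OF R'(2)])
      also have "\<dots> = (\<Sum>r\<in>R'. scl (c r) (d (unitv r)))"
        by (rule sum.cong) (auto simp: u)
      finally have "(\<Sum>b\<in>B. scl (?u b) b) = 0" using c by simp
      moreover have "finite B" "d (unitv r) \<in> B" using R' fR' r by auto
      ultimately have "?u (d (unitv r)) = 0"
        using pm.independentD[OF B(2), of B ?u "d (unitv r)"] by simp
      then show "c r = 0" using u[OF r] by simp
    qed
    then show ?thesis using indep_iff[OF R'(1)] R' card by blast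
  qed
  show ?thesis
    unfolding mat_rank_def
  proof (rule Max_eqI)
    have "{card R' |R'. R' \<subseteq> R \<and> lin_indep_rows R' C M} \<subseteq> card ` Pow R" by auto
    then show "finite {card R' |R'. R' \<subseteq> R \<and> lin_indep_rows R' C M}"
      by (rule finite_subset) (use R in simp)
    show "y \<le> ?D" if "y \<in> {card R' |R'. R' \<subseteq> R \<and> lin_indep_rows R' C M}" for y
      using that le by auto
    show "?D \<in> {card R' |R'. R' \<subseteq> R \<and> lin_indep_rows R' C M}"
    proof -
      obtain R' where "R' \<subseteq> R" "lin_indep_rows R' C M" "card R' = ?D" using ex by blast
      then show ?thesis by (intro CollectI exI[of _ R']) simp
    qed
  qed
qed

text \<open>\<open>hom_dim\<close> counts no outgoing rank in degree 0, which on the side of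
  \<open>betti\<close> is the assumption \<open>d0\<close>. In higher degrees the number of basis
  elements minus the rank is the dimension of the cycles.\<close>

lemma hom_dim_eq_betti:
  fixes B :: "nat \<Rightarrow> 'x set" and coef :: "'x \<Rightarrow> 'x \<Rightarrow> 'k::field"
  assumes fin: "\<And>i. finite (B i)" and d: "linear_pm d"
    and d0: "\<And>x. x \<in> B 0 \<Longrightarrow> d (unitv x) = 0"
    and dS: "\<And>i x. x \<in> B (Suc i) \<Longrightarrow> d (unitv x) = (\<Sum>y\<in>B i. scl (coef x y) (unitv y))"
  shows "hom_dim B coef i = betti d (\<lambda>i. SP (B i)) i"
proof -
  have r: "mat_rank (B (Suc i)) (B i) coef = pm.dim (d ` SP (B (Suc i)))" for i
    by (intro mat_rank_eq_dim fin d dS)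
  have c: "card (B i) = pm.dim (cycles d (\<lambda>i. SP (B i)) i) + pm.dim (d ` SP (B i))" for i
    unfolding cycles_def using rank_nullity[OF d fd_SP[OF fin[of i]]] dim_SP[OF fin[of i], where 'k='k]
    by simp
  show ?thesis
  proof (cases i)
    case 0
    have "d z = 0" if "z \<in> SP (B 0)" for z
      using linear_eq_on_units[OF d linear_pmI, of "\<lambda>_. 0" z] that d0 by (auto simp: SP_def)
    then have "cycles d (\<lambda>i. SP (B i)) 0 = SP (B 0)" by (auto simp: cycles_def)
    then show ?thesis
      using 0 r[of 0] dim_SP[OF fin[of 0], where 'k='k]
      by (simp add: hom_dim_def betti_def boundaries_def)
  next
    case (Suc j)
    then show ?thesis using c[of i] r[of i] r[of j]
      by (simp add: hom_dim_def betti_def boundaries_def)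
  qed
qed

section \<open>Bar complexes with coefficients in a dg module\<close>

text \<open>The letter \<open>(m, False)\<close> stands for the monomial \<open>m\<close> and \<open>(m, True)\<close> for \<open>\<sigma> m\<close>; products of two
  \<open>\<sigma>\<close>-letters vanish. The weight of a word counts each letter once and each \<open>\<sigma>\<close> once more.\<close>

type_synonym letter = "(nat \<Rightarrow> nat) \<times> bool"

text \<open>(-1) to the degree of the letter in the dg algebra, that is, without the shift by one
  which the bar construction adds.\<close>

definition sg :: "letter \<Rightarrow> 'k::field" where
  "sg b = (if snd b then - 1 else 1)"

definition bprod :: "letter \<Rightarrow> letter \<Rightarrow> letter" where
  "bprod b b' = (fst b + fst b', snd b \<or> snd b')"

definition ten :: "letter list \<Rightarrow> ('l \<Rightarrow>\<^sub>0 'k::field) \<Rightarrow> (letter list \<times> 'l \<Rightarrow>\<^sub>0 'k)" where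
  "ten w = lin (\<lambda>l. unitv (w, l))"

definition wcomp :: "letter list \<Rightarrow> (letter list \<times> 'l \<Rightarrow>\<^sub>0 'k::field) \<Rightarrow> ('l \<Rightarrow>\<^sub>0 'k)" where
  "wcomp w = lin (\<lambda>(w', l). if w' = w then unitv l else 0)"

definition cns :: "letter \<Rightarrow> (letter list \<times> 'l \<Rightarrow>\<^sub>0 'k::field) \<Rightarrow> (letter list \<times> 'l \<Rightarrow>\<^sub>0 'k)" where
  "cns b = lin (\<lambda>(w, l). unitv (b # w, l))"

definition bdel :: "letter \<Rightarrow> (letter list \<times> 'l \<Rightarrow>\<^sub>0 'k::field) \<Rightarrow> (letter list \<times> 'l \<Rightarrow>\<^sub>0 'k)" where
  "bdel b y = (if snd b then cns (fst b, False) y else 0)"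

fun bmul1 :: "(letter \<Rightarrow> 'l \<Rightarrow> ('l \<Rightarrow>\<^sub>0 'k::field)) \<Rightarrow> letter \<Rightarrow> letter list \<Rightarrow> 'l \<Rightarrow> (letter list \<times> 'l \<Rightarrow>\<^sub>0 'k)" where
  "bmul1 act b [] l = ten [] (act b l)"
| "bmul1 act b (b' # w) l = (if snd b \<and> snd b' then 0 else unitv (bprod b b' # w, l))"

definition bmul :: "(letter \<Rightarrow> 'l \<Rightarrow> ('l \<Rightarrow>\<^sub>0 'k::field)) \<Rightarrow> letter \<Rightarrow> (letter list \<times> 'l \<Rightarrow>\<^sub>0 'k) \<Rightarrow> (letter list \<times> 'l \<Rightarrow>\<^sub>0 'k)" where
  "bmul act b = lin (\<lambda>(w, l). bmul1 act b w l)"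

text \<open>The bar differential by recursion on the first letter: its \<sigma> is removed, it is
  multiplied into the next letter (into the coefficient if the word ends), or the rest is
  differentiated. The alternating signs of the faces arise from the repeated minus sign, and later
  identities become inductions on the word through \<open>bar_cns\<close>.\<close>

fun bar1 :: "(letter \<Rightarrow> 'l \<Rightarrow> ('l \<Rightarrow>\<^sub>0 'k::field)) \<Rightarrow> ('l \<Rightarrow> ('l \<Rightarrow>\<^sub>0 'k)) \<Rightarrow> letter list \<Rightarrow> 'l \<Rightarrow> (letter list \<times> 'l \<Rightarrow>\<^sub>0 'k)" where
  "bar1 act dl [] l = ten [] (dl l)"
| "bar1 act dl (b # w) l =
     bdel b (unitv (w, l)) + scl (sg b) (bmul1 act b w l - cns b (bar1 act dl w l))"

definition bar :: "(letter \<Rightarrow> 'l \<Rightarrow> ('l \<Rightarrow>\<^sub>0 'k::field)) \<Rightarrow> ('l \<Rightarrow> ('l \<Rightarrow>\<^sub>0 'k)) \<Rightarrow> (letter list \<times> 'l \<Rightarrow>\<^sub>0 'k) \<Rightarrow> (letter list \<times> 'l \<Rightarrow>\<^sub>0 'k)" where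
  "bar act dl = lin (\<lambda>(w, l). bar1 act dl w l)"

lemma linear_bar_ops [simp, intro]:
  "linear_pm (ten w)" "linear_pm (wcomp w)" "linear_pm (cns b)" "linear_pm (bmul act b)" "linear_pm (bar act dl)"
  by (auto simp: ten_def wcomp_def cns_def bmul_def bar_def)

lemma linear_bdel [simp, intro]: "linear_pm (bdel b)"
  by (rule linear_pmI) (auto simp: bdel_def cns_def)

lemmas linear_pm_simps = pp.linear_add pp.linear_diff pp.linear_scale pp.linear_neg pp.linear_0

lemmas bar_ops_simps [simp] =
  linear_pm_simps[OF linear_bar_ops(1)] linear_pm_simps[OF linear_bar_ops(2)]
  linear_pm_simps[OF linear_bar_ops(3)] linear_pm_simps[OF linear_bar_ops(4)]
  linear_pm_simps[OF linear_bar_ops(5)] linear_pm_simps[OF linear_bdel]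

lemma ten_unitv: "ten w (unitv l) = unitv (w, l)"
  by (simp add: ten_def)

lemma cns_unitv: "cns b (unitv (w, l)) = unitv (b # w, l)"
  by (simp add: cns_def)

lemma cns_ten: "cns b (ten w y) = ten (b # w) y"
  by (rule linear_eq_on_units[OF linear_pm_compose[OF linear_bar_ops(1) linear_bar_ops(3)] linear_bar_ops(1)])
     (simp add: ten_unitv cns_unitv)

lemma wcomp_unitv: "wcomp w (unitv (w', l)) = (if w' = w then unitv l else 0)"
  by (simp add: wcomp_def)

lemma wcomp_ten: "wcomp w (ten w' y) = (if w' = w then y else 0)"
proof (cases "w' = w")
  case True
  have "wcomp w (ten w' y) = lin unitv y"
    by (rule linear_eq_on_units[OF linear_pm_compose[OF linear_bar_ops(1) linear_bar_ops(2)] linear_lin])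
       (simp add: ten_unitv wcomp_unitv True)
  then show ?thesis using True by (simp add: lin_id)
next
  case False
  have "wcomp w (ten w' y) = lin (\<lambda>_. 0) y"
    by (rule linear_eq_on_units[OF linear_pm_compose[OF linear_bar_ops(1) linear_bar_ops(2)] linear_lin])
       (simp add: ten_unitv wcomp_unitv False)
  then show ?thesis using False by (simp add: lin_def)
qed

lemma lookup_wcomp: "lookup (wcomp w p) l = lookup p (w, l)"
proof -
  have "lookup (wcomp w p) l = (\<Sum>x\<in>keys p. if x = (w, l) then lookup p x else 0)"
    unfolding wcomp_def lin_def lookup_sum
    by (intro sum.cong refl) (auto simp: lookup_unitv split: prod.splits if_splits)
  then show ?thesis by (simp add: in_keys_iff)
qed

lemma ten_expand: "p = (\<Sum>w\<in>fst ` keys p. ten w (wcomp w p))"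
proof (rule poly_mapping_eqI)
  fix x :: "letter list \<times> 'a"
  obtain w l where x: "x = (w, l)" by (cases x)
  have "lookup (ten v (wcomp v p)) (w, l) = (if v = w then lookup p (w, l) else 0)" for v
  proof -
    have "lookup (ten v (wcomp v p)) (w, l) = lookup (if v = w then wcomp v p else 0) l"
      using lookup_wcomp[of w "ten v (wcomp v p)" l] by (simp only: wcomp_ten)
    then show ?thesis by (auto simp: lookup_wcomp)
  qed
  moreover have "lookup p (w, l) = 0" if "w \<notin> fst ` keys p"
    using that by (metis fst_conv image_eqI in_keys_iff)
  ultimately show "lookup p x = lookup (\<Sum>w\<in>fst ` keys p. ten w (wcomp w p)) x"
    by (simp add: x lookup_sum)
qed

lemma wcomp_eq_0_iff: "wcomp w p = 0 \<longleftrightarrow> w \<notin> fst ` keys p"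
proof -
  have "wcomp w p = 0 \<longleftrightarrow> (\<forall>l. (w, l) \<notin> keys p)"
    by (simp add: poly_mapping_eq_iff fun_eq_iff lookup_wcomp in_keys_iff)
  then show ?thesis by force
qed

lemma bmul_unitv: "bmul act b (unitv (w, l)) = bmul1 act b w l"
  by (simp add: bmul_def)

lemma bar_unitv: "bar act dl (unitv (w, l)) = bar1 act dl w l"
  by (simp add: bar_def)

lemma bmul_cns: "bmul act b (cns b' y) = (if snd b \<and> snd b' then 0 else cns (bprod b b') y)"
proof -
  have "bmul act b (cns b' y) = lin (\<lambda>(w, l). if snd b \<and> snd b' then 0 else unitv (bprod b b' # w, l)) y"
    by (rule linear_eq_on_units[OF linear_pm_compose[OF linear_bar_ops(3) linear_bar_ops(4)] linear_lin])
       (auto simp: cns_unitv bmul_def)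
  then show ?thesis by (auto simp: cns_def lin_def split_def)
qed

lemma bmul_ten_Nil: "bmul act b (ten [] y) = ten [] (lin (act b) y)"
  by (rule linear_eq_on_units[OF linear_pm_compose[OF linear_bar_ops(1) linear_bar_ops(4)]
        linear_pm_compose[OF linear_lin linear_bar_ops(1)]])
     (simp add: ten_unitv bmul_def)

lemma bar_ten_Nil: "bar act dl (ten [] y) = ten [] (lin dl y)"
  by (rule linear_eq_on_units[OF linear_pm_compose[OF linear_bar_ops(1) linear_bar_ops(5)]
        linear_pm_compose[OF linear_lin linear_bar_ops(1)]])
     (simp add: ten_unitv bar_def)

lemma bar_cns: "bar act dl (cns b y) = bdel b y + scl (sg b) (bmul act b y - cns b (bar act dl y))"
proof (rule linear_eq_on_units[of "\<lambda>y. bar act dl (cns b y)"])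
  show "linear_pm (\<lambda>y. bar act dl (cns b y))" by (rule linear_pm_compose[of "cns b" "bar act dl"]) auto
  show "linear_pm (\<lambda>y. bdel b y + scl (sg b) (bmul act b y - cns b (bar act dl y)))"
    by (rule linear_pmI) (auto simp: algebra_simps pm.scale_right_distrib pm.scale_right_diff_distrib)
  fix x :: "letter list \<times> 'a"
  obtain w l where "x = (w, l)" by (cases x)
  then show "bar act dl (cns b (unitv x)) =
    bdel b (unitv x) + scl (sg b) (bmul act b (unitv x) - cns b (bar act dl (unitv x)))"
    by (simp add: cns_unitv bar_def bmul_def)
qed

lemma unit_cases:
  obtains l where "x = ([], l)" | b w l where "x = (b # w, l)"
  by (cases x; cases "fst x") auto

text \<open>Associativity, Leibniz rule and square zero, stated once on the basis of the whole
  coefficient space. Gradings and submodules are left to \<open>dgfam\<close>, so that the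
  identities need not be repeated for each submodule.\<close>

definition dgmod :: "(letter \<Rightarrow> 'l \<Rightarrow> ('l \<Rightarrow>\<^sub>0 'k::field)) \<Rightarrow> ('l \<Rightarrow> ('l \<Rightarrow>\<^sub>0 'k)) \<Rightarrow> bool" where
  "dgmod act dl \<longleftrightarrow>
     (\<forall>b b' l. lin (act b) (act b' l) = (if snd b \<and> snd b' then 0 else act (bprod b b') l)) \<and>
     (\<forall>b l. lin dl (act b l) = (if snd b then act (fst b, False) l else 0) + scl (sg b) (lin (act b) (dl l))) \<and>
     (\<forall>l. lin dl (dl l) = 0)"

lemma dgmod_units:
  assumes "dgmod act dl"
  shows "lin (act b) (act b' l) = (if snd b \<and> snd b' then 0 else act (bprod b b') l)"
    "lin dl (act b l) = (if snd b then act (fst b, False) l else 0) + scl (sg b) (lin (act b) (dl l))"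
    "lin dl (dl l) = 0"
  using assms unfolding dgmod_def by blast+

lemma dgmodD:
  assumes "dgmod act dl"
  shows "lin (act b) (lin (act b') y) = (if snd b \<and> snd b' then 0 else lin (act (bprod b b')) y)"
    "lin dl (lin (act b) y) = (if snd b then lin (act (fst b, False)) y else 0) + scl (sg b) (lin (act b) (lin dl y))"
    "lin dl (lin dl y) = 0"
proof -
  have "lin (act b) (lin (act b') y) = lin (\<lambda>l. if snd b \<and> snd b' then 0 else act (bprod b b') l) y"
    by (rule linear_eq_on_units[OF linear_pm_compose[OF linear_lin linear_lin] linear_lin])
       (use assms in \<open>simp add: dgmod_units[OF assms]\<close>)
  then show "lin (act b) (lin (act b') y) = (if snd b \<and> snd b' then 0 else lin (act (bprod b b')) y)"
    by (auto simp: lin_def)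
  show "lin dl (lin (act b) y) = (if snd b then lin (act (fst b, False)) y else 0) + scl (sg b) (lin (act b) (lin dl y))"
  proof (rule linear_eq_on_units[of "\<lambda>y. lin dl (lin (act b) y)"])
    show "linear_pm (\<lambda>y. lin dl (lin (act b) y))" by (rule linear_pm_compose[of "lin (act b)" "lin dl"]) auto
    show "linear_pm (\<lambda>y. (if snd b then lin (act (fst b, False)) y else 0) + scl (sg b) (lin (act b) (lin dl y)))"
      by (rule linear_pmI) (auto simp: algebra_simps pm.scale_right_distrib)
  qed (use assms in \<open>simp add: dgmod_units[OF assms]\<close>)
  have "lin dl (lin dl y) = lin (\<lambda>_. 0) y"
    by (rule linear_eq_on_units[OF linear_pm_compose[OF linear_lin linear_lin] linear_lin])
       (use assms in \<open>simp add: dgmod_units[OF assms]\<close>)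
  then show "lin dl (lin dl y) = 0" by (simp add: lin_def)
qed

lemma bmul_bmul:
  assumes "dgmod act dl"
  shows "bmul act b (bmul act b' y) = (if snd b \<and> snd b' then 0 else bmul act (bprod b b') y)"
proof -
  have "bmul act b (bmul act b' y) =
    lin (\<lambda>x. if snd b \<and> snd b' then 0 else bmul act (bprod b b') (unitv x)) y"
  proof (rule linear_eq_on_units[OF linear_pm_compose[OF linear_bar_ops(4) linear_bar_ops(4)] linear_lin])
    fix x :: "letter list \<times> 'a"
    show "bmul act b (bmul act b' (unitv x)) =
      lin (\<lambda>x. if snd b \<and> snd b' then 0 else bmul act (bprod b b') (unitv x)) (unitv x)"
    proof (cases x rule: unit_cases)
      case (1 l)
      then show ?thesis
        by (simp add: bmul_unitv bmul_ten_Nil dgmod_units[OF assms])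
    next
      case (2 b'' w l)
      then show ?thesis
        by (auto simp: bmul_unitv bprod_def add.assoc)
    qed
  qed
  then show ?thesis
    using linear_eq_lin[OF linear_bar_ops(4), of act "bprod b b'" y] by (auto simp: lin_def)
qed

text \<open>Multiplication by a letter from the left obeys the Leibniz rule with respect to
  \<open>bar\<close>. In the square of \<open>bar\<close> on a longer word this is what cancels the
  mixed terms, so that \<open>bar_bar\<close> follows by induction on the word.\<close>

lemma bar_bmul:
  assumes "dgmod act dl"
  shows "bar act dl (bmul act b y) =
    (if snd b then bmul act (fst b, False) y else 0) + scl (sg b) (bmul act b (bar act dl y))"
proof (rule linear_eq_on_units[of "\<lambda>y. bar act dl (bmul act b y)"])
  show "linear_pm (\<lambda>y. bar act dl (bmul act b y))" by (rule linear_pm_compose[of "bmul act b" "bar act dl"]) auto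
  show "linear_pm (\<lambda>y. (if snd b then bmul act (fst b, False) y else 0) + scl (sg b) (bmul act b (bar act dl y)))"
    by (rule linear_pmI) (auto simp: algebra_simps pm.scale_right_distrib)
  fix x :: "letter list \<times> 'a"
  show "bar act dl (bmul act b (unitv x)) =
    (if snd b then bmul act (fst b, False) (unitv x) else 0) + scl (sg b) (bmul act b (bar act dl (unitv x)))"
  proof (cases x rule: unit_cases)
    case (1 l)
    then show ?thesis
      by (simp add: bmul_unitv bar_unitv bmul_ten_Nil bar_ten_Nil dgmod_units[OF assms])
  next
    case (2 b' w l)
    show ?thesis
      unfolding 2 cns_unitv[symmetric]
      by (cases "snd b"; cases "snd b'")
         (simp_all add: bmul_cns bar_cns bdel_def bmul_bmul[OF assms] sg_def bprod_def algebra_simps)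
  qed
qed

lemma bar_bar:
  assumes "dgmod act dl"
  shows "bar act dl (bar act dl y) = 0"
proof -
  have *: "bar act dl (bar act dl (unitv (w, l))) = 0" for w l
  proof (induction w)
    case Nil
    show ?case
      by (simp add: bar_unitv bar_ten_Nil dgmod_units[OF assms])
  next
    case (Cons b w)
    show ?case
      unfolding cns_unitv[symmetric] using Cons
      by (cases "snd b") (simp_all add: bar_cns bdel_def bar_bmul[OF assms] sg_def algebra_simps)
  qed
  have "bar act dl (bar act dl y) = lin (\<lambda>_. 0) y"
    by (rule linear_eq_on_units[OF linear_pm_compose[OF linear_bar_ops(5) linear_bar_ops(5)] linear_lin])
       (auto simp: *)
  then show ?thesis by (simp add: lin_def)
qed

section \<open>Weight, multidegree and the filtration by weight\<close>

fun wtw :: "letter list \<Rightarrow> nat" where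
  "wtw [] = 0"
| "wtw (b # w) = Suc (of_bool (snd b)) + wtw w"

fun wdeg :: "letter list \<Rightarrow> (nat \<Rightarrow> nat)" where
  "wdeg [] = 0"
| "wdeg (b # w) = fst b + wdeg w"

text \<open>The sign with which the differential of the coefficient appears in \<open>bar\<close>
  behind the word: each letter passed contributes the minus sign of \<open>bar1\<close> and its own
  sign.\<close>

fun sgw :: "letter list \<Rightarrow> 'k::field" where
  "sgw [] = 1"
| "sgw (b # w) = - sg b * sgw w"

lemma length_le_wtw: "length w \<le> wtw w"
  by (induction w) auto

lemma sgw_square [simp]: "sgw w * sgw w = (1::'k::field)"
proof (induction w)
  case (Cons b w)
  have "sgw (b # w) * sgw (b # w) = (sg b * sg b) * (sgw w * sgw w :: 'k)" by simp
  then show ?case using Cons by (simp add: sg_def)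
qed simp

definition letters_closed :: "letter set \<Rightarrow> bool" where
  "letters_closed Lt \<longleftrightarrow> (\<forall>m. (m, True) \<in> Lt \<longrightarrow> (m, False) \<in> Lt) \<and>
     (\<forall>b\<in>Lt. \<forall>b'\<in>Lt. \<not> (snd b \<and> snd b') \<longrightarrow> bprod b b' \<in> Lt)"

text \<open>A dg submodule given by its bigraded pieces, with q the homological degree and c the
  multidegree. Arbitrary subspaces are allowed because the modules \<open>P\<close> and
  \<open>P + H\<close> of the splitting need not have a basis of monomials.\<close>

definition dgfam :: "letter set \<Rightarrow> (letter \<Rightarrow> 'l \<Rightarrow> ('l \<Rightarrow>\<^sub>0 'k::field)) \<Rightarrow> ('l \<Rightarrow> ('l \<Rightarrow>\<^sub>0 'k)) \<Rightarrow>
    (nat \<Rightarrow> (nat \<Rightarrow> nat) \<Rightarrow> ('l \<Rightarrow>\<^sub>0 'k) set) \<Rightarrow> bool" where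
  "dgfam Lt act dl M \<longleftrightarrow>
     (\<forall>q c. pm.subspace (M q c)) \<and>
     (\<forall>b\<in>Lt. \<forall>q c. \<forall>y\<in>M q c. lin (act b) y \<in> M (q + of_bool (snd b)) (fst b + c)) \<and>
     (\<forall>q c. \<forall>y\<in>M (Suc q) c. lin dl y \<in> M q c) \<and>
     (\<forall>c. \<forall>y\<in>M 0 c. lin dl y = 0)"

lemma dgfamD:
  assumes "dgfam Lt act dl M"
  shows "pm.subspace (M q c)"
    "b \<in> Lt \<Longrightarrow> y \<in> M q c \<Longrightarrow> lin (act b) y \<in> M (q + of_bool (snd b)) (fst b + c)"
    "y \<in> M (Suc q) c \<Longrightarrow> lin dl y \<in> M q c"
    "y \<in> M 0 c \<Longrightarrow> lin dl y = 0"
  using assms unfolding dgfam_def by blast+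

text \<open>The bound \<open>T\<close> is a filtration by weight; it is void for \<open>T = Suc i\<close>.\<close>

definition bspace :: "letter set \<Rightarrow> nat \<Rightarrow> (nat \<Rightarrow> (nat \<Rightarrow> nat) \<Rightarrow> ('l \<Rightarrow>\<^sub>0 'k::field) set) \<Rightarrow>
    nat \<Rightarrow> (nat \<Rightarrow> nat) \<Rightarrow> (letter list \<times> 'l \<Rightarrow>\<^sub>0 'k) set" where
  "bspace Lt T M i a = {p. \<forall>w. wcomp w p \<noteq> 0 \<longrightarrow> set w \<subseteq> Lt \<and> wtw w < T \<and>
     (\<exists>q c. i = wtw w + q \<and> a = wdeg w + c \<and> wcomp w p \<in> M q c)}"

lemma bspaceD:
  assumes "p \<in> bspace Lt T M i a" "wcomp w p \<noteq> 0"
  obtains q c where "set w \<subseteq> Lt" "wtw w < T" "i = wtw w + q" "a = wdeg w + c" "wcomp w p \<in> M q c"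
  using assms unfolding bspace_def by blast

lemma bspace_support:
  assumes p: "p \<in> bspace Lt T M i a" and "T \<le> wtw w"
  shows "wcomp w p = 0"
proof (rule ccontr)
  assume "wcomp w p \<noteq> 0"
  then show False by (rule bspaceD[OF p]) (use assms in simp)
qed

lemma bspace_wcomp:
  assumes "p \<in> bspace Lt T M (wtw w + q) (wdeg w + c)" "pm.subspace (M q c)"
  shows "wcomp w p \<in> M q c"
proof (cases "wcomp w p = 0")
  case True
  then show ?thesis using assms(2) by (simp add: pm.subspace_0)
next
  case False
  then obtain q' c' where "wtw w + q = wtw w + q'" "wdeg w + c = wdeg w + c'" "wcomp w p \<in> M q' c'"
    using bspaceD[OF assms(1)] by metis
  then show ?thesis by simp
qed

lemma ten_in_bspace:
  assumes "set w \<subseteq> Lt" "wtw w < T" "y \<in> M q c" "i = wtw w + q" "a = wdeg w + c"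
  shows "ten w y \<in> bspace Lt T M i a"
  using assms by (auto simp: bspace_def wcomp_ten)

lemma subspace_bspace:
  assumes "\<And>q c. pm.subspace (M q c)"
  shows "pm.subspace (bspace Lt T M i a)"
proof (rule pm.subspaceI)
  show "0 \<in> bspace Lt T M i a" by (simp add: bspace_def)
next
  fix x y assume x: "x \<in> bspace Lt T M i a" and y: "y \<in> bspace Lt T M i a"
  show "x + y \<in> bspace Lt T M i a"
    unfolding bspace_def
  proof (intro CollectI allI impI)
    fix w assume "wcomp w (x + y) \<noteq> 0"
    then have "wcomp w x \<noteq> 0 \<or> wcomp w y \<noteq> 0" by auto
    then obtain q c where w: "set w \<subseteq> Lt" "wtw w < T" "i = wtw w + q" "a = wdeg w + c"
      using bspaceD[OF x] bspaceD[OF y] by metis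
    have "wcomp w x \<in> M q c" "wcomp w y \<in> M q c"
      using bspace_wcomp[of x Lt T M w q c] bspace_wcomp[of y Lt T M w q c] x y w assms by auto
    then have "wcomp w (x + y) \<in> M q c" by (simp add: pm.subspace_add[OF assms])
    then show "set w \<subseteq> Lt \<and> wtw w < T \<and> (\<exists>q c. i = wtw w + q \<and> a = wdeg w + c \<and> wcomp w (x + y) \<in> M q c)"
      using w by blast
  qed
next
  fix r x assume x: "x \<in> bspace Lt T M i a"
  show "scl r x \<in> bspace Lt T M i a"
    unfolding bspace_def
  proof (intro CollectI allI impI)
    fix w assume "wcomp w (scl r x) \<noteq> 0"
    then have "wcomp w x \<noteq> 0" by auto
    then obtain q c where w: "set w \<subseteq> Lt" "wtw w < T" "i = wtw w + q" "a = wdeg w + c" "wcomp w x \<in> M q c"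
      by (rule bspaceD[OF x])
    then have "wcomp w (scl r x) \<in> M q c" by (simp add: pm.subspace_scale[OF assms])
    then show "set w \<subseteq> Lt \<and> wtw w < T \<and> (\<exists>q c. i = wtw w + q \<and> a = wdeg w + c \<and> wcomp w (scl r x) \<in> M q c)"
      using w by blast
  qed
qed

lemma bspace_induct [consumes 1, case_names zero add ten]:
  assumes p: "p \<in> bspace Lt T M i a"
    and zero: "P 0" and add: "\<And>x y. P x \<Longrightarrow> P y \<Longrightarrow> P (x + y)"
    and ten: "\<And>w q c y. set w \<subseteq> Lt \<Longrightarrow> wtw w < T \<Longrightarrow> i = wtw w + q \<Longrightarrow> a = wdeg w + c \<Longrightarrow> y \<in> M q c \<Longrightarrow> P (ten w y)"
  shows "P p"
proof -
  have sum: "P (sum f A)" if "finite A" "\<And>w. w \<in> A \<Longrightarrow> P (f w)" for A and f :: "letter list \<Rightarrow> _"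
    using that by (induction A rule: finite_induct) (auto simp: zero add)
  have "P (ten w (wcomp w p))" for w
  proof (cases "wcomp w p = 0")
    case True
    then show ?thesis using zero by simp
  next
    case False
    then show ?thesis using bspaceD[OF p False] ten by metis
  qed
  then have "P (\<Sum>w\<in>fst ` keys p. ten w (wcomp w p))" by (intro sum) auto
  then show ?thesis using ten_expand[of p] by simp
qed

lemma bspace_mono:
  assumes "T \<le> T'" "\<And>q c. M q c \<subseteq> M' q c"
  shows "bspace Lt T M i a \<subseteq> bspace Lt T' M' i a"
proof
  fix p assume p: "p \<in> bspace Lt T M i a"
  show "p \<in> bspace Lt T' M' i a"
    unfolding bspace_def
  proof (intro CollectI allI impI)
    fix w assume "wcomp w p \<noteq> 0"
    then obtain q c where w: "set w \<subseteq> Lt" "wtw w < T" "i = wtw w + q" "a = wdeg w + c" "wcomp w p \<in> M q c"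
      by (rule bspaceD[OF p])
    then show "set w \<subseteq> Lt \<and> wtw w < T' \<and> (\<exists>q c. i = wtw w + q \<and> a = wdeg w + c \<and> wcomp w p \<in> M' q c)"
      using assms by (intro conjI exI[of _ q] exI[of _ c]) auto
  qed
qed

lemma bspace_Suc_eq: "i < T \<Longrightarrow> bspace Lt T M i a = bspace Lt (Suc i) M i a"
  unfolding bspace_def by force

lemma cns_in_bspace:
  assumes "p \<in> bspace Lt T M i a" "b \<in> Lt" "\<And>q c. pm.subspace (M q c)"
    and "T' = Suc (of_bool (snd b)) + T" "i' = Suc (of_bool (snd b)) + i" "a' = fst b + a"
  shows "cns b p \<in> bspace Lt T' M i' a'"
  using assms(1)
proof (induction rule: bspace_induct)
  case zero
  then show ?case using pm.subspace_0[OF subspace_bspace[OF assms(3)]] by simp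
next
  case (add x y)
  then show ?case using pm.subspace_add[OF subspace_bspace[OF assms(3)]] by simp
next
  case (ten w q c y)
  then show ?case
    unfolding cns_ten by (intro ten_in_bspace[of _ _ _ y M q c]) (use assms in \<open>auto simp: add.assoc\<close>)
qed

text \<open>Removing a \<sigma>, merging two letters and letting the last letter act all lower the
  weight of the word; only the differential of the coefficient keeps the word. On the graded pieces
  of the weight filtration \<open>bar\<close> is therefore the coefficient differential up to the
  sign \<open>sgw\<close>.\<close>

lemma bar_ten_lower:
  assumes Lt: "letters_closed Lt" and M: "dgfam Lt act dl M"
    and w: "set w \<subseteq> Lt" and y: "y \<in> M q c" and i: "wtw w + q = Suc i"
  shows "bar act dl (ten w y) - scl (sgw w) (ten w (lin dl y)) \<in> bspace Lt (wtw w) M i (wdeg w + c)"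
  using w i
proof (induction w arbitrary: i)
  case Nil
  then show ?case
    using pm.subspace_0[OF subspace_bspace[OF dgfamD(1)[OF M]]] by (simp add: bar_ten_Nil)
next
  case (Cons b w)
  let ?B = "bspace Lt (wtw (b # w)) M i (wdeg (b # w) + c)"
  have sub: "pm.subspace ?B" by (rule subspace_bspace[OF dgfamD(1)[OF M]])
  have b: "b \<in> Lt" and w: "set w \<subseteq> Lt" using Cons by auto
  let ?E = "bar act dl (ten w y) - scl (sgw w) (ten w (lin dl y))"
  have eq: "bar act dl (ten (b # w) y) - scl (sgw (b # w)) (ten (b # w) (lin dl y)) =
    bdel b (ten w y) + scl (sg b) (bmul act b (ten w y)) - scl (sg b) (cns b ?E)"
    by (simp add: cns_ten[symmetric] bar_cns pm.scale_right_diff_distrib algebra_simps)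
  have 1: "bdel b (ten w y) \<in> ?B"
  proof (cases "snd b")
    case True
    then have "(fst b, False) \<in> Lt" using b Lt by (cases b) (auto simp: letters_closed_def)
    then show ?thesis using True Cons.prems y w
      by (auto simp: bdel_def cns_ten add.assoc intro!: ten_in_bspace[of _ _ _ y M q c])
  next
    case False
    then show ?thesis using pm.subspace_0[OF sub] by (simp add: bdel_def)
  qed
  have 2: "bmul act b (ten w y) \<in> ?B"
  proof (cases w)
    case Nil
    have "ten [] (lin (act b) y) \<in> ?B"
    proof (rule ten_in_bspace[where y = "lin (act b) y" and M = M and q = "q + of_bool (snd b)" and c = "fst b + c"])
      show "lin (act b) y \<in> M (q + of_bool (snd b)) (fst b + c)" by (rule dgfamD(2)[OF M, OF b y])
    qed (use Cons.prems Nil in simp_all)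
    then show ?thesis by (simp add: Nil bmul_ten_Nil)
  next
    case (Cons b' w')
    show ?thesis
    proof (cases "snd b \<and> snd b'")
      case True
      then show ?thesis
        using pm.subspace_0[OF sub] by (simp add: Cons cns_ten[symmetric] bmul_cns)
    next
      case False
      then have "bprod b b' \<in> Lt" using b w Lt Cons by (auto simp: letters_closed_def)
      moreover have "of_bool (snd b \<or> snd b') = of_bool (snd b) + (of_bool (snd b') :: nat)"
        using False by auto
      ultimately have "ten (bprod b b' # w') y \<in> ?B"
        using w Cons.prems y Cons
        by (intro ten_in_bspace[of _ _ _ y M q c]) (auto simp: bprod_def add.assoc)
      then show ?thesis using False by (auto simp: Cons cns_ten[symmetric] bmul_cns)
    qed
  qed
  have 3: "cns b ?E \<in> ?B"
  proof (cases "wtw w + q")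
    case 0
    then have "w = []" "q = 0" by (cases w, auto)+
    then have "?E = 0" using dgfamD(4)[OF M, of y c] y by (simp add: bar_ten_Nil)
    then show ?thesis using pm.subspace_0[OF sub] by simp
  next
    case (Suc j)
    show ?thesis
      by (rule cns_in_bspace[OF Cons.IH[OF w Suc] b dgfamD(1)[OF M]])
         (use Cons.prems Suc in \<open>auto simp: add.assoc\<close>)
  qed
  show ?case
    unfolding eq by (intro pm.subspace_diff[OF sub] pm.subspace_add[OF sub] pm.subspace_scale[OF sub] 1 2 3)
qed

lemma bar_bspace:
  assumes Lt: "letters_closed Lt" and M: "dgfam Lt act dl M" and p: "p \<in> bspace Lt T M (Suc i) a"
  shows "bar act dl p \<in> bspace Lt T M i a"
  using p
proof (induction rule: bspace_induct)
  case zero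
  then show ?case using pm.subspace_0[OF subspace_bspace[OF dgfamD(1)[OF M]]] by simp
next
  case (add x y)
  then show ?case using pm.subspace_add[OF subspace_bspace[OF dgfamD(1)[OF M]]] by simp
next
  case (ten w q c y)
  have sub: "pm.subspace (bspace Lt T M i a)" by (rule subspace_bspace[OF dgfamD(1)[OF M]])
  have "bar act dl (ten w y) - scl (sgw w) (ten w (lin dl y)) \<in> bspace Lt (wtw w) M i (wdeg w + c)"
    by (rule bar_ten_lower[OF Lt M, OF ten(1,5) ten(3)[symmetric]])
  then have 1: "bar act dl (ten w y) - scl (sgw w) (ten w (lin dl y)) \<in> bspace Lt T M i a"
    using bspace_mono[of "wtw w" T M M Lt i a] ten by auto
  have 2: "ten w (lin dl y) \<in> bspace Lt T M i a"
  proof (cases q)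
    case 0
    then show ?thesis using dgfamD(4)[OF M, of y c] ten pm.subspace_0[OF sub] by simp
  next
    case (Suc r)
    then show ?thesis using dgfamD(3)[OF M, of y r c] ten by (intro ten_in_bspace[of _ _ _ _ M r c]) auto
  qed
  show ?case
    using pm.subspace_add[OF sub 1 pm.subspace_scale[OF sub 2, of "sgw w"]] by simp
qed

lemma bar_bspace_0:
  assumes M: "dgfam Lt act dl M" and p: "p \<in> bspace Lt T M 0 a"
  shows "bar act dl p = 0"
  using p
proof (induction rule: bspace_induct)
  case (ten w q c y)
  then have "w = []" "q = 0" by (cases w, auto)+
  then show ?case using dgfamD(4)[OF M, of y c] ten by (simp add: bar_ten_Nil)
qed auto

lemma wcomp_bar_top:
  assumes Lt: "letters_closed Lt" and M: "dgfam Lt act dl M" and p: "p \<in> bspace Lt (Suc T) M i a"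
    and w: "wtw w = T"
  shows "wcomp w (bar act dl p) = scl (sgw w) (lin dl (wcomp w p))"
  using p
proof (induction rule: bspace_induct)
  case zero
  then show ?case by simp
next
  case (add x y)
  then show ?case by (simp add: pm.scale_right_distrib)
next
  case (ten v q c y)
  show ?case
  proof (cases "wtw v + q")
    case 0
    then have "v = []" "q = 0" by (cases v, auto)+
    then show ?thesis using dgfamD(4)[OF M, of y c] ten by (simp add: bar_ten_Nil wcomp_ten)
  next
    case (Suc j)
    let ?E = "bar act dl (ten v y) - scl (sgw v) (ten v (lin dl y))"
    have "?E \<in> bspace Lt (wtw v) M j (wdeg v + c)"
      by (rule bar_ten_lower[OF Lt M, OF ten(1,5) Suc])
    then have "wcomp w ?E = 0" by (rule bspace_support) (use w ten in simp)
    then show ?thesis by (auto simp: wcomp_ten)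
  qed
qed

text \<open>\<open>ac\<close> says that M modulo A is acyclic, and the claim is the same for the bar
  complexes. On words of maximal weight \<open>bar\<close> is the coefficient differential up to
  sign (\<open>wcomp_bar_top\<close>), so \<open>ac\<close> applies to each of these components;
  subtracting the results leaves words of smaller weight. With A zero this transfers acyclicity of M
  itself.\<close>

lemma bspace_relative_acyclic:
  assumes Lt: "letters_closed Lt" and M: "dgfam Lt act dl M" and A: "dgfam Lt act dl A"
    and AM: "\<And>q c. A q c \<subseteq> M q c" and dg: "dgmod act dl"
    and ac: "\<And>q c y. y \<in> M q c \<Longrightarrow> lin dl y \<in> A (q - 1) c \<Longrightarrow> \<exists>x\<in>A q c. \<exists>m\<in>M (Suc q) c. y = x + lin dl m"
    and z: "z \<in> bspace Lt T M i a" "bar act dl z \<in> bspace Lt (Suc (i - 1)) A (i - 1) a"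
  shows "\<exists>x\<in>bspace Lt (Suc i) A i a. \<exists>y\<in>bspace Lt (Suc (Suc i)) M (Suc i) a. z = x + bar act dl y"
  using z
proof (induction T arbitrary: z)
  case 0
  then have "z = 0" using ten_expand[of z] by (auto simp: bspace_def intro: sum.neutral)
  then show ?case
    using pm.subspace_0[OF subspace_bspace[OF dgfamD(1)[OF M]]] pm.subspace_0[OF subspace_bspace[OF dgfamD(1)[OF A]]]
    by (intro bexI[of _ 0]) auto
next
  case (Suc T)
  let ?XA = "bspace Lt (Suc i) A i a" and ?XM = "bspace Lt (Suc (Suc i)) M (Suc i) a"
  have sA: "pm.subspace ?XA" and sM: "pm.subspace ?XM"
    by (rule subspace_bspace[OF dgfamD(1)[OF A]], rule subspace_bspace[OF dgfamD(1)[OF M]])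
  let ?W = "{w \<in> fst ` keys z. wtw w = T}"
  have fin: "finite ?W" by simp
  have "\<exists>xm. ten w (fst xm) \<in> ?XA \<and> ten w (snd xm) \<in> bspace Lt (Suc T) M (Suc i) a \<and>
      ten w (snd xm) \<in> ?XM \<and> wcomp w z = fst xm + lin dl (snd xm)"
    if "w \<in> ?W" for w
  proof -
    have w0: "wcomp w z \<noteq> 0" "wtw w = T" using that by (auto simp: wcomp_eq_0_iff)
    obtain q c where w: "set w \<subseteq> Lt" "wtw w < Suc T" "i = wtw w + q" "a = wdeg w + c" "wcomp w z \<in> M q c"
      by (rule bspaceD[OF Suc.prems(1) w0(1)])
    have top: "wcomp w (bar act dl z) = scl (sgw w) (lin dl (wcomp w z))"
      by (rule wcomp_bar_top[OF Lt M, OF Suc.prems(1) w0(2)])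
    have "lin dl (wcomp w z) \<in> A (q - 1) c"
    \<comment> \<open>At q = 0 the index q - 1 is 0 again; the differential vanishes there, and 0
      lies in A.\<close>
    proof (cases q)
      case 0
      then show ?thesis using w dgfamD(4)[OF M, of "wcomp w z" c] pm.subspace_0[OF dgfamD(1)[OF A]] by simp
    next
      case (Suc r)
      have "wcomp w (bar act dl z) \<in> A r c"
        by (rule bspace_wcomp[where M = A and q = r and c = c and T = "Suc (i - 1)" and Lt = Lt])
           (use Suc.prems(2) w(3) Suc dgfamD(1)[OF A] in \<open>simp_all add: w(4)[symmetric]\<close>)
      then have "scl (sgw w) (wcomp w (bar act dl z)) \<in> A r c"
        by (intro pm.subspace_scale[OF dgfamD(1)[OF A]])
      then show ?thesis using Suc by (simp add: top)
    qed
    then obtain x m where xm: "x \<in> A q c" "m \<in> M (Suc q) c" "wcomp w z = x + lin dl m"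
      using ac[where q = q and c = c, OF w(5)] by blast
    have "ten w x \<in> ?XA" using w xm by (intro ten_in_bspace[of _ _ _ _ A q c]) auto
    moreover have "ten w m \<in> bspace Lt (Suc T) M (Suc i) a"
      using w xm w0 by (intro ten_in_bspace[of _ _ _ _ M "Suc q" c]) auto
    moreover have "ten w m \<in> ?XM"
      using w xm w0 by (intro ten_in_bspace[of _ _ _ _ M "Suc q" c]) auto
    ultimately show ?thesis using xm by (intro exI[of _ "(x, m)"]) simp
  qed
  then have "\<forall>w\<in>?W. \<exists>xm. ten w (fst xm) \<in> ?XA \<and> ten w (snd xm) \<in> bspace Lt (Suc T) M (Suc i) a \<and>
      ten w (snd xm) \<in> ?XM \<and> wcomp w z = fst xm + lin dl (snd xm)" by (rule ballI)
  from bchoice[OF this] obtain g where g: "\<forall>w\<in>?W. ten w (fst (g w)) \<in> ?XA \<and>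
      ten w (snd (g w)) \<in> bspace Lt (Suc T) M (Suc i) a \<and>
      ten w (snd (g w)) \<in> ?XM \<and> wcomp w z = fst (g w) + lin dl (snd (g w))" ..
  define fx where "fx = (\<lambda>w. fst (g w))"
  define fm where "fm = (\<lambda>w. snd (g w))"
  have f: "ten w (fx w) \<in> ?XA" "ten w (fm w) \<in> bspace Lt (Suc T) M (Suc i) a"
    "ten w (fm w) \<in> ?XM" "wcomp w z = fx w + lin dl (fm w)" if "w \<in> ?W" for w
    using bspec[OF g that] by (simp_all add: fx_def fm_def)
  define x0 where "x0 = (\<Sum>w\<in>?W. ten w (fx w))"
  \<comment> \<open>The factor \<open>sgw w\<close> cancels the sign in
    \<open>wcomp_bar_top\<close>, as its square is 1.\<close>
  define y0 where "y0 = (\<Sum>w\<in>?W. scl (sgw w) (ten w (fm w)))"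
  have x0: "x0 \<in> ?XA" unfolding x0_def by (intro pm.subspace_sum[OF sA] f)
  have y0: "y0 \<in> ?XM" unfolding y0_def by (intro pm.subspace_sum[OF sM] pm.subspace_scale[OF sM] f)
  have y0T: "y0 \<in> bspace Lt (Suc T) M (Suc i) a"
    unfolding y0_def by (intro pm.subspace_sum pm.subspace_scale subspace_bspace[OF dgfamD(1)[OF M]] f(2))
  let ?z = "z - x0 - bar act dl y0"
  have dy0: "bar act dl y0 \<in> bspace Lt (Suc T) M i a" by (rule bar_bspace[OF Lt M, OF y0T])
  have xM: "x0 \<in> bspace Lt (Suc i) M i a" using x0 bspace_mono[of "Suc i" "Suc i" A M] AM by blast
  have comp0: "wcomp w ?z = 0" if w: "T \<le> wtw w" for w
  proof (cases "wtw w = T")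
    case True
    have sel: "wcomp w (\<Sum>v\<in>?W. ten v (g v)) = (if w \<in> ?W then g w else 0)" for g :: "letter list \<Rightarrow> _"
      using fin by (simp add: pp.linear_sum[OF linear_bar_ops(2)] wcomp_ten)
    have c1: "wcomp w x0 = (if w \<in> ?W then fx w else 0)" unfolding x0_def by (rule sel)
    have "y0 = (\<Sum>v\<in>?W. ten v (scl (sgw v) (fm v)))" by (simp add: y0_def)
    then have c2: "wcomp w y0 = (if w \<in> ?W then scl (sgw w) (fm w) else 0)" by (simp only: sel)
    have "wcomp w (bar act dl y0) = scl (sgw w) (lin dl (wcomp w y0))"
      by (rule wcomp_bar_top[OF Lt M, OF y0T True])
    then have c3: "wcomp w (bar act dl y0) = (if w \<in> ?W then lin dl (fm w) else 0)"
      by (simp add: c2)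
    have "wcomp w z = 0" if "w \<notin> ?W" using that True by (simp add: wcomp_eq_0_iff)
    then show ?thesis using f(4)[of w] by (simp add: c1 c3 del: mem_Collect_eq) 
  next
    case False
    then have big: "Suc T \<le> wtw w" using w by simp
    have "wcomp w z = 0" by (rule bspace_support[OF Suc.prems(1) big])
    moreover have "wcomp w (bar act dl y0) = 0" by (rule bspace_support[OF dy0 big])
    moreover have "wcomp w x0 = 0"
    proof -
      have "wcomp w (ten v (fx v)) = 0" if "v \<in> ?W" for v
        using that False by (auto simp: wcomp_ten)
      then show ?thesis unfolding x0_def pp.linear_sum[OF linear_bar_ops(2)] by (intro sum.neutral ballI)
    qed
    ultimately show ?thesis by simp
  qed
  \<comment> \<open>The weights of words are bounded by T for z and for the differential of y0, by i
    for x0, and neither bound dominates; all are placed in one space with the larger bound.\<close>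
  have iT: "bspace Lt (Suc i) M i a \<subseteq> bspace Lt (max (Suc i) (Suc T)) M i a"
    "bspace Lt (Suc T) M i a \<subseteq> bspace Lt (max (Suc i) (Suc T)) M i a"
    by (intro bspace_mono; simp)+
  have "?z \<in> bspace Lt (max (Suc i) (Suc T)) M i a"
    using Suc.prems(1) xM dy0 iT
    by (intro pm.subspace_diff[OF subspace_bspace[OF dgfamD(1)[OF M]]]) auto
  then have zM: "?z \<in> bspace Lt (max (Suc i) (Suc T)) M i a" .
  have zT: "?z \<in> bspace Lt T M i a"
    unfolding bspace_def
  proof (intro CollectI allI impI)
    fix w assume w0: "wcomp w ?z \<noteq> 0"
    then have "wtw w < T" using comp0[of w] not_le by blast
    moreover obtain q c where "set w \<subseteq> Lt" "i = wtw w + q" "a = wdeg w + c" "wcomp w ?z \<in> M q c"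
      by (rule bspaceD[OF zM w0])
    ultimately show "set w \<subseteq> Lt \<and> wtw w < T \<and> (\<exists>q c. i = wtw w + q \<and> a = wdeg w + c \<and> wcomp w ?z \<in> M q c)"
      by (intro conjI exI[of _ q] exI[of _ c])
  qed
  have "bar act dl ?z = bar act dl z - bar act dl x0"
    by (simp add: bar_bar[OF dg])
  moreover have "bar act dl x0 \<in> bspace Lt (Suc (i - 1)) A (i - 1) a"
  proof (cases i)
    case 0
    then show ?thesis
      using bar_bspace_0[OF A, of x0 "Suc i" a] x0 pm.subspace_0[OF subspace_bspace[OF dgfamD(1)[OF A]]] by simp
  next
    case (Suc j)
    then have "bar act dl x0 \<in> bspace Lt (Suc i) A j a" using bar_bspace[OF Lt A, of x0 "Suc i" j a] x0 by simp
    then show ?thesis using bspace_Suc_eq[of j "Suc i" Lt A a] Suc by simp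
  qed
  ultimately have "bar act dl ?z \<in> bspace Lt (Suc (i - 1)) A (i - 1) a"
    using Suc.prems(2) pm.subspace_diff[OF subspace_bspace[OF dgfamD(1)[OF A]]] by simp
  from Suc.IH[OF zT this] obtain x y where xy: "x \<in> ?XA" "y \<in> ?XM" "?z = x + bar act dl y"
    by (elim bexE)
  have "z = (x + x0) + bar act dl (y + y0)"
    using xy(3) by (simp add: algebra_simps)
  then show ?case
    using pm.subspace_add[OF sA xy(1) x0] pm.subspace_add[OF sM xy(2) y0] by blast
qed

section \<open>Functoriality of the bar complex in its coefficients\<close>

definition bmap :: "('l \<Rightarrow> ('m \<Rightarrow>\<^sub>0 'k::field)) \<Rightarrow> (letter list \<times> 'l \<Rightarrow>\<^sub>0 'k) \<Rightarrow> (letter list \<times> 'm \<Rightarrow>\<^sub>0 'k)" where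
  "bmap f = lin (\<lambda>(w, l). ten w (f l))"

lemma linear_bmap [simp, intro]: "linear_pm (bmap f)"
  by (simp add: bmap_def)

lemmas bmap_simps [simp] = linear_pm_simps[OF linear_bmap]

lemma bmap_ten: "bmap f (ten w y) = ten w (lin f y)"
  by (rule linear_eq_on_units[OF linear_pm_compose[OF linear_bar_ops(1) linear_bmap]
        linear_pm_compose[OF linear_lin linear_bar_ops(1)]])
     (simp add: ten_unitv bmap_def)

lemma bmap_cns:
  fixes f :: "'l \<Rightarrow> ('m \<Rightarrow>\<^sub>0 'k::field)"
  shows "bmap f (cns b p) = cns b (bmap f p)"
proof (rule linear_eq_on_units[OF linear_pm_compose[OF linear_bar_ops(3) linear_bmap]
      linear_pm_compose[OF linear_bmap linear_bar_ops(3)]])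
  fix x :: "letter list \<times> 'l"
  show "bmap f (cns b (unitv x)) = cns b (bmap f (unitv x))"
    by (cases x) (simp add: bmap_def cns_unitv cns_ten)
qed

lemma wcomp_bmap:
  fixes f :: "'l \<Rightarrow> ('m \<Rightarrow>\<^sub>0 'k::field)"
  shows "wcomp w (bmap f p) = lin f (wcomp w p)"
proof (rule linear_eq_on_units[OF linear_pm_compose[OF linear_bmap linear_bar_ops(2)]
      linear_pm_compose[OF linear_bar_ops(2) linear_lin]])
  fix x :: "letter list \<times> 'l"
  show "wcomp w (bmap f (unitv x)) = lin f (wcomp w (unitv x))"
    by (cases x) (simp add: bmap_def wcomp_ten wcomp_unitv)
qed

text \<open>Compatibility with action and differential is demanded on M only: the coordinates on
  \<open>P + H\<close> used later commute with them there and are not asked to do so on all of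
  \<open>L\<close>.\<close>

lemma bmap_bar:
  assumes act: "\<And>b q c y. b \<in> Lt \<Longrightarrow> y \<in> M q c \<Longrightarrow> lin f (lin (act b) y) = lin (act' b) (lin f y)"
    and dl: "\<And>q c y. y \<in> M q c \<Longrightarrow> lin f (lin dl y) = lin dl' (lin f y)"
    and p: "p \<in> bspace Lt T M i a"
  shows "bmap f (bar act dl p) = bar act' dl' (bmap f p)"
  using p
proof (induction rule: bspace_induct)
  case (ten w q c y)
  note y = ten(5)
  show ?case
    using ten(1)
  proof (induction w)
    case Nil
    show ?case by (simp add: bar_ten_Nil bmap_ten dl[OF y])
  next
    case (Cons b w)
    have 1: "bmap f (bdel b (ten w y)) = bdel b (bmap f (ten w y))"
      by (simp add: bdel_def bmap_cns)
    have 2: "bmap f (bmul act b (ten w y)) = bmul act' b (bmap f (ten w y))"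
    proof (cases w)
      case Nil
      then show ?thesis using act[OF _ y, of b] Cons.prems by (simp add: bmul_ten_Nil bmap_ten)
    next
      case (Cons b' w')
      then show ?thesis by (simp add: cns_ten[symmetric] bmul_cns bmap_cns)
    qed
    have 3: "bmap f (bar act dl (ten w y)) = bar act' dl' (bmap f (ten w y))"
      using Cons by simp
    have "bmap f (bar act dl (cns b (ten w y))) = bar act' dl' (bmap f (cns b (ten w y)))"
      by (simp add: bar_cns bmap_cns 1 2 3)
    then show ?case by (simp add: cns_ten)
  qed
qed auto

lemma bmap_into:
  assumes f: "\<And>q c y. y \<in> M q c \<Longrightarrow> lin f y \<in> M' q c"
    and M': "\<And>q c. pm.subspace (M' q c)" and p: "p \<in> bspace Lt T M i a"
  shows "bmap f p \<in> bspace Lt T M' i a"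
  using p
proof (induction rule: bspace_induct)
  have sub: "pm.subspace (bspace Lt T M' i a)" by (rule subspace_bspace) (rule M')
  case zero
  show ?case using pm.subspace_0[OF sub] by simp
next
  have sub: "pm.subspace (bspace Lt T M' i a)" by (rule subspace_bspace) (rule M')
  case (add x y)
  then show ?case using pm.subspace_add[OF sub] by simp
next
  case (ten w q c y)
  have "lin f y \<in> M' q c" using f ten(5) by blast
  then show ?case unfolding bmap_ten by (intro ten_in_bspace[OF ten(1,2) _ ten(3,4)])
qed

lemma bmap_image:
  assumes f: "\<And>q c. lin f ` M q c = M' q c"
    and M: "\<And>q c. pm.subspace (M q c)" and M': "\<And>q c. pm.subspace (M' q c)"
  shows "bmap f ` bspace Lt T M i a = bspace Lt T M' i a"
proof (rule subset_antisym)
  have "pm.subspace (bspace Lt T M i a)" by (rule subspace_bspace) (rule M)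
  then have sub: "pm.subspace (bmap f ` bspace Lt T M i a)" by (rule pp.linear_subspace_image[OF linear_bmap])
  show "bmap f ` bspace Lt T M i a \<subseteq> bspace Lt T M' i a"
    using bmap_into[of M f M' _ Lt T i a] f M' by blast
  show "bspace Lt T M' i a \<subseteq> bmap f ` bspace Lt T M i a"
  proof
    fix p assume "p \<in> bspace Lt T M' i a"
    then show "p \<in> bmap f ` bspace Lt T M i a"
    proof (induction rule: bspace_induct)
      case zero
      show ?case
        by (rule pm.subspace_0[OF sub])
    next
      case (add x y)
      then show ?case
        by (intro pm.subspace_add[OF sub])
    next
      case (ten w q c y)
      then obtain y' where y': "y' \<in> M q c" "y = lin f y'" using f[of q c] by blast
      have "ten w y' \<in> bspace Lt T M i a" by (rule ten_in_bspace[where M = M and q = q and c = c, OF ten(1,2) y'(1) ten(3,4)])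
      then show ?case unfolding y'(2) bmap_ten[symmetric] by (rule imageI)
    qed
  qed
qed

lemma bmap_kernel:
  assumes M: "\<And>q c. pm.subspace (M q c)"
  shows "{z \<in> bspace Lt T M i a. bmap f z = 0} = bspace Lt T (\<lambda>q c. {y \<in> M q c. lin f y = 0}) i a"
proof (rule subset_antisym)
  show "{z \<in> bspace Lt T M i a. bmap f z = 0} \<subseteq> bspace Lt T (\<lambda>q c. {y \<in> M q c. lin f y = 0}) i a"
  proof clarify
    fix z assume z: "z \<in> bspace Lt T M i a" "bmap f z = 0"
    have "lin f (wcomp w z) = 0" for w using z(2) wcomp_bmap[of w f z] by simp
    then show "z \<in> bspace Lt T (\<lambda>q c. {y \<in> M q c. lin f y = 0}) i a"
      using z(1) by (simp add: bspace_def)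
  qed
  show "bspace Lt T (\<lambda>q c. {y \<in> M q c. lin f y = 0}) i a \<subseteq> {z \<in> bspace Lt T M i a. bmap f z = 0}"
  proof
    fix z assume z: "z \<in> bspace Lt T (\<lambda>q c. {y \<in> M q c. lin f y = 0}) i a"
    then have "bmap f z = 0"
      by (induction rule: bspace_induct) (auto simp: bmap_ten)
    moreover have "z \<in> bspace Lt T M i a"
      using z bspace_mono[of T T "\<lambda>q c. {y \<in> M q c. lin f y = 0}" M Lt i a] by auto
    ultimately show "z \<in> {z \<in> bspace Lt T M i a. bmap f z = 0}" by simp
  qed
qed

lemma bspace_SP:
  fixes Lb :: "nat \<Rightarrow> (nat \<Rightarrow> nat) \<Rightarrow> 'l set"
  shows "bspace Lt (Suc i) (\<lambda>q c. SP (Lb q c) :: ('l \<Rightarrow>\<^sub>0 'k::field) set) i a =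
   SP {(w, l). set w \<subseteq> Lt \<and> (\<exists>q c. i = wtw w + q \<and> a = wdeg w + c \<and> l \<in> Lb q c)}" (is "?L = SP ?R")
proof (rule subset_antisym)
  show "?L \<subseteq> SP ?R"
  proof
    fix p :: "letter list \<times> 'l \<Rightarrow>\<^sub>0 'k"
    assume "p \<in> ?L"
    then show "p \<in> SP ?R"
    proof (induction rule: bspace_induct)
      case zero
      then show ?case by (simp add: SP_def)
    next
      case (add x y)
      then show ?case by (intro pm.subspace_add[OF subspace_SP])
    next
      case (ten w q c y)
      show ?case unfolding ten_def
        by (rule lin_in_subspace[OF subspace_SP]) (use ten in \<open>auto simp: SP_def\<close>)
    qed
  qed
  have sub: "pm.subspace ?L" by (rule subspace_bspace) simp
  show "SP ?R \<subseteq> ?L"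
  proof
    fix p :: "letter list \<times> 'l \<Rightarrow>\<^sub>0 'k"
    assume p: "p \<in> SP ?R"
    have "lin unitv p \<in> ?L"
    proof (rule lin_in_subspace[OF sub])
      fix x assume "x \<in> keys p"
      then obtain w l q c where x: "x = (w, l)" "set w \<subseteq> Lt" "i = wtw w + q" "a = wdeg w + c" "l \<in> Lb q c"
        using p by (auto simp: SP_def)
      have "ten w (unitv l) \<in> ?L"
        by (rule ten_in_bspace[where M = "\<lambda>q c. SP (Lb q c)" and q = q and c = c]) (use x in simp_all)
      then show "unitv x \<in> ?L" by (simp add: x(1) ten_unitv)
    qed
    then show "p \<in> ?L" by (simp add: lin_id)
  qed
qed

text \<open>Weight bounds the length of a word because each letter counts at least once, and the
  multidegree bounds its letters. This is the gain from splitting by multidegree.\<close>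

lemma finite_words:
  assumes "finite {b \<in> Lt. fst b \<le> a}"
  shows "finite {w. set w \<subseteq> Lt \<and> wtw w \<le> i \<and> wdeg w \<le> a}"
proof (rule finite_subset)
  have le: "b \<in> set w \<Longrightarrow> fst b \<le> wdeg w" for b w
  proof (induction w)
    case (Cons b' w)
    show ?case
    proof (cases "b = b'")
      case True
      then show ?thesis by (auto simp: le_fun_def)
    next
      case False
      then have "fst b \<le> wdeg w" using Cons by simp
      then show ?thesis by (auto simp: le_fun_def intro: trans_le_add2)
    qed
  qed simp
  show "{w. set w \<subseteq> Lt \<and> wtw w \<le> i \<and> wdeg w \<le> a} \<subseteq> {w. set w \<subseteq> {b \<in> Lt. fst b \<le> a} \<and> length w \<le> i}"
    using length_le_wtw le by (fastforce intro: order_trans)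
  show "finite {w. set w \<subseteq> {b \<in> Lt. fst b \<le> a} \<and> length w \<le> i}"
    by (rule finite_lists_length_le[OF assms])
qed

lemma fd_bspace:
  fixes M :: "nat \<Rightarrow> (nat \<Rightarrow> nat) \<Rightarrow> ('l \<Rightarrow>\<^sub>0 'k::field) set"
  assumes M: "\<And>q c. pm.subspace (M q c)" "\<And>q c. M q c \<subseteq> SP (Lb q c)"
    and fin: "\<And>q c. finite (Lb q c)" "finite {b \<in> Lt. fst b \<le> a}"
  shows "fd (bspace Lt (Suc i) M i a)"
proof (rule fd_subset[OF _ subspace_bspace[OF M(1)]])
  let ?R = "{(w, l). set w \<subseteq> Lt \<and> (\<exists>q c. i = wtw w + q \<and> a = wdeg w + c \<and> l \<in> Lb q c)}"
  have "?R \<subseteq> (SIGMA w:{w. set w \<subseteq> Lt \<and> wtw w \<le> i \<and> wdeg w \<le> a}. Lb (i - wtw w) (a - wdeg w))"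
    by (auto simp: le_fun_def)
  then have "finite ?R"
    by (rule finite_subset) (intro finite_SigmaI finite_words fin)
  then show "fd (SP ?R :: (letter list \<times> 'l \<Rightarrow>\<^sub>0 'k) set)" by (rule fd_SP)
  show "bspace Lt (Suc i) M i a \<subseteq> SP ?R"
    unfolding bspace_SP[symmetric] using M(2) by (intro bspace_mono) auto
qed

lemma cpx_bar:
  assumes "letters_closed Lt" "dgfam Lt act dl M" "dgmod act dl" "\<And>q c. M q c \<subseteq> SP (Lb q c)"
    and "\<And>q c. finite (Lb q c)" "finite {b \<in> Lt. fst b \<le> a}"
  shows "cpx (bar act dl) (\<lambda>i. bspace Lt (Suc i) M i a)"
  unfolding cpx_def
proof (intro conjI allI ballI)
  show "fd (bspace Lt (Suc i) M i a)" for i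
    by (rule fd_bspace[where Lb = Lb]) (use assms dgfamD(1)[OF assms(2)] in auto)
  show "bar act dl z \<in> bspace Lt (Suc i) M i a" if "z \<in> bspace Lt (Suc (Suc i)) M (Suc i) a" for z i
    using bar_bspace[OF assms(1,2), OF that] bspace_Suc_eq[of i "Suc (Suc i)" Lt M a] by simp
  show "bar act dl z = 0" if "z \<in> bspace Lt (Suc 0) M 0 a" for z
    by (rule bar_bspace_0[OF assms(2), OF that])
qed (simp_all add: bar_bar[OF assms(3)])

text \<open>As g is a section of f by chain maps, C is the direct sum of the kernel of f and a copy
  of C'. For the boundaries, c - g (f c) supplies the projection onto the kernel.\<close>

lemma betti_split:
  assumes C: "cpx d C" and C': "cpx d' C'" and f: "linear_pm f" and g: "linear_pm g"
    and fC: "\<And>i z. z \<in> C i \<Longrightarrow> f z \<in> C' i" and gC: "\<And>i z. z \<in> C' i \<Longrightarrow> g z \<in> C i"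
    and fd: "\<And>i z. z \<in> C i \<Longrightarrow> f (d z) = d' (f z)" and gd: "\<And>i z. z \<in> C' i \<Longrightarrow> g (d' z) = d (g z)"
    and fg: "\<And>i z. z \<in> C' i \<Longrightarrow> f (g z) = z"
  shows "betti d C i = betti d (\<lambda>i. {z \<in> C i. f z = 0}) i + betti d' C' i"
proof -
  let ?A = "\<lambda>i. {z \<in> C i. f z = 0}"
  have A: "cpx d ?A" by (rule kernel_cpx[OF C C' f fd])
  have zi: "f ` cycles d C i = cycles d' C' i"
  proof (rule subset_antisym)
    show "f ` cycles d C i \<subseteq> cycles d' C' i"
    proof clarify
      fix z assume "z \<in> cycles d C i"
      then have "z \<in> C i" "d z = 0" by (auto simp: cycles_def)
      then show "f z \<in> cycles d' C' i" using fd[of z i] fC by (simp add: cycles_def pp.linear_0[OF f])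
    qed
    show "cycles d' C' i \<subseteq> f ` cycles d C i"
    proof
      fix z assume z: "z \<in> cycles d' C' i"
      then have "g z \<in> cycles d C i"
        using gd[of z i] gC by (simp add: cycles_def pp.linear_0[OF g])
      moreover have "z = f (g z)" using z fg[of z i] by (simp add: cycles_def)
      ultimately show "z \<in> f ` cycles d C i" by (rule rev_image_eqI)
    qed
  qed
  have zk: "{z \<in> cycles d C i. f z = 0} = cycles d ?A i" by (auto simp: cycles_def)
  have bi: "f ` boundaries d C i = boundaries d' C' i"
  proof -
    have "f ` boundaries d C i = (\<lambda>z. d' (f z)) ` C (Suc i)"
      unfolding boundaries_def image_image by (intro image_cong refl fd)
    moreover have "f ` C (Suc i) = C' (Suc i)"
    proof (rule subset_antisym)
      show "f ` C (Suc i) \<subseteq> C' (Suc i)" using fC by blast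
      show "C' (Suc i) \<subseteq> f ` C (Suc i)"
      proof
        fix z assume "z \<in> C' (Suc i)"
        then show "z \<in> f ` C (Suc i)" using fg[of z "Suc i"] gC[of z "Suc i"] by (metis image_eqI)
      qed
    qed
    ultimately show ?thesis unfolding boundaries_def by (metis image_image)
  qed
  have bk: "{z \<in> boundaries d C i. f z = 0} = boundaries d ?A i"
  proof (rule subset_antisym)
    show "boundaries d ?A i \<subseteq> {z \<in> boundaries d C i. f z = 0}"
      using fd[of _ "Suc i"] pp.linear_0[OF cpxD(1)[OF C']] by (auto simp: boundaries_def)
    show "{z \<in> boundaries d C i. f z = 0} \<subseteq> boundaries d ?A i"
    proof clarify
      fix z assume z: "z \<in> boundaries d C i" "f z = 0"
      then obtain c where c: "c \<in> C (Suc i)" "z = d c" by (auto simp: boundaries_def)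
      let ?c = "c - g (f c)"
      have "d (g (f c)) = g (d' (f c))" using gd[OF fC[OF c(1)]] by simp
      also have "\<dots> = 0" using fd[OF c(1)] z c by (simp add: pp.linear_0[OF g])
      finally have "z = d ?c" using c by (simp add: pp.linear_diff[OF cpxD(1)[OF C]])
      moreover have "?c \<in> C (Suc i)"
        by (rule pm.subspace_diff[OF cpxD(6)[OF C] c(1) gC[OF fC[OF c(1)]]])
      moreover have "f ?c = 0" using fg[OF fC[OF c(1)]] by (simp add: pp.linear_diff[OF f])
      ultimately show "z \<in> boundaries d ?A i" by (auto simp: boundaries_def)
    qed
  qed
  have "pm.dim (cycles d C i) = pm.dim (cycles d ?A i) + pm.dim (cycles d' C' i)"
    using rank_nullity[OF f fd_cycles[OF C, of i]] by (simp add: zi zk)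
  moreover have "pm.dim (boundaries d C i) = pm.dim (boundaries d ?A i) + pm.dim (boundaries d' C' i)"
    using rank_nullity[OF f fd_boundaries[OF C, of i]] by (simp add: bi bk)
  ultimately show ?thesis
    using dim_cycles[OF C, of i] dim_cycles[OF C', of i] dim_cycles[OF A, of i] by simp
qed

lemma cpx_image:
  assumes C: "cpx d C" and d': "linear_pm d'" and f: "linear_pm f"
    and surj: "\<And>i. f ` C i = C' i" and comm: "\<And>i z. z \<in> C i \<Longrightarrow> f (d z) = d' (f z)"
  shows "cpx d' C'"
  unfolding cpx_def
proof (intro conjI allI ballI d')
  show "fd (C' i)" for i using fd_image[OF f cpxD(2)[OF C, of i]] by (simp add: surj)
  show "d' z \<in> C' i" if z: "z \<in> C' (Suc i)" for z i
  proof -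
    obtain y where y: "y \<in> C (Suc i)" "z = f y" using z unfolding surj[symmetric] by blast
    then have "d' z = f (d y)" using comm by simp
    then show ?thesis using cpxD(3)[OF C y(1)] unfolding surj[symmetric] by blast
  qed
  show "d' z = 0" if z: "z \<in> C' 0" for z
  proof -
    obtain y where y: "y \<in> C 0" "z = f y" using z unfolding surj[symmetric] by blast
    then show ?thesis using comm[OF y(1)] cpxD(4)[OF C y(1)] by (simp add: pp.linear_0[OF f])
  qed
  show "d' (d' z) = 0" if z: "z \<in> C' i" for z i
  proof -
    obtain y where y: "y \<in> C i" "z = f y" using z unfolding surj[symmetric] by blast
    show ?thesis
    proof (cases i)
      case 0
      then show ?thesis using comm[OF y(1)] cpxD(4)[OF C] y
        by (simp add: pp.linear_0[OF f] pp.linear_0[OF d'])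
    next
      case (Suc j)
      have "d' (d' z) = f (d (d y))"
        using comm[OF y(1)] comm[of "d y" j] cpxD(3)[OF C] y Suc by simp
      then show ?thesis using cpxD(5)[OF C y(1)] by (simp add: pp.linear_0[OF f])
    qed
  qed
qed

section \<open>Coefficients with zero action and zero differential\<close>

lemma lin_zero_fun [simp]: "lin (\<lambda>_. 0) p = 0"
  by (simp add: lin_def)

abbreviation bar0 :: "(letter list \<times> 'l \<Rightarrow>\<^sub>0 'k::field) \<Rightarrow> (letter list \<times> 'l \<Rightarrow>\<^sub>0 'k)" where
  "bar0 \<equiv> bar (\<lambda>_ _. 0) (\<lambda>_. 0)"

lemma dgmod_trivial: "dgmod (\<lambda>_ _. 0) (\<lambda>_. 0)"
  by (simp add: dgmod_def)

lemma dgfam_trivial: "(\<And>q c. pm.subspace (M q c)) \<Longrightarrow> dgfam Lt (\<lambda>_ _. 0) (\<lambda>_. 0) M"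
  by (simp add: dgfam_def pm.subspace_0)

lemma dim_zero_space: "pm.dim {0 :: 'x \<Rightarrow>\<^sub>0 'k::field} = 0"
  using pm.dim_span_eq_card_independent[OF pm.independent_empty] by simp

lemma betti_zero_space:
  assumes "C i = {0}" "linear_pm d"
  shows "betti d C i = 0"
proof -
  have "cycles d C i = {0}" using pp.linear_0[OF assms(2)] by (auto simp: cycles_def assms(1))
  then show ?thesis by (simp add: betti_def dim_zero_space)
qed

lemma SP_empty: "SP {} = {0}"
  by (auto simp: SP_def)

definition unit_fam :: "nat \<Rightarrow> (nat \<Rightarrow> nat) \<Rightarrow> nat \<Rightarrow> (nat \<Rightarrow> nat) \<Rightarrow> (unit \<Rightarrow>\<^sub>0 'k::field) set" where
  "unit_fam q0 c0 = (\<lambda>q c. SP (if q = q0 \<and> c = c0 then {()} else {}))"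

definition bar_betti :: "'k::field itself \<Rightarrow> letter set \<Rightarrow> nat \<Rightarrow> (nat \<Rightarrow> nat) \<Rightarrow> nat" where
  "bar_betti K Lt j a = betti bar0 (\<lambda>i. bspace Lt (Suc i) (unit_fam 0 0 :: _ \<Rightarrow> _ \<Rightarrow> (unit \<Rightarrow>\<^sub>0 'k) set) i a) j"

lemma bspace_unit_fam:
  "bspace Lt (Suc i) (unit_fam q0 c0 :: _ \<Rightarrow> _ \<Rightarrow> (unit \<Rightarrow>\<^sub>0 'k::field) set) i a =
   SP {(w, l). set w \<subseteq> Lt \<and> i = wtw w + q0 \<and> a = wdeg w + c0}"
  unfolding unit_fam_def bspace_SP by (rule arg_cong[where f = SP]) (auto split: if_splits)

lemma subspace_unit_fam [simp]: "pm.subspace (unit_fam q0 c0 q c)"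
  by (simp add: unit_fam_def)

lemma cpx_unit_fam:
  fixes a :: "nat \<Rightarrow> nat"
  assumes "letters_closed Lt" "finite {b \<in> Lt. fst b \<le> a}"
  shows "cpx bar0 (\<lambda>i. bspace Lt (Suc i) (unit_fam q0 c0 :: _ \<Rightarrow> _ \<Rightarrow> (unit \<Rightarrow>\<^sub>0 'k::field) set) i a)"
  by (rule cpx_bar[where Lb = "\<lambda>_ _. UNIV"])
     (use assms in \<open>simp_all add: dgmod_trivial dgfam_trivial SP_def\<close>)

text \<open>A line of coefficients in degree q0 and multidegree c0 merely shifts the complex, since
  the terms and signs of \<open>bar0\<close> depend on the word alone; where (q0, c0) does not fit,
  the chains are zero.\<close>

lemma betti_unit_fam:
  "betti bar0 (\<lambda>i. bspace Lt (Suc i) (unit_fam q0 c0 :: _ \<Rightarrow> _ \<Rightarrow> (unit \<Rightarrow>\<^sub>0 'k::field) set) i a) i =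
   (if q0 \<le> i \<and> c0 \<le> a then bar_betti TYPE('k) Lt (i - q0) (a - c0) else 0)"
proof (cases "q0 \<le> i \<and> c0 \<le> a")
  case True
  have "{(w, l :: unit). set w \<subseteq> Lt \<and> q0 + j = wtw w + q0 \<and> a = wdeg w + c0} =
    {(w, l). set w \<subseteq> Lt \<and> j = wtw w + 0 \<and> a - c0 = wdeg w + 0}" for j
  proof -
    have "a = wdeg w + c0 \<longleftrightarrow> a - c0 = wdeg w" for w
      using True by (auto simp: fun_eq_iff le_fun_def) (metis add.commute le_add_diff_inverse)
    then show ?thesis by auto
  qed
  then have "bspace Lt (Suc (q0 + j)) (unit_fam q0 c0 :: _ \<Rightarrow> _ \<Rightarrow> (unit \<Rightarrow>\<^sub>0 'k) set) (q0 + j) a =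
    bspace Lt (Suc j) (unit_fam 0 0) j (a - c0)" for j
    unfolding bspace_unit_fam by simp
  from this[of "i - q0"] this[of "Suc (i - q0)"] show ?thesis
    using True by (simp add: bar_betti_def betti_def cycles_def boundaries_def)
next
  case False
  then have e: "{(w, l :: unit). set w \<subseteq> Lt \<and> i = wtw w + q0 \<and> a = wdeg w + c0} = {}"
    by (auto simp: le_fun_def)
  have z: "bspace Lt (Suc i) (unit_fam q0 c0 :: _ \<Rightarrow> _ \<Rightarrow> (unit \<Rightarrow>\<^sub>0 'k) set) i a = {0}"
    unfolding bspace_unit_fam e SP_empty ..
  have "betti bar0 (\<lambda>i. bspace Lt (Suc i) (unit_fam q0 c0 :: _ \<Rightarrow> _ \<Rightarrow> (unit \<Rightarrow>\<^sub>0 'k) set) i a) i = 0"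
    by (rule betti_zero_space) (rule z, simp)
  then show ?thesis by (simp only: False if_False)
qed

definition graded_fam :: "('h \<Rightarrow> nat) \<Rightarrow> ('h \<Rightarrow> (nat \<Rightarrow> nat)) \<Rightarrow> 'h set \<Rightarrow> nat \<Rightarrow> (nat \<Rightarrow> nat) \<Rightarrow> ('h \<Rightarrow>\<^sub>0 'k::field) set" where
  "graded_fam hq hc H = (\<lambda>q c. SP {h \<in> H. hq h = q \<and> hc h = c})"

lemma cpx_graded_fam:
  fixes H :: "'h set"
  assumes "finite H" "letters_closed Lt" "finite {b \<in> Lt. fst b \<le> a}"
  shows "cpx bar0 (\<lambda>i. bspace Lt (Suc i) (graded_fam hq hc H :: _ \<Rightarrow> _ \<Rightarrow> ('h \<Rightarrow>\<^sub>0 'k::field) set) i a)"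
proof (rule cpx_bar[where Lb = "\<lambda>_ _. H"])
  show "dgfam Lt (\<lambda>_ _. 0) (\<lambda>_. 0) (graded_fam hq hc H :: _ \<Rightarrow> _ \<Rightarrow> ('h \<Rightarrow>\<^sub>0 'k) set)"
    by (rule dgfam_trivial) (simp add: graded_fam_def)
  show "graded_fam hq hc H q c \<subseteq> SP H" for q c
    unfolding graded_fam_def by (rule SP_mono) auto
qed (use assms dgmod_trivial in auto)

text \<open>With zero action and differential the complex is a direct sum over the labels in H. One
  label h at a time is split off, ?s projecting to its line and ?u including it; the kernel is the
  complex on the smaller label set.\<close>

lemma betti_graded_fam:
  fixes H :: "'h set"
  assumes H: "finite H" and Lt: "letters_closed Lt" "finite {b \<in> Lt. fst b \<le> a}"
  shows "cpx bar0 (\<lambda>i. bspace Lt (Suc i) (graded_fam hq hc H :: _ \<Rightarrow> _ \<Rightarrow> ('h \<Rightarrow>\<^sub>0 'k::field) set) i a) \<and>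
    betti bar0 (\<lambda>i. bspace Lt (Suc i) (graded_fam hq hc H :: _ \<Rightarrow> _ \<Rightarrow> ('h \<Rightarrow>\<^sub>0 'k) set) i a) i =
    (\<Sum>h\<in>H. if hq h \<le> i \<and> hc h \<le> a then bar_betti TYPE('k) Lt (i - hq h) (a - hc h) else 0)"
  using H
proof (induction H rule: finite_induct)
  case empty
  have "cpx bar0 (\<lambda>i. bspace Lt (Suc i) (graded_fam hq hc {} :: _ \<Rightarrow> _ \<Rightarrow> ('h \<Rightarrow>\<^sub>0 'k) set) i a)"
    by (rule cpx_graded_fam) (use Lt in simp_all)
  moreover have z: "bspace Lt (Suc i) (graded_fam hq hc {} :: _ \<Rightarrow> _ \<Rightarrow> ('h \<Rightarrow>\<^sub>0 'k) set) i a = {0}"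
    unfolding graded_fam_def bspace_SP by (simp add: SP_empty)
  have "betti bar0 (\<lambda>i. bspace Lt (Suc i) (graded_fam hq hc {} :: _ \<Rightarrow> _ \<Rightarrow> ('h \<Rightarrow>\<^sub>0 'k) set) i a) i = 0"
    by (rule betti_zero_space) (rule z, simp)
  ultimately show ?case by simp
next
  case (insert h H)
  let ?C = "\<lambda>i. bspace Lt (Suc i) (graded_fam hq hc (insert h H) :: _ \<Rightarrow> _ \<Rightarrow> ('h \<Rightarrow>\<^sub>0 'k) set) i a"
  let ?C' = "\<lambda>i. bspace Lt (Suc i) (unit_fam (hq h) (hc h) :: _ \<Rightarrow> _ \<Rightarrow> (unit \<Rightarrow>\<^sub>0 'k) set) i a"
  let ?s = "\<lambda>h'. if h' = h then unitv () else 0 :: unit \<Rightarrow>\<^sub>0 'k"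
  let ?u = "\<lambda>_ :: unit. unitv h :: 'h \<Rightarrow>\<^sub>0 'k"
  have C: "cpx bar0 ?C" by (rule cpx_graded_fam) (use Lt insert in simp_all)
  have C': "cpx bar0 ?C'" by (rule cpx_unit_fam[OF Lt])
  have s1: "lin ?s y \<in> unit_fam (hq h) (hc h) q c" if "y \<in> graded_fam hq hc (insert h H) q c" for y q c
    unfolding unit_fam_def
    by (rule lin_in_subspace[OF subspace_SP]) (use that in \<open>auto simp: graded_fam_def SP_def\<close>)
  have u1: "lin ?u y \<in> graded_fam hq hc (insert h H) q c" if "y \<in> unit_fam (hq h) (hc h) q c" for y q c
    unfolding graded_fam_def
    by (rule lin_in_subspace[OF subspace_SP]) (use that in \<open>auto simp: unit_fam_def SP_def split: if_splits\<close>)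
  have split: "betti bar0 ?C i = betti bar0 (\<lambda>i. {z \<in> ?C i. bmap ?s z = 0}) i + betti bar0 ?C' i"
  proof (rule betti_split[OF C C' linear_bmap linear_bmap[of ?u]])
    show "bmap ?s z \<in> ?C' i" if "z \<in> ?C i" for z i
      by (rule bmap_into[OF s1 _ that]) auto
    show "bmap ?u z \<in> ?C i" if "z \<in> ?C' i" for z i
      by (rule bmap_into[OF u1 _ that]) (auto simp: graded_fam_def)
    show "bmap ?s (bar0 z) = bar0 (bmap ?s z)" if "z \<in> ?C i" for z i
      by (rule bmap_bar[OF _ _ that]) auto
    show "bmap ?u (bar0 z) = bar0 (bmap ?u z)" if "z \<in> ?C' i" for z i
      by (rule bmap_bar[OF _ _ that]) auto
    show "bmap ?s (bmap ?u z) = z" for z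
    proof -
      have "bmap ?s (bmap ?u z) = lin unitv z"
        by (rule linear_eq_on_units[OF linear_pm_compose[OF linear_bmap linear_bmap] linear_lin])
           (auto simp: bmap_def ten_unitv)
      then show ?thesis by (simp add: lin_id)
    qed
  qed
  have look: "lin ?s y = 0 \<longleftrightarrow> lookup y h = 0" for y
  proof -
    have "lookup (lin ?s y) () = (\<Sum>x\<in>keys y. if x = h then lookup y x else 0)"
      unfolding lin_def lookup_sum by (intro sum.cong refl) (auto simp: lookup_unitv)
    also have "\<dots> = lookup y h" by (simp add: in_keys_iff)
    finally show ?thesis by (auto simp: poly_mapping_eq_iff fun_eq_iff)
  qed
  have "{y \<in> graded_fam hq hc (insert h H) q c. lin ?s y = 0} = graded_fam hq hc H q c" for q c
    using insert(2) by (auto simp: look graded_fam_def SP_def in_keys_iff)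
  then have ker: "{z \<in> ?C i. bmap ?s z = 0} =
      bspace Lt (Suc i) (graded_fam hq hc H :: _ \<Rightarrow> _ \<Rightarrow> ('h \<Rightarrow>\<^sub>0 'k) set) i a" for i
    by (subst bmap_kernel) (auto simp: graded_fam_def[of _ _ "insert h H"])
  show ?case
    using split insert C by (simp add: ker betti_unit_fam)
qed

section \<open>The bar complex of the quotient ring\<close>

text \<open>The monomial basis of the augmentation ideal of the dg algebra.\<close>

definition letters :: "nat \<Rightarrow> (nat \<Rightarrow> nat) set \<Rightarrow> letter set" where
  "letters n I = {(m, e). m \<in> mons n \<and> (if e then m \<in> I else m \<noteq> 0)}"

lemma zero_mons [simp]: "0 \<in> mons n"
  by (simp add: mons_def)

lemma add_mons [simp]: "m \<in> mons n \<Longrightarrow> m' \<in> mons n \<Longrightarrow> m + m' \<in> mons n"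
  by (simp add: mons_def)

lemma finite_mons_le: "finite {m \<in> mons n. m \<le> a}"
proof (rule finite_imageD)
  let ?f = "\<lambda>m. restrict m {..<n}"
  have "?f ` {m \<in> mons n. m \<le> a} \<subseteq> PiE {..<n} (\<lambda>i. {..a i})"
    by (auto simp: le_fun_def PiE_def extensional_def)
  then show "finite (?f ` {m \<in> mons n. m \<le> a})"
    by (rule finite_subset) (intro finite_PiE; simp)
  show "inj_on ?f {m \<in> mons n. m \<le> a}"
  proof (rule inj_onI)
    fix x y :: "nat \<Rightarrow> nat"
    assume xy: "x \<in> {m \<in> mons n. m \<le> a}" "y \<in> {m \<in> mons n. m \<le> a}" "?f x = ?f y"
    show "x = y"
    proof
      fix j show "x j = y j"
        using xy(1,2) fun_cong[OF xy(3), of j] by (cases "j < n") (auto simp: mons_def)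
    qed
  qed
qed

lemma finite_letters_le: "finite {b \<in> letters n I. fst b \<le> a}"
  by (rule finite_subset[of _ "{m \<in> mons n. m \<le> a} \<times> UNIV"])
     (auto simp: letters_def finite_mons_le)

text \<open>Properness keeps the letters closed under d(\<sigma> m) = m: for m = 1 the result would
  be the unit, which is no letter.\<close>

locale monomial_ideal =
  fixes n :: nat and I :: "(nat \<Rightarrow> nat) set"
  assumes ideal: "is_monomial_ideal n I" and zero_notin: "0 \<notin> I"
begin

lemma ideal_mons: "m \<in> I \<Longrightarrow> m \<in> mons n"
  using ideal by (auto simp: is_monomial_ideal_def)

lemma ideal_up: "u \<in> I \<Longrightarrow> m \<in> mons n \<Longrightarrow> u \<le> m \<Longrightarrow> m \<in> I"
  using ideal by (simp add: is_monomial_ideal_def)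

lemma ideal_add:
  assumes "m \<in> I" "m' \<in> mons n"
  shows "m + m' \<in> I" "m' + m \<in> I"
  by (rule ideal_up[OF assms(1)]; use assms ideal_mons in \<open>auto simp: le_fun_def\<close>)+

abbreviation "Lt \<equiv> letters n I"

lemma letters_closed: "letters_closed Lt"
  unfolding letters_closed_def letters_def bprod_def
  using zero_notin ideal_add by (auto split: if_splits)

lemma sigma_in_ideal: "b \<in> Lt \<Longrightarrow> snd b \<Longrightarrow> fst b \<in> I"
  by (auto simp: letters_def split: if_splits)

lemma sigma_letter: "b \<in> Lt \<Longrightarrow> fst b \<in> I \<Longrightarrow> (fst b, True) \<in> Lt"
  by (auto simp: letters_def split: if_splits)

text \<open>Words with a letter in \<open>I\<close> or \<open>\<sigma>I\<close> span an acyclic subcomplex, contracted by putting \<open>\<sigma>\<close> on the first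
  letter of this kind; the quotient is the bar complex of \<open>S/I\<close>. The filtration by \<open>pre\<close> repairs the
  error terms of the contraction.\<close>

fun bad :: "letter list \<Rightarrow> bool" where
  "bad w \<longleftrightarrow> (\<exists>b\<in>set w. fst b \<in> I)"

declare bad.simps [simp del]

lemma bad_Cons [simp]: "bad (b # w) \<longleftrightarrow> fst b \<in> I \<or> bad w" "\<not> bad []"
  by (auto simp: bad.simps)

fun pre :: "letter list \<Rightarrow> nat" where
  "pre [] = 0"
| "pre (b # w) = (if fst b \<in> I then 0 else Suc (pre w))"

definition badspace :: "nat \<Rightarrow> (letter list \<times> unit \<Rightarrow>\<^sub>0 'k::field) set" where
  "badspace P = SP {(w, l). bad w \<and> pre w < P}"

fun htp1 :: "letter list \<Rightarrow> (letter list \<times> unit \<Rightarrow>\<^sub>0 'k::field)" where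
  "htp1 [] = 0"
| "htp1 (b # w) = (if fst b \<in> I then (if snd b then 0 else unitv ((fst b, True) # w, ())) else - cns b (htp1 w))"

definition htp :: "(letter list \<times> unit \<Rightarrow>\<^sub>0 'k::field) \<Rightarrow> (letter list \<times> unit \<Rightarrow>\<^sub>0 'k)" where
  "htp = lin (\<lambda>(w, l). htp1 w)"

lemma linear_htp [simp, intro]: "linear_pm htp"
  by (simp add: htp_def)

lemmas htp_simps [simp] = linear_pm_simps[OF linear_htp]

lemma htp_unitv: "htp (unitv (w, l)) = htp1 w"
  by (simp add: htp_def)

lemma htp_cns:
  fixes y :: "letter list \<times> unit \<Rightarrow>\<^sub>0 'k::field"
  shows "htp (cns b y) = (if fst b \<in> I then (if snd b then 0 else cns (fst b, True) y) else - cns b (htp y))"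
proof -
  have l: "linear_pm (\<lambda>y :: letter list \<times> unit \<Rightarrow>\<^sub>0 'k.
      if fst b \<in> I then (if snd b then 0 else cns (fst b, True) y) else - cns b (htp y))"
    by (rule linear_pmI) (auto simp: pm.scale_right_distrib)
  show ?thesis
  proof (rule linear_eq_on_units[OF linear_pm_compose[OF linear_bar_ops(3) linear_htp] l])
    fix x :: "letter list \<times> unit"
    show "htp (cns b (unitv x)) =
      (if fst b \<in> I then (if snd b then 0 else cns (fst b, True) (unitv x)) else - cns b (htp (unitv x)) :: _ \<Rightarrow>\<^sub>0 'k)"
      by (cases x) (simp add: cns_unitv htp_unitv)
  qed
qed

lemma cns_SP:
  assumes "p \<in> SP A" "\<And>w l. (w, l) \<in> A \<Longrightarrow> (b # w, l) \<in> B"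
  shows "cns b p \<in> SP B"
  unfolding cns_def by (rule lin_in_subspace[OF subspace_SP]) (use assms in \<open>auto simp: SP_def\<close>)

lemma bmul_act0_Nil: "bmul (\<lambda>_ _. 0) b (unitv ([], l)) = 0"
  by (simp add: bmul_unitv)

lemma bmul_act0_Cons: "bmul (\<lambda>_ _. 0) b (unitv (b' # w, l)) = (if snd b \<and> snd b' then 0 else unitv (bprod b b' # w, l))"
  by (simp add: bmul_unitv)

lemma htp1_SP:
  assumes "set w \<subseteq> Lt"
  shows "(htp1 w :: _ \<Rightarrow>\<^sub>0 'k::field) \<in> SP {(w', l). set w' \<subseteq> Lt \<and> wtw w' = Suc (wtw w) \<and> wdeg w' = wdeg w \<and> bad w'}"
  using assms
proof (induction w)
  case Nil
  then show ?case by (simp add: pm.subspace_0)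
next
  case (Cons b w)
  show ?case
  proof (cases "fst b \<in> I")
    case True
    then show ?thesis using Cons.prems sigma_letter[of b] by (auto simp: pm.subspace_0)
  next
    case False
    have "cns b (htp1 w :: _ \<Rightarrow>\<^sub>0 'k) \<in> SP {(w', l). set w' \<subseteq> Lt \<and> wtw w' = Suc (wtw (b # w)) \<and> wdeg w' = wdeg (b # w) \<and> bad w'}"
      by (rule cns_SP[OF Cons.IH]) (use Cons.prems in auto)
    from pm.subspace_neg[OF subspace_SP this] show ?thesis
      by (simp only: htp1.simps False if_False)
  qed
qed

text \<open>A true defect arises only when two letters outside I merge to a product in I. The first
  letter in I has then moved to the front, so the defect has a smaller value of \<open>pre\<close>;
  prefixing a letter outside I to an earlier defect raises both values by one and keeps it
  smaller.\<close>

lemma htp_homotopy: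
  assumes "set w \<subseteq> Lt" "bad w"
  shows "bar0 (htp (unitv (w, l))) + htp (bar0 (unitv (w, l))) - unitv (w, l) \<in> (badspace (pre w) :: (_ \<Rightarrow>\<^sub>0 'k::field) set)"
  using assms
proof (induction w)
  case Nil
  then show ?case by simp
next
  case (Cons b w)
  let ?y = "unitv (w, l) :: _ \<Rightarrow>\<^sub>0 'k"
  let ?mul = "bmul (\<lambda>_ _. 0 :: unit \<Rightarrow>\<^sub>0 'k)"
  have b: "b \<in> Lt" and w: "set w \<subseteq> Lt" using Cons by auto
  have sub: "pm.subspace (badspace P :: (_ \<Rightarrow>\<^sub>0 'k) set)" for P by (simp add: badspace_def)
  show ?case
  proof (cases "fst b \<in> I")
    case True
    have prodI: "fst (bprod b b') \<in> I" if "b' \<in> Lt" for b'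
      using True that ideal_add(1) by (auto simp: bprod_def letters_def)
    have "bar0 (htp (cns b ?y)) + htp (bar0 (cns b ?y)) - cns b ?y = 0"
    proof (cases "snd b")
      case sb: True
      have "htp (?mul b ?y) = 0"
      proof (cases w)
        case Nil then show ?thesis by (simp add: bmul_act0_Nil)
      next
        case (Cons b' w')
        then have "fst (bprod b b') \<in> I" using w prodI by auto
        then show ?thesis using Cons sb by (simp add: bmul_act0_Cons htp_unitv) (simp add: bprod_def)
      qed
      moreover have "cns (fst b, True) ?y = cns b ?y" using sb by (cases b) simp
      ultimately show ?thesis using True sb by (simp add: htp_cns bar_cns bdel_def sg_def)
    next
      case sb: False
      have "htp (?mul b ?y) = ?mul (fst b, True) ?y"
      proof (cases w)
        case Nil then show ?thesis by (simp add: bmul_act0_Nil)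
      next
        case (Cons b' w')
        then have "fst (bprod b b') \<in> I" using w prodI by auto
        then show ?thesis using Cons sb by (simp add: bmul_act0_Cons htp_unitv) (simp add: bprod_def)
      qed
      moreover have "cns (fst b, False) ?y = cns b ?y" using sb by (cases b) simp
      ultimately show ?thesis using True sb by (simp add: htp_cns bar_cns bdel_def sg_def)
    qed
    then show ?thesis using pm.subspace_0[OF sub] by (simp add: cns_unitv)
  next
    case False
    have sb: "\<not> snd b" using False b sigma_in_ideal by blast
    have bw: "bad w" using False Cons.prems by simp
    let ?K = "bar0 (htp ?y) + htp (bar0 ?y) - ?y"
    have K: "cns b ?K \<in> badspace (pre (b # w))"
      using Cons.IH[OF w bw] unfolding badspace_def by (rule cns_SP) (use False in auto)
    have E: "htp (?mul b ?y) - ?mul b (htp ?y) \<in> badspace (pre (b # w))"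
    proof (cases w)
      case Nil
      then show ?thesis using bw by simp
    next
      case (Cons b' w')
      have b': "b' \<in> Lt" using w Cons by simp
      let ?z = "unitv (w', l) :: _ \<Rightarrow>\<^sub>0 'k"
      have y: "?y = cns b' ?z" by (simp add: Cons cns_unitv)
      have my: "?mul b ?y = cns (bprod b b') ?z" unfolding y using sb by (simp add: bmul_cns)
      show ?thesis
      proof (cases "fst b' \<in> I")
        case True
        then have "fst (bprod b b') \<in> I" using b ideal_add(2) by (auto simp: bprod_def letters_def)
        then have "htp (?mul b ?y) - ?mul b (htp ?y) = 0"
          using True sb unfolding my y by (simp add: htp_cns bmul_cns) (simp add: bprod_def)
        then show ?thesis using pm.subspace_0[OF sub] by simp
      next
        case nb': False
        have hy: "?mul b (htp ?y) = - cns (bprod b b') (htp ?z)"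
          using nb' sb unfolding y by (simp add: htp_cns bmul_cns)
        show ?thesis
        proof (cases "fst (bprod b b') \<in> I")
          case False
          then have "htp (?mul b ?y) - ?mul b (htp ?y) = 0"
            unfolding hy my by (simp add: htp_cns)
          then show ?thesis using pm.subspace_0[OF sub] by simp
        next
          case pI: True
          have "\<not> snd b'" using nb' b' sigma_in_ideal by blast
          then have "htp (?mul b ?y) - ?mul b (htp ?y) = cns (fst (bprod b b'), True) ?z + cns (bprod b b') (htp ?z)"
            unfolding hy my using pI sb by (simp add: htp_cns) (simp add: bprod_def)
          moreover have "cns c p \<in> badspace (pre (b # w))" if "fst c \<in> I" for c and p :: "_ \<Rightarrow>\<^sub>0 'k"
            unfolding badspace_def by (rule cns_SP[of p UNIV]) (use that False in \<open>auto simp: SP_def\<close>)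
          ultimately show ?thesis using pI by (simp add: pm.subspace_add[OF sub])
        qed
      qed
    qed
    have eq: "bar0 (htp (cns b ?y)) + htp (bar0 (cns b ?y)) - cns b ?y = cns b ?K + (htp (?mul b ?y) - ?mul b (htp ?y))"
      using False sb by (simp add: htp_cns bar_cns bdel_def sg_def algebra_simps)
    show ?thesis unfolding cns_unitv[symmetric] eq by (rule pm.subspace_add[OF sub K E])
  qed
qed

definition bchain :: "nat \<Rightarrow> (nat \<Rightarrow> nat) \<Rightarrow> (letter list \<times> unit \<Rightarrow>\<^sub>0 'k::field) set" where
  "bchain i a = bspace Lt (Suc i) (unit_fam 0 0) i a"

lemma bchain_eq: "bchain i a = SP {(w, l). set w \<subseteq> Lt \<and> i = wtw w \<and> a = wdeg w}"
  unfolding bchain_def bspace_unit_fam by simp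

lemma cpx_bchain: "cpx bar0 (\<lambda>i. bchain i a)"
  unfolding bchain_def by (rule cpx_unit_fam[OF letters_closed finite_letters_le])

lemma htp_bchain:
  fixes z :: "letter list \<times> unit \<Rightarrow>\<^sub>0 'k::field"
  assumes "z \<in> bchain i a"
  shows "htp z \<in> bchain (Suc i) a" "htp z \<in> SP {(w, l). bad w}"
  unfolding bchain_eq htp_def
proof -
  have "(htp1 w :: _ \<Rightarrow>\<^sub>0 'k) \<in> SP {(w', l). set w' \<subseteq> Lt \<and> Suc i = wtw w' \<and> a = wdeg w'} \<and>
      (htp1 w :: _ \<Rightarrow>\<^sub>0 'k) \<in> SP {(w, l). bad w}"
    if "(w, l) \<in> keys z" for w l
  proof -
    have "set w \<subseteq> Lt" "i = wtw w" "a = wdeg w" using assms that unfolding bchain_eq SP_def by blast+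
    then show ?thesis using htp1_SP[of w, where 'k = 'k] by (auto simp: SP_def)
  qed
  then show "lin (\<lambda>(w, l). htp1 w) z \<in> SP {(w, l). set w \<subseteq> Lt \<and> Suc i = wtw w \<and> a = wdeg w}"
    "lin (\<lambda>(w, l). htp1 w) z \<in> SP {(w, l). bad w}"
    by (auto intro!: lin_in_subspace[OF subspace_SP])
qed

text \<open>For a cycle z the homotopy writes z as a boundary up to a cycle of smaller
  \<open>pre\<close>, and iteration exhausts the filtration.\<close>

lemma bad_acyclic:
  assumes "z \<in> bchain i a" "z \<in> badspace P" "bar0 z = 0"
  shows "\<exists>y\<in>bchain (Suc i) a. y \<in> SP {(w, l). bad w} \<and> z = bar0 y"
  using assms
proof (induction P arbitrary: z)
  case 0
  then have "z = 0" by (simp add: badspace_def SP_empty)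
  then have "z = bar0 0" by simp
  moreover have "0 \<in> bchain (Suc i) a" by (rule pm.subspace_0[OF cpxD(6)[OF cpx_bchain]])
  moreover have "0 \<in> SP {(w, l). bad w}" by (rule pm.subspace_0[OF subspace_SP])
  ultimately show ?case by (intro bexI[of _ 0] conjI)
next
  case (Suc P)
  let ?K = "\<lambda>z. bar0 (htp z) + htp (bar0 z) - z"
  have "linear_pm ?K" by (rule linear_pmI) (auto simp: algebra_simps pm.scale_right_distrib pm.scale_right_diff_distrib)
  then have "?K z = lin (\<lambda>x. ?K (unitv x)) z" by (rule linear_eq_lin)
  also have "\<dots> \<in> badspace P"
  proof (rule lin_in_subspace)
    show "pm.subspace (badspace P)" by (simp add: badspace_def)
    fix x assume x: "x \<in> keys z"
    obtain w l where wl: "x = (w, l)" by (cases x)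
    have w: "set w \<subseteq> Lt" "bad w" "pre w < Suc P"
      using x Suc.prems(1,2) unfolding bchain_eq badspace_def SP_def wl by blast+
    have "badspace (pre w) \<subseteq> badspace P" unfolding badspace_def by (rule SP_mono) (use w in auto)
    then show "?K (unitv x) \<in> badspace P" using htp_homotopy[OF w(1,2), of l] unfolding wl by blast
  qed
  finally have K: "?K z \<in> badspace P" .
  have Kz: "?K z = bar0 (htp z) - z" using Suc.prems by simp
  have hz: "htp z \<in> bchain (Suc i) a" "htp z \<in> SP {(w, l). bad w}" using htp_bchain[OF Suc.prems(1)] .
  have "?K z \<in> bchain i a"
    unfolding Kz by (rule pm.subspace_diff[OF cpxD(6)[OF cpx_bchain] cpxD(3)[OF cpx_bchain, OF hz(1)] Suc.prems(1)])
  moreover have "bar0 (?K z) = 0"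
    using Suc.prems by (simp add: Kz bar_bar[OF dgmod_trivial])
  ultimately obtain y where y: "y \<in> bchain (Suc i) a" "y \<in> SP {(w, l). bad w}" "?K z = bar0 y"
    using Suc.IH K by blast
  have "z = bar0 (htp z - y)" using y Kz by (simp add: algebra_simps)
  moreover have "htp z - y \<in> bchain (Suc i) a"
    by (rule pm.subspace_diff[OF cpxD(6)[OF cpx_bchain] hz(1) y(1)])
  moreover have "htp z - y \<in> SP {(w, l). bad w}" by (rule pm.subspace_diff[OF subspace_SP hz(2) y(2)])
  ultimately show ?case by blast
qed

text \<open>The map of bar complexes induced by the surjection of the dg algebra onto S/I that sends
  \<sigma> to zero. The sign reconciles conventions: face j has sign (-1)^j in \<open>bar1\<close>
  and (-1)^(j+1) in \<open>bar_coef\<close>, and a face shortens the word by one.\<close>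

definition bar_proj :: "(letter list \<times> unit \<Rightarrow>\<^sub>0 'k::field) \<Rightarrow> ((nat \<Rightarrow> nat) list \<Rightarrow>\<^sub>0 'k)" where
  "bar_proj = lin (\<lambda>(w, l). if bad w then 0 else scl ((- 1) ^ length w) (unitv (map fst w)))"

definition bar_R :: "((nat \<Rightarrow> nat) list \<Rightarrow>\<^sub>0 'k::field) \<Rightarrow> ((nat \<Rightarrow> nat) list \<Rightarrow>\<^sub>0 'k)" where
  "bar_R = lin (\<lambda>s. \<Sum>j<length s - 1. if set (bar_merge j s) \<inter> I = {}
     then scl ((- 1) ^ Suc j) (unitv (bar_merge j s)) else 0)"

lemma linear_bar_proj [simp, intro]: "linear_pm bar_proj"
  by (simp add: bar_proj_def)

lemma linear_bar_R [simp, intro]: "linear_pm bar_R"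
  by (simp add: bar_R_def)

lemma good_word:
  assumes "set w \<subseteq> Lt" "\<not> bad w"
  shows "w = map (\<lambda>m. (m, False)) (map fst w)" "wtw w = length w" "wdeg w = sum_list (map fst w)"
    "map fst w \<in> bar_basis n I (length w) (wdeg w)"
proof -
  have s: "\<not> snd b \<and> fst b \<in> mons n \<and> fst b \<notin> I \<and> fst b \<noteq> 0" if "b \<in> set w" for b
  proof -
    have "b \<in> Lt" "fst b \<notin> I" using assms that by (auto simp: bad.simps)
    then show ?thesis using sigma_in_ideal[of b] by (cases b) (auto simp: letters_def split: if_splits)
  qed
  have "map (\<lambda>b. (fst b, False)) w = map id w"
  proof (rule map_cong[OF refl])
    fix b assume "b \<in> set w"
    then show "(fst b, False) = id b" using s[of b] by (simp add: prod_eq_iff)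
  qed
  then show "w = map (\<lambda>m. (m, False)) (map fst w)" by (simp add: o_def)
  show "wtw w = length w" using s by (induction w) auto
  show d: "wdeg w = sum_list (map fst w)" by (induction w) auto
  show "map fst w \<in> bar_basis n I (length w) (wdeg w)"
    using s by (auto simp: bar_basis_def d)
qed

lemma bad_map: "bad (map (\<lambda>m. (m, False)) ms) \<longleftrightarrow> set ms \<inter> I \<noteq> {}"
  by (auto simp: bad.simps)

lemma basis_word:
  assumes "ms \<in> bar_basis n I i a"
  defines "w \<equiv> map (\<lambda>m. (m, False)) ms"
  shows "set w \<subseteq> Lt" "\<not> bad w" "wtw w = i" "wdeg w = a" "length w = i" "map fst w = ms"
proof -
  have m: "length ms = i" "sum_list ms = a" "\<forall>m\<in>set ms. m \<in> mons n \<and> m \<notin> I \<and> m \<noteq> 0"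
    using assms by (auto simp: bar_basis_def)
  show 1: "set w \<subseteq> Lt" using m by (auto simp: w_def letters_def)
  show 2: "\<not> bad w" using m by (auto simp: w_def bad_map)
  show 3: "map fst w = ms" by (simp add: w_def o_def)
  show "length w = i" using m by (simp add: w_def)
  then show "wtw w = i" "wdeg w = a" using good_word[OF 1 2] m 3 by simp_all
qed

lemma bad_bar1:
  assumes "set w \<subseteq> Lt" "bad w"
  shows "bar1 (\<lambda>_ _. 0) (\<lambda>_. 0) w l \<in> (SP {(w, l). bad w} :: (letter list \<times> unit \<Rightarrow>\<^sub>0 'k::field) set)"
  using assms
proof (induction w)
  case (Cons b w)
  let ?S = "SP {(w, l). bad w} :: (letter list \<times> unit \<Rightarrow>\<^sub>0 'k) set"
  have 1: "bdel b (unitv (w, l)) \<in> ?S"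
    using Cons.prems by (auto simp: bdel_def cns_unitv pm.subspace_0)
  have 2: "bmul1 (\<lambda>_ _. 0) b w l \<in> ?S"
  proof (cases w)
    case Nil
    then show ?thesis by (simp add: pm.subspace_0)
  next
    case (Cons b' w')
    have "fst (bprod b b') \<in> I \<or> bad w'"
      using Cons.prems Cons ideal_add by (auto simp: bprod_def letters_def)
    then show ?thesis using Cons by (auto simp: pm.subspace_0)
  qed
  have 3: "cns b (bar1 (\<lambda>_ _. 0) (\<lambda>_. 0) w l) \<in> ?S"
  proof (cases "fst b \<in> I")
    case True
    show ?thesis by (rule cns_SP[where A = UNIV]) (use True in \<open>auto simp: SP_def\<close>)
  next
    case False
    show ?thesis by (rule cns_SP[OF Cons.IH]) (use False Cons.prems in auto)
  qed
  show ?case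
    unfolding bar1.simps
    by (intro pm.subspace_add[OF subspace_SP] pm.subspace_scale[OF subspace_SP] pm.subspace_diff[OF subspace_SP] 1 2 3)
qed simp

lemma bar_proj_bad:
  assumes "z \<in> SP {(w, l). bad w}"
  shows "bar_proj z = 0"
proof -
  have "bar_proj z = lin (\<lambda>_. 0) z"
    unfolding bar_proj_def by (rule lin_cong) (use assms in \<open>auto simp: SP_def\<close>)
  then show ?thesis by simp
qed

lemma bar1_plain:
  "bar1 (\<lambda>_ _. 0) (\<lambda>_. 0) (map (\<lambda>m. (m, False)) ms) l =
   (\<Sum>j<length ms - 1. scl ((- 1) ^ j) (unitv (map (\<lambda>m. (m, False)) (bar_merge j ms), l)) :: letter list \<times> unit \<Rightarrow>\<^sub>0 'k::field)"
proof (induction ms)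
  case Nil
  then show ?case by simp
next
  case (Cons m ms)
  show ?case
  proof (cases ms)
    case Nil
    then show ?thesis by (simp add: bdel_def)
  next
    case ms: (Cons m' ms')
    let ?p = "map (\<lambda>m. (m, False))"
    have 1: "bmul1 (\<lambda>_ _. 0) (m, False) (?p ms) l = (unitv (?p (bar_merge 0 (m # ms)), l) :: letter list \<times> unit \<Rightarrow>\<^sub>0 'k)"
      by (simp add: ms bprod_def bar_merge_def)
    have 2: "cns (m, False) (\<Sum>j<length ms - 1. scl ((- 1) ^ j) (unitv (?p (bar_merge j ms), l))) =
      (\<Sum>j<length ms - 1. scl ((- 1) ^ j) (unitv (?p (bar_merge (Suc j) (m # ms)), l)) :: letter list \<times> unit \<Rightarrow>\<^sub>0 'k)"
      unfolding pp.linear_sum[OF linear_bar_ops(3)]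
      by (intro sum.cong refl) (simp add: cns_unitv bar_merge_def)
    have len: "length (m # ms) - 1 = Suc (length ms - 1)" by (simp add: ms)
    have "bar1 (\<lambda>_ _. 0) (\<lambda>_. 0) (?p (m # ms)) l =
      unitv (?p (bar_merge 0 (m # ms)), l) -
      (\<Sum>j<length ms - 1. scl ((- 1) ^ j) (unitv (?p (bar_merge (Suc j) (m # ms)), l)) :: letter list \<times> unit \<Rightarrow>\<^sub>0 'k)"
      unfolding list.map bar1.simps Cons.IH 1 2 by (simp add: bdel_def sg_def)
    also have "\<dots> = (\<Sum>j<length (m # ms) - 1. scl ((- 1) ^ j) (unitv (?p (bar_merge j (m # ms)), l)))"
      unfolding len sum.lessThan_Suc_shift by (simp add: sum_negf)
    finally show ?thesis .
  qed
qed

lemma length_bar_merge: "Suc j < length s \<Longrightarrow> length (bar_merge j s) = length s - 1"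
  by (simp add: bar_merge_def)

lemma bar_proj_comm:
  fixes z :: "letter list \<times> unit \<Rightarrow>\<^sub>0 'k::field"
  assumes "z \<in> bchain i a"
  shows "bar_proj (bar0 z) = bar_R (bar_proj z)"
proof (rule linear_eq_on_units[OF linear_pm_compose[OF linear_bar_ops(5) linear_bar_proj]
      linear_pm_compose[OF linear_bar_proj linear_bar_R]])
  fix x assume x: "x \<in> keys z"
  obtain w l where wl: "x = (w, l)" by (cases x)
  have w: "set w \<subseteq> Lt" using x assms unfolding bchain_eq SP_def wl by blast
  show "bar_proj (bar0 (unitv x)) = bar_R (bar_proj (unitv x :: _ \<Rightarrow>\<^sub>0 'k))"
  proof (cases "bad w")
    case True
    have "bar_proj (bar0 (unitv (w, l)) :: _ \<Rightarrow>\<^sub>0 'k) = 0"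
      unfolding bar_unitv by (rule bar_proj_bad[OF bad_bar1[OF w True]])
    moreover have "bar_proj (unitv (w, l) :: _ \<Rightarrow>\<^sub>0 'k) = 0"
      by (rule bar_proj_bad) (use True in simp)
    ultimately show ?thesis by (simp add: wl pp.linear_0[OF linear_bar_R])
  next
    case False
    define ms where "ms = map fst w"
    let ?p = "map (\<lambda>m. (m, False))"
    have wms: "w = ?p ms" using good_word(1)[OF w False] by (simp add: ms_def)
    have "bar_proj (bar0 (unitv (w, l)) :: _ \<Rightarrow>\<^sub>0 'k) =
      (\<Sum>j<length ms - 1. scl ((- 1) ^ j) (bar_proj (unitv (?p (bar_merge j ms), l))))"
      unfolding bar_unitv wms bar1_plain pp.linear_sum[OF linear_bar_proj] pp.linear_scale[OF linear_bar_proj] ..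
    also have "\<dots> = scl ((- 1) ^ length ms) (\<Sum>j<length ms - 1. if set (bar_merge j ms) \<inter> I = {}
     then scl ((- 1) ^ Suc j) (unitv (bar_merge j ms)) else 0)"
      unfolding pm.scale_sum_right
    proof (rule sum.cong[OF refl])
      fix j assume "j \<in> {..<length ms - 1}"
      then have j: "Suc j < length ms" by auto
      then obtain k where k: "length ms = Suc k" by (cases "length ms") auto
      have "(- 1) ^ j * (- 1) ^ k = (- 1) ^ Suc k * (- 1 :: 'k) ^ Suc j"
        by simp
      then show "scl ((- 1) ^ j) (bar_proj (unitv (?p (bar_merge j ms), l))) =
         scl ((- 1) ^ length ms) (if set (bar_merge j ms) \<inter> I = {}
          then scl ((- 1) ^ Suc j) (unitv (bar_merge j ms)) else (0 :: _ \<Rightarrow>\<^sub>0 'k))"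
        using length_bar_merge[OF j] k
        by (simp add: bar_proj_def bad_map o_def del: power_Suc)
    qed
    also have "\<dots> = bar_R (bar_proj (unitv (w, l)))"
      unfolding ms_def using False
      by (simp add: bar_proj_def pp.linear_scale[OF linear_bar_R]) (simp add: bar_R_def)
    finally show ?thesis by (simp add: wl)
  qed
qed

lemma bar_proj_image: "bar_proj ` (bchain i a :: (_ \<Rightarrow>\<^sub>0 'k::field) set) = SP (bar_basis n I i a)"
proof (rule subset_antisym)
  show "bar_proj ` (bchain i a :: (_ \<Rightarrow>\<^sub>0 'k) set) \<subseteq> SP (bar_basis n I i a)"
  proof clarify
    fix z :: "_ \<Rightarrow>\<^sub>0 'k" assume z: "z \<in> bchain i a"
    show "bar_proj z \<in> SP (bar_basis n I i a)"
      unfolding bar_proj_def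
    proof (rule lin_in_subspace[OF subspace_SP])
      fix x assume x: "x \<in> keys z"
      obtain w l where wl: "x = (w, l)" by (cases x)
      have w: "set w \<subseteq> Lt" "i = wtw w" "a = wdeg w" using x z unfolding bchain_eq SP_def wl by blast+
      show "(case x of (w, l) \<Rightarrow> if bad w then 0 else scl ((- 1) ^ length w) (unitv (map fst w))) \<in> (SP (bar_basis n I i a) :: (_ \<Rightarrow>\<^sub>0 'k) set)"
        using good_word[OF w(1)] w by (auto simp: wl pm.subspace_0 intro!: pm.subspace_scale)
    qed
  qed
  have sub: "pm.subspace (bar_proj ` (bchain i a :: (_ \<Rightarrow>\<^sub>0 'k) set))"
    by (rule pp.linear_subspace_image[OF linear_bar_proj cpxD(6)[OF cpx_bchain]])
  show "SP (bar_basis n I i a) \<subseteq> bar_proj ` (bchain i a :: (_ \<Rightarrow>\<^sub>0 'k) set)"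
    unfolding SP_eq_span
  proof (rule pm.span_minimal[OF _ sub], clarify)
    fix ms assume ms: "ms \<in> bar_basis n I i a"
    let ?w = "map (\<lambda>m. (m, False)) ms"
    note w = basis_word[OF ms]
    have "(unitv (?w, ()) :: _ \<Rightarrow>\<^sub>0 'k) \<in> bchain i a" using w unfolding bchain_eq by simp
    then have "scl ((- 1) ^ i) (unitv (?w, ()) :: _ \<Rightarrow>\<^sub>0 'k) \<in> bchain i a"
      by (rule pm.subspace_scale[OF cpxD(6)[OF cpx_bchain]])
    moreover have "bar_proj (scl ((- 1) ^ i) (unitv (?w, ()) :: _ \<Rightarrow>\<^sub>0 'k)) = unitv ms"
      unfolding pp.linear_scale[OF linear_bar_proj] using w
      by (simp add: bar_proj_def o_def power_mult_distrib[symmetric])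
    ultimately show "unitv ms \<in> bar_proj ` (bchain i a :: (_ \<Rightarrow>\<^sub>0 'k) set)" by (metis image_eqI)
  qed
qed

lemma bar_proj_kernel:
  fixes z :: "letter list \<times> unit \<Rightarrow>\<^sub>0 'k::field"
  assumes z: "z \<in> bchain i a" and "bar_proj z = 0"
  shows "z \<in> SP {(w, l). bad w}"
proof -
  have "bad w" if x: "(w, l) \<in> keys z" for w l
  proof (rule ccontr)
    assume nb: "\<not> bad w"
    have w: "set w \<subseteq> Lt" if "(w, l) \<in> keys z" for w l using that z unfolding bchain_eq SP_def by blast
    have "lookup (bar_proj z) (map fst w) = (\<Sum>y\<in>keys z. if y = (w, l) then (- 1) ^ length w * lookup z (w, l) else 0)"
      unfolding bar_proj_def lin_def lookup_sum
    proof (rule sum.cong[OF refl])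
      fix y assume y: "y \<in> keys z"
      obtain v u where vu: "y = (v, u)" by (cases y)
      show "lookup (scl (lookup z y) (case y of (w, l) \<Rightarrow> if bad w then 0 else scl ((- 1) ^ length w) (unitv (map fst w)))) (map fst w) =
         (if y = (w, l) then (- 1) ^ length w * lookup z (w, l) else 0)"
      proof (cases "\<not> bad v \<and> map fst v = map fst w")
        case True
        then have "v = w" using good_word(1)[OF w[of v u]] good_word(1)[OF w[OF x] nb] y vu by metis
        then show ?thesis using True by (simp add: vu lookup_unitv)
      next
        case False
        then show ?thesis using nb by (auto simp: vu lookup_unitv)
      qed
    qed
    also have "\<dots> = (- 1) ^ length w * lookup z (w, l)" using x by simp
    finally show False using assms x by (simp add: in_keys_iff)
  qed
  then show ?thesis by (auto simp: SP_def)
qed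

lemma finite_bar_basis: "finite (bar_basis n I i a)"
proof (rule finite_subset)
  show "bar_basis n I i a \<subseteq> {ms. set ms \<subseteq> {m \<in> mons n. m \<le> a} \<and> length ms = i}"
    by (auto simp: bar_basis_def le_fun_def intro: order_trans[OF member_le_sum_list])
       (metis elem_le_sum_list in_set_conv_nth le_fun_def)
  show "finite {ms. set ms \<subseteq> {m \<in> mons n. m \<le> a} \<and> length ms = i}"
    by (rule finite_lists_length_eq[OF finite_mons_le])
qed

lemma bar_merge_basis:
  assumes s: "s \<in> bar_basis n I (Suc i) a" and j: "j < length s - 1"
  shows "bar_merge j s \<in> bar_basis n I i a \<longleftrightarrow> set (bar_merge j s) \<inter> I = {}"
proof -
  have j': "Suc j < length s" using j by simp
  have s': "length s = Suc i" "\<forall>m\<in>set s. m \<in> mons n \<and> m \<notin> I \<and> m \<noteq> 0" "sum_list s = a"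
    using s by (auto simp: bar_basis_def)
  have dec: "s = take j s @ [s ! j, s ! Suc j] @ drop (Suc (Suc j)) s"
    using j' by (simp add: Cons_nth_drop_Suc)
  have "sum_list s = sum_list (bar_merge j s)"
    by (subst dec) (simp only: bar_merge_def sum_list.append sum_list_simps, simp add: add.assoc)
  moreover have "m \<in> mons n \<and> m \<noteq> 0" if "m \<in> set (bar_merge j s)" for m
    using that s'(2) j' nth_mem[of j s] nth_mem[of "Suc j" s]
    by (auto simp: bar_merge_def dest: in_set_takeD in_set_dropD)
  ultimately show ?thesis
    using length_bar_merge[OF j'] s' by (auto simp: bar_basis_def)
qed

text \<open>\<open>bar_proj\<close> is onto the bar complex of S/I, and its kernel, spanned by the
  bad words, is acyclic; hence the dg algebra may replace S/I.\<close>

lemma tor_R_KK_eq: "tor_R_KK (K :: 'k::field itself) n I i a = bar_betti TYPE('k) Lt i a"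
proof -
  have "hom_dim (\<lambda>j. bar_basis n I j a) (bar_coef :: _ \<Rightarrow> _ \<Rightarrow> 'k) i =
      betti (bar_R :: (_ \<Rightarrow>\<^sub>0 'k) \<Rightarrow> _) (\<lambda>j. SP (bar_basis n I j a)) i"
  proof (rule hom_dim_eq_betti)
    show "finite (bar_basis n I i a)" for i by (rule finite_bar_basis)
    show "linear_pm bar_R" by (rule linear_bar_R)
    show "bar_R (unitv x) = (0 :: _ \<Rightarrow>\<^sub>0 'k)" if "x \<in> bar_basis n I 0 a" for x
      using that by (simp add: bar_R_def bar_basis_def)
    fix i x assume x: "x \<in> bar_basis n I (Suc i) a"
    have "(\<Sum>y\<in>bar_basis n I i a. scl (bar_coef x y) (unitv y)) =
      (\<Sum>y\<in>bar_basis n I i a. \<Sum>j<length x - 1. if bar_merge j x = y then scl ((- 1) ^ Suc j) (unitv y) else (0 :: _ \<Rightarrow>\<^sub>0 'k))"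
      unfolding bar_coef_def pm.scale_sum_left by (intro sum.cong refl) auto
    also have "\<dots> = (\<Sum>j<length x - 1. \<Sum>y\<in>bar_basis n I i a. if bar_merge j x = y then scl ((- 1) ^ Suc j) (unitv y) else 0)"
      by (rule sum.swap)
    also have "\<dots> = (\<Sum>j<length x - 1. if set (bar_merge j x) \<inter> I = {}
     then scl ((- 1) ^ Suc j) (unitv (bar_merge j x)) else 0)"
      by (intro sum.cong refl) (use bar_merge_basis[OF x] finite_bar_basis in \<open>simp add: del: power_Suc\<close>)
    finally show "bar_R (unitv x) = (\<Sum>y\<in>bar_basis n I i a. scl (bar_coef x y) (unitv y) :: _ \<Rightarrow>\<^sub>0 'k)"
      by (simp add: bar_R_def)
  qed
  also have "\<dots> = betti bar0 (\<lambda>i. bchain i a :: (_ \<Rightarrow>\<^sub>0 'k) set) i"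
  proof (rule betti_surj_acyclic_kernel[OF cpx_bchain _ linear_bar_proj bar_proj_image bar_proj_comm, symmetric])
    show "cpx bar_R (\<lambda>i. SP (bar_basis n I i a) :: (_ \<Rightarrow>\<^sub>0 'k) set)"
      by (rule cpx_image[OF cpx_bchain linear_bar_R linear_bar_proj bar_proj_image bar_proj_comm])
    fix i and z :: "_ \<Rightarrow>\<^sub>0 'k"
    assume z: "z \<in> bchain i a" "bar_proj z = 0" "bar0 z = 0"
    have zb: "z \<in> SP {(w, l). bad w}" by (rule bar_proj_kernel[OF z(1,2)])
    \<comment> \<open>A bound above \<open>pre\<close> of every word in z; inserting 0 keeps
      \<open>Max\<close> defined when z is zero.\<close>
    define P where "P = Suc (Max (insert 0 ((\<lambda>(w, l). pre w) ` keys z)))"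
    have "z \<in> badspace P"
      unfolding badspace_def SP_def
    proof clarify
      fix w l assume k: "(w, l) \<in> keys z"
      then have "pre w \<le> Max (insert 0 ((\<lambda>(w, l). pre w) ` keys z))" by (intro Max_ge) force+
      then show "bad w \<and> pre w < P" using k zb by (auto simp: P_def SP_def)
    qed
    then obtain y where "y \<in> bchain (Suc i) a" "y \<in> SP {(w, l). bad w}" "z = bar0 y"
      using bad_acyclic[OF z(1) _ z(3)] by blast
    then show "\<exists>y\<in>bchain (Suc i) a. bar_proj y = 0 \<and> z = bar0 y" using bar_proj_bad by blast
  qed
  finally show ?thesis by (simp add: tor_R_KK_def bar_betti_def bchain_def)
qed

end

section \<open>The Koszul complex\<close>

definition ksg :: "nat set \<Rightarrow> nat \<Rightarrow> 'k::field" where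
  "ksg F j = (- 1) ^ card {k \<in> F. k < j}"

lemma ksg_square [simp]: "ksg F j * ksg F j = (1 :: 'k::field)"
  by (simp add: ksg_def power_mult_distrib[symmetric])

lemma ksg_insert:
  assumes "finite F" "i \<notin> F"
  shows "ksg (insert i F) j = (if i < j then - ksg F j else ksg F j :: 'k::field)"
proof -
  have "{k \<in> insert i F. k < j} = (if i < j then insert i {k \<in> F. k < j} else {k \<in> F. k < j})" by auto
  then show ?thesis using assms by (simp add: ksg_def)
qed

lemma ksg_remove:
  assumes "finite F" "i \<in> F"
  shows "ksg (F - {i}) j = (if i < j then - ksg F j else ksg F j :: 'k::field)"
  using ksg_insert[of "F - {i}" i j, where 'k = 'k] assms by (auto simp: insert_absorb)

lemma antisym_sum_zero:
  fixes g :: "nat \<Rightarrow> nat \<Rightarrow> 'v::ab_group_add"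
  assumes "finite F" "\<And>j k. j \<in> F \<Longrightarrow> k \<in> F \<Longrightarrow> j \<noteq> k \<Longrightarrow> g j k + g k j = 0"
  shows "(\<Sum>j\<in>F. \<Sum>k\<in>F - {j}. g j k) = 0"
  using assms
proof (induction F rule: finite_induct)
  case (insert x F)
  have "(\<Sum>k\<in>insert x F - {j}. g j k) = g j x + (\<Sum>k\<in>F - {j}. g j k)" if "j \<in> F" for j
  proof -
    have "insert x F - {j} = insert x (F - {j})" using insert that by auto
    then show ?thesis using insert by simp
  qed
  moreover have "insert x F - {x} = F" using insert by auto
  ultimately have "(\<Sum>j\<in>insert x F. \<Sum>k\<in>insert x F - {j}. g j k) =
      (\<Sum>k\<in>F. g x k) + (\<Sum>j\<in>F. g j x) + (\<Sum>j\<in>F. \<Sum>k\<in>F - {j}. g j k)"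
    using insert by (simp add: sum.distrib add.assoc)
  also have "(\<Sum>k\<in>F. g x k) + (\<Sum>j\<in>F. g j x) = (\<Sum>k\<in>F. g x k + g k x)" by (simp add: sum.distrib)
  also have "\<dots> = 0" using insert by (intro sum.neutral) auto
  finally show ?case using insert by simp
qed simp

type_synonym lbase = "letter \<times> nat set"

definition lact :: "letter \<Rightarrow> lbase \<Rightarrow> (lbase \<Rightarrow>\<^sub>0 'k::field)" where
  "lact b l = (if snd b \<and> snd (fst l) then 0 else unitv (bprod b (fst l), snd l))"

definition kos :: "letter \<Rightarrow> nat set \<Rightarrow> (lbase \<Rightarrow>\<^sub>0 'k::field)" where
  "kos b F = (\<Sum>j\<in>F. scl (ksg F j) (unitv ((fst b + var j, snd b), F - {j})))"

text \<open>The total differential of a tensor product: d(\<sigma> m) = m on the first factor and,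
  with the sign of its degree, the Koszul differential on the exterior factor.\<close>

definition kd :: "lbase \<Rightarrow> (lbase \<Rightarrow>\<^sub>0 'k::field)" where
  "kd l = (if snd (fst l) then unitv ((fst (fst l), False), snd l) else 0) + scl (sg (fst l)) (kos (fst l) (snd l))"

lemma lact_kos: "lin (lact b) (kos b0 F) = (if snd b \<and> snd b0 then 0 else kos (bprod b b0) F)"
  unfolding kos_def lin_sum
  by (auto simp: lact_def bprod_def add.assoc intro!: sum.neutral sum.cong)

lemma kd_unit: "kd ((m, e), F) = (if e then unitv ((m, False), F) else 0) + scl (if e then - 1 else 1) (kos (m, e) F)"
  by (simp add: kd_def sg_def)

lemma kos_kos: "(\<Sum>j\<in>F. scl (ksg F j) (kos (m + var j, e) (F - {j}))) = (0 :: lbase \<Rightarrow>\<^sub>0 'k::field)"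
proof (cases "finite F")
  case True
  let ?g = "\<lambda>j k. scl (ksg F j * ksg (F - {j}) k) (unitv ((m + var j + var k, e), F - {j} - {k})) :: lbase \<Rightarrow>\<^sub>0 'k"
  have "(\<Sum>j\<in>F. scl (ksg F j) (kos (m + var j, e) (F - {j}))) = (\<Sum>j\<in>F. \<Sum>k\<in>F - {j}. ?g j k)"
    unfolding kos_def pm.scale_sum_right by simp
  also have "\<dots> = 0"
  proof (rule antisym_sum_zero[OF True])
    fix j k assume jk: "j \<in> F" "k \<in> F" "j \<noteq> k"
    have "ksg F j * ksg (F - {j}) k + ksg F k * ksg (F - {k}) j = (0 :: 'k)"
      using jk True by (cases "j < k") (simp_all add: ksg_remove)
    moreover have "F - {j} - {k} = F - {k} - {j}" "m + var j + var k = m + var k + var j"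
      by (auto simp: fun_eq_iff)
    ultimately show "?g j k + ?g k j = 0" by (simp add: pm.scale_left_distrib[symmetric])
  qed
  finally show ?thesis .
qed simp

lemma kd_kos: "lin kd (kos (m, e) F) = (if e then kos (m, False) F else (0 :: lbase \<Rightarrow>\<^sub>0 'k::field))"
proof -
  have "lin kd (kos (m, e) F) = (\<Sum>j\<in>F. scl (ksg F j) (kd ((m + var j, e), F - {j})))"
    by (simp add: kos_def lin_sum)
  also have "\<dots> = (\<Sum>j\<in>F. scl (ksg F j) (if e then unitv ((m + var j, False), F - {j}) else 0)) +
      scl (if e then - 1 else 1) (\<Sum>j\<in>F. scl (ksg F j) (kos (m + var j, e) (F - {j})))"
    by (simp add: kd_unit pm.scale_right_distrib sum.distrib pm.scale_sum_right sum_negf)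
  also have "\<dots> = (if e then kos (m, False) F else 0)"
    unfolding kos_kos by (simp add: kos_def)
  finally show ?thesis .
qed

lemma dgmod_lact: "dgmod lact (kd :: _ \<Rightarrow> (_ \<Rightarrow>\<^sub>0 'k::field))"
  unfolding dgmod_def
proof (intro conjI allI)
  show "lin (lact b) (lact b' l) = (if snd b \<and> snd b' then 0 else lact (bprod b b') l :: _ \<Rightarrow>\<^sub>0 'k)" for b b' l
    by (auto simp: lact_def bprod_def add.assoc)
  show "lin kd (lact b l) = (if snd b then lact (fst b, False) l else 0) + scl (sg b) (lin (lact b) (kd l) :: _ \<Rightarrow>\<^sub>0 'k)" for b l
  proof -
    obtain m e m0 e0 F where "b = (m, e)" "l = ((m0, e0), F)" by (metis prod.exhaust)
    then show ?thesis
      by (cases e; cases e0) (simp_all add: lact_def bprod_def kd_unit sg_def lact_kos[unfolded bprod_def])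
  qed
  show "lin kd (kd l) = (0 :: _ \<Rightarrow>\<^sub>0 'k)" for l
  proof -
    obtain m0 e0 F where "l = ((m0, e0), F)" by (metis prod.exhaust)
    then show ?thesis by (cases e0) (simp_all add: kd_unit kd_kos)
  qed
qed

text \<open>Division by x_i followed by exterior multiplication with e_i. In every multidegree with
  positive i-th entry the Koszul complex of x_i alone is exact, and the signs \<open>ksg\<close>
  make the contributions of the other variables cancel, which turns this map into a contraction of
  the whole strand.\<close>

definition khtp1 :: "nat \<Rightarrow> lbase \<Rightarrow> (lbase \<Rightarrow>\<^sub>0 'k::field)" where
  "khtp1 i l = (if i \<in> snd l \<or> fst (fst l) i = 0 then 0
     else scl (ksg (snd l) i) (unitv ((fst (fst l) - var i, snd (fst l)), insert i (snd l))))"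

lemma add_var_diff: "(m + var j) - var j = (m :: nat \<Rightarrow> nat)"
  "m i \<noteq> 0 \<Longrightarrow> (m + var j) - var i = (m - var i) + var j" "m i \<noteq> 0 \<Longrightarrow> (m - var i) + var i = m"
  by (auto simp: fun_eq_iff var_def)

lemma khtp_homotopy:
  assumes F: "finite F" and i: "i \<in> F \<or> m i \<noteq> 0"
  shows "lin kd (khtp1 i ((m, False), F)) + lin (khtp1 i) (kd ((m, False), F)) = (unitv ((m, False), F) :: _ \<Rightarrow>\<^sub>0 'k::field)"
proof (cases "i \<in> F")
  case True
  have "lin (khtp1 i) (kos (m, False) F) = (\<Sum>j\<in>F. scl (ksg F j) (khtp1 i ((m + var j, False), F - {j})))"
    by (simp add: kos_def lin_sum)
  also have "\<dots> = (\<Sum>j\<in>F. if j = i then unitv ((m, False), F) else (0 :: _ \<Rightarrow>\<^sub>0 'k))"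
  proof (rule sum.cong[OF refl])
    fix j assume "j \<in> F"
    show "scl (ksg F j) (khtp1 i ((m + var j, False), F - {j})) = (if j = i then unitv ((m, False), F) else (0 :: _ \<Rightarrow>\<^sub>0 'k))"
    proof (cases "j = i")
      case True
      have "var i i = (1 :: nat)" by (simp add: var_def)
      then show ?thesis using True \<open>i \<in> F\<close> F
        by (simp add: khtp1_def ksg_remove insert_absorb add_var_diff(1))
    next
      case False
      then show ?thesis using \<open>i \<in> F\<close> by (simp add: khtp1_def)
    qed
  qed
  also have "\<dots> = unitv ((m, False), F)" using True F by simp
  finally show ?thesis using True by (simp add: khtp1_def kd_unit)
next
  case False
  then have mi: "m i \<noteq> 0" using i by simp
  have "lin kd (khtp1 i ((m, False), F)) = scl (ksg F i) (kos (m - var i, False) (insert i F) :: _ \<Rightarrow>\<^sub>0 'k)"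
    using False mi by (simp add: khtp1_def kd_unit)
  also have "\<dots> = unitv ((m, False), F) + (\<Sum>j\<in>F. scl (ksg F i * ksg (insert i F) j) (unitv ((m - var i + var j, False), insert i F - {j})))"
  proof -
    have "ksg (insert i F) i = (ksg F i :: 'k)" using False F by (simp add: ksg_insert)
    moreover have "insert i F - {i} = F" using False by auto
    ultimately show ?thesis using False F
      by (simp add: kos_def pm.scale_right_distrib pm.scale_sum_right add_var_diff(3)[of m i, OF mi])
  qed
  finally have 1: "lin kd (khtp1 i ((m, False), F)) = unitv ((m, False), F) +
      (\<Sum>j\<in>F. scl (ksg F i * ksg (insert i F) j) (unitv ((m - var i + var j, False), insert i F - {j})) :: _ \<Rightarrow>\<^sub>0 'k)" .
  have "lin (khtp1 i) (kos (m, False) F) = (\<Sum>j\<in>F. scl (ksg F j) (khtp1 i ((m + var j, False), F - {j}) :: _ \<Rightarrow>\<^sub>0 'k))"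
    by (simp add: kos_def lin_sum)
  also have "\<dots> = (\<Sum>j\<in>F. scl (- (ksg F i * ksg (insert i F) j)) (unitv ((m - var i + var j, False), insert i F - {j})))"
  proof (rule sum.cong[OF refl])
    fix j assume j: "j \<in> F"
    have ji: "j \<noteq> i" using j False by auto
    have "ksg F j * ksg (F - {j}) i = - (ksg F i * ksg (insert i F) j :: 'k)"
      using j ji F False by (cases "j < i") (simp_all add: ksg_remove ksg_insert)
    moreover have "insert i (F - {j}) = insert i F - {j}" using ji by auto
    ultimately show "scl (ksg F j) (khtp1 i ((m + var j, False), F - {j})) =
        scl (- (ksg F i * ksg (insert i F) j)) (unitv ((m - var i + var j, False), insert i F - {j}) :: _ \<Rightarrow>\<^sub>0 'k)"
      using False mi by (simp add: khtp1_def add_var_diff(2)[of m i j])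
  qed
  also have "\<dots> = - (\<Sum>j\<in>F. scl (ksg F i * ksg (insert i F) j) (unitv ((m - var i + var j, False), insert i F - {j})))"
    by (simp add: sum_negf)
  finally show ?thesis using 1 by (simp add: kd_unit)
qed

section \<open>Total degrees and the multigraded strands of \<open>L\<close>\<close>

definition mdeg :: "nat \<Rightarrow> (nat \<Rightarrow> nat) \<Rightarrow> nat" where
  "mdeg n m = (\<Sum>i<n. m i)"

lemma mdeg_0 [simp]: "mdeg n 0 = 0"
  by (simp add: mdeg_def)

lemma mdeg_add [simp]: "mdeg n (m + m') = mdeg n m + mdeg n m'"
  by (simp add: mdeg_def sum.distrib)

lemma mdeg_var [simp]: "j < n \<Longrightarrow> mdeg n (var j) = 1"
  by (simp add: mdeg_def var_def)

lemma mdeg_indic: "F \<subseteq> {..<n} \<Longrightarrow> mdeg n (indic F) = card F"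
  by (simp add: mdeg_def indic_def sum.If_cases Int_absorb1)

lemma mdeg_pos: "mdeg n m \<noteq> 0 \<Longrightarrow> \<exists>i<n. m i \<noteq> 0"
  by (auto simp: mdeg_def)

lemma mdeg_eq_0: "m \<in> mons n \<Longrightarrow> mdeg n m = 0 \<Longrightarrow> m = 0"
proof
  fix i assume "m \<in> mons n" "mdeg n m = 0"
  then show "m i = 0 i" by (cases "i < n") (auto simp: mdeg_def mons_def)
qed

lemma mdeg_strict: "m \<in> mons n \<Longrightarrow> m' \<in> mons n \<Longrightarrow> m \<le> m' \<Longrightarrow> m \<noteq> m' \<Longrightarrow> mdeg n m < mdeg n m'"
proof -
  assume m: "m \<in> mons n" "m' \<in> mons n" "m \<le> m'" "m \<noteq> m'"
  have e: "m + (m' - m) = m'" using m(3) by (auto simp: fun_eq_iff le_fun_def)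
  have "m' - m \<in> mons n" using m by (auto simp: mons_def)
  moreover have "m' - m \<noteq> 0" using e m(4) by auto
  ultimately have "mdeg n (m' - m) \<noteq> 0" using mdeg_eq_0 by blast
  then show ?thesis using mdeg_add[of n m "m' - m"] e by simp
qed

lemma indic_remove: "j \<in> F \<Longrightarrow> var j + indic (F - {j}) = indic F"
  by (auto simp: fun_eq_iff var_def indic_def)

lemma indic_insert: "j \<notin> F \<Longrightarrow> indic (insert j F) = var j + indic F"
  by (auto simp: fun_eq_iff var_def indic_def)

lemma var_mons [simp]: "j < n \<Longrightarrow> var j \<in> mons n"
  by (auto simp: mons_def var_def)

lemma diff_mons [simp]: "m \<in> mons n \<Longrightarrow> m - m' \<in> mons n"
  by (auto simp: mons_def)

lemma indic_mons [simp]: "F \<subseteq> {..<n} \<Longrightarrow> indic F \<in> mons n"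
  by (auto simp: mons_def indic_def subset_iff not_le)

text \<open>The ideal J is a parameter because the vanishing result is proved by adding generators
  one at a time; for J empty only the Koszul complex of S is left.\<close>

definition Lb :: "nat \<Rightarrow> (nat \<Rightarrow> nat) set \<Rightarrow> nat \<Rightarrow> (nat \<Rightarrow> nat) \<Rightarrow> lbase set" where
  "Lb n J q c = {((m, e), F). F \<subseteq> {..<n} \<and> m \<in> mons n \<and> (e \<longrightarrow> m \<in> J) \<and>
     card F + of_bool e = q \<and> m + indic F = c}"

lemma finite_Lb: "finite (Lb n J q c)"
proof (rule finite_subset)
  show "Lb n J q c \<subseteq> ({m \<in> mons n. m \<le> c} \<times> UNIV) \<times> Pow {..<n}"
    by (auto simp: Lb_def le_fun_def)
  show "finite (({m \<in> mons n. m \<le> c} \<times> (UNIV :: bool set)) \<times> Pow {..<n})"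
    by (intro finite_cartesian_product finite_mons_le) auto
qed

lemma Lb_mons: "x \<in> Lb n J q c \<Longrightarrow> c \<in> mons n"
  by (auto simp: Lb_def)

definition up_closed :: "nat \<Rightarrow> (nat \<Rightarrow> nat) set \<Rightarrow> bool" where
  "up_closed n J \<longleftrightarrow> (\<forall>m\<in>J. \<forall>m'\<in>mons n. m + m' \<in> J)"

lemma kos_Lb:
  assumes "up_closed n J" "((m, e), F) \<in> Lb n J (Suc q) c" "j \<in> F"
  shows "((m + var j, e), F - {j}) \<in> Lb n J q c"
proof -
  have F: "F \<subseteq> {..<n}" "finite F" and j: "j < n" using assms finite_subset[of F "{..<n}"] by (auto simp: Lb_def)
  have "card F = Suc (card (F - {j}))" using F assms by (metis card_Suc_Diff1)
  moreover have "m + var j + indic (F - {j}) = c"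
    using assms(2) indic_remove[OF assms(3)] by (auto simp: Lb_def add.assoc)
  ultimately show ?thesis using assms j by (auto simp: Lb_def up_closed_def)
qed

lemma kd_SP:
  assumes J: "up_closed n J" and z: "(z :: _ \<Rightarrow>\<^sub>0 'k::field) \<in> SP (Lb n J (Suc q) c)"
  shows "lin kd z \<in> SP (Lb n J q c)"
proof (rule lin_in_subspace[OF subspace_SP])
  fix x assume "x \<in> keys z"
  then have x: "x \<in> Lb n J (Suc q) c" using z by (auto simp: SP_def)
  obtain m e F where xx: "x = ((m, e), F)" by (metis prod.exhaust)
  have 1: "(if e then unitv ((m, False), F) else 0) \<in> (SP (Lb n J q c) :: (_ \<Rightarrow>\<^sub>0 'k) set)"
    using x by (auto simp: xx Lb_def pm.subspace_0)
  have 2: "kos (m, e) F \<in> (SP (Lb n J q c) :: (_ \<Rightarrow>\<^sub>0 'k) set)"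
    unfolding kos_def
    by (intro pm.subspace_sum[OF subspace_SP] pm.subspace_scale[OF subspace_SP])
       (use kos_Lb[OF J x[unfolded xx]] in simp)
  show "kd x \<in> (SP (Lb n J q c) :: (_ \<Rightarrow>\<^sub>0 'k) set)"
    unfolding xx kd_unit by (intro pm.subspace_add[OF subspace_SP] pm.subspace_scale[OF subspace_SP] 1 2)
qed

lemma kd_SP_0:
  assumes "(z :: _ \<Rightarrow>\<^sub>0 'k::field) \<in> SP (Lb n J 0 c)"
  shows "lin kd z = 0"
proof -
  have "lin kd z = lin (\<lambda>_. 0) z"
  proof (rule lin_cong)
    fix x assume "x \<in> keys z"
    then have "x \<in> Lb n J 0 c" using assms by (auto simp: SP_def)
    then obtain m F where "x = ((m, False), F)" "F = {}"
      by (auto simp: Lb_def finite_subset[of _ "{..<n}"])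
    then show "kd x = (0 :: _ \<Rightarrow>\<^sub>0 'k)" by (simp add: kd_unit kos_def)
  qed
  then show ?thesis by simp
qed

lemma khtp_SP:
  assumes z: "(z :: _ \<Rightarrow>\<^sub>0 'k::field) \<in> SP (Lb n {} q c)" and i: "i < n"
  shows "lin (khtp1 i) z \<in> SP (Lb n {} (Suc q) c)"
proof (rule lin_in_subspace[OF subspace_SP])
  fix x assume "x \<in> keys z"
  then have x: "x \<in> Lb n {} q c" using z by (auto simp: SP_def)
  obtain m e F where xx: "x = ((m, e), F)" by (metis prod.exhaust)
  show "khtp1 i x \<in> (SP (Lb n {} (Suc q) c) :: (_ \<Rightarrow>\<^sub>0 'k) set)"
  proof (cases "i \<in> F \<or> m i = 0")
    case True
    then show ?thesis by (auto simp: xx khtp1_def pm.subspace_0)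
  next
    case False
    have "finite F" using x finite_subset[of F "{..<n}"] by (auto simp: xx Lb_def)
    moreover have "m - var i + indic (insert i F) = m + indic F"
      using False indic_insert[of i F] add_var_diff(3)[of m i] by (simp add: add.assoc[symmetric])
    ultimately have "((m - var i, e), insert i F) \<in> Lb n {} (Suc q) c"
      using x False i by (auto simp: xx Lb_def)
    then show ?thesis using False by (simp add: xx khtp1_def pm.subspace_scale)
  qed
qed

lemma khtp_homotopy_SP:
  assumes z: "(z :: _ \<Rightarrow>\<^sub>0 'k::field) \<in> SP (Lb n {} q c)" and i: "c i \<noteq> 0"
  shows "lin kd (lin (khtp1 i) z) + lin (khtp1 i) (lin kd z) = z"
proof -
  let ?K = "\<lambda>z :: _ \<Rightarrow>\<^sub>0 'k. lin kd (lin (khtp1 i) z) + lin (khtp1 i) (lin kd z)"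
  have "linear_pm ?K" by (rule linear_pmI) (auto simp: algebra_simps pm.scale_right_distrib)
  from linear_eq_lin[OF this, of z] have "?K z = lin (\<lambda>x. ?K (unitv x)) z" .
  also have "\<dots> = lin unitv z"
  proof (rule lin_cong)
    fix x assume "x \<in> keys z"
    then have x: "x \<in> Lb n {} q c" using z by (auto simp: SP_def)
    then obtain m F where xx: "x = ((m, False), F)" by (auto simp: Lb_def)
    have "finite F" using x finite_subset[of F "{..<n}"] by (auto simp: xx Lb_def)
    moreover have "i \<in> F \<or> m i \<noteq> 0" using x i by (auto simp: xx Lb_def indic_def fun_eq_iff split: if_splits)
    ultimately show "?K (unitv x) = unitv x" using khtp_homotopy[of F i m, where 'k = 'k] by (simp add: xx)
  qed
  finally show ?thesis by (simp add: lin_id)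
qed

text \<open>Linear quotients: each colon ideal of the earlier generators by \<open>v\<close> is generated by variables \<open>x_k\<close>.\<close>

inductive lq :: "nat \<Rightarrow> (nat \<Rightarrow> nat) set \<Rightarrow> bool" for n where
  lq_empty: "lq n {}"
| lq_insert: "lq n A \<Longrightarrow> v \<in> mons n \<Longrightarrow>
    (\<And>u. u \<in> A \<Longrightarrow> \<exists>k w. w \<in> A \<and> k < n \<and> v k < u k \<and> w \<le> v + var k) \<Longrightarrow> lq n (insert v A)"

lemma up_closed_gen: "up_closed n (gen_ideal n A)"
  unfolding up_closed_def gen_ideal_def
proof clarify
  fix m m' a assume "m \<in> mons n" "m' \<in> mons n" "a \<in> A" "a \<le> m"
  moreover have "m \<le> m + m'" by (simp add: le_fun_def)
  ultimately show "m + m' \<in> mons n \<and> (\<exists>a\<in>A. a \<le> m + m')" using order_trans by auto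
qed

text \<open>A regularity bound. The homology in question is Tor_q(S/J, K) in multidegree c; linear
  quotients on generators of degree at most D confine it to degrees below q + D, and q < |c| sets
  aside the class of 1. When v is added to J', the quotient J/J' is a copy of S modulo the variables
  in V, shifted by v, and contracting along a variable outside V removes the component of z
  there.\<close>

lemma lq_vanishing:
  fixes z :: "lbase \<Rightarrow>\<^sub>0 'k::field"
  assumes "lq n A" "\<And>u. u \<in> A \<Longrightarrow> mdeg n u \<le> D" "q + D \<le> mdeg n c" "q < mdeg n c"
    and "z \<in> SP (Lb n (gen_ideal n A) q c)" "lin kd z = 0"
  shows "\<exists>y\<in>SP (Lb n (gen_ideal n A) (Suc q) c). z = lin kd y"
  using assms(1,2,5,6)
proof (induction arbitrary: z rule: lq.induct)
  case lq_empty
  have g: "gen_ideal n {} = {}" by (simp add: gen_ideal_def)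
  obtain i where i: "i < n" "c i \<noteq> 0" using mdeg_pos[of n c] assms(4) by auto
  have "z = lin kd (lin (khtp1 i) z)"
    using khtp_homotopy_SP[where c = c and z = z and n = n and q = q and i = i] lq_empty i by (simp add: g)
  moreover have "lin (khtp1 i) z \<in> SP (Lb n {} (Suc q) c)"
    by (rule khtp_SP) (use lq_empty i g in auto)
  ultimately show ?case unfolding g by blast
next
  case (lq_insert A v)
  let ?J = "gen_ideal n (insert v A)" and ?J' = "gen_ideal n A"
  let ?P = "SP {((M, e), F). F \<subseteq> {..<n} \<and> (e \<longrightarrow> M \<in> ?J')} :: (lbase \<Rightarrow>\<^sub>0 'k) set"
  let ?L = "SP (Lb n ?J q c) :: (lbase \<Rightarrow>\<^sub>0 'k) set" and ?L' = "SP (Lb n ?J' q c) :: (lbase \<Rightarrow>\<^sub>0 'k) set"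
  define V where "V = {k. k < n \<and> (\<exists>w\<in>A. w \<le> v + var k)}"
  have v: "v \<in> mons n" by fact
  have colon: "v + m \<in> ?J' \<longleftrightarrow> (\<exists>k\<in>V. m k \<noteq> 0)" if m: "m \<in> mons n" for m
  proof
    assume "v + m \<in> ?J'"
    then obtain u where u: "u \<in> A" "u \<le> v + m" by (auto simp: gen_ideal_def)
    obtain k w where k: "w \<in> A" "k < n" "v k < u k" "w \<le> v + var k" using lq_insert(3)[OF u(1)] by blast
    have "u k \<le> v k + m k" using u(2) by (simp add: le_fun_def)
    then have "m k \<noteq> 0" using k(3) by linarith
    moreover have "k \<in> V" using k by (auto simp: V_def)
    ultimately show "\<exists>k\<in>V. m k \<noteq> 0" by blast
  next
    assume "\<exists>k\<in>V. m k \<noteq> 0"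
    then obtain k w where k: "w \<in> A" "w \<le> v + var k" "m k \<noteq> 0" by (auto simp: V_def)
    have "w j \<le> (v + m) j" for j
    proof -
      have "w j \<le> v j + var k j" using k(2) by (simp add: le_fun_def)
      also have "\<dots> \<le> v j + m j" using k(3) by (auto simp: var_def)
      finally show ?thesis by simp
    qed
    then show "v + m \<in> ?J'" using k(1) m v by (auto simp: gen_ideal_def le_fun_def)
  qed
  have J'J: "?J' \<subseteq> ?J" by (auto simp: gen_ideal_def)
  have top: "v \<le> M \<and> M \<in> mons n" if "M \<in> ?J" "M \<notin> ?J'" for M
    using that by (auto simp: gen_ideal_def)
  have LP: "p \<in> ?L'" if "p \<in> ?L" "p \<in> ?P" for p
    using that by (auto simp: SP_def Lb_def)
  show ?case
  proof (cases "z \<in> ?P")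
    case True
    then have "z \<in> ?L'" using LP lq_insert.prems by blast
    then obtain y where y: "y \<in> SP (Lb n ?J' (Suc q) c)" "z = lin kd y"
      using lq_insert.IH[of z] lq_insert.prems by auto
    have "Lb n ?J' (Suc q) c \<subseteq> Lb n ?J (Suc q) c" using J'J by (auto simp: Lb_def)
    then show ?thesis using y SP_mono by blast
  next
    case False
    then obtain M0 F0 where M0: "((M0, True), F0) \<in> keys z" "M0 \<notin> ?J'"
      using lq_insert.prems(2) by (force simp: SP_def Lb_def)
    have M0J: "((M0, True), F0) \<in> Lb n ?J q c" using M0 lq_insert.prems(2) by (auto simp: SP_def)
    then have F0: "F0 \<subseteq> {..<n}" "M0 + indic F0 = c" "q = Suc (card F0)" "M0 \<in> ?J" by (auto simp: Lb_def)
    have vM0: "v \<le> M0" "M0 \<in> mons n" using top[OF F0(4) M0(2)] by auto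
    have vM0e: "v + (M0 - v) = M0" using vM0 by (auto simp: fun_eq_iff le_fun_def)
    define c' where "c' = (M0 - v) + indic F0"
    have cc': "c = v + c'" using F0(2) vM0e by (simp add: c'_def add.assoc[symmetric])
    define q' where "q' = card F0"
    \<comment> \<open>zf extracts the component in \<sigma>J modulo \<sigma>J' and divides it by v.
      The result zeta lies in the Koszul complex of S and is a cycle modulo the variables in
      V.\<close>
    define zf :: "lbase \<Rightarrow> lbase \<Rightarrow>\<^sub>0 'k" where
      "zf = (\<lambda>x. if snd (fst x) \<and> fst (fst x) \<notin> ?J' then unitv ((fst (fst x) - v, False), snd x) else 0)"
    define zeta where "zeta = lin zf z"
    have zeta: "zeta \<in> SP (Lb n {} q' c')"
      unfolding zeta_def
    proof (rule lin_in_subspace[OF subspace_SP])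
      fix x assume "x \<in> keys z"
      then have x: "x \<in> Lb n ?J q c" using lq_insert.prems(2) by (auto simp: SP_def)
      obtain M e F where xx: "x = ((M, e), F)" by (metis prod.exhaust)
      have "((M - v, False), F) \<in> Lb n {} q' c'" if eM: "e" "M \<notin> ?J'"
      proof -
        have "v \<le> M" using top[of M] x eM by (auto simp: xx Lb_def)
        then have "v + (M - v) = M" by (auto simp: fun_eq_iff le_fun_def)
        then have "v + (M - v + indic F) = v + c'" using x cc' by (auto simp: xx Lb_def add.assoc[symmetric])
        then show ?thesis using x eM F0(3) by (auto simp: xx Lb_def q'_def)
      qed
      then show "zf x \<in> SP (Lb n {} q' c')"
        by (simp add: xx zf_def pm.subspace_0)
    qed
    let ?th = "lin (lact (v, True)) :: (_ \<Rightarrow>\<^sub>0 'k) \<Rightarrow> _"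
    have z': "z - ?th zeta \<in> ?P"
    proof -
      have "linear_pm (\<lambda>z. z - ?th (lin zf z))"
        by (rule linear_pmI) (auto simp: algebra_simps pm.scale_right_diff_distrib)
      from linear_eq_lin[OF this, of z] have "z - ?th zeta = lin (\<lambda>x. unitv x - ?th (zf x)) z"
        unfolding zeta_def by simp
      also have "\<dots> \<in> ?P"
      proof (rule lin_in_subspace[OF subspace_SP])
        fix x assume "x \<in> keys z"
        then have x: "x \<in> Lb n ?J q c" using lq_insert.prems(2) by (auto simp: SP_def)
        obtain M e F where xx: "x = ((M, e), F)" by (metis prod.exhaust)
        show "unitv x - ?th (zf x) \<in> ?P"
        proof (cases "e \<and> M \<notin> ?J'")
          case True
          then have "v \<le> M" using top[of M] x by (auto simp: xx Lb_def)
          then have "v + (M - v) = M" by (auto simp: fun_eq_iff le_fun_def)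
          then show ?thesis using True by (simp add: xx zf_def lact_def bprod_def pm.subspace_0)
        next
          case False
          then show ?thesis using x by (auto simp: xx zf_def Lb_def)
        qed
      qed
      finally show ?thesis .
    qed
    have actF: "lin (lact (v, False)) p \<in> ?P" if "p \<in> SP (Lb n {} r d)" for p :: "_ \<Rightarrow>\<^sub>0 'k" and r d
    proof (rule lin_in_subspace[OF subspace_SP])
      fix x assume "x \<in> keys p"
      then have "x \<in> Lb n {} r d" using that by (auto simp: SP_def)
      then show "lact (v, False) x \<in> ?P" by (auto simp: lact_def bprod_def Lb_def)
    qed
    have kdP: "lin kd p \<in> ?P" if p: "p \<in> ?P" for p
    proof (rule lin_in_subspace[OF subspace_SP])
      fix x assume "x \<in> keys p"
      then obtain M e F where xx: "x = ((M, e), F)" "F \<subseteq> {..<n}" "e \<longrightarrow> M \<in> ?J'" using p by (auto simp: SP_def)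
      have "(if e then unitv ((M, False), F) else 0) \<in> ?P" using xx by (simp add: pm.subspace_0)
      moreover have "kos (M, e) F \<in> ?P"
        unfolding kos_def
        by (intro pm.subspace_sum[OF subspace_SP] pm.subspace_scale[OF subspace_SP])
           (use xx up_closed_gen[of n A] in \<open>auto simp: up_closed_def\<close>)
      ultimately show "kd x \<in> ?P"
        unfolding xx kd_unit by (intro pm.subspace_add[OF subspace_SP] pm.subspace_scale[OF subspace_SP])
    qed
    have kdth: "lin kd (?th p) = lin (lact (v, False)) p - ?th (lin kd p)" for p
      using dgmodD(2)[OF dgmod_lact, of "(v, True)" p] by (simp add: sg_def)
    have "?th (lin kd zeta) = lin kd (z - ?th zeta) + lin (lact (v, False)) zeta"
      using lq_insert.prems by (simp add: kdth)
    also have "\<dots> \<in> ?P" by (intro pm.subspace_add[OF subspace_SP] kdP[OF z'] actF[OF zeta])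
    finally have thP: "?th (lin kd zeta) \<in> ?P" .
    let ?G = "{((m, e), F). \<not> e \<and> F \<subseteq> {..<n} \<and> m \<in> mons n \<and> v + m \<in> ?J'}"
    have kdz: "lin kd zeta \<in> SP ?G"
      unfolding SP_def
    proof clarify
      fix m e F assume k: "((m, e), F) \<in> keys (lin kd zeta)"
      have kL: "keys (lin kd zeta) \<subseteq> {((m, e), F). \<not> e \<and> F \<subseteq> {..<n} \<and> m \<in> mons n}"
      proof (cases q')
        case 0
        have "lin kd zeta = 0" by (rule kd_SP_0[of _ n "{}" c']) (use zeta 0 in simp)
        then show ?thesis by simp
      next
        case (Suc r)
        have "lin kd zeta \<in> SP (Lb n {} r c')" by (rule kd_SP) (use zeta Suc in \<open>auto simp: up_closed_def\<close>)
        then show ?thesis by (force simp: SP_def Lb_def)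
      qed
      then have e: "\<not> e" "F \<subseteq> {..<n}" "m \<in> mons n" using k by auto
      \<comment> \<open>Multiplication by \<sigma> v is injective on elements free of \<sigma>, so
        the terms of the differential of zeta can be read off after it.\<close>
      have "lookup (?th (lin kd zeta)) ((v + m, True), F) =
          (\<Sum>x\<in>keys (lin kd zeta). if x = ((m, e), F) then lookup (lin kd zeta) x else 0)"
        unfolding lin_def[of "lact (v, True)"] lookup_sum
      proof (rule sum.cong[OF refl])
        fix x assume "x \<in> keys (lin kd zeta)"
        then obtain m' F' where "x = ((m', False), F')" using kL by auto
        then show "lookup (scl (lookup (lin kd zeta) x) (lact (v, True) x)) ((v + m, True), F) =
            (if x = ((m, e), F) then lookup (lin kd zeta) x else 0)"
          using e by (auto simp: lact_def bprod_def lookup_unitv)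
      qed
      also have "\<dots> = lookup (lin kd zeta) ((m, e), F)" using k by simp
      finally have "((v + m, True), F) \<in> keys (?th (lin kd zeta))" using k by (simp add: in_keys_iff)
      then have "v + m \<in> ?J'" using thP by (auto simp: SP_def)
      then show "\<not> e \<and> F \<subseteq> {..<n} \<and> m \<in> mons n \<and> v + m \<in> ?J'" using e by simp
    qed
    define m0 where "m0 = M0 - v"
    have m0: "m0 \<in> mons n" "v + m0 = M0" using vM0 vM0e by (simp_all add: m0_def)
    \<comment> \<open>|F0| = q - 1, |v| \<le> D and q + D \<le> |c| leave |m0| \<ge> 1. A variable
      x_i of m0 lies outside V because v m0 is not in J'; contracting along it therefore preserves
      multiples of the variables in V.\<close>
    have "mdeg n v \<le> D" using lq_insert.prems(1) by simp
    moreover have "mdeg n c = mdeg n v + mdeg n m0 + card F0"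
      using mdeg_add[of n v m0] mdeg_add[of n M0 "indic F0"] m0 F0 by (simp add: mdeg_indic)
    ultimately have "mdeg n m0 \<noteq> 0" using F0(3) assms(3) by linarith
    then obtain i where i: "i < n" "m0 i \<noteq> 0" using mdeg_pos by blast
    have iV: "i \<notin> V" using colon[OF m0(1)] M0(2) m0(2) i(2) by auto
    have ci: "c' i \<noteq> 0" using i(2) by (simp add: c'_def m0_def)
    let ?h = "lin (khtp1 i) :: (_ \<Rightarrow>\<^sub>0 'k) \<Rightarrow> _"
    have hz: "zeta = lin kd (?h zeta) + ?h (lin kd zeta)"
      using khtp_homotopy_SP[where c = c' and i = i, OF zeta ci] by simp
    have hzL: "?h zeta \<in> SP (Lb n {} (Suc q') c')" by (rule khtp_SP[OF zeta i(1)])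
    have thh: "?th (?h (lin kd zeta)) \<in> ?P"
    proof -
      have hG: "?h (lin kd zeta) \<in> SP ?G"
      proof (rule lin_in_subspace[OF subspace_SP])
        fix x assume "x \<in> keys (lin kd zeta)"
        then have "x \<in> ?G" using kdz by (auto simp: SP_def)
        then obtain m F where x: "x = ((m, False), F)" "F \<subseteq> {..<n}" "m \<in> mons n" "v + m \<in> ?J'" by auto
        obtain k where k: "k \<in> V" "m k \<noteq> 0" using colon x by auto
        have "(m - var i) k \<noteq> 0" using k iV by (auto simp: var_def)
        then have "v + (m - var i) \<in> ?J'" using colon[of "m - var i"] x(3) k(1) by auto
        then show "khtp1 i x \<in> SP ?G" using x i(1) by (auto simp: khtp1_def pm.subspace_0 intro!: pm.subspace_scale)
      qed
      show ?thesis
      proof (rule lin_in_subspace[OF subspace_SP])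
        fix x assume "x \<in> keys (?h (lin kd zeta))"
        then have "x \<in> ?G" using hG by (auto simp: SP_def)
        then show "lact (v, True) x \<in> ?P" by (auto simp: lact_def bprod_def)
      qed
    qed
    let ?y0 = "?th (?h zeta)"
    have y0: "?y0 \<in> SP (Lb n ?J (Suc q) c)"
    proof (rule lin_in_subspace[OF subspace_SP])
      fix x assume "x \<in> keys (?h zeta)"
      then have "x \<in> Lb n {} (Suc q') c'" using hzL by (auto simp: SP_def)
      then obtain m F where x: "x = ((m, False), F)" "F \<subseteq> {..<n}" "m \<in> mons n" "card F = Suc q'" "m + indic F = c'"
        by (auto simp: Lb_def)
      have "v + m \<in> ?J" using v x(3) by (auto simp: gen_ideal_def le_fun_def)
      then show "lact (v, True) x \<in> SP (Lb n ?J (Suc q) c)"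
        using x v F0(3) cc' by (auto simp: lact_def bprod_def Lb_def q'_def add.assoc)
    qed
    \<comment> \<open>The differential of y0 is added, not subtracted, because d(\<sigma>v p) = v p
      - \<sigma>v dp; the term v p is free of \<sigma> and so lies in ?P.\<close>
    have eq: "z + lin kd ?y0 = (z - ?th zeta) + lin (lact (v, False)) (?h zeta) + ?th (?h (lin kd zeta))"
    proof -
      have "?th zeta = ?th (lin kd (?h zeta)) + ?th (?h (lin kd zeta))"
        by (subst hz) simp
      then show ?thesis by (simp add: kdth)
    qed
    have "z + lin kd ?y0 \<in> ?P"
      unfolding eq by (intro pm.subspace_add[OF subspace_SP] z' thh actF[OF hzL])
    moreover have "z + lin kd ?y0 \<in> ?L"
      by (intro pm.subspace_add[OF subspace_SP] lq_insert.prems(2) kd_SP[OF up_closed_gen y0])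
    ultimately have "z + lin kd ?y0 \<in> ?L'" by (rule LP[rotated])
    moreover have "lin kd (z + lin kd ?y0) = 0"
      using lq_insert.prems(3) dgmodD(3)[OF dgmod_lact] by simp
    ultimately obtain y1 where y1: "y1 \<in> SP (Lb n ?J' (Suc q) c)" "z + lin kd ?y0 = lin kd y1"
      using lq_insert.IH[of "z + lin kd ?y0"] lq_insert.prems(1) by auto
    have "Lb n ?J' (Suc q) c \<subseteq> Lb n ?J (Suc q) c" using J'J by (auto simp: Lb_def)
    then have "y1 \<in> SP (Lb n ?J (Suc q) c)" using y1(1) SP_mono by blast
    then have "y1 - ?y0 \<in> SP (Lb n ?J (Suc q) c)" using y0 by (intro pm.subspace_diff[OF subspace_SP])
    moreover have "z = lin kd (y1 - ?y0)" using y1(2) by (simp add: algebra_simps)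
    ultimately show ?thesis by blast
  qed
qed

section \<open>The bar complex with Koszul coefficients\<close>

context monomial_ideal
begin

abbreviation LL :: "nat \<Rightarrow> (nat \<Rightarrow> nat) \<Rightarrow> (lbase \<Rightarrow>\<^sub>0 'k::field) set" where
  "LL \<equiv> (\<lambda>q c. SP (Lb n I q c))"

abbreviation D :: "(letter list \<times> lbase \<Rightarrow>\<^sub>0 'k::field) \<Rightarrow> (letter list \<times> lbase \<Rightarrow>\<^sub>0 'k)" where
  "D \<equiv> bar lact kd"

lemma up_closed_I: "up_closed n I"
  using ideal_add by (auto simp: up_closed_def)

lemma letter_nonzero: "b \<in> Lt \<Longrightarrow> fst b \<noteq> 0"
  using zero_notin by (auto simp: letters_def split: if_splits)

lemma letter_mons: "b \<in> Lt \<Longrightarrow> fst b \<in> mons n"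
  by (auto simp: letters_def)

lemma lact_Lb:
  assumes b: "b \<in> Lt" and x: "x \<in> Lb n I q c"
  shows "lact b x \<in> SP (Lb n I (q + of_bool (snd b)) (fst b + c))"
proof -
  obtain m e F where xx: "x = ((m, e), F)" by (metis prod.exhaust)
  have "(bprod b (m, e), F) \<in> Lb n I (q + of_bool (snd b)) (fst b + c)" if "\<not> (snd b \<and> e)"
    using that x letter_mons[OF b] sigma_in_ideal[OF b] ideal_add
    by (auto simp: xx Lb_def bprod_def add.assoc)
  then show ?thesis by (auto simp: xx lact_def pm.subspace_0)
qed

lemma dgfam_LL: "dgfam Lt lact kd (LL :: _ \<Rightarrow> _ \<Rightarrow> (_ \<Rightarrow>\<^sub>0 'k::field) set)"
  unfolding dgfam_def
proof (intro conjI ballI allI)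
  show "lin (lact b) y \<in> LL (q + of_bool (snd b)) (fst b + c)"
    if b: "b \<in> Lt" and y: "y \<in> LL q c" for b q c and y :: "_ \<Rightarrow>\<^sub>0 'k"
  proof (rule lin_in_subspace[OF subspace_SP])
    fix x assume "x \<in> keys y"
    then have "x \<in> Lb n I q c" using y by (auto simp: SP_def)
    then show "lact b x \<in> LL (q + of_bool (snd b)) (fst b + c)" by (rule lact_Lb[OF b])
  qed
qed (auto intro: kd_SP[OF up_closed_I] kd_SP_0)

lemma cpx_D:
  assumes "dgfam Lt lact kd M" "\<And>q c. M q c \<subseteq> LL q c"
  shows "cpx (D :: (_ \<Rightarrow>\<^sub>0 'k::field) \<Rightarrow> _) (\<lambda>i. bspace Lt (Suc i) M i a)"
  by (rule cpx_bar[where Lb = "Lb n I", OF letters_closed assms(1) dgmod_lact assms(2) finite_Lb finite_letters_le])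

definition xb :: "nat \<Rightarrow> (nat \<Rightarrow> nat) \<Rightarrow> (letter list \<times> lbase) set" where
  "xb i a = {(w, ((m, e), F)). set w \<subseteq> Lt \<and> F \<subseteq> {..<n} \<and> m \<in> mons n \<and> (e \<longrightarrow> m \<in> I) \<and>
     wtw w + card F + of_bool e = i \<and> wdeg w + (m + indic F) = a}"

lemma bspace_LL: "bspace Lt (Suc i) LL i a = SP (xb i a)"
  unfolding bspace_SP by (rule arg_cong[where f = SP]) (auto simp: xb_def Lb_def)

text \<open>Moving the Koszul coefficient into the word contracts everything except the classes
  \<open>[] \<otimes> 1 \<otimes> e_F\<close>.\<close>

definition ncrit :: "(letter list \<times> lbase) set" where
  "ncrit = {(w, (b, F)). \<not> (w = [] \<and> b = (0, False))}"

fun gh1 :: "letter list \<Rightarrow> lbase \<Rightarrow> (letter list \<times> lbase \<Rightarrow>\<^sub>0 'k::field)" where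
  "gh1 [] l = (if fst l = (0, False) then 0 else scl (sg (fst l)) (unitv ([fst l], ((0, False), snd l))))"
| "gh1 (b # w) l = - scl (sg b) (cns b (gh1 w l))"

definition gh :: "(letter list \<times> lbase \<Rightarrow>\<^sub>0 'k::field) \<Rightarrow> (letter list \<times> lbase \<Rightarrow>\<^sub>0 'k)" where
  "gh = lin (\<lambda>(w, l). gh1 w l)"

lemma linear_gh [simp, intro]: "linear_pm gh"
  by (simp add: gh_def)

lemmas gh_simps [simp] = linear_pm_simps[OF linear_gh]

lemma gh_unitv: "gh (unitv (w, l)) = gh1 w l"
  by (simp add: gh_def)

lemma gh_cns:
  fixes y :: "letter list \<times> lbase \<Rightarrow>\<^sub>0 'k::field"
  shows "gh (cns b y) = - scl (sg b) (cns b (gh y))"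
proof (rule linear_eq_on_units[OF linear_pm_compose[OF linear_bar_ops(3) linear_gh]])
  show "linear_pm (\<lambda>y. - scl (sg b) (cns b (gh y)) :: letter list \<times> lbase \<Rightarrow>\<^sub>0 'k)"
    by (rule linear_pmI) (auto simp: pm.scale_right_distrib algebra_simps)
  show "gh (cns b (unitv x)) = - scl (sg b) (cns b (gh (unitv x :: _ \<Rightarrow>\<^sub>0 'k)))" for x
    by (cases x) (simp add: cns_unitv gh_unitv)
qed

lemma gh1_SP:
  assumes "(w, ((m, e), F)) \<in> xb i a"
  shows "(gh1 w ((m, e), F) :: _ \<Rightarrow>\<^sub>0 'k::field) \<in> SP {x \<in> xb (Suc i) a. fst x \<noteq> []}"
  using assms
proof (induction w arbitrary: i a)
  case Nil
  have "([(m, e)], ((0, False), F)) \<in> xb (Suc i) a" if "(m, e) \<noteq> (0, False)"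
    using Nil that by (auto simp: xb_def letters_def)
  then show ?case by (auto simp: pm.subspace_0 intro!: pm.subspace_scale)
next
  case (Cons b w)
  have b: "b \<in> Lt" using Cons.prems by (auto simp: xb_def)
  define j where "j = wtw w + card F + of_bool e"
  define c where "c = wdeg w + (m + indic F)"
  have ij: "i = Suc (of_bool (snd b)) + j" "a = fst b + c"
    using Cons.prems by (auto simp: xb_def j_def c_def add.assoc)
  have "(w, ((m, e), F)) \<in> xb j c" using Cons.prems by (auto simp: xb_def j_def c_def)
  from Cons.IH[OF this] have "cns b (gh1 w ((m, e), F) :: _ \<Rightarrow>\<^sub>0 'k) \<in> SP {x \<in> xb (Suc i) a. fst x \<noteq> []}"
  proof (rule cns_SP)
    fix w' l assume "(w', l) \<in> {x \<in> xb (Suc j) c. fst x \<noteq> []}"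
    then show "(b # w', l) \<in> {x \<in> xb (Suc i) a. fst x \<noteq> []}"
      using b ij by (auto simp: xb_def add.assoc)
  qed
  then show ?case
    unfolding gh1.simps by (intro pm.subspace_neg[OF subspace_SP] pm.subspace_scale[OF subspace_SP])
qed

definition low :: "nat \<Rightarrow> (letter list \<times> lbase \<Rightarrow>\<^sub>0 'k::field) set" where
  "low r = SP {(w, (b, F)). card F < r \<and> (w, (b, F)) \<in> ncrit}"

lemma subspace_low [simp]: "pm.subspace (low r)"
  by (simp add: low_def)

lemma cns_low:
  assumes "p \<in> low r" shows "cns b p \<in> low r"
  using assms unfolding low_def by (rule cns_SP) (auto simp: ncrit_def)

lemma ten_kos_low:
  assumes "finite F" "w \<noteq> []"
  shows "ten w (kos b F) \<in> low (card F)"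
  unfolding kos_def pp.linear_sum[OF linear_bar_ops(1)] pp.linear_scale[OF linear_bar_ops(1)] ten_unitv
proof (intro pm.subspace_sum[OF subspace_low] pm.subspace_scale[OF subspace_low])
  fix j assume "j \<in> F"
  then have "card (F - {j}) < card F" using assms by (intro card_Diff1_less)
  then show "unitv (w, (fst b + var j, snd b), F - {j}) \<in> low (card F)"
    using assms(2) by (simp add: low_def ncrit_def)
qed

lemma var_nonzero [simp]: "var j \<noteq> 0" "m + var j \<noteq> 0"
  by (auto simp: fun_eq_iff var_def)

lemma gh_ten_kos_low:
  assumes "finite F"
  shows "gh (ten [] (kos b F)) \<in> low (card F)"
  unfolding kos_def pp.linear_sum[OF linear_bar_ops(1)] pp.linear_scale[OF linear_bar_ops(1)] ten_unitv
    pp.linear_sum[OF linear_gh] pp.linear_scale[OF linear_gh] gh_unitv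
proof (intro pm.subspace_sum[OF subspace_low] pm.subspace_scale[OF subspace_low])
  fix j assume "j \<in> F"
  then have "card (F - {j}) < card F" using assms by (intro card_Diff1_less)
  then show "gh1 [] ((fst b + var j, snd b), F - {j}) \<in> low (card F)"
    by (simp add: low_def ncrit_def pm.subspace_scale)
qed

text \<open>With the exterior factor held fixed, moving the coefficient into the word is the usual
  contraction of a bar construction with free coefficients. Only the Koszul part of the differential
  disturbs it, and that part removes an element of F; the defect has fewer exterior factors, so the
  filtration \<open>low\<close> exhausts it.\<close>

lemma gh_homotopy:
  assumes "set w \<subseteq> Lt" "finite F" "e \<longrightarrow> m \<noteq> 0" "(w, ((m, e), F)) \<in> ncrit"
  shows "D (gh (unitv (w, ((m, e), F)))) + gh (D (unitv (w, ((m, e), F)))) - unitv (w, ((m, e), F)) \<in>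
    (low (card F) :: (_ \<Rightarrow>\<^sub>0 'k::field) set)"
  using assms
proof (induction w)
  case Nil
  let ?u1 = "unitv ([], ((0, False), F)) :: _ \<Rightarrow>\<^sub>0 'k" and ?u = "unitv ([], ((m, e), F)) :: _ \<Rightarrow>\<^sub>0 'k"
  let ?b = "(m, e)"
  have nb: "?b \<noteq> (0, False)" using Nil by (auto simp: ncrit_def)
  have grp: "A = X + (u - C) \<Longrightarrow> B = Y + Z \<Longrightarrow> A + B - u = (X + Y) + (Z - C)"
    for A B C X Y Z u :: "letter list \<times> lbase \<Rightarrow>\<^sub>0 'k"
    by (simp add: algebra_simps)
  have gu: "gh ?u = scl (sg ?b) (cns ?b ?u1)" using nb by (auto simp: gh_unitv cns_unitv)
  have mu: "bmul lact ?b ?u1 = ?u" by (simp add: bmul_unitv lact_def bprod_def ten_unitv)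
  have Du1: "D ?u1 = ten [] (kos (0, False) F)" by (simp add: bar_unitv kd_unit)
  have Du: "D ?u = (if e then unitv ([], ((m, False), F)) else 0) + scl (sg ?b) (ten [] (kos ?b F))"
    by (simp add: bar_unitv kd_unit sg_def ten_unitv)
  have c: "scl (sg ?b) (bdel ?b ?u1) + gh (if e then unitv ([], ((m, False), F)) else 0) = (0 :: _ \<Rightarrow>\<^sub>0 'k)"
    using Nil(3) by (auto simp: bdel_def sg_def gh_unitv cns_unitv)
  have "D (gh ?u) = scl (sg ?b) (bdel ?b ?u1) + (?u - cns ?b (ten [] (kos (0, False) F)))"
    unfolding gu by (simp add: bar_cns mu Du1 pm.scale_right_distrib sg_def)
  moreover have "gh (D ?u) = gh (if e then unitv ([], ((m, False), F)) else 0) + scl (sg ?b) (gh (ten [] (kos ?b F)))"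
    unfolding Du by simp
  ultimately have "D (gh ?u) + gh (D ?u) - ?u =
    (scl (sg ?b) (bdel ?b ?u1) + gh (if e then unitv ([], ((m, False), F)) else 0)) +
    (scl (sg ?b) (gh (ten [] (kos ?b F))) - cns ?b (ten [] (kos (0, False) F)))"
    by (rule grp)
  also have "\<dots> = scl (sg ?b) (gh (ten [] (kos ?b F))) - cns ?b (ten [] (kos (0, False) F))"
    unfolding c by simp
  also have "\<dots> \<in> low (card F)"
    unfolding cns_ten
    by (intro pm.subspace_diff[OF subspace_low] pm.subspace_scale[OF subspace_low] gh_ten_kos_low ten_kos_low Nil) simp
  finally show ?case .
next
  case (Cons b w)
  let ?y = "unitv (w, ((m, e), F)) :: _ \<Rightarrow>\<^sub>0 'k"
  have b: "b \<in> Lt" and w: "set w \<subseteq> Lt" using Cons.prems by auto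
  have Kc: "D (gh (cns b ?y)) + gh (D (cns b ?y)) - cns b ?y =
    cns b (D (gh ?y) + gh (D ?y) - ?y) + (scl (sg b) (gh (bmul lact b ?y)) - bmul lact b (gh ?y))"
    by (cases "snd b") (simp_all add: gh_cns bar_cns bdel_def sg_def algebra_simps)
  show ?case
  proof (cases "(w, ((m, e), F)) \<in> ncrit")
    case True
    have "scl (sg b) (gh (bmul lact b ?y)) - bmul lact b (gh ?y) = (0 :: _ \<Rightarrow>\<^sub>0 'k)"
    proof (cases w)
      case Nil
      have nb: "(m, e) \<noteq> (0, False)" using True Nil by (auto simp: ncrit_def)
      then show ?thesis
        by (cases "snd b"; cases e)
           (auto simp: Nil bmul_unitv lact_def ten_unitv gh_unitv sg_def bprod_def)
    next
      case (Cons b' w')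
      have y: "?y = cns b' (unitv (w', ((m, e), F)))" by (simp add: Cons cns_unitv)
      show ?thesis
        unfolding y by (cases "snd b"; cases "snd b'") (simp_all add: bmul_cns gh_cns sg_def bprod_def)
    qed
    then show ?thesis
      using cns_low[OF Cons.IH[OF w Cons.prems(2,3) True], of b] Kc by (simp add: cns_unitv)
  next
    case False
    \<comment> \<open>The word is the single letter b, with coefficient 1 times e_F.
      \<open>gh\<close> annihilates it, but the last face multiplies b into the coefficient, and
      \<open>gh\<close> moves it back: this recovers the term.\<close>
    then have wm: "w = []" "m = 0" "\<not> e" by (auto simp: ncrit_def)
    have "fst b \<noteq> 0" by (rule letter_nonzero[OF b])
    then have g: "scl (sg b) (gh (bmul lact b ?y)) = cns b ?y" "gh ?y = 0"
      using wm by (cases b; auto simp: bmul_unitv lact_def ten_unitv gh_unitv bprod_def cns_unitv sg_def)+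
    have "D ?y = ten [] (kos (0, False) F)" using wm by (simp add: bar_unitv kd_unit)
    then have "D (gh (cns b ?y)) + gh (D (cns b ?y)) - cns b ?y = cns b (gh (ten [] (kos (0, False) F)))"
      unfolding Kc using g by simp
    moreover have "cns b (gh (ten [] (kos (0, False) F))) \<in> (low (card F) :: (_ \<Rightarrow>\<^sub>0 'k) set)"
      by (intro cns_low gh_ten_kos_low Cons.prems)
    ultimately show ?thesis by (simp add: cns_unitv)
  qed
qed

lemma gh_xb:
  assumes "z \<in> SP (xb i a)"
  shows "gh z \<in> SP (xb (Suc i) a)" "gh z \<in> SP ncrit"
proof -
  have "gh z \<in> SP {x \<in> xb (Suc i) a. fst x \<noteq> []}"
    unfolding gh_def
  proof (rule lin_in_subspace[OF subspace_SP])
    fix x assume "x \<in> keys z"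
    then have x: "x \<in> xb i a" using assms by (auto simp: SP_def)
    obtain w m e F where xx: "x = (w, ((m, e), F))" by (metis prod.exhaust)
    show "(case x of (w, l) \<Rightarrow> gh1 w l) \<in> SP {x \<in> xb (Suc i) a. fst x \<noteq> []}"
      using gh1_SP x unfolding xx by auto
  qed
  moreover have "{x \<in> xb (Suc i) a. fst x \<noteq> []} \<subseteq> xb (Suc i) a" "{x \<in> xb (Suc i) a. fst x \<noteq> []} \<subseteq> ncrit"
    by (auto simp: ncrit_def)
  ultimately show "gh z \<in> SP (xb (Suc i) a)" "gh z \<in> SP ncrit" using SP_mono by blast+
qed

lemma D_xb: "z \<in> SP (xb (Suc i) a) \<Longrightarrow> D z \<in> SP (xb i a)"
  using cpxD(3)[OF cpx_D[OF dgfam_LL], of z i a] by (simp add: bspace_LL)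

lemma ncrit_acyclic:
  fixes z :: "_ \<Rightarrow>\<^sub>0 'k::field"
  assumes "z \<in> SP (xb i a)" "z \<in> low r" "D z = 0"
  shows "\<exists>y\<in>SP (xb (Suc i) a). y \<in> SP ncrit \<and> z = D y"
  using assms
proof (induction r arbitrary: z)
  case 0
  have "x \<notin> keys z" for x using 0(2) by (cases x) (auto simp: low_def SP_def)
  then have "keys z = {}" by blast
  then have "z = D 0" by simp
  then show ?case by (intro bexI[of _ 0] conjI pm.subspace_0[OF subspace_SP])
next
  case (Suc r)
  let ?K = "\<lambda>z :: _ \<Rightarrow>\<^sub>0 'k. D (gh z) + gh (D z) - z"
  have "linear_pm ?K" by (rule linear_pmI) (auto simp: algebra_simps pm.scale_right_distrib pm.scale_right_diff_distrib)
  then have "?K z = lin (\<lambda>x. ?K (unitv x)) z" by (rule linear_eq_lin)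
  also have "\<dots> \<in> low r"
  proof (rule lin_in_subspace[OF subspace_low])
    fix x assume x: "x \<in> keys z"
    obtain w m e F where xx: "x = (w, ((m, e), F))" by (metis prod.exhaust)
    have w: "x \<in> xb i a" "x \<in> ncrit" "card F < Suc r" using x Suc.prems(1,2) by (auto simp: xx low_def SP_def)
    then have w': "set w \<subseteq> Lt" "finite F" "e \<longrightarrow> m \<noteq> 0"
      using zero_notin finite_subset[of F "{..<n}"] by (auto simp: xx xb_def)
    have "low (card F) \<subseteq> (low r :: (_ \<Rightarrow>\<^sub>0 'k) set)" unfolding low_def by (rule SP_mono) (use w in auto)
    then show "?K (unitv x) \<in> low r"
      using gh_homotopy[OF w'] w(2) unfolding xx by blast
  qed
  finally have K: "?K z \<in> low r" .
  have Kz: "?K z = D (gh z) - z" using Suc.prems by simp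
  note hz = gh_xb[OF Suc.prems(1)]
  have "?K z \<in> SP (xb i a)"
    unfolding Kz by (intro pm.subspace_diff[OF subspace_SP] D_xb hz(1) Suc.prems(1))
  moreover have "D (?K z) = 0"
    using Suc.prems by (simp add: Kz bar_bar[OF dgmod_lact])
  ultimately obtain y where y: "y \<in> SP (xb (Suc i) a)" "y \<in> SP ncrit" "?K z = D y"
    using Suc.IH K by blast
  have "z = D (gh z - y)" using y Kz by (simp add: algebra_simps)
  moreover have "gh z - y \<in> SP (xb (Suc i) a)" "gh z - y \<in> SP ncrit"
    by (intro pm.subspace_diff[OF subspace_SP] hz y)+
  ultimately show ?case by blast
qed

lemma ncrit_acyclic':
  fixes z :: "_ \<Rightarrow>\<^sub>0 'k::field"
  assumes "z \<in> SP (xb i a)" "z \<in> SP ncrit" "D z = 0"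
  shows "\<exists>y\<in>SP (xb (Suc i) a). y \<in> SP ncrit \<and> z = D y"
proof (rule ncrit_acyclic[OF assms(1) _ assms(3)])
  show "z \<in> low (Suc n)"
    unfolding low_def SP_def
  proof clarify
    fix w m e F assume k: "(w, ((m, e), F)) \<in> keys z"
    then have "F \<subseteq> {..<n}" using assms(1) by (auto simp: SP_def xb_def)
    then have "card F \<le> n" using card_mono[of "{..<n}" F] by simp
    then show "card F < Suc n \<and> (w, (m, e), F) \<in> ncrit" using k assms(2) by (auto simp: SP_def)
  qed
qed

section \<open>Homology of the bar complex with coefficients in \<open>L\<close>\<close>

definition crit_proj :: "(letter list \<times> lbase \<Rightarrow>\<^sub>0 'k::field) \<Rightarrow> (nat set \<Rightarrow>\<^sub>0 'k)" where
  "crit_proj = lin (\<lambda>x. if x \<in> ncrit then 0 else unitv (snd (snd x)))"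

lemma linear_crit_proj [simp, intro]: "linear_pm crit_proj"
  by (simp add: crit_proj_def)

lemma crit_proj_ncrit: "z \<in> SP ncrit \<Longrightarrow> crit_proj z = 0"
  unfolding crit_proj_def
  by (rule trans[OF lin_cong[of z _ "\<lambda>_. 0"]]) (auto simp: SP_def)

lemma crit_proj_kernel:
  fixes z :: "_ \<Rightarrow>\<^sub>0 'k::field"
  assumes "crit_proj z = 0"
  shows "z \<in> SP ncrit"
proof -
  have "x \<in> ncrit" if x: "x \<in> keys z" for x
  proof (rule ccontr)
    assume nx: "x \<notin> ncrit"
    have "lookup (crit_proj z) (snd (snd x)) = (\<Sum>y\<in>keys z. if y = x then lookup z x else 0)"
      unfolding crit_proj_def lin_def lookup_sum
    proof (rule sum.cong[OF refl])
      fix y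
      show "lookup (scl (lookup z y) (if y \<in> ncrit then 0 else unitv (snd (snd y)))) (snd (snd x)) = (if y = x then lookup z x else 0)"
        using nx by (cases x; cases y) (auto simp: lookup_unitv ncrit_def)
    qed
    also have "\<dots> = lookup z x" using x by simp
    finally show False using assms x by (simp add: in_keys_iff)
  qed
  then show ?thesis by (auto simp: SP_def)
qed

text \<open>Minimality: a critical term would have to arise by multiplication with a letter or a
  variable, or from d(\<sigma> m) = m, and all of these produce non-constant monomials because 1 is
  not in I. Critical classes therefore carry no differential.\<close>

lemma D_ncrit:
  fixes z :: "_ \<Rightarrow>\<^sub>0 'k::field"
  assumes "z \<in> SP (xb i a)"
  shows "D z \<in> SP ncrit"
  unfolding bar_def
proof (rule lin_in_subspace[OF subspace_SP])
  fix x assume "x \<in> keys z"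
  then have x: "x \<in> xb i a" using assms by (auto simp: SP_def)
  obtain w m e F where xx: "x = (w, ((m, e), F))" by (metis prod.exhaust)
  have cn: "cns b p \<in> (SP ncrit :: (_ \<Rightarrow>\<^sub>0 'k) set)" for b p
    by (rule cns_SP[where A = UNIV]) (auto simp: SP_def ncrit_def)
  have "bar1 lact kd w ((m, e), F) \<in> (SP ncrit :: (_ \<Rightarrow>\<^sub>0 'k) set)"
  proof (cases w)
    case Nil
    have "e \<longrightarrow> m \<noteq> 0" using x zero_notin by (auto simp: xx xb_def)
    then show ?thesis
      by (auto simp: Nil kd_unit kos_def ten_unitv pp.linear_sum[OF linear_bar_ops(1)] ncrit_def pm.subspace_0
          intro!: pm.subspace_add[OF subspace_SP] pm.subspace_sum[OF subspace_SP] pm.subspace_scale[OF subspace_SP]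
            pm.subspace_diff[OF subspace_SP])
  next
    case (Cons b w')
    have "fst b \<noteq> 0" using x letter_nonzero[of b] by (auto simp: xx xb_def Cons)
    then have "bmul1 lact b w' ((m, e), F) \<in> (SP ncrit :: (_ \<Rightarrow>\<^sub>0 'k) set)"
      by (cases w') (auto simp: lact_def ten_unitv bprod_def ncrit_def pm.subspace_0)
    moreover have "bdel b (unitv (w', ((m, e), F))) \<in> (SP ncrit :: (_ \<Rightarrow>\<^sub>0 'k) set)"
      using cn by (simp add: bdel_def pm.subspace_0)
    ultimately show ?thesis
      unfolding Cons bar1.simps
      by (intro pm.subspace_add[OF subspace_SP] pm.subspace_diff[OF subspace_SP] pm.subspace_scale[OF subspace_SP] cn)
  qed
  then show "(case x of (w, l) \<Rightarrow> bar1 lact kd w l) \<in> (SP ncrit :: (_ \<Rightarrow>\<^sub>0 'k) set)" by (simp add: xx)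
qed

text \<open>\<open>L\<close> is free over the dg algebra with basis the e_F and reduces to the
  exterior algebra with zero differential. All homology sits where i is the total degree of a, that
  is, in excess zero.\<close>

lemma betti_LL:
  "betti (D :: (_ \<Rightarrow>\<^sub>0 'k::field) \<Rightarrow> _) (\<lambda>i. bspace Lt (Suc i) LL i a) i =
   card {F. F \<subseteq> {..<n} \<and> card F = i \<and> indic F = a}"
proof -
  let ?E = "\<lambda>i. SP {F. F \<subseteq> {..<n} \<and> card F = i \<and> indic F = a} :: (nat set \<Rightarrow>\<^sub>0 'k) set"
  let ?z = "lin (\<lambda>_. 0) :: (nat set \<Rightarrow>\<^sub>0 'k) \<Rightarrow> (nat set \<Rightarrow>\<^sub>0 'k)"
  have fin: "finite {F. F \<subseteq> {..<n} \<and> card F = i \<and> indic F = a}" for i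
    by (rule finite_subset[of _ "Pow {..<n}"]) auto
  have C: "cpx (D :: (_ \<Rightarrow>\<^sub>0 'k) \<Rightarrow> _) (\<lambda>i. SP (xb i a))"
    using cpx_D[OF dgfam_LL, of a] by (simp add: bspace_LL)
  have E: "cpx ?z ?E" by (auto simp: cpx_def fd_SP fin pm.subspace_0)
  have img: "crit_proj ` SP (xb i a) = ?E i" for i
  proof (rule subset_antisym)
    show "crit_proj ` SP (xb i a) \<subseteq> ?E i"
    proof clarify
      fix z :: "_ \<Rightarrow>\<^sub>0 'k" assume z: "z \<in> SP (xb i a)"
      show "crit_proj z \<in> ?E i"
        unfolding crit_proj_def
      proof (rule lin_in_subspace[OF subspace_SP])
        fix x assume "x \<in> keys z"
        then have "x \<in> xb i a" using z by (auto simp: SP_def)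
        then show "(if x \<in> ncrit then 0 else unitv (snd (snd x))) \<in> ?E i"
          by (auto simp: xb_def ncrit_def pm.subspace_0)
      qed
    qed
    have sub: "pm.subspace (crit_proj ` SP (xb i a) :: (_ \<Rightarrow>\<^sub>0 'k) set)"
      by (rule pp.linear_subspace_image[OF linear_crit_proj subspace_SP])
    show "?E i \<subseteq> crit_proj ` SP (xb i a)"
      unfolding SP_eq_span[of "{F. F \<subseteq> {..<n} \<and> card F = i \<and> indic F = a}"]
    proof (rule pm.span_minimal[OF _ sub], clarify)
      fix F assume "F \<subseteq> {..<n}" "i = card F" "a = indic F"
      then have "unitv ([], ((0, False), F)) \<in> (SP (xb (card F) (indic F)) :: (_ \<Rightarrow>\<^sub>0 'k) set)"
        by (simp add: xb_def)
      moreover have "crit_proj (unitv ([], ((0, False), F))) = (unitv F :: _ \<Rightarrow>\<^sub>0 'k)"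
        by (simp add: crit_proj_def ncrit_def)
      ultimately show "unitv F \<in> (crit_proj ` SP (xb (card F) (indic F)) :: (_ \<Rightarrow>\<^sub>0 'k) set)" by (metis image_eqI)
    qed
  qed
  have "betti (D :: (_ \<Rightarrow>\<^sub>0 'k) \<Rightarrow> _) (\<lambda>i. SP (xb i a)) i = betti ?z ?E i"
  proof (rule betti_surj_acyclic_kernel[OF C E linear_crit_proj img])
    show "crit_proj (D z) = ?z (crit_proj z)" if "z \<in> SP (xb i a)" for i and z :: "_ \<Rightarrow>\<^sub>0 'k"
      using crit_proj_ncrit[OF D_ncrit[OF that]] by simp
    show "\<exists>y\<in>SP (xb (Suc i) a). crit_proj y = 0 \<and> z = D y"
      if z: "z \<in> SP (xb i a)" "crit_proj z = 0" "D z = 0" for i and z :: "_ \<Rightarrow>\<^sub>0 'k"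
      using ncrit_acyclic'[OF z(1) crit_proj_kernel[OF z(2)] z(3)] crit_proj_ncrit by blast
  qed
  also have "betti ?z ?E i = card {F. F \<subseteq> {..<n} \<and> card F = i \<and> indic F = a}"
  proof -
  have "0 \<in> ?E (Suc i)" by (rule pm.subspace_0[OF subspace_SP])
  then have "boundaries ?z ?E i = {0}" by (force simp: boundaries_def)
  moreover have "cycles ?z ?E i = ?E i" by (simp add: cycles_def)
  ultimately show ?thesis
    using dim_SP[OF fin[of i], where 'k = 'k] by (simp add: betti_def dim_zero_space)
  qed
  finally show ?thesis by (simp add: bspace_LL)
qed

end

section \<open>Splitting the Koszul complex\<close>

lemma subspace_zero: "pm.subspace {0}"
  by (rule pm.subspaceI) auto

text \<open>P is Q + W for a complement W of Z + Q in L. If x + w lies in Z, then w lies in Z + Q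
  and so vanishes: P meets Z only inside Q, while P + Z is everything.\<close>

lemma complement_pair:
  assumes Z: "pm.subspace Z" "Z \<subseteq> L" and Q: "pm.subspace Q" "Q \<subseteq> L" and L: "pm.subspace L"
  shows "\<exists>P. pm.subspace P \<and> Q \<subseteq> P \<and> P \<subseteq> L \<and> (\<forall>p\<in>P. p \<in> Z \<longrightarrow> p \<in> Q) \<and>
    (\<forall>y\<in>L. \<exists>p\<in>P. \<exists>z\<in>Z. y = p + z)"
proof -
  define S where "S = {z + x |z x. z \<in> Z \<and> x \<in> Q}"
  have sS: "pm.subspace S" unfolding S_def by (rule pm.subspace_sums[OF Z(1) Q(1)])
  have SL: "S \<subseteq> L" using pm.subspace_add[OF L] Z(2) Q(2) by (auto simp: S_def)
  obtain W where W: "pm.subspace W" "W \<subseteq> L" "S \<inter> W = {0}" "\<And>y. y \<in> L \<Longrightarrow> \<exists>s\<in>S. \<exists>w\<in>W. y = s + w"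
    using complement_exists[OF sS L SL] by blast
  define P where "P = {x + w |x w. x \<in> Q \<and> w \<in> W}"
  have "pm.subspace P" unfolding P_def by (rule pm.subspace_sums[OF Q(1) W(1)])
  moreover have "Q \<subseteq> P"
  proof
    fix x assume "x \<in> Q"
    then have "x = x + 0 \<and> x \<in> Q \<and> 0 \<in> W" using pm.subspace_0[OF W(1)] by simp
    then show "x \<in> P" unfolding P_def by blast
  qed
  moreover have "P \<subseteq> L" using pm.subspace_add[OF L] W(2) Q(2) by (auto simp: P_def)
  moreover have "p \<in> Q" if p: "p \<in> P" "p \<in> Z" for p
  proof -
    obtain x w where xw: "x \<in> Q" "w \<in> W" "p = x + w" using p(1) unfolding P_def by blast
    have "w = p + - x" using xw(3) by simp
    then have "w \<in> S" unfolding S_def using p(2) pm.subspace_neg[OF Q(1) xw(1)] by blast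
    then have "w = 0" using W(3) xw(2) by blast
    then show ?thesis using xw by simp
  qed
  moreover have "\<exists>p\<in>P. \<exists>z\<in>Z. y = p + z" if y: "y \<in> L" for y
  proof -
    obtain s w where sw: "s \<in> S" "w \<in> W" "y = s + w" using W(4)[OF y] by blast
    then obtain z x where zx: "z \<in> Z" "x \<in> Q" "s = z + x" unfolding S_def by blast
    have "x + w \<in> P" unfolding P_def using zx sw by blast
    moreover have "y = (x + w) + z" using zx(3) sw(3) by (simp add: algebra_simps)
    ultimately show ?thesis using zx(1) by blast
  qed
  ultimately show ?thesis by blast
qed

lemma (in monomial_ideal) mingen_below: "m \<in> I \<Longrightarrow> \<exists>u\<in>mingens I. u \<le> m"
proof (induction "mdeg n m" arbitrary: m rule: less_induct)
  case less
  show ?case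
  proof (cases "m \<in> mingens I")
    case False
    then obtain v where v: "v \<in> I" "v \<le> m" "v \<noteq> m" using less.prems by (auto simp: mingens_def)
    then have "mdeg n v < mdeg n m" using less.prems by (intro mdeg_strict ideal_mons)
    then obtain u where "u \<in> mingens I" "u \<le> v" using less.hyps v(1) by blast
    then show ?thesis using v(2) order_trans by blast
  qed auto
qed

text \<open>What the homological part asks of square-freeness and of the power. \<open>deg2\<close>
  makes letters raise the excess, \<open>gens_lq\<close> yields exactness, and
  \<open>gens_deg\<close> bounds the degrees of homology, so that total dimensions are finite
  sums.\<close>

locale golod_ideal = monomial_ideal +
  assumes deg2: "\<And>m. m \<in> I \<Longrightarrow> 2 \<le> mdeg n m"
    and gens_lq: "\<And>D. lq n {u \<in> mingens I. mdeg n u \<le> D}"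
    and gens_deg: "\<And>u. u \<in> mingens I \<Longrightarrow> mdeg n u \<le> n"
begin

lemma nonminimal: "m \<in> I \<Longrightarrow> m' \<noteq> 0 \<Longrightarrow> m + m' \<notin> mingens I" "m \<in> I \<Longrightarrow> m' \<noteq> 0 \<Longrightarrow> m' + m \<notin> mingens I"
proof -
  assume m: "m \<in> I" "m' \<noteq> 0"
  have "m \<le> m + m'" "m \<noteq> m + m'" using m(2) by (auto simp: le_fun_def)
  then show "m + m' \<notin> mingens I" using m(1) unfolding mingens_def by blast
  then show "m' + m \<notin> mingens I" by (simp add: add.commute)
qed

lemma gen_mingens: "A \<subseteq> mingens I \<Longrightarrow> gen_ideal n A \<subseteq> I"
  using ideal_up by (auto simp: gen_ideal_def mingens_def)

definition QQ :: "nat \<Rightarrow> (nat \<Rightarrow> nat) \<Rightarrow> (lbase \<Rightarrow>\<^sub>0 'k::field) set" where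
  "QQ q c = SP {x \<in> Lb n I q c. snd (fst x) \<longrightarrow> fst (fst x) \<notin> mingens I}"

lemma subspace_QQ [simp]: "pm.subspace (QQ q c)"
  by (simp add: QQ_def)

lemma QQ_LL: "QQ q c \<subseteq> LL q c"
  unfolding QQ_def by (rule SP_mono) auto

lemma mdeg_Lb: "((m, e), F) \<in> Lb n J q c \<Longrightarrow> mdeg n c = mdeg n m + card F"
  by (auto simp: Lb_def mdeg_indic)

text \<open>The Koszul part multiplies by a variable, so no boundary has a minimal generator under
  \<sigma>.\<close>

lemma kd_QQ:
  assumes z: "(z :: _ \<Rightarrow>\<^sub>0 'k::field) \<in> LL (Suc q) c"
  shows "lin kd z \<in> QQ q c"
proof (rule lin_in_subspace[OF subspace_QQ])
  fix x assume "x \<in> keys z"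
  then have x: "x \<in> Lb n I (Suc q) c" using z by (auto simp: SP_def)
  obtain m e F where xx: "x = ((m, e), F)" by (metis prod.exhaust)
  have "(if e then unitv ((m, False), F) else 0) \<in> (QQ q c :: (_ \<Rightarrow>\<^sub>0 'k) set)"
    using x by (auto simp: xx Lb_def QQ_def pm.subspace_0)
  moreover have "kos (m, e) F \<in> (QQ q c :: (_ \<Rightarrow>\<^sub>0 'k) set)"
    unfolding kos_def
  proof (intro pm.subspace_sum[OF subspace_QQ] pm.subspace_scale[OF subspace_QQ])
    fix j assume j: "j \<in> F"
    have "e \<longrightarrow> m \<in> I" using x by (auto simp: xx Lb_def)
    then show "unitv ((fst (m, e) + var j, snd (m, e)), F - {j}) \<in> QQ q c"
      using kos_Lb[OF up_closed_I x[unfolded xx] j] nonminimal(1)[of m "var j"] by (simp add: QQ_def)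
  qed
  ultimately show "kd x \<in> (QQ q c :: (_ \<Rightarrow>\<^sub>0 'k) set)"
    unfolding xx kd_unit by (intro pm.subspace_add[OF subspace_QQ] pm.subspace_scale[OF subspace_QQ])
qed

text \<open>The excess of a basis element is |m|, less one for a \<sigma>; being positive, it forces
  m to be non-constant. Whichever factor carries \<sigma>, the product is then a proper multiple of
  an element of I.\<close>

lemma act_QQ:
  assumes b: "b \<in> Lt" and z: "(z :: _ \<Rightarrow>\<^sub>0 'k::field) \<in> LL q c" and q: "q < mdeg n c"
  shows "lin (lact b) z \<in> QQ (q + of_bool (snd b)) (fst b + c)"
proof (rule lin_in_subspace[OF subspace_QQ])
  fix x assume "x \<in> keys z"
  then have x: "x \<in> Lb n I q c" using z by (auto simp: SP_def)
  obtain m e F where xx: "x = ((m, e), F)" by (metis prod.exhaust)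
  have L: "lact b x \<in> (LL (q + of_bool (snd b)) (fst b + c) :: (_ \<Rightarrow>\<^sub>0 'k) set)" by (rule lact_Lb[OF b x])
  show "lact b x \<in> (QQ (q + of_bool (snd b)) (fst b + c) :: (_ \<Rightarrow>\<^sub>0 'k) set)"
  proof (cases "snd b \<and> e")
    case True
    then show ?thesis by (simp add: xx lact_def pm.subspace_0)
  next
    case False
    have "fst b + m \<notin> mingens I" if "snd b \<or> e"
    proof (cases e)
      case True
      then show ?thesis using x letter_nonzero[OF b] nonminimal(2)[of m "fst b"] by (auto simp: xx Lb_def)
    next
      case ne: False
      then have "snd b" using that by simp
      moreover have "m \<noteq> 0" using mdeg_Lb[of m e F] x q ne by (auto simp: xx Lb_def)
      ultimately show ?thesis using sigma_in_ideal[OF b] nonminimal(1)[of "fst b" m] by simp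
    qed
    then show ?thesis using L False by (auto simp: xx lact_def QQ_def bprod_def)
  qed
qed

lemma QQ_exact:
  assumes z: "(z :: _ \<Rightarrow>\<^sub>0 'k::field) \<in> QQ q c" and "lin kd z = 0" and q: "q < mdeg n c"
  shows "\<exists>y\<in>LL (Suc q) c. z = lin kd y"
proof -
  \<comment> \<open>With the excess as degree bound, q + D \<le> |c| holds with equality: this is
    the largest truncation that \<open>lq_vanishing\<close> admits.\<close>
  define s where "s = mdeg n c - q"
  let ?A = "{u \<in> mingens I. mdeg n u \<le> s}"
  have "z \<in> SP (Lb n (gen_ideal n ?A) q c)"
    unfolding SP_def
  proof (intro CollectI subsetI)
    fix x assume "x \<in> keys z"
    then have x: "x \<in> Lb n I q c" "snd (fst x) \<longrightarrow> fst (fst x) \<notin> mingens I" using z by (auto simp: QQ_def SP_def)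
    obtain m e F where xx: "x = ((m, e), F)" by (metis prod.exhaust)
    have "m \<in> gen_ideal n ?A" if e
    proof -
      have m: "m \<in> I" "m \<in> mons n" "q = Suc (card F)" using x that by (auto simp: xx Lb_def)
      obtain u where u: "u \<in> mingens I" "u \<le> m" using mingen_below[OF m(1)] by blast
      have "u \<noteq> m" using u x that by (auto simp: xx)
      moreover have "u \<in> mons n" using u ideal_mons by (auto simp: mingens_def)
      ultimately have "mdeg n u < mdeg n m" using mdeg_strict u m by blast
      moreover have "mdeg n c = mdeg n m + card F" using x mdeg_Lb by (simp add: xx)
      ultimately have "mdeg n u \<le> s" using m(3) unfolding s_def by linarith
      then show ?thesis using u m by (auto simp: gen_ideal_def)
    qed
    then show "x \<in> Lb n (gen_ideal n ?A) q c" using x by (auto simp: xx Lb_def)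
  qed
  then obtain y where y: "y \<in> SP (Lb n (gen_ideal n ?A) (Suc q) c)" "z = lin kd y"
    using lq_vanishing[OF gens_lq[of s], of s q c z] assms by (auto simp: s_def)
  have "Lb n (gen_ideal n ?A) (Suc q) c \<subseteq> Lb n I (Suc q) c"
    using gen_mingens[of ?A] by (auto simp: Lb_def)
  then show ?thesis using y SP_mono by blast
qed

text \<open>The degree bound n from \<open>gens_deg\<close> makes the truncation all of I. The
  result confines homology in degree q to multidegrees of total degree below q + n, which yields
  finite total dimensions.\<close>

lemma high_degree_exact:
  assumes z: "(z :: _ \<Rightarrow>\<^sub>0 'k::field) \<in> LL q c" and "lin kd z = 0" and q: "q < mdeg n c" "q + n \<le> mdeg n c"
  shows "\<exists>y\<in>LL (Suc q) c. z = lin kd y"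
proof -
  let ?A = "{u \<in> mingens I. mdeg n u \<le> n}"
  have "I \<subseteq> gen_ideal n ?A"
    using mingen_below gens_deg ideal_mons by (fastforce simp: gen_ideal_def)
  moreover have "gen_ideal n ?A \<subseteq> I" by (rule gen_mingens) auto
  ultimately have "gen_ideal n ?A = I" by (rule subset_antisym[rotated])
  then show ?thesis
    using lq_vanishing[OF gens_lq[of n], of n q c z] assms by auto
qed

text \<open>In the strand of excess one the space \<open>P\<close> must not contain cycles: there are no elements of \<open>P\<close> in
  excess zero that could bound them. The condition on \<open>Q\<close> is only available in larger excess, which
  suffices because every letter increases the excess.\<close>

definition split_props :: "nat \<Rightarrow> (nat \<Rightarrow> nat) \<Rightarrow> (lbase \<Rightarrow>\<^sub>0 'k::field) set \<Rightarrow> (lbase \<Rightarrow>\<^sub>0 'k) set \<Rightarrow> bool" where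
  "split_props q c P H \<longleftrightarrow> pm.subspace P \<and> pm.subspace H \<and> P \<subseteq> LL q c \<and> H \<subseteq> LL q c \<and>
     (\<forall>h\<in>H. lin kd h = 0) \<and>
     (\<forall>p\<in>P. lin kd p = 0 \<longrightarrow> p \<in> lin kd ` LL (Suc q) c) \<and>
     (\<forall>y\<in>LL q c. \<exists>p\<in>P. \<exists>z\<in>LL q c. lin kd z = 0 \<and> y = p + z) \<and>
     (\<forall>h\<in>H. h \<in> lin kd ` LL (Suc q) c \<longrightarrow> h = 0) \<and>
     (\<forall>z\<in>LL q c. lin kd z = 0 \<longrightarrow> (\<exists>h\<in>H. \<exists>l\<in>LL (Suc q) c. z = h + lin kd l)) \<and>
     (Suc q < mdeg n c \<longrightarrow> QQ q c \<subseteq> P) \<and>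
     (Suc q = mdeg n c \<longrightarrow> (\<forall>p\<in>P. lin kd p = 0 \<longrightarrow> p = 0))"

lemma split_exists:
  assumes q: "q < mdeg n c"
  shows "\<exists>PH. split_props q c (fst PH) (snd PH :: (lbase \<Rightarrow>\<^sub>0 'k::field) set)"
proof -
  let ?L = "LL q c :: (lbase \<Rightarrow>\<^sub>0 'k) set" and ?B = "lin kd ` (LL (Suc q) c) :: (lbase \<Rightarrow>\<^sub>0 'k) set"
  let ?Z = "{z \<in> ?L. lin kd z = 0}"
  have sZ: "pm.subspace ?Z" by (rule subspace_ker_on) auto
  have sB: "pm.subspace ?B" by (rule pp.linear_subspace_image) auto
  have BZ: "?B \<subseteq> ?Z" using kd_SP[OF up_closed_I] dgmodD(3)[OF dgmod_lact] by auto
  obtain H where H: "pm.subspace H" "H \<subseteq> ?Z" "?B \<inter> H = {0}" "\<And>z. z \<in> ?Z \<Longrightarrow> \<exists>b\<in>?B. \<exists>h\<in>H. z = b + h"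
    using complement_exists[OF sB sZ BZ] by blast
  have H5: "\<forall>h\<in>H. h \<in> ?B \<longrightarrow> h = 0" using H(3) by blast
  have H6: "\<forall>z\<in>?L. lin kd z = 0 \<longrightarrow> (\<exists>h\<in>H. \<exists>l\<in>LL (Suc q) c. z = h + lin kd l)"
  proof (intro ballI impI)
    fix z assume "z \<in> ?L" "lin kd z = 0"
    then obtain b h where bh: "b \<in> ?B" "h \<in> H" "z = b + h" using H(4)[of z] by blast
    then obtain l where "l \<in> LL (Suc q) c" "z = h + lin kd l" by (auto simp: add.commute)
    then show "\<exists>h\<in>H. \<exists>l\<in>LL (Suc q) c. z = h + lin kd l" using bh(2) by blast
  qed
  have ZL: "?Z \<subseteq> ?L" by blast
  \<comment> \<open>Taking zero in excess one makes P a complement of the cycles there.\<close>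
  define Q where "Q = (if Suc q = mdeg n c then {0} else QQ q c :: (lbase \<Rightarrow>\<^sub>0 'k) set)"
  have Q: "pm.subspace Q" "Q \<subseteq> ?L"
    using subspace_zero QQ_LL by (auto simp: Q_def pm.subspace_0)
  from complement_pair[OF sZ ZL Q subspace_SP] obtain P where P0: "pm.subspace P \<and> Q \<subseteq> P \<and> P \<subseteq> ?L \<and>
    (\<forall>p\<in>P. p \<in> ?Z \<longrightarrow> p \<in> Q) \<and> (\<forall>y\<in>?L. \<exists>p\<in>P. \<exists>z\<in>?Z. y = p + z)" ..
  note P = P0[THEN conjunct1] P0[THEN conjunct2, THEN conjunct1] P0[THEN conjunct2, THEN conjunct2, THEN conjunct1]
    P0[THEN conjunct2, THEN conjunct2, THEN conjunct2, THEN conjunct1]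
    P0[THEN conjunct2, THEN conjunct2, THEN conjunct2, THEN conjunct2]
  have P3: "\<forall>p\<in>P. lin kd p = 0 \<longrightarrow> p \<in> Q" using P(3,4) by blast
  have P3': "\<forall>p\<in>P. lin kd p = 0 \<longrightarrow> p \<in> ?B"
  proof (intro ballI impI)
    fix p assume p: "p \<in> P" "lin kd p = 0"
    show "p \<in> ?B"
    proof (cases "Suc q = mdeg n c")
      case True
      then have "p = 0" using p P3 by (simp add: Q_def)
      then show ?thesis using pm.subspace_0[OF sB] by simp
    next
      case False
      then have "p \<in> QQ q c" using p P3 by (simp add: Q_def)
      then show ?thesis using QQ_exact[OF _ p(2) q] by blast
    qed
  qed
  have P4: "\<forall>y\<in>?L. \<exists>p\<in>P. \<exists>z\<in>?L. lin kd z = 0 \<and> y = p + z"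
  proof
    fix y assume "y \<in> ?L"
    then obtain p z where "p \<in> P" "z \<in> ?Z" "y = p + z" using bspec[OF P(5), of y] by blast
    then show "\<exists>p\<in>P. \<exists>z\<in>?L. lin kd z = 0 \<and> y = p + z" by blast
  qed
  have P7: "Suc q < mdeg n c \<longrightarrow> QQ q c \<subseteq> P" using P(2) by (auto simp: Q_def)
  have P8: "Suc q = mdeg n c \<longrightarrow> (\<forall>p\<in>P. lin kd p = 0 \<longrightarrow> p = 0)" using P3 by (auto simp: Q_def)
  have "H \<subseteq> ?L" "\<forall>h\<in>H. lin kd h = 0" using H(2) by auto
  then have "split_props q c P H"
    unfolding split_props_def using P(1,3) P3' P4 P7 P8 H(1) H5 H6 by (intro conjI)
  then show ?thesis by (intro exI[of _ "(P, H)"]) simp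
qed

text \<open>The choice is made separately in each strand. Without positive excess \<open>L\<close>
  contains at most multiples of some e_F, and none of these is a nonzero cycle of the augmentation
  kernel, so nothing has to be split off.\<close>

definition PH :: "nat \<Rightarrow> (nat \<Rightarrow> nat) \<Rightarrow> (lbase \<Rightarrow>\<^sub>0 'k::field) set \<times> (lbase \<Rightarrow>\<^sub>0 'k) set" where
  "PH q c = (if q < mdeg n c then SOME PH. split_props q c (fst PH) (snd PH) else ({0}, {0}))"

definition PP :: "nat \<Rightarrow> (nat \<Rightarrow> nat) \<Rightarrow> (lbase \<Rightarrow>\<^sub>0 'k::field) set" where
  "PP q c = fst (PH q c)"

definition HH :: "nat \<Rightarrow> (nat \<Rightarrow> nat) \<Rightarrow> (lbase \<Rightarrow>\<^sub>0 'k::field) set" where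
  "HH q c = snd (PH q c)"

lemma PH_props:
  assumes "q < mdeg n c"
  shows "split_props q c (PP q c) (HH q c)"
  using someI_ex[OF split_exists[OF assms]] assms by (simp add: PP_def HH_def PH_def)

lemma PH_zero: "\<not> q < mdeg n c \<Longrightarrow> PP q c = {0}" "\<not> q < mdeg n c \<Longrightarrow> HH q c = {0}"
  by (simp_all add: PP_def HH_def PH_def)

lemma split_propsD:
  assumes "split_props q c P H"
  shows "pm.subspace P" "pm.subspace H" "P \<subseteq> LL q c" "H \<subseteq> LL q c" "\<forall>h\<in>H. lin kd h = 0"
    "\<forall>p\<in>P. lin kd p = 0 \<longrightarrow> p \<in> lin kd ` LL (Suc q) c"
    "\<forall>y\<in>LL q c. \<exists>p\<in>P. \<exists>z\<in>LL q c. lin kd z = 0 \<and> y = p + z"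
    "\<forall>h\<in>H. h \<in> lin kd ` LL (Suc q) c \<longrightarrow> h = 0"
    "\<forall>z\<in>LL q c. lin kd z = 0 \<longrightarrow> (\<exists>h\<in>H. \<exists>l\<in>LL (Suc q) c. z = h + lin kd l)"
    "Suc q < mdeg n c \<longrightarrow> QQ q c \<subseteq> P"
    "Suc q = mdeg n c \<longrightarrow> (\<forall>p\<in>P. lin kd p = 0 \<longrightarrow> p = 0)"
  using assms unfolding split_props_def by - (elim conjE, assumption)+

lemmas PH_D = split_propsD[OF PH_props]

lemma PH_subspace [simp]: "pm.subspace (PP q c)" "pm.subspace (HH q c)"
proof -
  show "pm.subspace (PP q c)"
  proof (cases "q < mdeg n c")
    case True
    then show ?thesis by (rule PH_D(1))
  next
    case False
    show ?thesis unfolding PH_zero(1)[OF False] by (rule subspace_zero)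
  qed
  show "pm.subspace (HH q c)"
  proof (cases "q < mdeg n c")
    case True
    then show ?thesis by (rule PH_D(2))
  next
    case False
    show ?thesis unfolding PH_zero(2)[OF False] by (rule subspace_zero)
  qed
qed

lemma PH_LL: "PP q c \<subseteq> LL q c" "HH q c \<subseteq> LL q c"
proof -
  show "PP q c \<subseteq> LL q c"
  proof (cases "q < mdeg n c")
    case True
    then show ?thesis by (rule PH_D(3))
  next
    case False
    show ?thesis unfolding PH_zero(1)[OF False] by (simp add: pm.subspace_0)
  qed
  show "HH q c \<subseteq> LL q c"
  proof (cases "q < mdeg n c")
    case True
    then show ?thesis by (rule PH_D(4))
  next
    case False
    show ?thesis unfolding PH_zero(2)[OF False] by (simp add: pm.subspace_0)
  qed
qed

lemma PP_0D: "\<not> q < mdeg n c \<Longrightarrow> y \<in> PP q c \<Longrightarrow> y = 0"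
  and HH_0D: "\<not> q < mdeg n c \<Longrightarrow> y \<in> HH q c \<Longrightarrow> y = 0"
  by (simp_all add: PH_zero)

lemma PP_in_LL: "y \<in> PP q c \<Longrightarrow> y \<in> LL q c" and HH_in_LL: "y \<in> HH q c \<Longrightarrow> y \<in> LL q c"
  by (erule subsetD[OF PH_LL(1)], erule subsetD[OF PH_LL(2)])

lemma HH_cycle:
  assumes h: "h \<in> HH q c"
  shows "lin kd h = 0"
proof (cases "q < mdeg n c")
  case True
  show ?thesis by (rule bspec[OF PH_D(5)[OF True] h])
next
  case False
  show ?thesis using h unfolding PH_zero(2)[OF False] by simp
qed

lemma PP_cycle: "q < mdeg n c \<Longrightarrow> p \<in> PP q c \<Longrightarrow> lin kd p = 0 \<Longrightarrow> p \<in> lin kd ` LL (Suc q) c"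
  by (rule PH_D(6)[rule_format])

lemma PP_cycle_1:
  assumes "Suc q = mdeg n c" "p \<in> PP q c" "lin kd p = 0"
  shows "p = 0"
proof -
  have "q < mdeg n c" using assms(1) by simp
  from PH_D(11)[OF this, rule_format, OF assms] show ?thesis .
qed

lemma QQ_PP:
  assumes "Suc q < mdeg n c"
  shows "QQ q c \<subseteq> PP q c"
proof -
  have "q < mdeg n c" using assms by simp
  from PH_D(10)[OF this, rule_format, OF assms] show ?thesis .
qed

lemma PP_span: "q < mdeg n c \<Longrightarrow> y \<in> LL q c \<Longrightarrow> \<exists>p\<in>PP q c. \<exists>z\<in>LL q c. lin kd z = 0 \<and> y = p + z"
  by (rule PH_D(7)[rule_format])

lemma HH_boundary:
  assumes "h \<in> HH q c" "h \<in> lin kd ` LL (Suc q) c"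
  shows "h = 0"
proof (cases "q < mdeg n c")
  case True
  show ?thesis by (rule PH_D(8)[OF True, rule_format, OF assms])
next
  case False
  then show ?thesis by (rule HH_0D[OF _ assms(1)])
qed

lemma HH_span: "q < mdeg n c \<Longrightarrow> z \<in> LL q c \<Longrightarrow> lin kd z = 0 \<Longrightarrow> \<exists>h\<in>HH q c. \<exists>l\<in>LL (Suc q) c. z = h + lin kd l"
  by (rule PH_D(9)[rule_format])

lemma PP_HH:
  assumes "p \<in> PP q c" "p \<in> HH q c"
  shows "p = 0"
proof (cases "q < mdeg n c")
  case True
  show ?thesis by (rule HH_boundary[OF assms(2) PP_cycle[OF True assms(1) HH_cycle[OF assms(2)]]])
next
  case False
  then show ?thesis by (rule PP_0D[OF _ assms(1)])
qed

text \<open>The absence of variables from I enters through \<sigma>: such a letter has weight two,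
  and its monomial has degree at least two. Consequently words have nonnegative excess, and the
  action of a letter strictly raises the excess.\<close>

lemma letter_deg: "b \<in> Lt \<Longrightarrow> Suc (of_bool (snd b)) \<le> mdeg n (fst b)"
proof -
  assume b: "b \<in> Lt"
  show ?thesis
  proof (cases "snd b")
    case True
    then show ?thesis using deg2[OF sigma_in_ideal[OF b]] by simp
  next
    case False
    then show ?thesis using mdeg_eq_0[OF letter_mons[OF b]] letter_nonzero[OF b] by (cases "mdeg n (fst b)") auto
  qed
qed

lemma wtw_le: "set w \<subseteq> Lt \<Longrightarrow> wtw w \<le> mdeg n (wdeg w)"
proof (induction w)
  case (Cons b w)
  then have "Suc (of_bool (snd b)) \<le> mdeg n (fst b)" "wtw w \<le> mdeg n (wdeg w)"
    using letter_deg[of b] by simp_all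
  moreover have "mdeg n (wdeg (b # w)) = mdeg n (fst b) + mdeg n (wdeg w)"
    by (simp only: wdeg.simps mdeg_add)
  moreover have "wtw (b # w) = Suc (of_bool (snd b)) + wtw w" by simp
  ultimately show ?case by linarith
qed simp

text \<open>From positive excess a letter, like the differential, leads to excess at least two,
  where \<open>QQ\<close> is contained in \<open>PP\<close>; the exceptional choice in excess one is
  never a target.\<close>

lemma act_PP:
  assumes "b \<in> Lt" "y \<in> LL q c" "q < mdeg n c"
  shows "lin (lact b) y \<in> PP (q + of_bool (snd b)) (fst b + c)"
proof -
  have "Suc (q + of_bool (snd b)) < mdeg n (fst b + c)"
    using letter_deg[OF assms(1)] assms(3) by simp
  then show ?thesis by (rule subsetD[OF QQ_PP act_QQ[OF assms]])
qed

lemma kd_PP: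
  assumes "y \<in> PP (Suc q) c"
  shows "lin kd y \<in> PP q c"
proof (cases "Suc q < mdeg n c")
  case True
  show ?thesis by (rule subsetD[OF QQ_PP[OF True] kd_QQ[OF PP_in_LL[OF assms]]])
next
  case False
  then have "y = 0" by (rule PP_0D[OF _ assms])
  then show ?thesis by (simp add: pm.subspace_0)
qed

lemma dgfam_PP: "dgfam Lt lact kd PP"
  unfolding dgfam_def
proof (intro conjI ballI allI)
  show "lin (lact b) y \<in> PP (q + of_bool (snd b)) (fst b + c)" if "b \<in> Lt" "y \<in> PP q c" for b q c y
  proof (cases "q < mdeg n c")
    case True
    then show ?thesis by (rule act_PP[OF that(1) PP_in_LL[OF that(2)]])
  next
    case False
    then have "y = 0" by (rule PP_0D[OF _ that(2)])
    then show ?thesis by (simp add: pm.subspace_0)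
  qed
  show "lin kd y = 0" if "y \<in> PP 0 c" for y c
    by (rule kd_SP_0[of y n I c]) (rule PP_in_LL[OF that])
qed (simp_all add: kd_PP)

section \<open>The submodule \<open>P + H\<close> and the augmentation kernel\<close>

definition NN :: "nat \<Rightarrow> (nat \<Rightarrow> nat) \<Rightarrow> (lbase \<Rightarrow>\<^sub>0 'k::field) set" where
  "NN q c = {p + h |p h. p \<in> PP q c \<and> h \<in> HH q c}"

lemma subspace_NN [simp]: "pm.subspace (NN q c)"
  unfolding NN_def by (rule pm.subspace_sums) auto

lemma NN_E:
  assumes "y \<in> NN q c"
  obtains p h where "p \<in> PP q c" "h \<in> HH q c" "y = p + h"
  using assms by (auto simp: NN_def)

lemma NN_I: "p \<in> PP q c \<Longrightarrow> h \<in> HH q c \<Longrightarrow> p + h \<in> NN q c"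
  by (auto simp: NN_def)

lemma PP_NN: "p \<in> PP q c \<Longrightarrow> p \<in> NN q c" and HH_NN: "h \<in> HH q c \<Longrightarrow> h \<in> NN q c"
  using NN_I[of p q c 0] NN_I[of 0 q c h] by (auto simp: pm.subspace_0)

lemma NN_LL: "NN q c \<subseteq> LL q c"
proof
  fix y assume "y \<in> NN q c"
  then obtain p h where "p \<in> PP q c" "h \<in> HH q c" "y = p + h" by (rule NN_E)
  then show "y \<in> LL q c"
    using pm.subspace_add[OF subspace_SP subsetD[OF PH_LL(1)] subsetD[OF PH_LL(2)]] by simp
qed

lemma NN_in_LL: "y \<in> NN q c \<Longrightarrow> y \<in> LL q c"
  by (erule subsetD[OF NN_LL])

lemma NN_zero: "\<not> q < mdeg n c \<Longrightarrow> NN q c = {0}"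
  by (auto simp: NN_def PH_zero)

lemma NN_0D: "\<not> q < mdeg n c \<Longrightarrow> y \<in> NN q c \<Longrightarrow> y = 0"
  by (simp add: NN_zero)

lemma kd_NN:
  assumes "y \<in> NN (Suc q) c" shows "lin kd y \<in> PP q c"
  using assms by (rule NN_E) (simp add: HH_cycle kd_PP)

lemma act_NN:
  assumes "b \<in> Lt" "y \<in> NN q c"
  shows "lin (lact b) y \<in> PP (q + of_bool (snd b)) (fst b + c)"
proof (cases "q < mdeg n c")
  case True
  then show ?thesis by (rule act_PP[OF assms(1) NN_in_LL[OF assms(2)]])
next
  case False
  then have "y = 0" by (rule NN_0D[OF _ assms(2)])
  then show ?thesis by (simp add: pm.subspace_0)
qed

lemma dgfam_NN: "dgfam Lt lact kd NN"
  unfolding dgfam_def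
proof (intro conjI ballI allI)
  show "lin kd y = 0" if "y \<in> NN 0 c" for y c
    by (rule kd_SP_0[of y n I c]) (rule NN_in_LL[OF that])
qed (simp_all add: PP_NN kd_NN act_NN)

definition aug :: "lbase \<Rightarrow> (unit \<Rightarrow>\<^sub>0 'k::field)" where
  "aug x = (if x = ((0, False), {}) then unitv () else 0)"

definition Lp :: "nat \<Rightarrow> (nat \<Rightarrow> nat) \<Rightarrow> (lbase \<Rightarrow>\<^sub>0 'k::field) set" where
  "Lp q c = {y \<in> LL q c. lin aug y = 0}"

lemma aug_zero:
  assumes "(y :: _ \<Rightarrow>\<^sub>0 'k::field) \<in> LL q c" "q \<noteq> 0 \<or> c \<noteq> 0"
  shows "lin aug y = 0"
proof -
  have "lin aug y = lin (\<lambda>_. 0) y"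
  proof (rule lin_cong)
    fix x assume "x \<in> keys y"
    then have x: "x \<in> Lb n I q c" using assms by (auto simp: SP_def)
    have "indic {} = (0 :: nat \<Rightarrow> nat)" by (auto simp: indic_def fun_eq_iff)
    then have "x \<noteq> ((0, False), {})" using x assms(2) by (auto simp: Lb_def)
    then show "aug x = (0 :: _ \<Rightarrow>\<^sub>0 'k)" by (simp add: aug_def)
  qed
  then show ?thesis by simp
qed

lemma aug_kd:
  assumes "(y :: _ \<Rightarrow>\<^sub>0 'k::field) \<in> LL q c"
  shows "lin aug (lin kd y) = 0"
proof -
  have "lin aug (lin kd y) = lin (\<lambda>_. 0) y"
  proof (rule trans[OF linear_eq_lin[OF linear_pm_compose[OF linear_lin linear_lin]] lin_cong])
    fix x assume "x \<in> keys y"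
    then have x: "x \<in> Lb n I q c" using assms by (auto simp: SP_def)
    obtain m e F where xx: "x = ((m, e), F)" by (metis prod.exhaust)
    have "e \<longrightarrow> m \<noteq> 0" using x zero_notin by (auto simp: xx Lb_def)
    then show "lin aug (lin kd (unitv x)) = (0 :: _ \<Rightarrow>\<^sub>0 'k)"
      by (auto simp: xx kd_unit kos_def lin_sum aug_def)
  qed
  then show ?thesis by simp
qed

lemma NN_Lp: "(NN q c :: (_ \<Rightarrow>\<^sub>0 'a::field) set) \<subseteq> Lp q c"
proof
  fix y :: "_ \<Rightarrow>\<^sub>0 'a" assume y: "y \<in> NN q c"
  show "y \<in> Lp q c"
  proof (cases "q < mdeg n c")
    case True
    then have "c \<noteq> 0" by auto
    then show ?thesis using NN_in_LL[OF y] aug_zero[OF NN_in_LL[OF y]] unfolding Lp_def by blast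
  next
    case False
    then have "y = 0" by (rule NN_0D[OF _ y])
    then show ?thesis by (simp add: Lp_def pm.subspace_0)
  qed
qed

lemma dgfam_Lp: "dgfam Lt lact kd (Lp :: _ \<Rightarrow> _ \<Rightarrow> (_ \<Rightarrow>\<^sub>0 'k::field) set)"
  unfolding dgfam_def
proof (intro conjI ballI allI)
  show "pm.subspace (Lp q c :: (_ \<Rightarrow>\<^sub>0 'k) set)" for q c unfolding Lp_def by (rule subspace_ker_on) auto
  show "lin (lact b) y \<in> Lp (q + of_bool (snd b)) (fst b + c)"
    if b: "b \<in> Lt" and y: "y \<in> Lp q c" for b q c and y :: "_ \<Rightarrow>\<^sub>0 'k"
  proof -
    have "lin (lact b) y \<in> LL (q + of_bool (snd b)) (fst b + c)"
      by (rule dgfamD(2)[OF dgfam_LL b]) (use y in \<open>simp add: Lp_def\<close>)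
    moreover have "fst b + c \<noteq> 0" using letter_nonzero[OF b] by simp
    ultimately show ?thesis using aug_zero[of "lin (lact b) y"] unfolding Lp_def by blast
  qed
  show "lin kd y \<in> Lp q c" if "y \<in> Lp (Suc q) c" for q c and y :: "_ \<Rightarrow>\<^sub>0 'k"
    using that kd_SP[OF up_closed_I] aug_kd by (auto simp: Lp_def)
  show "lin kd y = 0" if "y \<in> Lp 0 c" for c and y :: "_ \<Rightarrow>\<^sub>0 'k"
    using that by (intro kd_SP_0[of y n I c]) (simp add: Lp_def)
qed

text \<open>The excess of a basis element is |m|, less one for a \<sigma>, and elements of I have
  degree at least two. Without positive excess only multiples of e_F remain, and the multidegree
  determines F.\<close>

lemma low_excess:
  assumes y: "(y :: _ \<Rightarrow>\<^sub>0 'k::field) \<in> LL q c" and q: "\<not> q < mdeg n c"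
  obtains "y = 0" | r F where "y = scl r (unitv ((0, False), F))" "F \<subseteq> {..<n}" "c = indic F" "q = card F"
proof -
  have k: "m = 0 \<and> \<not> e \<and> F \<subseteq> {..<n} \<and> c = indic F \<and> q = card F" if "((m, e), F) \<in> keys y" for m e F
  proof -
    have x: "((m, e), F) \<in> Lb n I q c" using y that by (auto simp: SP_def)
    have "mdeg n c = mdeg n m + card F" by (rule mdeg_Lb[OF x])
    moreover have "q = card F + of_bool e" and m: "m \<in> mons n" and e: "e \<longrightarrow> m \<in> I" using x by (auto simp: Lb_def)
    ultimately have d: "mdeg n m \<le> of_bool e" using q by linarith
    have ne: "\<not> e" using d deg2[of m] e by auto
    then have "mdeg n m = 0" using d by simp
    then have "m = 0" using mdeg_eq_0[OF m] by simp
    then show ?thesis using ne x by (auto simp: Lb_def)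
  qed
  show ?thesis
  proof (cases "y = 0")
    case True then show ?thesis by (rule that(1))
  next
    case False
    then obtain m e F where "((m, e), F) \<in> keys y" by (metis all_not_in_conv keys_eq_empty prod.exhaust)
    then have F: "((0, False), F) \<in> keys y" "F \<subseteq> {..<n}" "c = indic F" "q = card F" using k[of m e F] by auto
    have "x = ((0, False), F)" if "x \<in> keys y" for x
    proof -
      obtain m e G where xx: "x = ((m, e), G)" by (metis prod.exhaust)
      have "indic G = indic F" using k[of m e G] that F by (simp add: xx)
      then have "G = F" by (auto simp: indic_def fun_eq_iff split: if_splits)
      then show ?thesis using k[of m e G] that by (simp add: xx)
    qed
    then have "keys y = {((0, False), F)}" using F by blast
    then have "y = scl (lookup y ((0, False), F)) (unitv ((0, False), F))"
      using pm_expand[of y] by simp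
    then show ?thesis using F that(2) by blast
  qed
qed

lemma kos_top_nonzero:
  assumes "F \<noteq> {}" "finite F"
  shows "kos (0, False) F \<noteq> (0 :: _ \<Rightarrow>\<^sub>0 'k::field)"
proof
  assume z: "kos (0, False) F = (0 :: _ \<Rightarrow>\<^sub>0 'k)"
  obtain j where j: "j \<in> F" using assms by blast
  have v: "var k = var j \<longleftrightarrow> k = j" for k by (auto simp: var_def fun_eq_iff split: if_splits)
  have "lookup (kos (0, False) F :: _ \<Rightarrow>\<^sub>0 'k) ((var j, False), F - {j}) = (\<Sum>k\<in>F. if k = j then ksg F j else 0)"
    unfolding kos_def lookup_sum by (intro sum.cong refl) (auto simp: lookup_unitv v)
  also have "\<dots> = ksg F j" using j assms by simp
  finally show False using z by (simp add: ksg_def)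
qed

text \<open>In positive excess \<open>L\<close> is the sum of P and the cycles, and the cycles are H
  plus boundaries. In excess zero y is a multiple of some e_F with F nonempty, whose differential is
  nonzero but cannot lie in \<open>P + H\<close>; so y vanishes.\<close>

lemma Lp_NN_acyclic:
  fixes y :: "_ \<Rightarrow>\<^sub>0 'k::field"
  assumes y: "y \<in> Lp q c" and dy: "lin kd y \<in> NN (q - 1) c"
  shows "\<exists>x\<in>NN q c. \<exists>m\<in>Lp (Suc q) c. y = x + lin kd m"
proof (cases "q < mdeg n c")
  case True
  have "y \<in> LL q c" using y by (simp add: Lp_def)
  then obtain p z where pz: "p \<in> PP q c" "z \<in> LL q c" "lin kd z = 0" "y = p + z"
    using PP_span[OF True] by blast
  obtain h l where hl: "h \<in> HH q c" "l \<in> LL (Suc q) c" "z = h + lin kd l"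
    using HH_span[OF True pz(2,3)] by blast
  have "l \<in> Lp (Suc q) c" using hl(2) aug_zero[of l "Suc q" c] by (simp add: Lp_def)
  moreover have "y = (p + h) + lin kd l" using pz(4) hl(3) by (simp add: add.assoc)
  ultimately show ?thesis using NN_I[OF pz(1) hl(1)] by blast
next
  case False
  have "y \<in> LL q c" using y by (simp add: Lp_def)
  then have "y = 0"
  proof (rule low_excess[OF _ False])
    fix r F assume F: "y = scl r (unitv ((0, False), F))" "F \<subseteq> {..<n}" "c = indic F" "q = card F"
    have fF: "finite F" using F(2) finite_subset by blast
    show "y = 0"
    proof (cases "F = {}")
      case True
      have "lin aug y = scl r (unitv ())" using True by (simp add: F(1) aug_def)
      moreover have "lin aug y = 0" using y by (simp add: Lp_def)
      moreover have "(unitv () :: _ \<Rightarrow>\<^sub>0 'k) \<noteq> 0" by (metis keys_unitv keys_zero insert_not_empty)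
      ultimately have "r = 0" by simp
      then show ?thesis by (simp add: F(1))
    next
      case ne: False
      then obtain q' where q': "q = Suc q'" using ne F(4) fF by (metis card_0_eq not0_implies_Suc)
      have md: "Suc q' = mdeg n c" using F q' by (simp add: mdeg_indic)
      have "lin kd y \<in> NN q' c" using dy q' by simp
      then obtain p h where ph: "p \<in> PP q' c" "h \<in> HH q' c" "lin kd y = p + h" by (rule NN_E)
      have "lin kd (lin kd y) = 0" by (rule dgmodD(3)[OF dgmod_lact])
      then have "lin kd p = 0" using ph HH_cycle[OF ph(2)] by simp
      \<comment> \<open>The part of the differential in P is a cycle, and P has no nonzero cycles in
        excess one. The remaining part lies in H, is a boundary, and vanishes as well.\<close>
      then have "p = 0" by (rule PP_cycle_1[OF md ph(1)])
      then have "lin kd y \<in> HH q' c" using ph by simp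
      moreover have "lin kd y \<in> lin kd ` LL (Suc q') c" using y q' by (auto simp: Lp_def)
      ultimately have "lin kd y = 0" by (rule HH_boundary)
      then have "scl r (kos (0, False) F) = (0 :: _ \<Rightarrow>\<^sub>0 'k)" by (simp add: F(1) kd_unit)
      then have "r = 0" using kos_top_nonzero[OF ne fF, where 'k = 'k] by simp
      then show ?thesis by (simp add: F(1))
    qed
  qed
  moreover have "0 \<in> (NN q c :: (_ \<Rightarrow>\<^sub>0 'k) set)" "0 \<in> (Lp (Suc q) c :: (_ \<Rightarrow>\<^sub>0 'k) set)"
    by (simp_all add: pm.subspace_0 Lp_def)
  ultimately show ?thesis by (intro bexI[of _ 0]) simp_all
qed

text \<open>A cycle of P bounds in \<open>L\<close>; the bounding element may be replaced by its
  component in P, which differs from it by a cycle.\<close>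

lemma PP_acyclic:
  fixes y :: "_ \<Rightarrow>\<^sub>0 'k::field"
  assumes y: "y \<in> PP q c" and dy: "lin kd y \<in> {0}"
  shows "\<exists>x\<in>{0}. \<exists>m\<in>PP (Suc q) c. y = x + lin kd m"
proof (cases "Suc q < mdeg n c")
  case True
  then have q: "q < mdeg n c" by simp
  obtain l where l: "l \<in> LL (Suc q) c" "y = lin kd l" using PP_cycle[OF q y] dy by blast
  obtain p z where "p \<in> PP (Suc q) c" "lin kd z = 0" "l = p + z" using PP_span[OF True l(1)] by blast
  then show ?thesis using l(2) by auto
next
  case False
  have "y = 0"
  proof (cases "q < mdeg n c")
    case True
    then have "Suc q = mdeg n c" using False by simp
    then show ?thesis using PP_cycle_1[of q c y] y dy by simp
  next
    case False
    then show ?thesis by (rule PP_0D[OF _ y])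
  qed
  moreover have "0 \<in> (PP (Suc q) c :: (_ \<Rightarrow>\<^sub>0 'k) set)" by (simp add: pm.subspace_0)
  ultimately show ?thesis by (intro bexI[of _ 0]) simp_all
qed

end

section \<open>The recursion for Betti numbers\<close>

lemma sum_Sigma_Sigma:
  assumes "finite A" "finite B" "\<And>x y. finite (C x y)"
  shows "sum g (Sigma A (\<lambda>x. Sigma B (C x))) = (\<Sum>x\<in>A. \<Sum>y\<in>B. \<Sum>z\<in>C x y. g (x, y, z))"
proof -
  have "sum g (Sigma A (\<lambda>x. Sigma B (C x))) = (\<Sum>x\<in>A. \<Sum>p\<in>Sigma B (C x). g (x, p))"
    using assms by (subst sum.Sigma) (auto simp: finite_SigmaI)
  also have "\<dots> = (\<Sum>x\<in>A. \<Sum>y\<in>B. \<Sum>z\<in>C x y. g (x, y, z))"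
    using assms by (intro sum.cong refl) (subst sum.Sigma, auto)
  finally show ?thesis .
qed

text \<open>The projection along P is injective on H, and a basis of its image is numbered. The
  labels \<open>e j\<close> allow the coordinates of all strands to live disjointly in one space of
  finitely supported functions.\<close>

lemma coordinates_exist:
  fixes H P :: "('x \<Rightarrow>\<^sub>0 'k::field) set" and e :: "nat \<Rightarrow> 'y"
  assumes H: "fd H" and P: "pm.subspace P" and PH: "\<And>p. p \<in> P \<Longrightarrow> p \<in> H \<Longrightarrow> p = 0" and e: "inj e"
  shows "\<exists>\<kappa>. linear_pm \<kappa> \<and> (\<forall>p\<in>P. \<kappa> p = 0) \<and> \<kappa> ` H = SP (e ` {..<pm.dim H}) \<and> (\<forall>h\<in>H. \<kappa> h = 0 \<longrightarrow> h = 0)"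
proof -
  obtain f where f: "linear_pm f" "\<And>x. x - f x \<in> P" "\<And>x. x \<in> P \<Longrightarrow> f x = 0"
    using linear_projection_exists[OF P] by blast
  have fP: "f x = 0 \<longleftrightarrow> x \<in> P" for x using f(2)[of x] f(3)[of x] by auto
  have "{h \<in> H. f h = 0} = {0}"
    unfolding fP using PH pm.subspace_0[OF fd_subspace[OF H]] pm.subspace_0[OF P] by blast
  then have dim: "pm.dim (f ` H) = pm.dim H" using rank_nullity[OF f(1) H] dim_zero_space by simp
  obtain B where B: "finite B" "B \<subseteq> f ` H" "pm.independent B" "pm.span B = f ` H" "card B = pm.dim (f ` H)"
    using fd_basis[OF fd_image[OF f(1) H]] by blast
  obtain \<beta> where \<beta>: "bij_betw \<beta> B {..<pm.dim H}"
    using ex_bij_betw_finite_nat[OF B(1)] B(5) dim by (auto simp: lessThan_atLeast0)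
  obtain g where g: "linear_pm g" "\<forall>b\<in>B. g b = unitv (e (\<beta> b))"
    using pp.linear_independent_extend[OF B(3), of "\<lambda>b. unitv (e (\<beta> b))"] by blast
  have gB: "g ` B = unitv ` (e ` {..<pm.dim H})"
  proof -
    have "g ` B = (\<lambda>b. unitv (e (\<beta> b))) ` B" using g(2) by (intro image_cong) auto
    also have "\<dots> = unitv ` (e ` (\<beta> ` B))" by (simp add: image_image)
    also have "\<beta> ` B = {..<pm.dim H}" using \<beta> by (rule bij_betw_imp_surj_on)
    finally show ?thesis .
  qed
  define \<kappa> where "\<kappa> = (\<lambda>x. g (f x))"
  have k: "linear_pm \<kappa>" unfolding \<kappa>_def by (rule linear_pm_compose[OF f(1) g(1)])
  have "\<kappa> ` H = g ` (f ` H)" by (simp add: \<kappa>_def image_image)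
  also have "\<dots> = pm.span (g ` B)" unfolding B(4)[symmetric] by (rule pp.linear_span_image[OF g(1), symmetric])
  also have "\<dots> = SP (e ` {..<pm.dim H})" unfolding gB SP_eq_span ..
  finally have im: "\<kappa> ` H = SP (e ` {..<pm.dim H})" .
  have fK: "fd {h \<in> H. \<kappa> h = 0}"
    by (rule fd_subset[OF H subspace_ker_on[OF k fd_subspace[OF H]]]) auto
  have "pm.dim (\<kappa> ` H) = pm.dim H"
    unfolding im using e by (simp add: dim_SP card_image inj_on_subset)
  then have "pm.dim {h \<in> H. \<kappa> h = 0} = 0" using rank_nullity[OF k H] by simp
  then have "{h \<in> H. \<kappa> h = 0} \<subseteq> {0}"
    using fd_basis[OF fK] by (metis card_0_eq pm.span_empty subset_refl)
  moreover have "\<forall>p\<in>P. \<kappa> p = 0" using f(3) pp.linear_0[OF g(1)] by (simp add: \<kappa>_def)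
  ultimately show ?thesis using k im by blast
qed

context golod_ideal
begin

lemma cpx_LL: "cpx (lin kd) (\<lambda>q. LL q c :: (lbase \<Rightarrow>\<^sub>0 'k::field) set)"
  unfolding cpx_def
proof (intro conjI allI ballI)
  show "fd (LL q c :: (lbase \<Rightarrow>\<^sub>0 'k) set)" for q by (rule fd_SP[OF finite_Lb])
  show "lin kd z \<in> LL q c" if "z \<in> LL (Suc q) c" for q and z :: "lbase \<Rightarrow>\<^sub>0 'k"
    by (rule kd_SP[OF up_closed_I that])
  show "lin kd z = 0" if "z \<in> LL 0 c" for z :: "lbase \<Rightarrow>\<^sub>0 'k" by (rule kd_SP_0[OF that])
  show "lin kd (lin kd z) = 0" for z :: "lbase \<Rightarrow>\<^sub>0 'k" by (rule dgmodD(3)[OF dgmod_lact])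
qed simp

lemma fd_HH: "fd (HH q c :: (lbase \<Rightarrow>\<^sub>0 'k::field) set)"
  by (rule fd_subset[OF fd_SP[OF finite_Lb] PH_subspace(2) PH_LL(2)])

text \<open>H is a complement of the boundaries in the cycles. Without positive excess only
  multiples of e_F occur; for F nonempty these are no cycles unless zero, and the assumption on q
  and c excludes F empty.\<close>

lemma betti_LL_HH:
  assumes "q \<noteq> 0 \<or> c \<noteq> 0"
  shows "betti (lin kd) (\<lambda>q. LL q c :: (lbase \<Rightarrow>\<^sub>0 'k::field) set) q = pm.dim (HH q c :: (lbase \<Rightarrow>\<^sub>0 'k) set)"
proof (cases "q < mdeg n c")
  case True
  let ?C = "\<lambda>q. LL q c :: (lbase \<Rightarrow>\<^sub>0 'k) set"
  let ?B = "boundaries (lin kd) ?C q" and ?Z = "cycles (lin kd) ?C q"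
  have sB: "pm.subspace ?B" unfolding boundaries_def by (rule pp.linear_subspace_image) auto
  have BZ: "?B \<subseteq> ?Z"
    using kd_SP[OF up_closed_I] dgmodD(3)[OF dgmod_lact] by (auto simp: boundaries_def cycles_def)
  obtain f where f: "linear_pm f" "\<And>x. x - f x \<in> ?B" "\<And>x. x \<in> ?B \<Longrightarrow> f x = 0"
    using linear_projection_exists[OF sB] by blast
  have fZ: "fd ?Z" unfolding cycles_def
    by (rule fd_subset[OF fd_SP[OF finite_Lb] subspace_ker_on]) auto
  have fB: "f x = 0 \<longleftrightarrow> x \<in> ?B" for x using f(2)[of x] f(3)[of x] by auto
  have ker: "{z \<in> ?Z. f z = 0} = ?B" unfolding fB using BZ by blast
  have fH: "f ` ?Z = f ` (HH q c)"
  proof (intro subset_antisym image_subsetI)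
    fix z assume "z \<in> ?Z"
    then have "z \<in> LL q c" "lin kd z = 0" by (auto simp: cycles_def)
    then obtain h l where hl: "h \<in> HH q c" "l \<in> LL (Suc q) c" "z = h + lin kd l" using HH_span[OF True] by blast
    have "f z = f h" using f(3)[of "lin kd l"] hl by (simp add: boundaries_def pp.linear_add[OF f(1)])
    then show "f z \<in> f ` HH q c" using hl(1) by blast
  next
    fix h assume "h \<in> (HH q c :: (lbase \<Rightarrow>\<^sub>0 'k) set)"
    then have "h \<in> ?Z" unfolding cycles_def by (intro CollectI conjI HH_in_LL HH_cycle)
    then show "f h \<in> f ` ?Z" by (rule imageI)
  qed
  have "h = 0" if h: "h \<in> HH q c" "f h = 0" for h
  proof (rule HH_boundary[OF h(1)])
    show "h \<in> lin kd ` LL (Suc q) c" using f(2)[of h] h(2) by (simp add: boundaries_def)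
  qed
  then have "{h \<in> HH q c. f h = 0} \<subseteq> {0}" by blast
  moreover have "0 \<in> {h \<in> HH q c. f h = 0}" by (simp add: pm.subspace_0 pp.linear_0[OF f(1)])
  ultimately have k0: "{h \<in> HH q c. f h = 0} = {0}" by blast
  have "pm.dim (HH q c :: (lbase \<Rightarrow>\<^sub>0 'k) set) = pm.dim (f ` (HH q c))"
    using rank_nullity[OF f(1) fd_HH, of q c] unfolding k0 by (simp add: dim_zero_space)
  also have "\<dots> = pm.dim ?Z - pm.dim ?B"
    using rank_nullity[OF f(1) fZ] unfolding ker fH by simp
  finally show ?thesis by (simp add: betti_def)
next
  case False
  let ?C = "\<lambda>q. LL q c :: (lbase \<Rightarrow>\<^sub>0 'k) set"
  have "z = 0" if "z \<in> cycles (lin kd) ?C q" for z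
  proof -
    have z: "z \<in> LL q c" "lin kd z = 0" using that by (auto simp: cycles_def)
    show "z = 0"
    proof (rule low_excess[OF z(1) False])
      fix r F assume F: "z = scl r (unitv ((0, False), F))" "F \<subseteq> {..<n}" "c = indic F" "q = card F"
      have "indic {} = (0 :: nat \<Rightarrow> nat)" by (auto simp: indic_def fun_eq_iff)
      then have ne: "F \<noteq> {}" using assms F(3,4) by auto
      have fF: "finite F" using F(2) finite_subset by blast
      have "scl r (kos (0, False) F) = (0 :: _ \<Rightarrow>\<^sub>0 'k)" using z(2) by (simp add: F(1) kd_unit)
      then have "r = 0" using kos_top_nonzero[OF ne fF, where 'k = 'k] by simp
      then show "z = 0" by (simp add: F(1))
    qed
  qed
  then have "cycles (lin kd) ?C q \<subseteq> {0}" by blast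
  moreover have "0 \<in> cycles (lin kd) ?C q" by (simp add: cycles_def pm.subspace_0)
  ultimately have "cycles (lin kd) ?C q = {0}" by blast
  then show ?thesis unfolding betti_def PH_zero(2)[OF False] by (simp add: dim_zero_space)
qed

text \<open>In homological degree zero a strand of positive degree contains only multiples of x^c,
  which is the differential of (x^c / x_j) e_j.\<close>

lemma HH_0_zero: "h \<in> (HH 0 c :: (lbase \<Rightarrow>\<^sub>0 'k::field) set) \<Longrightarrow> h = 0"
proof (cases "0 < mdeg n c")
  case False
  assume "h \<in> (HH 0 c :: (lbase \<Rightarrow>\<^sub>0 'k) set)"
  then show ?thesis by (rule HH_0D[OF False])
next
  case True
  assume h: "h \<in> (HH 0 c :: (lbase \<Rightarrow>\<^sub>0 'k) set)"
  obtain j where j: "j < n" "c j \<noteq> 0" using mdeg_pos[of n c] True by auto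
  have vj: "c - var j + var j = c" using j(2) by (auto simp: var_def fun_eq_iff)
  have i0: "indic {} = (0 :: nat \<Rightarrow> nat)" by (auto simp: indic_def fun_eq_iff)
  have "h \<in> lin kd ` (LL (Suc 0) c)"
  proof (rule subsetD[OF _ HH_in_LL[OF h]], rule subsetI)
    fix y :: "lbase \<Rightarrow>\<^sub>0 'k" assume y: "y \<in> LL 0 c"
    show "y \<in> lin kd ` (LL (Suc 0) c)"
    proof (rule lin_in_subspace[of _ y unitv, unfolded lin_id])
      show "pm.subspace (lin kd ` (LL (Suc 0) c) :: (lbase \<Rightarrow>\<^sub>0 'k) set)"
        by (rule pp.linear_subspace_image) auto
      fix x assume "x \<in> keys y"
      then have x: "x \<in> Lb n I 0 c" using y by (auto simp: SP_def)
      obtain m e F where xx: "x = ((m, e), F)" by (metis prod.exhaust)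
      have F: "F \<subseteq> {..<n}" "card F = 0" "\<not> e" "m + indic F = c" "m \<in> mons n" using x by (auto simp: xx Lb_def)
      then have F0: "F = {}" using finite_subset[OF F(1)] by simp
      then have x': "x = ((c, False), {})" "c \<in> mons n" using F by (auto simp: xx i0)
      have ij: "indic {j} = var j" by (auto simp: indic_def var_def fun_eq_iff)
      have "((c - var j, False), {j}) \<in> Lb n I (Suc 0) c" using j x'(2) vj by (simp add: Lb_def ij)
      then have "unitv ((c - var j, False), {j}) \<in> (LL (Suc 0) c :: (lbase \<Rightarrow>\<^sub>0 'k) set)" by simp
      moreover have "lin kd (unitv ((c - var j, False), {j})) = (unitv x :: lbase \<Rightarrow>\<^sub>0 'k)"
      proof -
        have "{k \<in> {j}. k < j} = {}" by auto
        then have "ksg {j} j = (1 :: 'k)" unfolding ksg_def by (simp only: card.empty power_0)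
        then show ?thesis by (simp add: kd_unit kos_def x' vj del: plus_fun_apply)
      qed
      ultimately show "unitv x \<in> lin kd ` (LL (Suc 0) c :: (lbase \<Rightarrow>\<^sub>0 'k) set)" by (metis imageI)
    qed
  qed
  then show "h = 0" by (rule HH_boundary[OF h])
qed

lemma dim_HH_0: "pm.dim (HH 0 c :: (lbase \<Rightarrow>\<^sub>0 'k::field) set) = 0"
proof -
  have "(HH 0 c :: (lbase \<Rightarrow>\<^sub>0 'k) set) = {0}"
  proof (intro subset_antisym subsetI)
    fix h assume "h \<in> (HH 0 c :: (lbase \<Rightarrow>\<^sub>0 'k) set)"
    then have "h = 0" by (rule HH_0_zero)
    then show "h \<in> {0}" by simp
  qed (simp add: pm.subspace_0)
  then show ?thesis by (simp add: dim_zero_space)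
qed

lemma Lp_LL: "y \<in> Lp q c \<Longrightarrow> y \<in> LL q c"
  by (simp add: Lp_def)

lemma cpx_Lp: "cpx (D :: (_ \<Rightarrow>\<^sub>0 'k::field) \<Rightarrow> _) (\<lambda>i. bspace Lt (Suc i) Lp i a)"
  by (rule cpx_D[OF dgfam_Lp subsetI]) (rule Lp_LL)

lemma cpx_NN: "cpx (D :: (_ \<Rightarrow>\<^sub>0 'k::field) \<Rightarrow> _) (\<lambda>i. bspace Lt (Suc i) NN i a)"
  by (rule cpx_D[OF dgfam_NN NN_LL])

lemma betti_Lp_NN:
  "betti (D :: (_ \<Rightarrow>\<^sub>0 'k::field) \<Rightarrow> _) (\<lambda>i. bspace Lt (Suc i) NN i a) i =
   betti (D :: (_ \<Rightarrow>\<^sub>0 'k) \<Rightarrow> _) (\<lambda>i. bspace Lt (Suc i) Lp i a) i"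
proof (rule betti_sub_acyclic_quotient[OF cpx_Lp cpx_NN])
  show "bspace Lt (Suc i) NN i a \<subseteq> (bspace Lt (Suc i) Lp i a :: (_ \<Rightarrow>\<^sub>0 'k) set)" for i
    by (rule bspace_mono[OF order_refl NN_Lp])
  show "\<exists>x\<in>bspace Lt (Suc i) NN i a. \<exists>y\<in>bspace Lt (Suc (Suc i)) Lp (Suc i) a. z = x + D y"
    if "z \<in> bspace Lt (Suc i) Lp i a" "D z \<in> bspace Lt (Suc (i - 1)) NN (i - 1) a" for i and z :: "_ \<Rightarrow>\<^sub>0 'k"
    by (rule bspace_relative_acyclic[OF letters_closed dgfam_Lp dgfam_NN NN_Lp dgmod_lact Lp_NN_acyclic that])
qed

text \<open>Excess adds up: words have nonnegative excess by \<open>wtw_le\<close>, and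
  \<open>P + H\<close> lives in positive excess.\<close>

lemma bspace_NN_top:
  assumes "p \<in> bspace Lt T NN i a" "mdeg n a \<le> i"
  shows "p = (0 :: _ \<Rightarrow>\<^sub>0 'k::field)"
  using assms(1)
proof (induction rule: bspace_induct)
  case (ten w q c y)
  have "wtw w \<le> mdeg n (wdeg w)" using ten by (intro wtw_le)
  moreover have "mdeg n a = mdeg n (wdeg w) + mdeg n c" using ten by (simp only: mdeg_add)
  ultimately have "\<not> q < mdeg n c" using assms(2) ten by linarith
  then have "y = 0" using ten(5) by (rule NN_0D)
  then show ?case by simp
qed simp_all

lemma LL_trivial:
  assumes "c \<notin> mons n" shows "LL q c = {0}"
proof -
  have "Lb n I q c = {}" using Lb_mons assms by blast
  then show ?thesis by (simp add: SP_empty)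
qed

lemma dim_HH_mons: "pm.dim (HH q c :: (lbase \<Rightarrow>\<^sub>0 'k::field) set) \<noteq> 0 \<Longrightarrow> c \<in> mons n"
proof (rule ccontr)
  assume d: "pm.dim (HH q c :: (lbase \<Rightarrow>\<^sub>0 'k) set) \<noteq> 0" and c: "c \<notin> mons n"
  have "HH q c \<subseteq> ({0} :: (lbase \<Rightarrow>\<^sub>0 'k) set)" using PH_LL(2)[of q c] unfolding LL_trivial[OF c] .
  moreover have "0 \<in> (HH q c :: (lbase \<Rightarrow>\<^sub>0 'k) set)" by (simp add: pm.subspace_0)
  ultimately have "HH q c = ({0} :: (lbase \<Rightarrow>\<^sub>0 'k) set)" by (intro subset_antisym) simp_all
  then show False using d by (simp add: dim_zero_space)
qed

text \<open>Coordinates on H define a map from \<open>P + H\<close> that kills P, hence kills the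
  action and the differential. Its kernel P is acyclic, and so is the bar complex over it. What
  remains is the complex with trivial coefficients H, a sum of shifted copies of the complex
  computing Tor^R(K, K).\<close>

lemma betti_NN:
  "betti (D :: (_ \<Rightarrow>\<^sub>0 'k::field) \<Rightarrow> _) (\<lambda>i. bspace Lt (Suc i) NN i a) i =
   (\<Sum>q\<le>i. \<Sum>c\<in>{c \<in> mons n. c \<le> a}. pm.dim (HH q c :: (lbase \<Rightarrow>\<^sub>0 'k) set) * bar_betti TYPE('k) Lt (i - q) (a - c))"
proof -
  define dH where "dH = (\<lambda>q c. pm.dim (HH q c :: (lbase \<Rightarrow>\<^sub>0 'k) set))"
  define e where "e = (\<lambda>(q::nat) (c::nat \<Rightarrow> nat) (j::nat). (q, c, j))"
  have "\<exists>\<kappa>. linear_pm \<kappa> \<and> (\<forall>p\<in>PP q c. \<kappa> p = 0) \<and> \<kappa> ` (HH q c) = SP (e q c ` {..<dH q c}) \<and>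
     (\<forall>h\<in>HH q c. \<kappa> h = 0 \<longrightarrow> h = (0 :: lbase \<Rightarrow>\<^sub>0 'k))" for q c
    unfolding dH_def
    by (rule coordinates_exist[OF fd_HH PH_subspace(1) PP_HH]) (auto simp: e_def inj_on_def)
  then obtain \<kappa> where \<kappa>': "\<forall>q c. linear_pm (\<kappa> q c) \<and> (\<forall>p\<in>PP q c. \<kappa> q c p = 0) \<and>
     \<kappa> q c ` (HH q c) = SP (e q c ` {..<dH q c}) \<and> (\<forall>h\<in>HH q c. \<kappa> q c h = 0 \<longrightarrow> h = (0 :: lbase \<Rightarrow>\<^sub>0 'k))"
    by metis
  have k1: "linear_pm (\<kappa> q c)" and k2: "p \<in> PP q c \<Longrightarrow> \<kappa> q c p = 0"
    and k3: "\<kappa> q c ` (HH q c) = SP (e q c ` {..<dH q c})"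
    and k4: "h \<in> HH q c \<Longrightarrow> \<kappa> q c h = 0 \<Longrightarrow> h = 0" for q c p h
    using \<kappa>'[rule_format, of q c] by simp_all
  \<comment> \<open>The coordinate maps vary with the strand; since a basis element determines its
    strand, they combine to one map on basis elements.\<close>
  define kx where "kx = (\<lambda>x :: lbase. \<kappa> (card (snd x) + of_bool (snd (fst x))) (fst (fst x) + indic (snd x)) (unitv x))"
  have kx: "lin kx y = \<kappa> q c y" if "y \<in> LL q c" for q c y
    unfolding linear_eq_lin[OF k1[of q c], of y]
  proof (rule lin_cong)
    fix x assume "x \<in> keys y"
    then have "x \<in> Lb n I q c" using that by (auto simp: SP_def)
    then have "card (snd x) + of_bool (snd (fst x)) = q" "fst (fst x) + indic (snd x) = c" unfolding Lb_def by auto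
    then show "kx x = \<kappa> q c (unitv x)" unfolding kx_def by (simp only:)
  qed
  have kPP: "lin kx p = 0" if "p \<in> PP q c" for p q c
    unfolding kx[OF PP_in_LL[OF that]] by (rule k2[OF that])
  define HX where "HX = {x :: nat \<times> (nat \<Rightarrow> nat) \<times> nat. snd (snd x) < dH (fst x) (fst (snd x))}"
  let ?hq = "fst :: nat \<times> (nat \<Rightarrow> nat) \<times> nat \<Rightarrow> nat" and ?hc = "\<lambda>x :: nat \<times> (nat \<Rightarrow> nat) \<times> nat. fst (snd x)"
  let ?G = "graded_fam ?hq ?hc HX :: _ \<Rightarrow> _ \<Rightarrow> (_ \<Rightarrow>\<^sub>0 'k) set"
  have G: "?G q c = SP (e q c ` {..<dH q c})" for q c
  proof -
    have "{h \<in> HX. ?hq h = q \<and> ?hc h = c} = e q c ` {..<dH q c}" by (force simp: HX_def e_def)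
    then show ?thesis by (simp add: graded_fam_def)
  qed
  have im: "lin kx ` NN q c = ?G q c" for q c
    unfolding G k3[symmetric]
  proof (intro subset_antisym image_subsetI)
    fix y :: "lbase \<Rightarrow>\<^sub>0 'k" assume "y \<in> NN q c"
    then obtain p h where ph: "p \<in> PP q c" "h \<in> HH q c" "y = p + h" by (rule NN_E)
    have "lin kx y = \<kappa> q c h" using kPP[OF ph(1)] kx[OF HH_in_LL[OF ph(2)]] by (simp add: ph(3))
    then show "lin kx y \<in> \<kappa> q c ` HH q c" using ph(2) by simp
  next
    fix h :: "lbase \<Rightarrow>\<^sub>0 'k" assume h: "h \<in> HH q c"
    have "lin kx h = \<kappa> q c h" by (rule kx[OF HH_in_LL[OF h]])
    then show "\<kappa> q c h \<in> lin kx ` NN q c" using HH_NN[OF h] by (metis imageI)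
  qed
  have ker: "{y \<in> NN q c. lin kx y = 0} = PP q c" for q c
  proof (intro subset_antisym subsetI)
    fix y assume "y \<in> {y \<in> NN q c. lin kx y = 0}"
    then have y: "y \<in> NN q c" "lin kx y = 0" by simp_all
    obtain p h where ph: "p \<in> PP q c" "h \<in> HH q c" "y = p + h" using y(1) by (rule NN_E)
    have "\<kappa> q c h = 0" using y(2) kPP[OF ph(1)] kx[OF HH_in_LL[OF ph(2)]] by (simp add: ph(3))
    then have "h = 0" by (rule k4[OF ph(2)])
    then show "y \<in> PP q c" using ph by simp
  next
    fix y :: "lbase \<Rightarrow>\<^sub>0 'k" assume "y \<in> PP q c"
    then show "y \<in> {y \<in> NN q c. lin kx y = 0}" using PP_NN kPP by simp
  qed
  have sG: "pm.subspace (?G q c)" for q c unfolding G by simp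
  have surj: "bmap kx ` bspace Lt (Suc i) NN i a = bspace Lt (Suc i) ?G i a" for i
    by (rule bmap_image[OF im subspace_NN sG])
  have comm: "bmap kx (D z) = bar0 (bmap kx z)" if "z \<in> bspace Lt (Suc i) NN i a" for i z
  proof (rule bmap_bar[OF _ _ that])
    show "lin kx (lin (lact b) y) = lin (\<lambda>_. 0) (lin kx y)" if "b \<in> Lt" "y \<in> NN q c" for b q c y
      using kPP[OF act_NN[OF that]] by simp
    show "lin kx (lin kd y) = lin (\<lambda>_. 0) (lin kx y)" if y: "y \<in> NN q c" for q c y
    proof (cases q)
      case 0
      then have "lin kd y = 0" using dgfamD(4)[OF dgfam_NN] y by blast
      then show ?thesis by simp
    next
      case (Suc q')
      then show ?thesis using kPP[OF kd_NN[of y q' c]] y by simp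
    qed
  qed
  have lb: "linear_pm (bmap kx)" unfolding bmap_def by simp
  have l0: "linear_pm (bar0 :: (_ \<Rightarrow>\<^sub>0 'k) \<Rightarrow> _)" unfolding bar_def by simp
  have cG: "cpx bar0 (\<lambda>i. bspace Lt (Suc i) ?G i a)"
    by (rule cpx_image[OF cpx_NN[of a] l0 lb]) (simp_all only: surj comm)
  have "betti (D :: (_ \<Rightarrow>\<^sub>0 'k) \<Rightarrow> _) (\<lambda>i. bspace Lt (Suc i) NN i a) i = betti bar0 (\<lambda>i. bspace Lt (Suc i) ?G i a) i"
  proof (rule betti_surj_acyclic_kernel[OF cpx_NN cG lb])
    show "bmap kx ` bspace Lt (Suc i) NN i a = bspace Lt (Suc i) ?G i a" for i by (rule surj)
    show "bmap kx (D z) = bar0 (bmap kx z)" if "z \<in> bspace Lt (Suc i) NN i a" for i z by (rule comm[OF that])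
    fix i z assume z: "z \<in> bspace Lt (Suc i) NN i a" "bmap kx z = 0" "D z = 0"
    have "z \<in> {z \<in> bspace Lt (Suc i) NN i a. bmap kx z = 0}" using z by simp
    then have z': "z \<in> bspace Lt (Suc i) PP i a" unfolding bmap_kernel[OF subspace_NN] ker .
    have A0: "dgfam Lt lact kd (\<lambda>_ _. {0})" unfolding dgfam_def by (simp add: subspace_zero)
    have "\<exists>x\<in>bspace Lt (Suc i) (\<lambda>_ _. {0}) i a. \<exists>y\<in>bspace Lt (Suc (Suc i)) PP (Suc i) a. z = x + D y"
    proof (rule bspace_relative_acyclic[OF letters_closed dgfam_PP A0 _ dgmod_lact PP_acyclic z'])
      show "{0} \<subseteq> (PP q c :: (lbase \<Rightarrow>\<^sub>0 'k) set)" for q c by (simp add: pm.subspace_0)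
      show "D z \<in> bspace Lt (Suc (i - 1)) (\<lambda>_ _. {0}) (i - 1) a"
        unfolding z(3) by (rule pm.subspace_0[OF subspace_bspace[OF subspace_zero]])
    qed
    then obtain x y where xy: "x \<in> bspace Lt (Suc i) (\<lambda>_ _. {0}) i a" "y \<in> bspace Lt (Suc (Suc i)) PP (Suc i) a" "z = x + D y"
      by blast
    have "x = 0" using xy(1) by (induction rule: bspace_induct) simp_all
    then have "z = D y" using xy(3) by simp
    moreover have "y \<in> {y \<in> bspace Lt (Suc (Suc i)) NN (Suc i) a. bmap kx y = 0}"
      unfolding bmap_kernel[OF subspace_NN] ker by (rule xy(2))
    ultimately show "\<exists>y\<in>bspace Lt (Suc (Suc i)) NN (Suc i) a. bmap kx y = 0 \<and> z = D y" by blast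
  qed
  also
  \<comment> \<open>HX collects the labels of all strands and may be infinite, but at multidegree a
    and up to degree i + 1, which the boundaries in degree i require, only finitely many labels
    occur. Those with q = i + 1 contribute 0 in the end.\<close>
  let ?F = "Sigma {..Suc i} (\<lambda>q. Sigma {c \<in> mons n. c \<le> a} (\<lambda>c. {..<dH q c}))"
  have "\<dots> = betti bar0 (\<lambda>i. bspace Lt (Suc i) (graded_fam ?hq ?hc ?F :: _ \<Rightarrow> _ \<Rightarrow> (_ \<Rightarrow>\<^sub>0 'k) set) i a) i"
  proof -
    have "bspace Lt (Suc i') ?G i' a = bspace Lt (Suc i') (graded_fam ?hq ?hc ?F :: _ \<Rightarrow> _ \<Rightarrow> (_ \<Rightarrow>\<^sub>0 'k) set) i' a" if "i' \<le> Suc i" for i'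
    proof -
      have eq: "h \<in> HX \<longleftrightarrow> h \<in> ?F" if "i' = wtw w + ?hq h" "a = wdeg w + ?hc h" for w h
      proof -
        have "?hc h \<le> a" unfolding that(2) by (simp add: le_fun_def)
        moreover have "?hq h \<le> Suc i" using that(1) \<open>i' \<le> Suc i\<close> by simp
        moreover have "?hc h \<in> mons n" if "h \<in> HX"
          using that dim_HH_mons[of "?hq h" "?hc h", where 'k = 'k] by (auto simp: HX_def dH_def)
        ultimately show ?thesis by (cases h) (auto simp: HX_def)
      qed
      have "{(w, l). set w \<subseteq> Lt \<and> (\<exists>q c. i' = wtw w + q \<and> a = wdeg w + c \<and> l \<in> {h \<in> HX. ?hq h = q \<and> ?hc h = c})} =
        {(w, l). set w \<subseteq> Lt \<and> (\<exists>q c. i' = wtw w + q \<and> a = wdeg w + c \<and> l \<in> {h \<in> ?F. ?hq h = q \<and> ?hc h = c})}"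
        using eq by blast
      then show ?thesis unfolding graded_fam_def bspace_SP by (rule arg_cong)
    qed
    then show ?thesis unfolding betti_def cycles_def boundaries_def by simp
  qed
  also have "\<dots> = (\<Sum>h\<in>?F. if ?hq h \<le> i \<and> ?hc h \<le> a then bar_betti TYPE('k) Lt (i - ?hq h) (a - ?hc h) else 0)"
    by (rule betti_graded_fam[THEN conjunct2, OF _ letters_closed finite_letters_le])
      (intro finite_SigmaI finite_mons_le finite_atMost finite_lessThan)
  also have "\<dots> = (\<Sum>q\<le>Suc i. \<Sum>c\<in>{c \<in> mons n. c \<le> a}. \<Sum>j<dH q c.
      if q \<le> i \<and> c \<le> a then bar_betti TYPE('k) Lt (i - q) (a - c) else 0)"
    by (subst sum_Sigma_Sigma) (simp_all add: finite_mons_le)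
  also have "\<dots> = (\<Sum>q\<le>i. \<Sum>c\<in>{c \<in> mons n. c \<le> a}. dH q c * bar_betti TYPE('k) Lt (i - q) (a - c))"
  proof -
    let ?C = "{c \<in> mons n. c \<le> a}" and ?b = "\<lambda>q c. bar_betti TYPE('k) Lt (i - q) (a - c)"
    have z: "(\<Sum>c\<in>?C. \<Sum>j<dH (Suc i) c. if Suc i \<le> i \<and> c \<le> a then ?b (Suc i) c else 0) = 0" by simp
    have t: "(\<Sum>c\<in>?C. \<Sum>j<dH q c. if q \<le> i \<and> c \<le> a then ?b q c else 0) = (\<Sum>c\<in>?C. dH q c * ?b q c)"
      if "q \<in> {..i}" for q
      by (rule sum.cong[OF refl]) (use that in simp)
    show ?thesis unfolding sum.atMost_Suc z add_0_right by (rule sum.cong[OF refl t])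
  qed
  finally show ?thesis unfolding dH_def .
qed

text \<open>The augmentation of \<open>L\<close> induces a surjection onto the complex with trivial
  coefficients, whose kernel is the bar complex of the augmentation kernel. The inclusion of this
  kernel is zero on homology, so \<open>betti_connecting\<close> applies, and
  \<open>betti_Lp_NN\<close> replaces the kernel by \<open>P + H\<close>.\<close>

lemma bar_betti_rec:
  "bar_betti TYPE('k::field) Lt 0 a = card {F. F \<subseteq> {..<n} \<and> card F = 0 \<and> indic F = a}" (is ?thesis1)
  "bar_betti TYPE('k) Lt (Suc i) a = card {F. F \<subseteq> {..<n} \<and> card F = Suc i \<and> indic F = a} +
    betti (D :: (_ \<Rightarrow>\<^sub>0 'k) \<Rightarrow> _) (\<lambda>i. bspace Lt (Suc i) NN i a) i" (is ?thesis2)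
proof -
  let ?C = "\<lambda>i. bspace Lt (Suc i) LL i a :: (_ \<Rightarrow>\<^sub>0 'k) set"
  let ?U = "\<lambda>i. bspace Lt (Suc i) (unit_fam 0 0 :: _ \<Rightarrow> _ \<Rightarrow> (unit \<Rightarrow>\<^sub>0 'k) set) i a"
  let ?f = "bmap aug :: (_ \<Rightarrow>\<^sub>0 'k) \<Rightarrow> _"
  have C: "cpx D ?C" by (rule cpx_D[OF dgfam_LL subset_refl])
  have U: "cpx bar0 ?U" by (rule cpx_unit_fam[OF letters_closed finite_letters_le])
  have i0: "indic {} = (0 :: nat \<Rightarrow> nat)" by (auto simp: indic_def fun_eq_iff)
  have im: "lin aug ` LL q c = (unit_fam 0 0 q c :: (unit \<Rightarrow>\<^sub>0 'k) set)" for q c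
  proof (cases "q = 0 \<and> c = 0")
    case True
    have "((0, False), {}) \<in> Lb n I 0 0" by (simp add: Lb_def i0 mons_def)
    then have u: "unitv ((0, False), {}) \<in> (LL 0 0 :: (_ \<Rightarrow>\<^sub>0 'k) set)" by simp
    have "y \<in> lin aug ` LL 0 0" for y :: "unit \<Rightarrow>\<^sub>0 'k"
    proof (rule image_eqI)
      show "scl (lookup y ()) (unitv ((0, False), {})) \<in> (LL 0 0 :: (_ \<Rightarrow>\<^sub>0 'k) set)"
        by (rule pm.subspace_scale[OF subspace_SP u])
      show "y = lin aug (scl (lookup y ()) (unitv ((0, False), {})))"
        by (rule poly_mapping_eqI) (simp add: aug_def lookup_unitv)
    qed
    then have "lin aug ` LL 0 0 = (UNIV :: (unit \<Rightarrow>\<^sub>0 'k) set)" by (intro UNIV_eq_I[symmetric])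
    moreover have "unit_fam 0 0 0 0 = (UNIV :: (unit \<Rightarrow>\<^sub>0 'k) set)" by (auto simp: unit_fam_def SP_def)
    ultimately show ?thesis using True by simp
  next
    case False
    then have "\<forall>y\<in>LL q c. lin aug y = (0 :: unit \<Rightarrow>\<^sub>0 'k)" using aug_zero[of _ q c, where 'k = 'k] by blast
    moreover have "0 \<in> (LL q c :: (_ \<Rightarrow>\<^sub>0 'k) set)" by (simp add: pm.subspace_0)
    ultimately have "lin aug ` LL q c = ({0} :: (unit \<Rightarrow>\<^sub>0 'k) set)" by (metis (no_types, lifting) image_cong image_constant)
    then show ?thesis using False by (auto simp: unit_fam_def SP_empty)
  qed
  have sU: "pm.subspace (unit_fam 0 0 q c :: (unit \<Rightarrow>\<^sub>0 'k) set)" for q c by (simp add: unit_fam_def)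
  have surj: "?f ` ?C i = ?U i" for i 
    by (rule bmap_image[where M = LL and M' = "unit_fam 0 0"]) (simp_all only: im subspace_SP sU)
  have comm: "?f (D z) = bar0 (?f z)" if "z \<in> ?C i" for i z
  proof (rule bmap_bar[where M = LL, OF _ _ that])
    fix b q c and y :: "lbase \<Rightarrow>\<^sub>0 'k" assume b: "b \<in> Lt" and y: "y \<in> LL q c"
    have ne: "fst b + c \<noteq> 0" using letter_nonzero[OF b] by simp
    have "lin (lact b) y \<in> LL (q + of_bool (snd b)) (fst b + c)" by (rule dgfamD(2)[OF dgfam_LL, OF b, OF y])
    then have "lin aug (lin (lact b) y) = (0 :: unit \<Rightarrow>\<^sub>0 'k)" by (rule aug_zero[OF _ disjI2[OF ne]])
    then show "lin aug (lin (lact b) y) = lin (\<lambda>_. 0) (lin aug y)" by (simp only: lin_zero_fun)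
  next
    fix q c and y :: "lbase \<Rightarrow>\<^sub>0 'k" assume "y \<in> LL q c"
    then have "lin aug (lin kd y) = (0 :: unit \<Rightarrow>\<^sub>0 'k)" by (rule aug_kd)
    then show "lin aug (lin kd y) = lin (\<lambda>_. 0) (lin aug y)" by (simp only: lin_zero_fun)
  qed
  have ker: "{z \<in> ?C i. ?f z = 0} = bspace Lt (Suc i) Lp i a" for i
    unfolding bmap_kernel[where M = LL, OF subspace_SP] Lp_def ..
  have lf: "linear_pm ?f" unfolding bmap_def by simp
  have cyc: "cycles D (\<lambda>i. {z \<in> ?C i. ?f z = 0}) i \<subseteq> boundaries D ?C i" for i
  proof
    fix z assume "z \<in> cycles D (\<lambda>i. {z \<in> ?C i. ?f z = 0}) i"
    then have z: "z \<in> ?C i" "z \<in> bspace Lt (Suc i) Lp i a" "D z = 0" unfolding cycles_def ker[symmetric] by simp_all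
    show "z \<in> boundaries D ?C i"
    \<comment> \<open>Homology with coefficients in \<open>L\<close> is concentrated where i = |a|.
      There a cycle of the augmentation kernel is a boundary because its component in
      \<open>P + H\<close> is zero; elsewhere there are no critical terms and the contraction
      applies.\<close>
    proof (cases "i = mdeg n a")
      case True
      have "\<exists>x\<in>bspace Lt (Suc i) NN i a. \<exists>y\<in>bspace Lt (Suc (Suc i)) Lp (Suc i) a. z = x + D y"
      proof (rule bspace_relative_acyclic[OF letters_closed dgfam_Lp dgfam_NN NN_Lp dgmod_lact Lp_NN_acyclic z(2)])
        show "D z \<in> bspace Lt (Suc (i - 1)) NN (i - 1) a"
          unfolding z(3) by (rule pm.subspace_0[OF subspace_bspace[OF subspace_NN]])
      qed
      then obtain x y where xy: "x \<in> bspace Lt (Suc i) NN i a" "y \<in> bspace Lt (Suc (Suc i)) Lp (Suc i) a" "z = x + D y"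
        by blast
      have "x = 0" using True by (intro bspace_NN_top[OF xy(1)]) simp
      then have "z = D y" using xy(3) by simp
      moreover have "bspace Lt (Suc (Suc i)) Lp (Suc i) a \<subseteq> ?C (Suc i)"
        by (rule bspace_mono[OF order_refl]) (auto simp: Lp_def)
      ultimately show ?thesis using xy(2) unfolding boundaries_def by blast
    next
      case False
      have zx: "z \<in> SP (xb i a)" using z(1) unfolding bspace_LL .
      have "z \<in> SP ncrit"
        unfolding SP_def
      proof (intro CollectI subsetI)
        fix x assume "x \<in> keys z"
        then have x: "x \<in> xb i a" using zx by (auto simp: SP_def)
        obtain w m e F where xx: "x = (w, ((m, e), F))" by (metis prod.exhaust)
        have "\<not> (w = [] \<and> (m, e) = (0, False))"
        proof
          assume "w = [] \<and> (m, e) = (0, False)"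
          then have "F \<subseteq> {..<n}" "card F = i" "indic F = a" using x by (auto simp: xx xb_def)
          then show False using False mdeg_indic[of F n] by simp
        qed
        then show "x \<in> ncrit" by (simp add: xx ncrit_def)
      qed
      then obtain y where "y \<in> SP (xb (Suc i) a)" "z = D y" using ncrit_acyclic'[OF zx _ z(3)] by blast
      then show ?thesis unfolding boundaries_def bspace_LL by blast
    qed
  qed
  have "betti bar0 ?U 0 = betti D ?C 0"
    by (rule betti_connecting(1)[OF C U lf surj comm cyc])
  then show ?thesis1 unfolding bar_betti_def betti_LL .
  have "betti bar0 ?U (Suc i) = betti D ?C (Suc i) + betti D (\<lambda>i. {z \<in> ?C i. ?f z = 0}) i"
    by (rule betti_connecting(2)[OF C U lf surj comm cyc])
  then show ?thesis2 unfolding bar_betti_def betti_LL ker betti_Lp_NN .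
qed

section \<open>Comparison with the Koszul complex of the quotient ring\<close>

definition kr :: "nat set \<times> (nat \<Rightarrow> nat) \<Rightarrow> (nat set \<times> (nat \<Rightarrow> nat) \<Rightarrow>\<^sub>0 'k::field)" where
  "kr x = (\<Sum>j\<in>fst x. if snd x + var j \<in> I then 0 else scl (ksg (fst x) j) (unitv (fst x - {j}, snd x + var j)))"

definition fr :: "lbase \<Rightarrow> (nat set \<times> (nat \<Rightarrow> nat) \<Rightarrow>\<^sub>0 'k::field)" where
  "fr x = (if snd (fst x) \<or> fst (fst x) \<in> I then 0 else unitv (snd x, fst (fst x)))"

definition kh :: "lbase \<Rightarrow> (lbase \<Rightarrow>\<^sub>0 'k::field)" where
  "kh x = (if \<not> snd (fst x) \<and> fst (fst x) \<in> I then unitv ((fst (fst x), True), snd x) else 0)"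

lemma kos_basis_eq: "kos_basis n I q c = (\<lambda>((m, e), F). (F, m)) ` {x \<in> Lb n I q c. \<not> snd (fst x) \<and> fst (fst x) \<notin> I}"
proof (intro subset_antisym subsetI)
  fix y assume "y \<in> kos_basis n I q c"
  then obtain F m where y: "y = (F, m)" "F \<subseteq> {..<n}" "card F = q" "m \<in> mons n" "m \<notin> I" "m + indic F = c"
    by (auto simp: kos_basis_def)
  then show "y \<in> (\<lambda>((m, e), F). (F, m)) ` {x \<in> Lb n I q c. \<not> snd (fst x) \<and> fst (fst x) \<notin> I}"
    by (intro image_eqI[of _ _ "((m, False), F)"]) (auto simp: Lb_def)
qed (auto simp: kos_basis_def Lb_def)

lemma fr_kd:
  assumes x: "x \<in> Lb n I q c"
  shows "lin fr (kd x) = (lin kr (fr x) :: _ \<Rightarrow>\<^sub>0 'k::field)"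
proof -
  obtain m e F where xx: "x = ((m, e), F)" by (metis prod.exhaust)
  have m: "m \<in> mons n" "e \<longrightarrow> m \<in> I" "F \<subseteq> {..<n}" using x by (auto simp: xx Lb_def)
  show ?thesis
  proof (cases "e \<or> m \<in> I")
    case True
    then have mI: "m \<in> I" using m by blast
    have "m + var j \<in> I" if "j \<in> F" for j
      using that m(3) by (intro ideal_up[OF mI]) (auto simp: add_mons m(1) le_fun_def)
    then show ?thesis by (auto simp: xx kd_unit kos_def lin_sum fr_def mI intro!: sum.neutral)
  next
    case False
    then have "lin fr (kd x) = (\<Sum>j\<in>F. scl (ksg F j) (if m + var j \<in> I then 0 else unitv (F - {j}, m + var j)))"
      by (simp add: xx kd_unit kos_def lin_sum fr_def del: plus_fun_apply cong: if_cong)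
    also have "\<dots> = kr (F, m)" unfolding kr_def fst_conv snd_conv by (intro sum.cong refl) simp
    finally show ?thesis using False by (simp add: xx fr_def)
  qed
qed

lemma linear_kr_kos:
  assumes x: "x \<in> kos_basis n I (Suc q) c"
  shows "kr x = (\<Sum>y\<in>kos_basis n I q c. scl (kos_coef x y :: 'k::field) (unitv y))"
proof -
  obtain F m where xx: "x = (F, m)" by (metis prod.exhaust)
  have F: "F \<subseteq> {..<n}" "card F = Suc q" "m \<in> mons n" "m + indic F = c" "finite F"
    using x finite_subset[of F "{..<n}"] by (auto simp: xx kos_basis_def)
  have fin: "finite (kos_basis n I q c)" unfolding kos_basis_eq using finite_Lb by simp
  have "(\<Sum>y\<in>kos_basis n I q c. scl (kos_coef x y :: 'k) (unitv y)) =
    (\<Sum>y\<in>kos_basis n I q c. \<Sum>j\<in>F. if y = (F - {j}, m + var j) then scl (ksg F j) (unitv y) else 0)"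
    unfolding kos_coef_def xx
    by (intro sum.cong refl, subst pm.scale_sum_left) (auto intro!: sum.cong simp: ksg_def prod_eq_iff)
  also have "\<dots> = (\<Sum>j\<in>F. \<Sum>y\<in>kos_basis n I q c. if y = (F - {j}, m + var j) then scl (ksg F j) (unitv y) else 0)"
    by (rule sum.swap)
  also have "\<dots> = kr x"
    unfolding kr_def xx fst_conv snd_conv
  proof (intro sum.cong refl)
    fix j assume j: "j \<in> F"
    have "m + var j + indic (F - {j}) = c" using indic_remove[OF j] F(4) by (simp only: add.assoc)
    then have "(F - {j}, m + var j) \<in> kos_basis n I q c \<longleftrightarrow> m + var j \<notin> I"
      using F j by (auto simp: kos_basis_def add_mons)
    then show "(\<Sum>y\<in>kos_basis n I q c. if y = (F - {j}, m + var j) then scl (ksg F j) (unitv y) else 0) =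
      (if m + var j \<in> I then 0 else scl (ksg F j) (unitv (F - {j}, m + var j)))"
      using fin by simp
  qed
  finally show ?thesis by simp
qed

text \<open>Elements with a \<sigma> or with coefficient in I form the cone of the identity of I,
  tensored with the exterior algebra; \<open>kh\<close> inverts d(\<sigma> m) = m and anticommutes
  with the Koszul part.\<close>

lemma kh_homotopy:
  assumes x: "x \<in> Lb n I q c" "snd (fst x) \<or> fst (fst x) \<in> I"
  shows "lin kd (kh x) + lin kh (kd x) = (unitv x :: _ \<Rightarrow>\<^sub>0 'k::field)"
proof -
  obtain m e F where xx: "x = ((m, e), F)" by (metis prod.exhaust)
  have m: "m \<in> mons n" "m \<in> I" "F \<subseteq> {..<n}" using x by (auto simp: xx Lb_def)
  have mj: "m + var j \<in> I" if "j \<in> F" for j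
    using that m(3) by (intro ideal_up[OF m(2)]) (auto simp: add_mons m(1) le_fun_def)
  show ?thesis
  proof (cases e)
    case True
    have "lin kh (kos (m, True) F) = (0 :: _ \<Rightarrow>\<^sub>0 'k)" by (simp add: kos_def lin_sum kh_def)
    then show ?thesis using m(2) True by (simp add: xx kd_unit kh_def)
  next
    case False
    have "lin kh (kos (m, False) F) = (kos (m, True) F :: _ \<Rightarrow>\<^sub>0 'k)"
      unfolding kos_def lin_sum by (intro sum.cong refl) (simp add: kh_def mj del: plus_fun_apply)
    then show ?thesis using m(2) False by (simp add: xx kd_unit kh_def)
  qed
qed

lemma fr_kernel:
  assumes z: "(z :: _ \<Rightarrow>\<^sub>0 'k::field) \<in> LL q c" "lin fr z = 0" and x: "x \<in> keys z"
  shows "snd (fst x) \<or> fst (fst x) \<in> I"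
proof (rule ccontr)
  assume n: "\<not> (snd (fst x) \<or> fst (fst x) \<in> I)"
  have "lookup (lin fr z) (snd x, fst (fst x)) = (\<Sum>y\<in>keys z. if y = x then lookup z x else 0)"
    unfolding lin_def lookup_sum
  proof (intro sum.cong refl)
    fix y :: lbase
    obtain m e F where xx: "x = ((m, e), F)" by (metis prod.exhaust)
    obtain m' e' F' where yy: "y = ((m', e'), F')" by (metis prod.exhaust)
    show "lookup (scl (lookup z y) (fr y)) (snd x, fst (fst x)) = (if y = x then lookup z x else 0)"
      using n by (auto simp: xx yy fr_def lookup_unitv)
  qed
  then have "lookup z x = 0" using x z(2) by simp
  then show False using x by (simp add: in_keys_iff)
qed

lemma tor_S_RK_eq: "tor_S_RK (K :: 'k::field itself) n I q c = betti (lin kd) (\<lambda>q. LL q c :: (_ \<Rightarrow>\<^sub>0 'k) set) q"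
proof -
  let ?C = "\<lambda>q. LL q c :: (_ \<Rightarrow>\<^sub>0 'k) set" and ?C' = "\<lambda>q. SP (kos_basis n I q c) :: (_ \<Rightarrow>\<^sub>0 'k) set"
  have "tor_S_RK K n I q c = betti (lin kr) ?C' q"
    unfolding tor_S_RK_def
  proof (rule hom_dim_eq_betti)
    show "finite (kos_basis n I j c)" for j unfolding kos_basis_eq using finite_Lb by simp
    show "lin kr (unitv x) = (0 :: _ \<Rightarrow>\<^sub>0 'k)" if "x \<in> kos_basis n I 0 c" for x
    proof -
      have "finite (fst x)" "card (fst x) = 0" using that finite_subset[of "fst x" "{..<n}"] by (auto simp: kos_basis_def)
      then show ?thesis by (simp add: kr_def)
    qed
    show "lin kr (unitv x) = (\<Sum>y\<in>kos_basis n I i c. scl (kos_coef x y :: 'k) (unitv y))" if "x \<in> kos_basis n I (Suc i) c" for i x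
      using linear_kr_kos[OF that, where 'k = 'k] by simp
  qed simp
  also have "\<dots> = betti (lin kd) ?C q"
  proof (rule sym)
    have surj: "lin fr ` ?C q = ?C' q" for q
    proof (intro subset_antisym image_subsetI subsetI)
      fix z assume z: "z \<in> ?C q"
      show "lin fr z \<in> ?C' q"
      proof (rule lin_in_subspace[OF subspace_SP])
        fix x assume "x \<in> keys z"
        then have "x \<in> Lb n I q c" using z by (auto simp: SP_def)
        then show "fr x \<in> ?C' q"
          by (cases x rule: prod.exhaust[case_product prod.exhaust])
            (auto simp: fr_def kos_basis_def Lb_def pm.subspace_0 split: prod.splits)
      qed
    next
      fix y assume y: "y \<in> ?C' q"
      show "y \<in> lin fr ` ?C q"
      proof (rule lin_in_subspace[of _ y unitv, unfolded lin_id])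
        show "pm.subspace (lin fr ` ?C q)" by (rule pp.linear_subspace_image) auto
        fix x assume "x \<in> keys y"
        then have "x \<in> kos_basis n I q c" using y by (auto simp: SP_def)
        then obtain l where l: "l \<in> Lb n I q c" "\<not> snd (fst l)" "fst (fst l) \<notin> I" "x = (snd l, fst (fst l))"
          unfolding kos_basis_eq by auto
        then have "lin fr (unitv l) = (unitv x :: _ \<Rightarrow>\<^sub>0 'k)" by (simp add: fr_def)
        moreover have "unitv l \<in> ?C q" using l by simp
        ultimately show "unitv x \<in> lin fr ` ?C q" by (metis imageI)
      qed
    qed
    have comm: "lin fr (lin kd z) = lin kr (lin fr z)" if "z \<in> ?C q" for q z
    proof (rule linear_eq_on_units[OF linear_pm_compose[OF linear_lin linear_lin] linear_pm_compose[OF linear_lin linear_lin]])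
      fix x assume "x \<in> keys z"
      then have "x \<in> Lb n I q c" using that by (auto simp: SP_def)
      then show "lin fr (lin kd (unitv x)) = (lin kr (lin fr (unitv x)) :: _ \<Rightarrow>\<^sub>0 'k)" using fr_kd[where 'k = 'k] by simp
    qed
    have lf: "linear_pm (lin fr :: _ \<Rightarrow> (_ \<Rightarrow>\<^sub>0 'k))" by simp
    have lk: "linear_pm (lin kr :: _ \<Rightarrow> (_ \<Rightarrow>\<^sub>0 'k))" by simp
    have C': "cpx (lin kr) ?C'" by (rule cpx_image[OF cpx_LL[of c] lk lf]) (simp_all only: surj comm)
    show "betti (lin kd) ?C q = betti (lin kr) ?C' q"
    proof (rule betti_surj_acyclic_kernel[OF cpx_LL C' lf])
      show "lin fr ` ?C i = ?C' i" for i by (rule surj)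
      show "lin fr (lin kd z) = lin kr (lin fr z)" if "z \<in> ?C i" for i z by (rule comm[OF that])
      fix i z assume z: "z \<in> ?C i" "lin fr z = (0 :: _ \<Rightarrow>\<^sub>0 'k)" "lin kd z = 0"
      have zk: "x \<in> Lb n I i c \<and> (snd (fst x) \<or> fst (fst x) \<in> I)" if "x \<in> keys z" for x
        using fr_kernel[OF z(1,2) that] that z(1) by (auto simp: SP_def)
      have l: "linear_pm (\<lambda>z. lin kd (lin kh z) + lin kh (lin kd z) :: _ \<Rightarrow>\<^sub>0 'k)"
        by (rule linear_pmI) (simp_all add: lin_add lin_scl pm.scale_right_distrib algebra_simps)
      have l': "linear_pm (\<lambda>z. z :: lbase \<Rightarrow>\<^sub>0 'k)" by (rule linear_pmI) simp_all
      have "lin kd (lin kh z) + lin kh (lin kd z) = z"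
      proof (rule linear_eq_on_units[OF l l'])
        fix x assume "x \<in> keys z"
        from kh_homotopy[OF conjunct1[OF zk[OF this]] conjunct2[OF zk[OF this]]]
        show "lin kd (lin kh (unitv x)) + lin kh (lin kd (unitv x)) = (unitv x :: _ \<Rightarrow>\<^sub>0 'k)" by simp
      qed
      then have "z = lin kd (lin kh z)" using z(3) by simp
      moreover have "lin kh z \<in> ?C (Suc i)"
      proof (rule lin_in_subspace[OF subspace_SP])
        fix x assume "x \<in> keys z"
        then have "x \<in> Lb n I i c" using zk by blast
        then show "kh x \<in> ?C (Suc i)" by (cases x) (auto simp: kh_def Lb_def pm.subspace_0)
      qed
      moreover have "lin fr (lin kh z) = (0 :: _ \<Rightarrow>\<^sub>0 'k)"
      proof -
        have "lin fr (lin kh z) = (lin (\<lambda>_. 0) z :: _ \<Rightarrow>\<^sub>0 'k)"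
          by (rule trans[OF linear_eq_lin[OF linear_pm_compose[OF linear_lin linear_lin]] lin_cong]) (simp add: kh_def fr_def)
        then show ?thesis by simp
      qed
      ultimately show "\<exists>y\<in>?C (Suc i). lin fr y = (0 :: _ \<Rightarrow>\<^sub>0 'k) \<and> z = lin kd y" by blast
    qed
  qed
  finally show ?thesis .
qed

lemma tor_S_RK_dim: "q \<noteq> 0 \<Longrightarrow> tor_S_RK (K :: 'k::field itself) n I q c = pm.dim (HH q c :: (_ \<Rightarrow>\<^sub>0 'k) set)"
  unfolding tor_S_RK_eq by (rule betti_LL_HH) simp

lemma tor_R_KK_0: "tor_R_KK (K :: 'k::field itself) n I 0 a = card {F. F \<subseteq> {..<n} \<and> card F = 0 \<and> indic F = a}"
  unfolding tor_R_KK_eq by (rule bar_betti_rec(1))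

lemma tor_R_KK_Suc:
  "tor_R_KK (K :: 'k::field itself) n I (Suc i) a = card {F. F \<subseteq> {..<n} \<and> card F = Suc i \<and> indic F = a} +
    (\<Sum>q\<le>i. \<Sum>c\<in>{c \<in> mons n. c \<le> a}. (if q = 0 then 0 else tor_S_RK K n I q c) * tor_R_KK K n I (i - q) (a - c))"
proof -
  have "pm.dim (HH q c :: (_ \<Rightarrow>\<^sub>0 'k) set) = (if q = 0 then 0 else tor_S_RK K n I q c)" for q c
    using tor_S_RK_dim[of q K c] dim_HH_0[of c, where 'k = 'k] by simp
  then show ?thesis unfolding tor_R_KK_eq bar_betti_rec(2) betti_NN by simp
qed

lemma tor_S_RK_finite:
  assumes "q \<noteq> 0"
  shows "finite {c \<in> mons n. tor_S_RK (K :: 'k::field itself) n I q c \<noteq> 0}"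
proof (rule finite_subset[OF _ finite_mons_le])
  \<comment> \<open>The bound q + n on the total degree is that of \<open>high_degree_exact\<close>;
    each exponent is at most the total degree.\<close>
  show "{c \<in> mons n. tor_S_RK K n I q c \<noteq> 0} \<subseteq> {c \<in> mons n. c \<le> (\<lambda>_. q + n)}"
  proof
    fix c assume "c \<in> {c \<in> mons n. tor_S_RK K n I q c \<noteq> 0}"
    then have c: "c \<in> mons n" "pm.dim (HH q c :: (_ \<Rightarrow>\<^sub>0 'k) set) \<noteq> 0"
      using tor_S_RK_dim[OF assms, of K c] by auto
    have "mdeg n c < q + n"
    proof (rule ccontr)
      assume d: "\<not> mdeg n c < q + n"
      have "h = 0" if h: "h \<in> (HH q c :: (_ \<Rightarrow>\<^sub>0 'k) set)" for h
      proof (cases "q < mdeg n c")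
        case True
        obtain y where "y \<in> LL (Suc q) c" "h = lin kd y"
          using high_degree_exact[OF HH_in_LL[OF h] HH_cycle[OF h] True] d by auto
        then show ?thesis by (intro HH_boundary[OF h]) (rule image_eqI)
      next
        case False
        then show ?thesis by (rule HH_0D[OF _ h])
      qed
      then have "(HH q c :: (_ \<Rightarrow>\<^sub>0 'k) set) \<subseteq> {0}" by blast
      moreover have "0 \<in> (HH q c :: (_ \<Rightarrow>\<^sub>0 'k) set)" by (simp add: pm.subspace_0)
      ultimately have "(HH q c :: (_ \<Rightarrow>\<^sub>0 'k) set) = {0}" by (intro subset_antisym) simp_all
      then show False using c(2) by (simp add: dim_zero_space)
    qed
    moreover have "c i \<le> mdeg n c" for i
    proof (cases "i < n")
      case True
      then show ?thesis unfolding mdeg_def by (intro member_le_sum) auto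
    next
      case False
      then show ?thesis using c(1) by (auto simp: mons_def)
    qed
    ultimately have "c i \<le> q + n" for i by (meson le_less_trans less_imp_le)
    then show "c \<in> {c \<in> mons n. c \<le> (\<lambda>_. q + n)}" using c(1) by (simp add: le_fun_def)
  qed
qed

end

text \<open>\<open>tot_dim\<close> is 0 by convention when infinitely many multidegrees contribute,
  so identities for it have to carry this finiteness.\<close>

abbreviation fin_mons :: "nat \<Rightarrow> ((nat \<Rightarrow> nat) \<Rightarrow> nat) \<Rightarrow> bool" where
  "fin_mons n f \<equiv> finite {a \<in> mons n. f a \<noteq> 0}"

lemma tot_dim_superset:
  assumes "finite S" "S \<subseteq> mons n" "\<And>a. a \<in> mons n \<Longrightarrow> f a \<noteq> 0 \<Longrightarrow> a \<in> S"
  shows "tot_dim n f = sum f S"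
  unfolding tot_dim_def using assms by (intro sum.mono_neutral_left) auto

lemma tot_dim_add:
  assumes "fin_mons n f" "fin_mons n g"
  shows "fin_mons n (\<lambda>a. f a + g a)" "tot_dim n (\<lambda>a. f a + g a) = tot_dim n f + tot_dim n g"
proof -
  let ?S = "{a \<in> mons n. f a \<noteq> 0} \<union> {a \<in> mons n. g a \<noteq> 0}"
  have fS: "finite ?S" using assms by simp
  then show "fin_mons n (\<lambda>a. f a + g a)" by (rule rev_finite_subset) auto
  have "tot_dim n (\<lambda>a. f a + g a) = (\<Sum>a\<in>?S. f a + g a)" using fS by (intro tot_dim_superset) auto
  also have "\<dots> = sum f ?S + sum g ?S" by (rule sum.distrib)
  also have "sum f ?S = tot_dim n f" using fS by (intro tot_dim_superset[symmetric]) auto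
  also have "sum g ?S = tot_dim n g" using fS by (intro tot_dim_superset[symmetric]) auto
  finally show "tot_dim n (\<lambda>a. f a + g a) = tot_dim n f + tot_dim n g" .
qed

lemma tot_dim_sum:
  assumes "finite A" "\<And>q. q \<in> A \<Longrightarrow> fin_mons n (f q)"
  shows "fin_mons n (\<lambda>a. \<Sum>q\<in>A. f q a) \<and> tot_dim n (\<lambda>a. \<Sum>q\<in>A. f q a) = (\<Sum>q\<in>A. tot_dim n (f q))"
  using assms
proof (induction A rule: finite_induct)
  case empty
  then show ?case by (simp add: tot_dim_def)
next
  case (insert x A)
  then show ?case using tot_dim_add[of n "f x" "\<lambda>a. \<Sum>q\<in>A. f q a"] by simp
qed

text \<open>The product of the totals is a sum over pairs of multidegrees in the two supports;
  grouping the pairs by their sum gives the convolution.\<close>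

lemma tot_dim_convolution:
  assumes f: "fin_mons n f" and g: "fin_mons n g"
  shows "fin_mons n (\<lambda>a. \<Sum>c\<in>{c \<in> mons n. c \<le> a}. f c * g (a - c))" (is ?fin)
    "tot_dim n (\<lambda>a. \<Sum>c\<in>{c \<in> mons n. c \<le> a}. f c * g (a - c)) = tot_dim n f * tot_dim n g" (is ?eq)
proof -
  let ?F = "{a \<in> mons n. f a \<noteq> 0}" and ?G = "{a \<in> mons n. g a \<noteq> 0}"
  let ?h = "\<lambda>a. \<Sum>c\<in>{c \<in> mons n. c \<le> a}. f c * g (a - c)"
  let ?S = "(\<lambda>p. fst p + snd p) ` (?F \<times> ?G)"
  have fS: "finite (?F \<times> ?G)" using f g by simp
  have Sm: "?S \<subseteq> mons n" using add_mons by auto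
  have ac: "c + (a - c) = a" if "c \<le> a" for a c :: "nat \<Rightarrow> nat" using that by (auto simp: le_fun_def fun_eq_iff)
  have hS: "a \<in> ?S" if a: "a \<in> mons n" "?h a \<noteq> 0" for a
  proof -
    have "\<exists>c\<in>{c \<in> mons n. c \<le> a}. f c * g (a - c) \<noteq> 0"
      using a(2) by (rule contrapos_np) (intro sum.neutral, blast)
    then obtain c where c: "c \<in> mons n" "c \<le> a" "f c * g (a - c) \<noteq> 0" by blast
    have p: "(c, a - c) \<in> ?F \<times> ?G" using c a(1) by auto
    show ?thesis by (rule image_eqI[OF _ p]) (simp only: fst_conv snd_conv ac[OF c(2)])
  qed
  show ?fin by (rule finite_subset[OF _ finite_imageI[OF fS]]) (use hS in blast)
  have "tot_dim n ?h = (\<Sum>a\<in>?S. ?h a)" by (rule tot_dim_superset[OF finite_imageI[OF fS] Sm hS])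
  also have "\<dots> = (\<Sum>a\<in>?S. \<Sum>p\<in>{p \<in> ?F \<times> ?G. fst p + snd p = a}. f (fst p) * g (snd p))"
  proof (intro sum.cong refl)
    fix a assume "a \<in> ?S"
    have "?h a = (\<Sum>c\<in>{c \<in> ?F. c \<le> a \<and> a - c \<in> ?G}. f c * g (a - c))"
      by (rule sum.mono_neutral_right[OF finite_mons_le]) (use Sm \<open>a \<in> ?S\<close> in auto)
    also have "\<dots> = (\<Sum>p\<in>{p \<in> ?F \<times> ?G. fst p + snd p = a}. f (fst p) * g (snd p))"
    proof (rule sum.reindex_bij_witness[of _ fst "\<lambda>c. (c, a - c)"])
      fix p assume p: "p \<in> {p \<in> ?F \<times> ?G. fst p + snd p = a}"
      have pa: "fst p + snd p = a" using p by simp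
      have "a - fst p = snd p" unfolding pa[symmetric] by (rule ext) simp
      moreover have "fst p \<le> a" unfolding pa[symmetric] by (simp add: le_fun_def)
      ultimately show "fst p \<in> {c \<in> ?F. c \<le> a \<and> a - c \<in> ?G}" "(fst p, a - fst p) = p"
        using p by (auto simp del: minus_apply)
    next
      fix c assume c: "c \<in> {c \<in> ?F. c \<le> a \<and> a - c \<in> ?G}"
      then show "(c, a - c) \<in> {p \<in> ?F \<times> ?G. fst p + snd p = a}" using ac[of c a] by (simp del: plus_fun_apply minus_apply)
    qed simp_all
    finally show "?h a = (\<Sum>p\<in>{p \<in> ?F \<times> ?G. fst p + snd p = a}. f (fst p) * g (snd p))" .
  qed
  also have "\<dots> = (\<Sum>p\<in>?F \<times> ?G. f (fst p) * g (snd p))" by (rule sum.image_gen[OF fS, symmetric])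
  also have "\<dots> = tot_dim n f * tot_dim n g"
    unfolding tot_dim_def sum_product sum.cartesian_product by (simp add: split_def)
  finally show ?eq .
qed

lemma tot_dim_indic:
  "fin_mons n (\<lambda>a. card {F. F \<subseteq> {..<n} \<and> card F = i \<and> indic F = a})" (is ?fin)
  "tot_dim n (\<lambda>a. card {F. F \<subseteq> {..<n} \<and> card F = i \<and> indic F = a}) = n choose i" (is ?eq)
proof -
  let ?A = "{F. F \<subseteq> {..<n} \<and> card F = i}"
  have fA: "finite ?A" by (rule finite_subset[of _ "Pow {..<n}"]) auto
  have s: "a \<in> indic ` ?A" if "card {F. F \<subseteq> {..<n} \<and> card F = i \<and> indic F = a} \<noteq> 0" for a
  proof -
    have "{F. F \<subseteq> {..<n} \<and> card F = i \<and> indic F = a} \<noteq> {}" using that by (intro notI) simp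
    then show ?thesis by blast
  qed
  show ?fin by (rule finite_subset[OF _ finite_imageI[OF fA, of indic]]) (use s in blast)
  have "tot_dim n (\<lambda>a. card {F. F \<subseteq> {..<n} \<and> card F = i \<and> indic F = a}) =
    (\<Sum>a\<in>indic ` ?A. card {F. F \<subseteq> {..<n} \<and> card F = i \<and> indic F = a})"
    by (rule tot_dim_superset[OF finite_imageI[OF fA]]) (use s in auto)
  also have "\<dots> = (\<Sum>a\<in>indic ` ?A. \<Sum>F\<in>{F \<in> ?A. indic F = a}. 1)"
    by (simp add: conj_assoc)
  also have "\<dots> = (\<Sum>F\<in>?A. 1)" by (rule sum.image_gen[OF fA, symmetric])
  also have "\<dots> = n choose i" by (simp add: n_subsets)
  finally show ?eq .
qed

context golod_ideal
begin

text \<open>The recursion expresses degree i through smaller degrees and through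
  \<open>tor_S_RK\<close>, whose support is finite by the regularity bound.\<close>

lemma tor_R_KK_finite: "fin_mons n (tor_R_KK (K :: 'k::field itself) n I i)"
proof (induction i rule: less_induct)
  case (less i)
  show ?case
  proof (cases i)
    case 0
    then show ?thesis unfolding tor_R_KK_0[abs_def] by (simp only: tor_R_KK_0 tot_dim_indic)
  next
    case (Suc i')
    have "fin_mons n (\<lambda>a. \<Sum>c\<in>{c \<in> mons n. c \<le> a}. (if q = 0 then 0 else tor_S_RK K n I q c) * tor_R_KK K n I (i' - q) (a - c))" for q
      by (rule tot_dim_convolution(1)) (use tor_S_RK_finite[of q K] less Suc in auto)
    then show ?thesis unfolding Suc tor_R_KK_Suc
      by (intro tot_dim_add(1) tot_dim_indic(1) tot_dim_sum[THEN conjunct1] finite_atMost)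
  qed
qed

lemma tot_dim_tor_R_KK_Suc:
  "tot_dim n (tor_R_KK (K :: 'k::field itself) n I (Suc i)) = (n choose Suc i) +
    (\<Sum>q\<le>i. (if q = 0 then 0 else tot_dim n (tor_S_RK K n I q)) * tot_dim n (tor_R_KK K n I (i - q)))"
proof -
  let ?g = "\<lambda>q a. \<Sum>c\<in>{c \<in> mons n. c \<le> a}. (if q = 0 then 0 else tor_S_RK K n I q c) * tor_R_KK K n I (i - q) (a - c)"
  have b: "fin_mons n (\<lambda>c. if q = 0 then 0 else tor_S_RK K n I q c)" for q
    using tor_S_RK_finite[of q K] by auto
  note conv = tot_dim_convolution[OF b tor_R_KK_finite]
  have s: "fin_mons n (\<lambda>a. \<Sum>q\<in>{..i}. ?g q a) \<and> tot_dim n (\<lambda>a. \<Sum>q\<in>{..i}. ?g q a) = (\<Sum>q\<in>{..i}. tot_dim n (?g q))"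
    by (rule tot_dim_sum[OF finite_atMost conv(1)])
  have "tor_R_KK K n I (Suc i) = (\<lambda>a. card {F. F \<subseteq> {..<n} \<and> card F = Suc i \<and> indic F = a} + (\<Sum>q\<in>{..i}. ?g q a))"
    by (rule ext) (rule tor_R_KK_Suc)
  then have "tot_dim n (tor_R_KK K n I (Suc i)) = (n choose Suc i) + (\<Sum>q\<in>{..i}. tot_dim n (?g q))"
    using tot_dim_add(2)[OF tot_dim_indic(1) conjunct1[OF s], of "Suc i"] conjunct2[OF s] tot_dim_indic(2)[of n "Suc i"] by simp
  moreover have "tot_dim n (?g q) = (if q = 0 then 0 else tot_dim n (tor_S_RK K n I q)) * tot_dim n (tor_R_KK K n I (i - q))" for q
    unfolding conv(2) by (simp add: tot_dim_def)
  ultimately show ?thesis by (simp only:)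
qed

lemma golod: "golod (K :: 'k::field itself) n I"
proof -
  define P where "P = (Abs_fps (\<lambda>i. of_nat (tot_dim n (tor_R_KK K n I i))) :: rat fps)"
  define b where "b = (Abs_fps (\<lambda>i. if i = 0 then 0 else of_nat (tot_dim n (tor_S_RK K n I i))) :: rat fps)"
  have bin: "fps_nth ((1 + fps_X) ^ n :: rat fps) i = of_nat (n choose i)" for i
    unfolding fps_binomial_of_nat[symmetric] fps_binomial_nth by (simp add: binomial_gbinomial)
  have "P = (1 + fps_X) ^ n + fps_X * (b * P)"
  proof (rule fps_ext)
    fix i
    show "fps_nth P i = fps_nth ((1 + fps_X) ^ n + fps_X * (b * P)) i"
    proof (cases i)
      case 0
      have "tor_R_KK K n I 0 = (\<lambda>a. card {F. F \<subseteq> {..<n} \<and> card F = 0 \<and> indic F = a})"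
        by (rule ext) (rule tor_R_KK_0)
      then have "tot_dim n (tor_R_KK K n I 0) = 1" using tot_dim_indic(2)[of n 0] by simp
      then show ?thesis using 0 bin[of 0] by (simp add: P_def)
    next
      case (Suc j)
      have "fps_nth (b * P) j = (\<Sum>q\<le>j. fps_nth b q * fps_nth P (j - q))" by (simp add: fps_mult_nth atLeast0AtMost)
      also have "\<dots> = of_nat (\<Sum>q\<le>j. (if q = 0 then 0 else tot_dim n (tor_S_RK K n I q)) * tot_dim n (tor_R_KK K n I (j - q)))"
        unfolding of_nat_sum by (intro sum.cong refl) (simp add: b_def P_def)
      finally have "fps_nth (b * P) j = of_nat (\<Sum>q\<le>j. (if q = 0 then 0 else tot_dim n (tor_S_RK K n I q)) * tot_dim n (tor_R_KK K n I (j - q)))" .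
      moreover have "fps_nth P (Suc j) = of_nat (tot_dim n (tor_R_KK K n I (Suc j)))" by (simp add: P_def)
      ultimately show ?thesis unfolding Suc fps_add_nth bin tot_dim_tor_R_KK_Suc by simp
    qed
  qed
  then have "P * (1 - fps_X * b) = (1 + fps_X) ^ n" by (simp add: algebra_simps)
  moreover have "1 - fps_X * b \<noteq> 0"
  proof
    assume "1 - fps_X * b = 0"
    then have "fps_nth (1 - fps_X * b) 0 = 0" by simp
    then show False by simp
  qed
  ultimately have "P = (1 + fps_X) ^ n / (1 - fps_X * b)" by (metis nonzero_mult_div_cancel_right)
  then show ?thesis unfolding golod_def P_def b_def .
qed

end

section \<open>Linear quotients of powers\<close>

lemma monomial_orderD:
  assumes "monomial_order n lt"
  shows "a \<in> mons n \<Longrightarrow> \<not> lt a a"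
    and "a \<in> mons n \<Longrightarrow> b \<in> mons n \<Longrightarrow> c \<in> mons n \<Longrightarrow> lt a b \<Longrightarrow> lt b c \<Longrightarrow> lt a c"
    and "a \<in> mons n \<Longrightarrow> b \<in> mons n \<Longrightarrow> a \<noteq> b \<Longrightarrow> lt a b \<or> lt b a"
    and "a \<in> mons n \<Longrightarrow> b \<in> mons n \<Longrightarrow> c \<in> mons n \<Longrightarrow> lt a b \<Longrightarrow> lt (a + c) (b + c)"
    and "a \<in> mons n \<Longrightarrow> a \<noteq> 0 \<Longrightarrow> lt 0 a"
  using assms unfolding monomial_order_def by blast+

lemma monomial_order_le:
  assumes lt: "monomial_order n lt" and ab: "a \<in> mons n" "b \<in> mons n" "a \<le> b"
  shows "a = b \<or> lt a b"
proof (cases "a = b")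
  case False
  have e: "(b - a) + a = b" using ab(3) by (auto simp: fun_eq_iff le_fun_def)
  have ne: "b - a \<noteq> 0"
  proof
    assume "b - a = 0"
    then show False using e False by simp
  qed
  have "lt (0 + a) ((b - a) + a)"
    by (intro monomial_orderD(4)[OF lt] monomial_orderD(5)[OF lt]) (use ab ne in \<open>simp_all add: zero_mons\<close>)
  then have "lt a b" by (simp only: e add_0)
  then show ?thesis by (rule disjI2)
qed simp

lemma monomial_order_less_le:
  assumes lt: "monomial_order n lt" and m: "a \<in> mons n" "b \<in> mons n" "c \<in> mons n" and ab: "a \<le> b" and bc: "lt b c"
  shows "lt a c"
proof (cases "a = b")
  case True
  then show ?thesis using bc by simp
next
  case False
  then have "lt a b" using monomial_order_le[OF lt, OF m(1,2) ab] by simp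
  then show ?thesis by (rule monomial_orderD(2)[OF lt, OF m _ bc])
qed

lemma smult_mons: "v \<in> mons n \<Longrightarrow> (\<lambda>k. s * v k) \<in> mons n"
  by (simp add: mons_def)

lemma monomial_order_smult:
  assumes lt: "monomial_order n lt" and uv: "u \<in> mons n" "v \<in> mons n" "lt u v"
  shows "lt (\<lambda>k. Suc s * u k) (\<lambda>k. Suc s * v k)"
proof (induction s)
  case 0
  then show ?case using uv(3) by simp
next
  case (Suc s)
  define a b where "a = (\<lambda>k. Suc s * u k)" and "b = (\<lambda>k. Suc s * v k)"
  have m: "a \<in> mons n" "b \<in> mons n"
    unfolding a_def b_def by (rule smult_mons[OF uv(1)], rule smult_mons[OF uv(2)])
  have ab: "lt a b" using Suc unfolding a_def b_def .
  have "lt (a + u) (b + u)" by (rule monomial_orderD(4)[OF lt, OF m uv(1) ab])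
  moreover have "lt (b + u) (b + v)"
    using monomial_orderD(4)[OF lt, OF uv(1,2) m(2) uv(3)] by (simp only: add.commute)
  ultimately have "lt (a + u) (b + v)"
    by (rule monomial_orderD(2)[OF lt, OF add_mons[OF m(1) uv(1)] add_mons[OF m(2) uv(1)] add_mons[OF m(2) uv(2)]])
  moreover have "a + u = (\<lambda>k. Suc (Suc s) * u k)" "b + v = (\<lambda>k. Suc (Suc s) * v k)"
    by (auto simp: fun_eq_iff a_def b_def)
  ultimately show ?case by (simp only:)
qed

lemma monomial_order_greatest:
  assumes lt: "monomial_order n lt" and "finite A" "A \<noteq> {}" "A \<subseteq> mons n"
  shows "\<exists>v\<in>A. \<forall>u\<in>A. u \<noteq> v \<longrightarrow> lt u v"
  using assms(2-4)
proof (induction A rule: finite_ne_induct)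
  case (insert x A)
  then obtain v where v: "v \<in> A" "\<forall>u\<in>A. u \<noteq> v \<longrightarrow> lt u v" by auto
  have m: "x \<in> mons n" "v \<in> mons n" using insert v by auto
  have "x \<noteq> v" using insert v by auto
  then consider "lt x v" | "lt v x" using monomial_orderD(3)[OF lt, OF m] by blast
  then show ?case
  proof cases
    case 1
    then show ?thesis using v by (intro bexI[of _ v]) auto
  next
    case 2
    have "lt u x" if "u \<in> A" for u
      using v(2) that 2 monomial_orderD(2)[OF lt, of u v x] m insert.prems by (cases "u = v") auto
    then show ?thesis by (intro bexI[of _ x]) auto
  qed
qed simp

lemma sum_list_mons: "set gs \<subseteq> mons n \<Longrightarrow> sum_list gs \<in> mons n"
  by (induction gs) (auto simp: zero_mons add_mons)

lemma sum_list_ge: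
  "(\<And>g. g \<in> set gs \<Longrightarrow> v \<le> g) \<Longrightarrow> (\<lambda>k. length gs * v k) \<le> (sum_list gs :: nat \<Rightarrow> nat)"
proof (induction gs)
  case (Cons g gs)
  then have "v k \<le> g k" "length gs * v k \<le> sum_list gs k" for k by (auto simp: le_fun_def)
  then show ?case by (auto simp: le_fun_def add_mono)
qed (simp add: le_fun_def)

lemma sum_list_replicate_fun: "sum_list (replicate s v) = (\<lambda>k. s * v k :: nat)"
  by (induction s) (auto simp: fun_eq_iff)

lemma member_le_sum_list_fun: "g \<in> set gs \<Longrightarrow> g \<le> (sum_list gs :: nat \<Rightarrow> nat)"
  by (induction gs) (auto simp: le_fun_def intro: trans_le_add2)

section \<open>Descent of linear quotients from the power to the ideal\<close>

context monomial_ideal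
begin

lemma generator_mons: "u \<in> mingens I \<Longrightarrow> u \<in> mons n"
  by (simp add: mingens_def ideal_mons)

context
  assumes sqfree: "\<And>u. u \<in> mingens I \<Longrightarrow> squarefree_mon u"
begin

text \<open>A minimal generator w below g has exponents at most 1 and support inside that of v, so
  it divides v; minimality of v gives w = v.\<close>

lemma generator_le_supported:
  assumes v: "v \<in> mingens I" and g: "g \<in> I" "\<And>k. v k = 0 \<Longrightarrow> g k = 0"
  shows "v \<le> g"
proof -
  obtain w where w: "w \<in> mingens I" "w \<le> g" using mingen_below[OF g(1)] by blast
  have "w k \<le> v k" for k
  proof (cases "v k = 0")
    case True
    then show ?thesis using w(2) g(2) by (metis le_fun_def le_zero_eq)
  next
    case False
    have "w k \<le> 1" using sqfree[OF w(1)] by (simp add: squarefree_mon_def)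
    then show ?thesis using False by simp
  qed
  then have "w \<le> v" by (simp add: le_fun_def)
  then have "w = v" using v w(1) by (auto simp: mingens_def)
  then show ?thesis using w(2) by simp
qed

text \<open>If a product of s elements of I divides the s-th power of v, each factor is supported on
  v and so is a multiple of v; the product is then the whole power.\<close>

lemma power_generator:
  assumes v: "v \<in> mingens I"
  shows "(\<lambda>k. s * v k) \<in> mingens (mon_ideal_power n I s)"
  unfolding mingens_def
proof (intro CollectI conjI ballI impI)
  have "set (replicate s v) \<subseteq> I" using v by (auto simp: mingens_def)
  then show "(\<lambda>k. s * v k) \<in> mon_ideal_power n I s"
    unfolding mon_ideal_power_def gen_ideal_def
    using smult_mons[OF generator_mons[OF v], of s] sum_list_replicate_fun[of s v]
    by (auto intro!: exI[of _ "replicate s v"])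
  fix w assume "w \<in> mon_ideal_power n I s" and ws: "w \<le> (\<lambda>k. s * v k)"
  then obtain gs where gs: "length gs = s" "set gs \<subseteq> I" "sum_list gs \<le> w"
    by (auto simp: mon_ideal_power_def gen_ideal_def)
  have "v \<le> g" if "g \<in> set gs" for g
  proof (rule generator_le_supported[OF v])
    show "g \<in> I" using that gs(2) by blast
    fix k assume "v k = 0"
    moreover have "g \<le> (\<lambda>k. s * v k)" using member_le_sum_list_fun[OF that] gs(3) ws by (meson order_trans)
    ultimately show "g k = 0" using le_funD[of g "\<lambda>k. s * v k" k] by simp
  qed
  then have "(\<lambda>k. s * v k) \<le> sum_list gs" using sum_list_ge[of gs v] gs(1) by blast
  then have "(\<lambda>k. s * v k) \<le> w" using gs(3) by (rule order_trans)
  then show "w = (\<lambda>k. s * v k)" using ws by (rule antisym[rotated])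
qed

text \<open>A generator \<open>w\<close> of the power with \<open>w \<le> s v + x\<^sub>k\<close> and \<open>w\<close> below \<open>s v\<close> is a product of
  \<open>s\<close> elements of the ideal; as \<open>v\<close> is square-free and \<open>x\<^sub>k\<close> does not divide it, all factors but
  one are multiples of \<open>v\<close>, and cancelling them leaves the remaining factor in place of \<open>w\<close>.\<close>

lemma power_linear_quotients:
  assumes s: "s \<ge> 1" and lt: "monomial_order n lt" and lq: "linear_quotients n (mon_ideal_power n I s) lt"
    and u: "u \<in> mingens I" and v: "v \<in> mingens I" and uv: "lt u v"
  shows "\<exists>k<n. \<exists>w\<in>mingens I. lt w v \<and> v k < u k \<and> w \<le> v + var k"
proof -
  let ?J = "mon_ideal_power n I s"
  let ?su = "\<lambda>k. s * u k" and ?sv = "\<lambda>k. s * v k"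
  let ?A = "{w \<in> mingens ?J. lt w ?sv}"
  have um: "u \<in> mons n" and vm: "v \<in> mons n" using u v by (auto intro: generator_mons)
  have sum': "?su \<in> mons n" "?sv \<in> mons n" using um vm by (auto intro: smult_mons)
  obtain s' where s': "s = Suc s'" using s by (cases s) auto
  obtain V where V: "V \<subseteq> {..<n}" "colon n (gen_ideal n ?A) ?sv = gen_ideal n (var ` V)"
    using lq power_generator[OF v] unfolding linear_quotients_def by blast
  have "lt ?su ?sv" unfolding s' by (rule monomial_order_smult[OF lt, OF um vm uv])
  then have "?su \<in> ?A" by (intro CollectI conjI power_generator[OF u])
  moreover have "?su \<le> (?su - ?sv) + ?sv" by (auto simp: le_fun_def)
  ultimately have "?su - ?sv \<in> colon n (gen_ideal n ?A) ?sv"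
    unfolding colon_def gen_ideal_def using sum' add_mons by auto
  then obtain k where k: "k \<in> V" "var k \<le> ?su - ?sv" unfolding V(2) by (auto simp: gen_ideal_def)
  have kn: "k < n" using k V by blast
  \<comment> \<open>The variable x_k is a generator of the colon ideal of the power that divides u^s
    / gcd(u^s, v^s). It divides u but not v, as u is square-free.\<close>
  have "1 \<le> s * u k - s * v k" using le_funD[OF k(2), of k] by (simp add: var_def)
  then have "s * v k < s * u k" by linarith
  then have uvk: "v k < u k" by simp
  have "u k \<le> 1" using sqfree[OF u] by (simp add: squarefree_mon_def)
  then have vk: "v k = 0" using uvk by linarith
  have "var k \<in> gen_ideal n (var ` V)" using k kn by (auto simp: gen_ideal_def)
  then have "var k + ?sv \<in> gen_ideal n ?A" unfolding V(2)[symmetric] by (simp add: colon_def)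
  then obtain w where w: "w \<in> mingens ?J" "lt w ?sv" "w \<le> var k + ?sv" by (auto simp: gen_ideal_def)
  have "w \<in> ?J" using w(1) by (simp add: mingens_def)
  then obtain gs where gs: "length gs = s" "set gs \<subseteq> I" "sum_list gs \<le> w" and wm: "w \<in> mons n"
    by (auto simp: mon_ideal_power_def gen_ideal_def)
  have gm: "set gs \<subseteq> mons n" using gs(2) ideal_mons by blast
  have glt: "lt (sum_list gs) ?sv" by (rule monomial_order_less_le[OF lt, OF sum_list_mons[OF gm] wm sum'(2) gs(3) w(2)])
  have gle: "sum_list gs \<le> var k + ?sv" using gs(3) w(3) by (rule order_trans)
  have supp: "g j = 0" if "g \<in> set gs" "v j = 0" "j \<noteq> k" for g j
    using le_funD[OF order_trans[OF member_le_sum_list_fun[OF that(1)] gle], of j] that by (simp add: var_def)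
  \<comment> \<open>Otherwise all s factors are multiples of v, and their product is not below v^s
    in the monomial order.\<close>
  have "\<exists>g\<in>set gs. g k \<noteq> 0"
  proof (rule ccontr)
    assume "\<not> (\<exists>g\<in>set gs. g k \<noteq> 0)"
    then have "v \<le> g" if "g \<in> set gs" for g
      using generator_le_supported[OF v, of g] gs(2) supp[OF that] that by (metis subsetD)
    then have "?sv \<le> sum_list gs" using sum_list_ge[of gs v] gs(1) by blast
    then show False
      using monomial_order_less_le[OF lt, OF sum'(2) sum_list_mons[OF gm] sum'(2) _ glt] monomial_orderD(1)[OF lt, OF sum'(2)] by blast
  qed
  then obtain g where g: "g \<in> set gs" "g k \<noteq> 0" by blast
  then obtain xs ys where xy: "gs = xs @ g # ys" by (metis split_list)
  define r where "r = xs @ ys"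
  have sumg: "sum_list gs = g + sum_list r" by (simp add: xy r_def add.left_commute)
  have rl: "length r = s'" using gs(1) by (simp add: xy r_def s')
  have rI: "set r \<subseteq> I" "set r \<subseteq> set gs" using gs(2) by (auto simp: xy r_def)
  \<comment> \<open>x_k divides v^s x_k just once, so g is the only factor divisible by it.\<close>
  have gk: "g k + sum_list r k \<le> 1" using le_funD[OF gle, of k] vk by (simp add: sumg var_def)
  have "v \<le> h" if h: "h \<in> set r" for h
  proof (rule generator_le_supported[OF v])
    show "h \<in> I" using h rI by blast
    fix j assume j: "v j = 0"
    have "h k \<le> sum_list r k" using member_le_sum_list_fun[OF h] by (rule le_funD)
    then have "h k = 0" using gk g(2) by linarith
    then show "h j = 0" using supp[of h j] h rI(2) j by (cases "j = k") auto
  qed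
  then have "(\<lambda>j. length r * v j) \<le> sum_list r" by (rule sum_list_ge)
  then have rv: "(\<lambda>j. s' * v j) \<le> sum_list r" by (simp only: rl)
  let ?rv = "\<lambda>j. s' * v j"
  have rvm: "?rv \<in> mons n" by (rule smult_mons[OF vm])
  have gv: "g + ?rv \<le> sum_list gs" unfolding sumg by (intro add_mono order_refl rv)
  have sv: "?sv = v + ?rv" by (auto simp: s' fun_eq_iff)
  have gmon: "g \<in> mons n" using g(1) gm by blast
  have gle': "g \<le> v + var k"
  proof (rule le_funI)
    fix j
    have "g j + s' * v j \<le> var k j + s * v j" using le_funD[OF order_trans[OF gv gle], of j] by simp
    then show "g j \<le> (v + var k) j" by (simp add: s')
  qed
  have glt': "lt (g + ?rv) (v + ?rv)"
    using monomial_order_less_le[OF lt, OF add_mons[OF gmon rvm] sum_list_mons[OF gm] sum'(2) gv glt] unfolding sv .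
  have gm': "g + ?rv \<in> mons n" by (rule add_mons[OF gmon rvm])
  have "g \<noteq> v" using glt' monomial_orderD(1)[OF lt, OF gm'] by metis
  moreover have "\<not> lt v g"
  proof
    assume "lt v g"
    then have "lt (v + ?rv) (g + ?rv)" by (rule monomial_orderD(4)[OF lt, OF vm gmon rvm])
    then have "lt (g + ?rv) (g + ?rv)" by (rule monomial_orderD(2)[OF lt, OF gm' add_mons[OF vm rvm] gm' glt'])
    then show False using monomial_orderD(1)[OF lt, OF gm'] by blast
  qed
  ultimately have gltv: "lt g v" using monomial_orderD(3)[OF lt, OF gmon vm] by blast
  obtain h where h: "h \<in> mingens I" "h \<le> g" using mingen_below g(1) gs(2) by blast
  have "lt h v" by (rule monomial_order_less_le[OF lt, OF generator_mons[OF h(1)] gmon vm h(2) gltv])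
  moreover have "h \<le> v + var k" using h(2) gle' by (rule order_trans)
  ultimately show ?thesis using kn h(1) uvk by blast
qed

lemma golod_squarefree:
  assumes vars: "\<And>i. i < n \<Longrightarrow> var i \<notin> I" and s: "s \<ge> 1" and lt: "monomial_order n lt"
    and lqs: "linear_quotients n (mon_ideal_power n I s) lt"
  shows "golod (K :: 'k::field itself) n I"
proof -
  have fin: "finite (mingens I)"
  proof (rule finite_subset[OF _ finite_mons_le])
    show "mingens I \<subseteq> {m \<in> mons n. m \<le> (\<lambda>_. 1)}"
      using sqfree generator_mons by (auto simp: squarefree_mon_def le_fun_def)
  qed
  \<comment> \<open>The largest element is removed first. Since the witnesses w lie below v, they
    survive in each smaller set, which therefore inherits the hypothesis.\<close>
  have lqA: "lq n A" if "finite A" "A \<subseteq> mingens I"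
    "\<forall>v\<in>A. \<forall>u\<in>A. lt u v \<longrightarrow> (\<exists>k<n. \<exists>w\<in>A. lt w v \<and> v k < u k \<and> w \<le> v + var k)" for A
    using that
  proof (induction "card A" arbitrary: A)
    case 0
    then show ?case by (simp add: lq_empty)
  next
    case (Suc m)
    have Am: "A \<subseteq> mons n" using Suc.prems(2) generator_mons by blast
    have "A \<noteq> {}" using Suc.hyps(2) by auto
    then obtain v where v: "v \<in> A" "\<forall>u\<in>A. u \<noteq> v \<longrightarrow> lt u v"
      using monomial_order_greatest[OF lt, OF Suc.prems(1) _ Am] by blast
    have irr: "\<not> lt v v" using monomial_orderD(1)[OF lt] v(1) Am by blast
    have "lq n (A - {v})"
    proof (rule Suc.hyps(1))
      show "m = card (A - {v})" using Suc.hyps(2) v(1) Suc.prems(1) by simp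
      show "finite (A - {v})" "A - {v} \<subseteq> mingens I" using Suc.prems by auto
      show "\<forall>v'\<in>A - {v}. \<forall>u\<in>A - {v}. lt u v' \<longrightarrow> (\<exists>k<n. \<exists>w\<in>A - {v}. lt w v' \<and> v' k < u k \<and> w \<le> v' + var k)"
      proof (intro ballI impI)
        fix v' u assume v': "v' \<in> A - {v}" and u: "u \<in> A - {v}" "lt u v'"
        obtain k w where w: "k < n" "w \<in> A" "lt w v'" "v' k < u k" "w \<le> v' + var k"
          using Suc.prems(3) v' u by blast
        have "lt v' v" using v(2) v' by blast
        then have "w \<noteq> v" using w(3) irr monomial_orderD(2)[OF lt, of v v' v] v(1) v' Am by blast
        then show "\<exists>k<n. \<exists>w\<in>A - {v}. lt w v' \<and> v' k < u k \<and> w \<le> v' + var k" using w by blast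
      qed
    qed
    moreover have "v \<in> mons n" using v(1) Am by blast
    moreover have "\<exists>k w. w \<in> A - {v} \<and> k < n \<and> v k < u k \<and> w \<le> v + var k" if "u \<in> A - {v}" for u
    proof -
      have "lt u v" using v(2) that by blast
      then obtain k w where w: "k < n" "w \<in> A" "lt w v" "v k < u k" "w \<le> v + var k"
        using Suc.prems(3) v(1) \<open>u \<in> A - {v}\<close> by blast
      then have "w \<noteq> v" using irr by blast
      then show ?thesis using w by blast
    qed
    ultimately have "lq n (insert v (A - {v}))" by (rule lq_insert)
    then show ?case using v(1) by (simp add: insert_absorb)
  qed
  interpret golod_ideal n I
  proof unfold_locales
    fix m assume m: "m \<in> I"
    have mm: "m \<in> mons n" by (rule ideal_mons[OF m])
    have "m \<noteq> 0" using m zero_notin by auto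
    then have "mdeg n m \<noteq> 0" using mdeg_eq_0[OF mm] by blast
    moreover have "mdeg n m \<noteq> 1"
    proof
      assume d: "mdeg n m = 1"
      then obtain i where i: "i < n" "m i \<noteq> 0" using mdeg_pos[of n m] by auto
      have "var i \<le> m" using i(2) by (auto simp: var_def le_fun_def)
      then have "var i = m" using mdeg_strict[OF var_mons[OF i(1)] mm] mdeg_var[OF i(1)] d by force
      then show False using vars[OF i(1)] m by simp
    qed
    ultimately show "2 \<le> mdeg n m" by linarith
  next
    fix u assume u: "u \<in> mingens I"
    have "u i \<le> 1" for i using sqfree[OF u] by (simp add: squarefree_mon_def)
    then have "mdeg n u \<le> (\<Sum>i<n. 1)" unfolding mdeg_def by (intro sum_mono)
    then show "mdeg n u \<le> n" by simp
  next
    fix D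
    show "lq n {u \<in> mingens I. mdeg n u \<le> D}"
    proof (rule lqA)
      show "\<forall>v\<in>{u \<in> mingens I. mdeg n u \<le> D}. \<forall>u\<in>{u \<in> mingens I. mdeg n u \<le> D}. lt u v \<longrightarrow>
        (\<exists>k<n. \<exists>w\<in>{u \<in> mingens I. mdeg n u \<le> D}. lt w v \<and> v k < u k \<and> w \<le> v + var k)"
      proof (intro ballI impI)
        fix v u assume v: "v \<in> {u \<in> mingens I. mdeg n u \<le> D}" and u: "u \<in> {u \<in> mingens I. mdeg n u \<le> D}" and uv: "lt u v"
        have vm: "v \<in> mingens I" "mdeg n v \<le> D" and um: "u \<in> mingens I" "mdeg n u \<le> D" using u v by auto
        obtain k w where w: "k < n" "w \<in> mingens I" "lt w v" "v k < u k" "w \<le> v + var k"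
          using power_linear_quotients[OF s lt lqs, OF um(1) vm(1) uv] by blast
        \<comment> \<open>Equality would make w a multiple of the generator v, hence equal to v. So
          w has degree below |v| + 1, and the truncation by degree keeps the witnesses.\<close>
        have "w \<noteq> v + var k"
        proof
          assume "w = v + var k"
          then have "v \<le> w" by (simp add: le_fun_def)
          then have "v = w" using w(2) vm(1) by (auto simp: mingens_def)
          then show False using w(3) monomial_orderD(1)[OF lt, OF generator_mons[OF vm(1)]] by blast
        qed
        then have "mdeg n w < mdeg n (v + var k)"
          by (intro mdeg_strict generator_mons w add_mons var_mons vm)
        then have "mdeg n w \<le> D" unfolding mdeg_add mdeg_var[OF w(1)] using vm(2) by linarith
        then show "\<exists>k<n. \<exists>w\<in>{u \<in> mingens I. mdeg n u \<le> D}. lt w v \<and> v k < u k \<and> w \<le> v + var k"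
          using w by blast
      qed
      show "finite {u \<in> mingens I. mdeg n u \<le> D}" using fin by simp
    qed blast
  qed
  show ?thesis by (rule golod)
qed

end

end

text \<open>The unit ideal can only satisfy the hypotheses for \<open>n = 0\<close>, where \<open>S/I = 0\<close> has the same
  bar and Koszul data as the zero ideal in positive degrees.\<close>

lemma golod_unit_ideal: "golod (K :: 'k::field itself) 0 {0} \<longleftrightarrow> golod K 0 {}"
proof -
  have m: "mons 0 = {0}" by (auto simp: mons_def fun_eq_iff)
  have "bar_basis 0 {0} = bar_basis 0 {}" by (auto simp: bar_basis_def m fun_eq_iff)
  then have "tor_R_KK K 0 {0} = tor_R_KK K 0 {}" by (simp add: tor_R_KK_def fun_eq_iff)
  moreover have "tor_S_RK K 0 J i = (\<lambda>_. 0)" if "i \<noteq> 0" for J i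
  proof
    fix a
    have "kos_basis 0 J i a = {}" using that by (auto simp: kos_basis_def)
    then show "tor_S_RK K 0 J i a = 0" by (simp add: tor_S_RK_def hom_dim_def)
  qed
  ultimately show ?thesis unfolding golod_def by (simp cong: if_cong)
qed

theorem theorem2p10:
  fixes K :: "'k::field itself" and n s :: nat
    and I :: "(nat \<Rightarrow> nat) set"
    and lt :: "(nat \<Rightarrow> nat) \<Rightarrow> (nat \<Rightarrow> nat) \<Rightarrow> bool"
  assumes "is_monomial_ideal n I"
    and "\<forall>u\<in>mingens I. squarefree_mon u"
    and "\<forall>i<n. var i \<notin> I"
    and "s \<ge> 1"
    and "monomial_order n lt"
    and "linear_quotients n (mon_ideal_power n I s) lt"
  shows "golod K n I"
proof (cases "0 \<in> I")
  case False
  interpret monomial_ideal n I using assms(1) False by unfold_locales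
  show ?thesis using assms by (intro golod_squarefree) auto
next
  case True
  then have "var i \<in> I" if "i < n" for i
    using assms(1) that by (auto simp: is_monomial_ideal_def le_fun_def)
  then have n: "n = 0" using assms(3) by blast
  have "mons 0 = {0}" by (auto simp: mons_def fun_eq_iff)
  then have I: "I = {0}" using assms(1) True by (auto simp: is_monomial_ideal_def n)
  \<comment> \<open>Over no variables the zero ideal satisfies the homological hypotheses trivially
    and stands in for the unit ideal.\<close>
  interpret golod_ideal 0 "{}" by unfold_locales (auto simp: is_monomial_ideal_def mingens_def lq_empty)
  show ?thesis unfolding n I golod_unit_ideal by (rule golod)
qed

end
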